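(* Let $K\in\mathbb{N}$ and $A,B\subset\{0,1,\dots,K-1\}$ with $|A|\cdot|B|=K$, $|A|>1$, $|B|>1$, and let $E_n$ ($n\ge 1$) and $E_\infty$ be the associated product Cantor iterations and product Cantor set. Assume that there is a direction $\theta_0$ such that the projection $\pi_{\theta_0}(E_\infty)$ has positive 1-dimensional measure. Then $t_0=\tan\theta_0$ is rational; write $|t_0|=q/r$ in lowest terms with $q,r\in\mathbb{N}$. Let $$\gamma=\min\Big(\frac{\log|A|}{\log K},\frac{\log|B|}{\log K}\Big)>0 .$$ Then for every $p>6+4(1+q+r)\gamma^{-1}$ there is a constant $C$, independent of $n$, such that $$\mathrm{Fav}(E_n)\le C\,n^{-1/p}\qquad\text{for all } n\ge 1.$$ In particular, there is a $p\in(6,\infty)$, depending on the choice of $K,A,B$, for which this bound holds.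
   Context: The set $E_1$ is obtained by dividing the unit square $[0,1]^2$ into $K^2$ congruent squares of sidelength $K^{-1}$ and keeping those whose bottom left vertex is in $K^{-1}(A\times B)$; the procedure is iterated in each kept square, and $E_n$ is the set obtained after $n$ iterations, consisting of $K^n$ squares of sidelength $K^{-n}$. Equivalently, with $A^n=\{\sum_{j=1}^n K^{-j}a_j:\ a_j\in A\}$ and $B^n=\{\sum_{j=1}^n K^{-j}b_j:\ b_j\in B\}$, one has $E_n=(A^n\times B^n)+[0,K^{-n}]^2$. Set $E_\infty=\bigcap_{n\ge1}E_n$. For a direction $\theta$ let $\pi_\theta(x,y)=x\cos\theta+y\sin\theta$. The Favard length of $\Omega\subset\mathbb{R}^2$ is $\mathrm{Fav}(\Omega)=\int_0^\pi|\pi_\theta(\Omega)|\,d\theta$, where $|\cdot|$ is Lebesgue measure on $\mathbb{R}$. The rationality of $\tan\theta_0$ when $\pi_{\theta_0}(E_\infty)$ has positive measure is a known result of Kenyon and of Lagarias and Wang. *)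

theory Defs
  imports "HOL-Analysis.Analysis"
begin

definition digit_sums :: "nat \<Rightarrow> nat set \<Rightarrow> nat \<Rightarrow> real set" where
  "digit_sums K A n =
     {\<Sum>j=1..n. real (a j) / real K ^ j | a :: nat \<Rightarrow> nat. \<forall>j\<in>{1..n}. a j \<in> A}"

text \<open>The outer \<open>+\<close> is the Minkowski sum of subsets of the plane, so that
  \<open>digit_sums K A n \<times> digit_sums K B n\<close> is the set of bottom left vertices of the
  closed squares of sidelength \<open>1 / K ^ n\<close> kept after \<open>n\<close> iterations.\<close>

definition cantor_iter :: "nat \<Rightarrow> nat set \<Rightarrow> nat set \<Rightarrow> nat \<Rightarrow> (real \<times> real) set" where
  "cantor_iter K A B n =
     (digit_sums K A n \<times> digit_sums K B n) + ({0..1 / real K ^ n} \<times> {0..1 / real K ^ n})"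

definition cantor_set :: "nat \<Rightarrow> nat set \<Rightarrow> nat set \<Rightarrow> (real \<times> real) set" where
  "cantor_set K A B = (\<Inter>n\<in>{1..}. cantor_iter K A B n)"

definition dir_proj :: "real \<Rightarrow> real \<times> real \<Rightarrow> real" where
  "dir_proj \<theta> z = fst z * cos \<theta> + snd z * sin \<theta>"

text \<open>The Favard length takes values in \<open>[0, \<infinity>]\<close>, so no integrability side condition is
  needed for it to be meaningful.\<close>

definition favard :: "(real \<times> real) set \<Rightarrow> ennreal" where
  "favard \<Omega> = (\<integral>\<^sup>+\<theta>\<in>{0..pi}. emeasure lebesgue (dir_proj \<theta> ` \<Omega>) \<partial>lebesgue)"

definition dim_exponent :: "nat \<Rightarrow> nat set \<Rightarrow> nat set \<Rightarrow> real" where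
  "dim_exponent K A B =
     min (ln (real (card A)) / ln (real K)) (ln (real (card B)) / ln (real K))"

end

theory Submission imports Defs "HOL-Computational_Algebra.Fundamental_Theorem_Algebra"
begin

text \<open>Fix a slope \<open>t\<close> in \<open>[0, 1]\<close>. If too many of the projected squares of the first \<open>N\<close> generations
  pile up on each other, then self-similarity repeats the pile \<open>L\<close> times independently and the
  projection of generation \<open>L * N\<close> is of size \<open>1 / M\<close>. Otherwise the number of overlapping pairs,
  which is the \<open>L\<^sup>2\<close> norm of a product of exponential sums, stays of order \<open>M\<close> on all scales, and
  it remains to show that this happens only for a set of slopes of measure \<open>1 / M\<close>.

  The exponential sum is positive definite, so its mass on \<open>[0, K ^ m]\<close> is bounded below. After
  averaging the \<open>B\<close>-factor over two shifts by \<open>X\<close> on about \<open>M log M\<close> scales (which keeps positive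
  definiteness but damps the peak at the origin) this mass must lie in \<open>[1, K ^ m]\<close>. For the
  unmodified sum these masses belong to disjoint bands and add up to \<open>O(M)\<close>, so for most starting
  scales the average must be much larger than the original sum. That requires the frequency to come
  close to a root of the polynomial of \<open>B\<close> on some scale or to gain from many scales; integrating over
  \<open>t\<close> and summing over residues block by block shows that this is rare.

  If a projection of the limit set has positive measure then the energy is bounded on all scales.
  The bands then tend to \<open>0\<close> while the mass in \<open>[1, K ^ m]\<close> does not, so some frequency keeps both
  exponential sums close to \<open>1\<close> along all its multiples by powers of \<open>K\<close>, and \<open>t\<close> is rational.\<close>

section \<open>Overlapping squares\<close>

text \<open>The obstacle is the peak at the origin: the mass on \<open>[0, K ^ m]\<close> is bounded
  below, but the unit interval alone could carry all of it. A smeared factor is at most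
  \<open>sqmod B X\<close>, about \<open>1 - c * X ^ 2\<close>, so with
  \<open>M = X powr - 2\<close> roughly \<open>M * ln M\<close> smeared scales are needed to damp a
  peak of size \<open>O(M)\<close>. Smearing also disturbs all other frequencies, and this error
  accumulates over all those scales. The symmetric average leaves an error of second order in
  \<open>X\<close>. Near roots the quotient of the smeared and the original factor is singular, so
  it is averaged over blocks of about \<open>ln M\<close> scales, long enough to resolve the
  singularity. The block error is then \<open>X powr (2 + codim / 3)\<close>, and
  \<open>M * ln M\<close> such errors stay bounded. The exponent is bookkeeping:
  \<open>M * ln M\<close> repetitions, \<open>M * T\<close> bands and \<open>M * ln M ^ 2\<close>
  scales per band give \<open>M ^ 3 * T\<close> up to logarithms, which are absorbed by taking
  \<open>M ^ 6 * T\<close> instead. Here \<open>T = M powr (9 / codim)\<close>, and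
  \<open>codim\<close> is three quarters of a dimension that is at least gamma, so
  \<open>p = 6 + 12 / gamma\<close> suffices. This is below the stated bound because
  \<open>q\<close> and \<open>r\<close> are positive.\<close>

fun digit_nums :: "nat \<Rightarrow> nat set \<Rightarrow> nat \<Rightarrow> nat set" where
  "digit_nums K A 0 = {0}"
| "digit_nums K A (Suc k) = (\<lambda>(x, a). K * x + a) ` (digit_nums K A k \<times> A)"

lemma digit_nums_less:
  assumes "A \<subseteq> {0..<K}" "x \<in> digit_nums K A k"
  shows "x < K ^ k"
  using assms(2)
proof (induction k arbitrary: x)
  case (Suc k)
  then obtain y a where y: "y \<in> digit_nums K A k" and a: "a \<in> A" and x: "x = K * y + a" by auto
  have "y < K ^ k" "a < K" using Suc.IH y a assms(1) by auto
  then have "K * y + a < K * (y + 1)" and "K * (y + 1) \<le> K * K ^ k"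
    by (simp, intro mult_le_mono2) simp
  then show ?case by (simp add: x)
qed simp

lemma digit_nums_Suc_iff:
  assumes "A \<subseteq> {0..<K}"
  shows "x \<in> digit_nums K A (Suc k) \<longleftrightarrow> x div K \<in> digit_nums K A k \<and> x mod K \<in> A"
proof
  assume "x \<in> digit_nums K A (Suc k)"
  then obtain y a where y: "y \<in> digit_nums K A k" "a \<in> A" "x = K * y + a" by auto
  moreover have "a < K" using y assms by auto
  ultimately show "x div K \<in> digit_nums K A k \<and> x mod K \<in> A" by simp
next
  assume "x div K \<in> digit_nums K A k \<and> x mod K \<in> A"
  then have "(x div K, x mod K) \<in> digit_nums K A k \<times> A" by auto
  moreover have "x = (\<lambda>(x, a). K * x + a) (x div K, x mod K)" by simp
  ultimately show "x \<in> digit_nums K A (Suc k)" by (metis digit_nums.simps(2) image_eqI)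
qed

lemma digit_nums_add_iff:
  assumes "A \<subseteq> {0..<K}"
  shows "x \<in> digit_nums K A (i + j) \<longleftrightarrow>
    x div K ^ j \<in> digit_nums K A i \<and> x mod K ^ j \<in> digit_nums K A j"
proof (induction j arbitrary: x)
  case 0
  then show ?case by simp
next
  case (Suc j)
  have 1: "x div K div K ^ j = x div K ^ Suc j" by (simp add: div_mult2_eq)
  have 2: "(x div K) mod K ^ j = (x mod K ^ Suc j) div K"
  proof -
    have "x mod (K * K ^ j) = K * (x div K mod K ^ j) + x mod K" by (rule mod_mult2_eq)
    then show ?thesis
      by (cases "K = 0") auto
  qed
  have 3: "x mod K = (x mod K ^ Suc j) mod K" by (simp add: mod_mod_cancel)
  have "x \<in> digit_nums K A (Suc (i + j)) \<longleftrightarrow> x div K \<in> digit_nums K A (i + j) \<and> x mod K \<in> A"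
    by (rule digit_nums_Suc_iff[OF assms])
  also have "\<dots> \<longleftrightarrow> x div K ^ Suc j \<in> digit_nums K A i \<and>
      (x mod K ^ Suc j) div K \<in> digit_nums K A j \<and> (x mod K ^ Suc j) mod K \<in> A"
    using Suc.IH[of "x div K"] 1 2 3 by simp
  also have "\<dots> \<longleftrightarrow> x div K ^ Suc j \<in> digit_nums K A i \<and> x mod K ^ Suc j \<in> digit_nums K A (Suc j)"
    by (simp only: digit_nums_Suc_iff[OF assms])
  finally show ?case by simp
qed

lemma finite_digit_nums: "finite A \<Longrightarrow> finite (digit_nums K A k)"
  by (induction k) auto

lemma card_digit_nums:
  assumes "A \<subseteq> {0..<K}"
  shows "card (digit_nums K A k) = card A ^ k"
proof (induction k)
  case (Suc k)
  have "inj_on (\<lambda>(x, a). K * x + a) (digit_nums K A k \<times> A)"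
  proof (rule inj_onI, clarsimp)
    fix x a y b assume "a \<in> A" "b \<in> A" and eq: "K * x + a = K * y + b"
    then have "a < K" "b < K" using assms by auto
    then have "(K * x + a) div K = x" "(K * y + b) div K = y" by auto
    then show "x = y \<and> a = b" using eq by auto
  qed
  then show ?case using Suc
    by (simp add: card_image card_cartesian_product mult.commute)
qed simp

locale digit_pair =
  fixes K :: nat and A B :: "nat set"
  assumes A_sub: "A \<subseteq> {0..<K}" and B_sub: "B \<subseteq> {0..<K}"
    and card_AB: "card A * card B = K" and card_A: "card A > 1" and card_B: "card B > 1"
begin

lemma finA: "finite A" and finB: "finite B"
  using A_sub B_sub finite_subset by auto

lemma K4: "K \<ge> 4"
proof -
  have "2 * 2 \<le> card A * card B" by (rule mult_le_mono) (use card_A card_B in auto)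
  then show ?thesis using card_AB by simp
qed

definition sq :: "nat \<Rightarrow> (nat \<times> nat) set" where
  "sq k = digit_nums K A k \<times> digit_nums K B k"

text \<open>Ancestors and relative positions of squares: \<open>up j\<close> goes back
  \<open>j\<close> generations, \<open>low j\<close> is the position inside that ancestor, and
  \<open>join j\<close> reassembles the two. With integer numerators this is division with remainder
  by \<open>K ^ j\<close>.\<close>

definition up :: "nat \<Rightarrow> nat \<times> nat \<Rightarrow> nat \<times> nat" where
  "up j d = (fst d div K ^ j, snd d div K ^ j)"

definition low :: "nat \<Rightarrow> nat \<times> nat \<Rightarrow> nat \<times> nat" where
  "low j d = (fst d mod K ^ j, snd d mod K ^ j)"

definition join :: "nat \<Rightarrow> nat \<times> nat \<Rightarrow> nat \<times> nat \<Rightarrow> nat \<times> nat" where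
  "join j x y = (K ^ j * fst x + fst y, K ^ j * snd x + snd y)"

definition pos :: "real \<Rightarrow> nat \<times> nat \<Rightarrow> real" where
  "pos t d = real (fst d) + t * real (snd d)"

lemma finite_sq [simp]: "finite (sq k)"
  by (simp add: sq_def finite_digit_nums finA finB)

lemma card_sq: "card (sq k) = K ^ k"
  by (simp add: sq_def card_cartesian_product card_digit_nums A_sub B_sub card_AB
      flip: power_mult_distrib)

lemma sq_add_iff: "d \<in> sq (i + j) \<longleftrightarrow> up j d \<in> sq i \<and> low j d \<in> sq j"
  by (auto simp: sq_def up_def low_def mem_Times_iff digit_nums_add_iff A_sub B_sub)

lemma sq_lt: "y \<in> sq j \<Longrightarrow> fst y < K ^ j \<and> snd y < K ^ j"
  by (auto simp: sq_def digit_nums_less[OF A_sub] digit_nums_less[OF B_sub])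

lemma up_join: "y \<in> sq j \<Longrightarrow> up j (join j x y) = x"
  and low_join: "y \<in> sq j \<Longrightarrow> low j (join j x y) = y"
  using sq_lt[of y j] K4 by (auto simp: up_def low_def join_def prod_eq_iff)

lemma join_up_low: "join j (up j d) (low j d) = d"
  by (simp add: up_def low_def join_def)

lemma join_sq: "x \<in> sq i \<Longrightarrow> y \<in> sq j \<Longrightarrow> join j x y \<in> sq (i + j)"
  by (simp add: sq_add_iff up_join low_join)

lemma up_sq: "d \<in> sq (i + j) \<Longrightarrow> up j d \<in> sq i"
  by (simp add: sq_add_iff)

lemma up_up: "up i (up j d) = up (i + j) d"
  by (simp add: up_def div_mult2_eq[symmetric] power_add mult.commute)

lemma up_0 [simp]: "up 0 d = d" by (simp add: up_def)

lemma up_sq': "d \<in> sq n \<Longrightarrow> k \<le> n \<Longrightarrow> up (n - k) d \<in> sq k"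
  using up_sq[of d k "n - k"] by simp

lemma bij_join: "bij_betw (\<lambda>(x, y). join j x y) (sq i \<times> sq j) (sq (i + j))"
  by (rule bij_betwI[where g = "\<lambda>d. (up j d, low j d)"])
    (auto simp: up_join low_join join_up_low join_sq sq_add_iff)

lemma sum_sq_add: "(\<Sum>d\<in>sq (i + j). F d) = (\<Sum>x\<in>sq i. \<Sum>y\<in>sq j. F (join j x y))"
  by (simp add: sum.cartesian_product sum.reindex_bij_betw[OF bij_join, symmetric] case_prod_beta)

lemma pos_join: "pos t (join j x y) = K ^ j * pos t x + pos t y"
  by (simp add: pos_def join_def algebra_simps)

lemma pos_nonneg: "t \<ge> 0 \<Longrightarrow> 0 \<le> pos t d"
  by (simp add: pos_def)

lemma pos_le: 
  assumes "t \<ge> 0" "d \<in> sq k" shows "pos t d \<le> (real K ^ k - 1) * (1 + t)"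
proof -
  have "real (fst d) + 1 \<le> real (K ^ k)" "real (snd d) + 1 \<le> real (K ^ k)"
    using sq_lt[OF assms(2)] by linarith+
  then have "real (fst d) \<le> real K ^ k - 1" "real (snd d) \<le> real K ^ k - 1"
    by simp_all
  then have "real (fst d) + t * real (snd d) \<le> (real K ^ k - 1) + t * (real K ^ k - 1)"
    by (intro add_mono mult_left_mono assms)
  then show ?thesis by (simp add: pos_def algebra_simps)
qed

text \<open>All intervals are measured in units of \<open>K ^ - n\<close>: the projection of the square with lower left
  vertex \<open>d / K ^ n\<close> is the interval \<open>[pos t d, pos t d + (1 + t)]\<close> in these units.\<close>

definition near :: "real \<Rightarrow> nat \<times> nat \<Rightarrow> nat \<times> nat \<Rightarrow> bool" where
  "near t d d' \<longleftrightarrow> \<bar>pos t d - pos t d'\<bar> \<le> 1 + t"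

definition nbrs :: "real \<Rightarrow> nat \<Rightarrow> nat \<times> nat \<Rightarrow> nat" where
  "nbrs t n d = card {d' \<in> sq n. near t d d'}"

definition energy :: "real \<Rightarrow> nat \<Rightarrow> nat" where
  "energy t n = (\<Sum>d\<in>sq n. nbrs t n d)"

definition cover :: "real \<Rightarrow> nat \<Rightarrow> real \<Rightarrow> nat" where
  "cover t n x = card {d \<in> sq n. pos t d \<le> x \<and> x \<le> pos t d + (1 + t)}"

text \<open>Multiplicity is tested only at left endpoints. Intervals of equal length that share a
  point also share the largest of their left endpoints, so no pile is missed, and the family of test
  points stays finite.\<close>

definition stacked :: "real \<Rightarrow> real \<Rightarrow> nat \<Rightarrow> nat \<times> nat \<Rightarrow> bool" where
  "stacked t M n P \<longleftrightarrow> (\<exists>P0\<in>sq n. pos t P \<le> pos t P0 \<and> pos t P0 \<le> pos t P + (1 + t)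
      \<and> M \<le> real (cover t n (pos t P0)))"

text \<open>Neighbours that start no later than \<open>d\<close> all cover the left endpoint of
  \<open>d\<close>. Those that start later all cover the largest of their own left endpoints, which
  still lies in the interval of \<open>d\<close>. Neither point is covered \<open>M\<close>
  times.\<close>

lemma nbrs_le:
  assumes "d \<in> sq n" "\<not> stacked t M n d" "t \<ge> 0"
  shows "real (nbrs t n d) \<le> 2 * M"
proof -
  let ?L = "{d' \<in> sq n. pos t d' \<le> pos t d \<and> pos t d \<le> pos t d' + (1 + t)}"
  let ?R = "{d' \<in> sq n. pos t d < pos t d' \<and> pos t d' \<le> pos t d + (1 + t)}"
  have "real (cover t n (pos t d)) < M"
    using assms by (auto simp: stacked_def not_le)
  then have L: "real (card ?L) \<le> M" by (simp add: cover_def)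
  have R: "real (card ?R) \<le> M"
  proof (cases "?R = {}")
    case True
    have "0 \<le> M" using L by linarith
    then show ?thesis using True by (metis card.empty of_nat_0)
  next
    case False
    have "finite ?R" by simp
    define m where "m = Max (pos t ` ?R)"
    have "m \<in> pos t ` ?R" unfolding m_def by (rule Max_in) (use False in auto)
    then obtain P0 where P0: "P0 \<in> ?R" "m = pos t P0" by auto
    have le: "pos t d' \<le> m" if "d' \<in> ?R" for d'
      unfolding m_def by (rule Max_ge) (use that in auto)
    have "?R \<subseteq> {d' \<in> sq n. pos t d' \<le> pos t P0 \<and> pos t P0 \<le> pos t d' + (1 + t)}"
      using le P0 by auto
    then have "card ?R \<le> cover t n (pos t P0)"
      unfolding cover_def by (intro card_mono) auto
    moreover have "real (cover t n (pos t P0)) < M"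
      using assms P0 by (auto simp: stacked_def not_le)
    ultimately show ?thesis by linarith
  qed
  have "{d' \<in> sq n. near t d d'} \<subseteq> ?L \<union> ?R" by (auto simp: near_def)
  then have "nbrs t n d \<le> card (?L \<union> ?R)" unfolding nbrs_def by (intro card_mono) auto
  also have "\<dots> \<le> card ?L + card ?R" by (rule card_Un_le)
  finally show ?thesis using L R by linarith
qed

end

text \<open>If \<open>N v\<close> is the size of the fibre over \<open>v\<close>, both sides are
  correlations of \<open>N\<close>, and \<open>2 * N v * N (v + j)\<close> is at most the sum of the
  two squares. A shift therefore never increases the number of coincidences.\<close>

lemma sum_card_fibres:
  assumes "finite S"
  shows "(\<Sum>y\<in>S. card {y'\<in>S. c y' = c y + (j::int)}) \<le> (\<Sum>y\<in>S. card {y'\<in>S. c y' = c y})"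
proof -
  define N where "N v = card {y\<in>S. c y = v}" for v
  define U where "U = c ` S \<union> (\<lambda>v. v - j) ` c ` S"
  have fU: "finite U" using assms by (simp add: U_def)
  have N0: "N v = 0" if "v \<notin> c ` S" for v
    using that assms by (auto simp: N_def)
  have eq: "(\<Sum>y\<in>S. F (c y)) = (\<Sum>v\<in>U. N v * F v)" for F :: "int \<Rightarrow> nat"
  proof -
    have "(\<Sum>y\<in>S. F (c y)) = (\<Sum>v\<in>c ` S. \<Sum>y | y \<in> S \<and> c y = v. F (c y))"
      by (rule sum.group[symmetric]) (use assms in auto)
    also have "\<dots> = (\<Sum>v\<in>c ` S. N v * F v)"
      by (rule sum.cong) (auto simp: N_def)
    also have "\<dots> = (\<Sum>v\<in>U. N v * F v)"
      by (rule sum.mono_neutral_left) (use fU N0 in \<open>auto simp: U_def\<close>)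
    finally show ?thesis .
  qed
  have sq: "(\<Sum>v\<in>U. N (v + j) * N (v + j)) \<le> (\<Sum>v\<in>U. N v * N v)"
  proof -
    have "(\<Sum>v\<in>U. N (v + j) * N (v + j)) = (\<Sum>w\<in>(\<lambda>v. v + j) ` U. N w * N w)"
      by (subst sum.reindex) (auto simp: inj_on_def)
    also have "\<dots> = (\<Sum>w\<in>(\<lambda>v. v + j) ` U \<inter> U. N w * N w)"
      by (rule sum.mono_neutral_right) (use fU N0 in \<open>auto simp: U_def\<close>)
    also have "\<dots> \<le> (\<Sum>v\<in>U. N v * N v)"
      by (rule sum_mono2) (use fU in auto)
    finally show ?thesis .
  qed
  have am: "2 * (a * b) \<le> a * a + b * b" for a b :: nat
  proof -
    have "0 \<le> (int a - int b)\<^sup>2" by simp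
    then have "2 * (int a * int b) \<le> int a * int a + int b * int b"
      by (simp add: power2_eq_square algebra_simps)
    then show ?thesis by (metis (mono_tags, lifting) of_nat_add of_nat_le_iff of_nat_mult of_nat_numeral)
  qed
  have "2 * (\<Sum>v\<in>U. N v * N (v + j)) \<le> (\<Sum>v\<in>U. N v * N v + N (v + j) * N (v + j))"
    unfolding sum_distrib_left by (intro sum_mono am)
  also have "\<dots> \<le> 2 * (\<Sum>v\<in>U. N v * N v)" using sq by (simp add: sum.distrib)
  finally have "(\<Sum>v\<in>U. N v * N (v + j)) \<le> (\<Sum>v\<in>U. N v * N v)" by simp
  then show ?thesis
    using eq[of "\<lambda>v. N (v + j)"] eq[of N] by (simp add: N_def)
qed

context digit_pair begin

text \<open>Cells have the length \<open>1 + t\<close> of the projected intervals, so equal cells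
  force \<open>near\<close>, and near squares lie in equal or adjacent cells.\<close>

definition cell :: "real \<Rightarrow> nat \<times> nat \<Rightarrow> int" where
  "cell t d = \<lfloor>pos t d / (1 + t)\<rfloor>"

lemma cell_near:
  assumes "t \<ge> 0" "cell t d = cell t d'" shows "near t d d'"
proof -
  have p: "1 + t > 0" using assms by simp
  have "\<bar>pos t d / (1 + t) - pos t d' / (1 + t)\<bar> \<le> 1"
    using assms(2) unfolding cell_def by linarith
  then have "\<bar>(pos t d - pos t d') / (1 + t)\<bar> \<le> 1" by (simp add: diff_divide_distrib)
  then show ?thesis using p by (simp add: near_def abs_divide)
qed

lemma cell_shift:
  assumes "t \<ge> 0"
  shows "(\<Sum>y\<in>sq n. card {y'\<in>sq n. cell t y' = cell t y + j}) \<le> energy t n"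
proof -
  have "(\<Sum>y\<in>sq n. card {y'\<in>sq n. cell t y' = cell t y + j})
      \<le> (\<Sum>y\<in>sq n. card {y'\<in>sq n. cell t y' = cell t y})"
    by (rule sum_card_fibres) simp
  also have "\<dots> \<le> energy t n"
    unfolding energy_def nbrs_def
    by (intro sum_mono card_mono) (auto intro!: cell_near assms)
  finally show ?thesis .
qed

lemma shift_count:
  assumes "t \<ge> 0"
  shows "(\<Sum>y\<in>sq n. card {y'\<in>sq n. \<bar>s + pos t y - pos t y'\<bar> \<le> 1 + t}) \<le> 4 * energy t n"
proof -
  have p: "1 + t > 0" using assms by simp
  define k where "k = \<lfloor>s / (1 + t)\<rfloor>"
  \<comment> \<open>Rounding \<open>s\<close>, \<open>pos t y\<close> and \<open>pos t y'\<close> to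
    cells leaves only four possible offsets; this is the factor 4.\<close>
  have sub: "{y'\<in>sq n. \<bar>s + pos t y - pos t y'\<bar> \<le> 1 + t}
      \<subseteq> (\<Union>i\<in>{-1,0,1,2}. {y'\<in>sq n. cell t y' = cell t y + (k + i)})" for y
  proof
    fix y' assume y': "y' \<in> {y'\<in>sq n. \<bar>s + pos t y - pos t y'\<bar> \<le> 1 + t}"
    then have "\<bar>(s + pos t y - pos t y') / (1 + t)\<bar> \<le> 1" using p by (simp add: abs_divide)
    then have "\<bar>s / (1 + t) + pos t y / (1 + t) - pos t y' / (1 + t)\<bar> \<le> 1"
      by (simp add: diff_divide_distrib add_divide_distrib)
    then have "cell t y' \<ge> cell t y + k - 1" "cell t y' \<le> cell t y + k + 2"
      unfolding cell_def k_def by linarith+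
    then have "cell t y' - cell t y - k \<in> {-1,0,1,2}" by auto
    then show "y' \<in> (\<Union>i\<in>{-1,0,1,2}. {y'\<in>sq n. cell t y' = cell t y + (k + i)})"
      using y' by force
  qed
  have "(\<Sum>y\<in>sq n. card {y'\<in>sq n. \<bar>s + pos t y - pos t y'\<bar> \<le> 1 + t})
     \<le> (\<Sum>y\<in>sq n. \<Sum>i\<in>{-1,0,1,2}. card {y'\<in>sq n. cell t y' = cell t y + (k + i)})"
  proof (rule sum_mono)
    fix y
    have "card {y'\<in>sq n. \<bar>s + pos t y - pos t y'\<bar> \<le> 1 + t}
      \<le> card (\<Union>i\<in>{-1,0,1,2}. {y'\<in>sq n. cell t y' = cell t y + (k + i)})"
      by (intro card_mono sub) auto
    also have "\<dots> \<le> (\<Sum>i\<in>{-1,0,1,2}. card {y'\<in>sq n. cell t y' = cell t y + (k + i)})"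
      by (rule card_UN_le) simp
    finally show "card {y'\<in>sq n. \<bar>s + pos t y - pos t y'\<bar> \<le> 1 + t} \<le> \<dots>" .
  qed
  also have "\<dots> = (\<Sum>i\<in>{-1,0,1,2}. \<Sum>y\<in>sq n. card {y'\<in>sq n. cell t y' = cell t y + (k + i)})"
    by (rule sum.swap)
  also have "\<dots> \<le> (\<Sum>i\<in>{-1,0,1,2::int}. energy t n)"
    by (intro sum_mono cell_shift assms)
  also have "\<dots> = 4 * energy t n" by simp
  finally show ?thesis .
qed

text \<open>Near squares have near parents, since a square is displaced inside its parent by at most
  \<open>K - 1\<close> of its own intervals, and every parent has \<open>K\<close> children.\<close>

lemma nbrs_up:
  assumes "t \<ge> 0" "d \<in> sq (Suc k)"
  shows "nbrs t (Suc k) d \<le> K * nbrs t k (up 1 d)"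
proof -
  let ?N = "{x \<in> sq k. near t (up 1 d) x}"
  have "{d' \<in> sq (Suc k). near t d d'} \<subseteq> (\<lambda>(x, y). join 1 x y) ` (?N \<times> sq 1)"
  proof
    fix d' assume d': "d' \<in> {d' \<in> sq (Suc k). near t d d'}"
    have m: "up 1 d' \<in> sq k" "low 1 d' \<in> sq 1" "low 1 d \<in> sq 1"
      using d' assms(2) sq_add_iff[of d' k 1] sq_add_iff[of d k 1] by auto
    have eqs: "pos t d = K * pos t (up 1 d) + pos t (low 1 d)"
      "pos t d' = K * pos t (up 1 d') + pos t (low 1 d')"
      by (metis join_up_low pos_join power_one_right)+
    have b: "0 \<le> pos t (low 1 d)" "pos t (low 1 d) \<le> (real K - 1) * (1 + t)"
      "0 \<le> pos t (low 1 d')" "pos t (low 1 d') \<le> (real K - 1) * (1 + t)"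
      using pos_le[OF assms(1) m(2)] pos_le[OF assms(1) m(3)] assms(1) by (auto simp: pos_nonneg)
    have "\<bar>pos t d - pos t d'\<bar> \<le> 1 + t" using d' by (simp add: near_def)
    then have "\<bar>real K * (pos t (up 1 d) - pos t (up 1 d'))\<bar> \<le> real K * (1 + t)"
      using b eqs by (simp add: algebra_simps)
    then have "real K * \<bar>pos t (up 1 d) - pos t (up 1 d')\<bar> \<le> real K * (1 + t)"
      by (simp add: abs_mult)
    then have "near t (up 1 d) (up 1 d')" using K4 by (simp add: near_def)
    then have "(up 1 d', low 1 d') \<in> ?N \<times> sq 1" using m by auto
    then show "d' \<in> (\<lambda>(x, y). join 1 x y) ` (?N \<times> sq 1)"
      by (rule rev_image_eqI) (simp add: join_up_low)
  qed
  then have "nbrs t (Suc k) d \<le> card ((\<lambda>(x, y). join 1 x y) ` (?N \<times> sq 1))"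
    unfolding nbrs_def by (intro card_mono) auto
  also have "\<dots> \<le> card (?N \<times> sq 1)" by (rule card_image_le) auto
  also have "\<dots> = K * nbrs t k (up 1 d)"
    by (simp add: card_cartesian_product card_sq nbrs_def)
  finally show ?thesis .
qed

text \<open>Squares near a descendant of \<open>P\<close> descend from squares near
  \<open>P\<close>. For each such ancestor the pairs of descendants form a shifted copy of the pairs
  of \<open>j\<close> generations, which \<open>shift_count\<close> compares with the unshifted
  energy.\<close>

lemma sum_nbrs_join:
  assumes "t \<ge> 0" "P \<in> sq k"
  shows "(\<Sum>y\<in>sq j. nbrs t (k + j) (join j P y)) \<le> nbrs t k P * (4 * energy t j)"
proof -
  let ?N = "{x \<in> sq k. near t P x}"
  let ?S = "\<lambda>x y. {y'\<in>sq j. \<bar>K ^ j * (pos t P - pos t x) + pos t y - pos t y'\<bar> \<le> 1 + t}"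
  have one: "nbrs t (k + j) (join j P y) \<le> (\<Sum>x\<in>?N. card (?S x y))" if y: "y \<in> sq j" for y
  proof -
    have "{d' \<in> sq (k + j). near t (join j P y) d'} \<subseteq> (\<Union>x\<in>?N. (\<lambda>y'. join j x y') ` ?S x y)"
    proof
      fix d' assume d': "d' \<in> {d' \<in> sq (k + j). near t (join j P y) d'}"
      have m: "up j d' \<in> sq k" "low j d' \<in> sq j" using d' sq_add_iff by auto
      have eqs: "pos t d' = K ^ j * pos t (up j d') + pos t (low j d')"
        by (metis join_up_low pos_join)
      have n: "\<bar>K ^ j * (pos t P - pos t (up j d')) + pos t y - pos t (low j d')\<bar> \<le> 1 + t"
        using d' eqs by (simp add: near_def pos_join algebra_simps)
      have b: "0 \<le> pos t y" "pos t y \<le> (real K ^ j - 1) * (1 + t)"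
        "0 \<le> pos t (low j d')" "pos t (low j d') \<le> (real K ^ j - 1) * (1 + t)"
        using pos_le[OF assms(1) m(2)] pos_le[OF assms(1) y] assms(1) by (auto simp: pos_nonneg)
      have "\<bar>real K ^ j * (pos t P - pos t (up j d'))\<bar> \<le> real K ^ j * (1 + t)"
        using b n by (simp add: algebra_simps)
      then have "real K ^ j * \<bar>pos t P - pos t (up j d')\<bar> \<le> real K ^ j * (1 + t)"
        by (simp add: abs_mult)
      then have "near t P (up j d')" using K4 by (simp add: near_def)
      then show "d' \<in> (\<Union>x\<in>?N. (\<lambda>y'. join j x y') ` ?S x y)"
        using m n by (intro UN_I[of "up j d'"] image_eqI[of _ _ "low j d'"]) (auto simp: join_up_low)
    qed
    then have "nbrs t (k + j) (join j P y) \<le> card (\<Union>x\<in>?N. (\<lambda>y'. join j x y') ` ?S x y)"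
      unfolding nbrs_def by (intro card_mono) auto
    also have "\<dots> \<le> (\<Sum>x\<in>?N. card ((\<lambda>y'. join j x y') ` ?S x y))"
      by (rule card_UN_le) simp
    also have "\<dots> \<le> (\<Sum>x\<in>?N. card (?S x y))"
      by (intro sum_mono card_image_le) auto
    finally show ?thesis .
  qed
  have "(\<Sum>y\<in>sq j. nbrs t (k + j) (join j P y)) \<le> (\<Sum>y\<in>sq j. \<Sum>x\<in>?N. card (?S x y))"
    by (intro sum_mono one)
  also have "\<dots> = (\<Sum>x\<in>?N. \<Sum>y\<in>sq j. card (?S x y))" by (rule sum.swap)
  also have "\<dots> \<le> (\<Sum>x\<in>?N. 4 * energy t j)"
    by (intro sum_mono shift_count assms)
  also have "\<dots> = nbrs t k P * (4 * energy t j)" by (simp add: nbrs_def)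
  finally show ?thesis .
qed

end

lemma sum_UN_le':
  fixes f :: "'b \<Rightarrow> real"
  assumes "finite I" "\<And>i. i \<in> I \<Longrightarrow> finite (F i)" "\<And>x. f x \<ge> 0"
  shows "(\<Sum>x\<in>(\<Union>i\<in>I. F i). f x) \<le> (\<Sum>i\<in>I. \<Sum>x\<in>F i. f x)"
  using assms(1,2)
proof (induction I)
  case (insert i I)
  have "(\<Sum>x\<in>(\<Union>i\<in>insert i I. F i). f x) \<le> (\<Sum>x\<in>F i. f x) + (\<Sum>x\<in>(\<Union>i\<in>I. F i). f x)"
    using insert assms(3) by (simp add: sum_Un sum_nonneg)
  then show ?case using insert by force
qed simp

context digit_pair begin

section \<open>Fresh stacks and the energy on all scales\<close>

definition stack_mass :: "real \<Rightarrow> real \<Rightarrow> nat \<Rightarrow> nat" where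
  "stack_mass t M N = card {d \<in> sq N. \<exists>k\<le>N. stacked t M k (up (N - k) d)}"

text \<open>The topmost stacks of each line of descent. No two of them lie above the same square, so
  their weights add up to at most \<open>stack_mass\<close>.\<close>

definition fresh :: "real \<Rightarrow> real \<Rightarrow> nat \<Rightarrow> nat \<times> nat \<Rightarrow> bool" where
  "fresh t M k P \<longleftrightarrow> stacked t M k P \<and> (\<forall>j<k. \<not> stacked t M j (up (k - j) P))"

lemma card_up_eq:
  assumes "k \<le> N"
  shows "card {d \<in> sq N. Q (up (N - k) d)} = card {P \<in> sq k. Q P} * K ^ (N - k)"
proof -
  let ?j = "N - k"
  have N: "N = k + ?j" using assms by simp
  have "card {d \<in> sq N. Q (up ?j d)} = (\<Sum>d\<in>sq N. if Q (up ?j d) then 1 else 0)"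
    by (simp add: sum.If_cases Int_def)
  also have "\<dots> = (\<Sum>x\<in>sq k. \<Sum>y\<in>sq ?j. if Q (up ?j (join ?j x y)) then 1 else 0)"
    by (subst N) (rule sum_sq_add)
  also have "\<dots> = (\<Sum>x\<in>sq k. \<Sum>y\<in>sq ?j. if Q x then 1 else 0)"
    by (intro sum.cong refl) (simp add: up_join)
  also have "\<dots> = (\<Sum>x\<in>sq k. (if Q x then 1 else 0) * K ^ ?j)"
    by (intro sum.cong) (auto simp: card_sq)
  also have "\<dots> = card {P \<in> sq k. Q P} * K ^ ?j"
    by (simp add: sum_distrib_right[symmetric] sum.If_cases Int_def)
  finally show ?thesis .
qed

lemma ex_fresh:
  assumes "d \<in> sq n" "\<exists>k\<le>n. stacked t M k (up (n - k) d)"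
  shows "\<exists>k\<le>n. fresh t M k (up (n - k) d)"
proof -
  define k where "k = (LEAST k. k \<le> n \<and> stacked t M k (up (n - k) d))"
  have k: "k \<le> n" "stacked t M k (up (n - k) d)"
    using LeastI_ex[of "\<lambda>k. k \<le> n \<and> stacked t M k (up (n - k) d)"] assms(2)
    by (auto simp: k_def)
  have "\<not> stacked t M j (up (k - j) (up (n - k) d))" if "j < k" for j
  proof -
    have "k - j + (n - k) = n - j" using that k by auto
    then have "up (k - j) (up (n - k) d) = up (n - j) d"
      by (simp add: up_up)
    moreover have "\<not> (j \<le> n \<and> stacked t M j (up (n - j) d))"
      using not_less_Least that unfolding k_def by blast
    ultimately show ?thesis using that k by auto
  qed
  then show ?thesis using k by (auto simp: fresh_def)
qed

lemma sum_fresh_le: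
  assumes "n \<le> N"
  shows "(\<Sum>k\<le>n. card {P \<in> sq k. fresh t M k P} * K ^ (N - k)) \<le> stack_mass t M N"
proof -
  let ?F = "\<lambda>k. {d \<in> sq N. fresh t M k (up (N - k) d)}"
  have "(\<Sum>k\<le>n. card {P \<in> sq k. fresh t M k P} * K ^ (N - k)) = (\<Sum>k\<le>n. card (?F k))"
    by (intro sum.cong refl card_up_eq[symmetric]) (use assms in auto)
  also have "\<dots> = card (\<Union>k\<in>{..n}. ?F k)"
  proof (rule card_UN_disjoint[symmetric])
    show "\<forall>i\<in>{..n}. \<forall>j\<in>{..n}. i \<noteq> j \<longrightarrow> ?F i \<inter> ?F j = {}"
    proof (intro ballI impI)
      have *: "?F i \<inter> ?F j = {}" if "i < j" "j \<le> n" for i j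
      proof -
        have "False" if d: "d \<in> ?F i" "d \<in> ?F j" for d
        proof -
          have "j - i + (N - j) = N - i" using \<open>i < j\<close> \<open>j \<le> n\<close> assms by auto
          then have "up (j - i) (up (N - j) d) = up (N - i) d" by (simp add: up_up)
          then show False using d \<open>i < j\<close> by (auto simp: fresh_def)
        qed
        then show ?thesis by blast
      qed
      fix i j assume "i \<in> {..n}" "j \<in> {..n}" "i \<noteq> j"
      then show "?F i \<inter> ?F j = {}" using *[of i j] *[of j i] by (cases "i < j") auto
    qed
  qed auto
  also have "\<dots> \<le> stack_mass t M N"
    unfolding stack_mass_def
  proof (rule card_mono)
    show "(\<Union>k\<in>{..n}. ?F k) \<subseteq> {d \<in> sq N. \<exists>k\<le>N. stacked t M k (up (N - k) d)}"
      using assms le_trans unfolding fresh_def by blast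
  qed simp
  finally show ?thesis .
qed

lemma not_stacked_0:
  fixes M :: real
  assumes "M > 1" shows "\<not> stacked t M 0 P"
proof -
  have "cover t 0 x \<le> card (sq 0)" for x
    unfolding cover_def by (intro card_mono) auto
  then have "real (cover t 0 x) \<le> 1" for x
    by (metis card_sq of_nat_1 of_nat_le_iff power_0)
  then have "\<not> M \<le> real (cover t 0 x)" for x
    using assms by (metis order_trans not_le)
  then show ?thesis by (auto simp: stacked_def)
qed

text \<open>Being stacked bounds the number of neighbours from below only. The upper bound comes
  from freshness: the parent is not stacked, so it has at most \<open>2 * M\<close>
  neighbours.\<close>

lemma fresh_nbrs:
  fixes M :: real
  assumes "t \<ge> 0" "M > 1" "P \<in> sq k" "fresh t M k P"
  shows "real (nbrs t k P) \<le> 2 * K * M"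
proof (cases k)
  case 0
  then show ?thesis using assms not_stacked_0 by (auto simp: fresh_def)
next
  case (Suc i)
  have "\<not> stacked t M i (up 1 P)" using assms(4) Suc by (auto simp: fresh_def)
  moreover have "up 1 P \<in> sq i" using up_sq[of P i 1] assms(3) Suc by simp
  ultimately have "real (nbrs t i (up 1 P)) \<le> 2 * M" using nbrs_le assms by blast
  then have "real K * real (nbrs t i (up 1 P)) \<le> real K * (2 * M)"
    by (intro mult_left_mono) auto
  moreover have "real (nbrs t k P) \<le> real (K * nbrs t i (up 1 P))"
    using nbrs_up[of t P i] assms Suc by (simp only: of_nat_le_iff)
  ultimately show ?thesis by simp
qed

text \<open>Pairs of squares lying below a fresh stack are controlled by the energy of lower levels, and
  the total weight of the fresh stacks is small, so the energy stays of order \<open>M\<close>.\<close>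

lemma energy_bound:
  fixes M :: real
  assumes t: "t \<ge> 0" and M: "M > 1" and sm: "real (stack_mass t M N) * (16 * K * M) \<le> K ^ N"
  shows "n \<le> N \<Longrightarrow> real (energy t n) \<le> 4 * M * K ^ n"
proof (induction n rule: less_induct)
  case (less n)
  let ?un = "{d \<in> sq n. \<forall>k\<le>n. \<not> stacked t M k (up (n - k) d)}"
  let ?F = "\<lambda>k. {d \<in> sq n. fresh t M k (up (n - k) d)}"
  let ?c = "\<lambda>k. real (card {P \<in> sq k. fresh t M k P})"
  have K0: "real K > 0" using K4 by simp
  have cover: "sq n \<subseteq> ?un \<union> (\<Union>k\<in>{..n}. ?F k)"
    using ex_fresh by blast
  have "real (energy t n) = (\<Sum>d\<in>sq n. real (nbrs t n d))" by (simp add: energy_def)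
  also have "\<dots> \<le> (\<Sum>d\<in>?un \<union> (\<Union>k\<in>{..n}. ?F k). real (nbrs t n d))"
    by (intro sum_mono2 cover) auto
  also have "\<dots> \<le> (\<Sum>d\<in>?un. real (nbrs t n d)) + (\<Sum>d\<in>(\<Union>k\<in>{..n}. ?F k). real (nbrs t n d))"
    by (subst sum_Un) (auto intro!: sum_nonneg)
  also have "(\<Sum>d\<in>?un. real (nbrs t n d)) \<le> (\<Sum>d\<in>?un. 2 * M)"
  proof (rule sum_mono)
    fix d assume d: "d \<in> ?un"
    then have "\<not> stacked t M n (up (n - n) d)" by blast
    then show "real (nbrs t n d) \<le> 2 * M" using nbrs_le[of d n t M] d t by simp
  qed
  also have "(\<Sum>d\<in>?un. 2 * M) \<le> (\<Sum>d\<in>sq n. 2 * M)"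
    by (intro sum_mono2) (use M in auto)
  also have "\<dots> = 2 * M * K ^ n" by (simp add: card_sq)
  also have "(\<Sum>d\<in>(\<Union>k\<in>{..n}. ?F k). real (nbrs t n d)) \<le> (\<Sum>k\<le>n. \<Sum>d\<in>?F k. real (nbrs t n d))"
    by (rule sum_UN_le') auto
  also have "\<dots> \<le> (\<Sum>k\<le>n. ?c k * (2 * K * M * (4 * (4 * M * K ^ (n - k)))))"
  proof (rule sum_mono)
    fix k assume k: "k \<in> {..n}"
    let ?j = "n - k"
    have n: "n = k + ?j" using k by simp
    show "(\<Sum>d\<in>?F k. real (nbrs t n d)) \<le> ?c k * (2 * K * M * (4 * (4 * M * K ^ ?j)))"
    proof (cases "k = 0")
      \<comment> \<open>The single square of generation 0 cannot be stacked when
        \<open>M > 1\<close>; hence only \<open>k > 0\<close> remains, and the induction hypothesis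
        applies to \<open>n - k < n\<close>.\<close>
      case True
      have "\<not> fresh t M 0 P" if "P \<in> sq 0" for P
        using not_stacked_0[OF M] by (auto simp: fresh_def)
      then have "?F k = {}" using up_sq'[of _ n 0] True by auto
      then have "(\<Sum>d\<in>?F k. real (nbrs t n d)) = 0" by (simp only: sum.empty)
      moreover have "0 \<le> ?c k * (2 * K * M * (4 * (4 * M * K ^ ?j)))" using M by simp
      ultimately show ?thesis by linarith
    next
      case False
      have IH: "real (energy t ?j) \<le> 4 * M * K ^ ?j"
        using less.IH[of ?j] less.prems False k by auto
      have "(\<Sum>d\<in>?F k. real (nbrs t n d)) = (\<Sum>d\<in>sq n. if fresh t M k (up ?j d) then real (nbrs t n d) else 0)"
        by (simp add: sum.If_cases Int_def)
      also have "\<dots> = (\<Sum>x\<in>sq k. \<Sum>y\<in>sq ?j. if fresh t M k (up ?j (join ?j x y)) then real (nbrs t n (join ?j x y)) else 0)"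
        using sum_sq_add[of "\<lambda>d. if fresh t M k (up ?j d) then real (nbrs t n d) else 0" k ?j] n by simp
      also have "\<dots> = (\<Sum>x\<in>sq k. if fresh t M k x then \<Sum>y\<in>sq ?j. real (nbrs t n (join ?j x y)) else 0)"
        by (intro sum.cong refl) (simp add: up_join)
      also have "\<dots> \<le> (\<Sum>x\<in>sq k. if fresh t M k x then 2 * K * M * (4 * (4 * M * K ^ ?j)) else 0)"
      proof (intro sum_mono)
        fix x assume x: "x \<in> sq k"
        have "(\<Sum>y\<in>sq ?j. real (nbrs t n (join ?j x y))) \<le> 2 * K * M * (4 * (4 * M * K ^ ?j))" if f: "fresh t M k x"
        proof -
          have "(\<Sum>y\<in>sq ?j. real (nbrs t n (join ?j x y))) \<le> real (nbrs t k x * (4 * energy t ?j))"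
          proof -
            have "(\<Sum>y\<in>sq ?j. nbrs t n (join ?j x y)) \<le> nbrs t k x * (4 * energy t ?j)"
              using sum_nbrs_join[OF t x, of ?j] n by simp
            then show ?thesis by (metis of_nat_le_iff of_nat_sum)
          qed
          also have "\<dots> = real (nbrs t k x) * (4 * real (energy t ?j))" by simp
          also have "\<dots> \<le> (2 * K * M) * (4 * (4 * M * K ^ ?j))"
            by (intro mult_mono fresh_nbrs t M x f) (use IH M in auto)
          finally show ?thesis .
        qed
        then show "(if fresh t M k x then \<Sum>y\<in>sq ?j. real (nbrs t n (join ?j x y)) else 0)
           \<le> (if fresh t M k x then 2 * K * M * (4 * (4 * M * K ^ ?j)) else 0)" by simp
      qed
      also have "\<dots> = ?c k * (2 * K * M * (4 * (4 * M * K ^ ?j)))"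
        by (simp add: sum.If_cases Int_def)
      finally show ?thesis .
    qed
  qed
  also have "\<dots> \<le> 2 * M * K ^ n"
  proof -
    \<comment> \<open>All weights are compared at generation \<open>N\<close>. The constant
      \<open>16 * K * M\<close> in \<open>sm\<close> is the one that makes the fresh stacks
      contribute no more than the \<open>2 * M * K ^ n\<close> of the unstacked squares.\<close>
    have "(\<Sum>k\<le>n. ?c k * (2 * K * M * (4 * (4 * M * K ^ (n - k))))) * K ^ (N - n)
      = (\<Sum>k\<le>n. ?c k * K ^ (N - k)) * (32 * K * M * M)"
      unfolding sum_distrib_right
    proof (intro sum.cong refl)
      fix k assume "k \<in> {..n}"
      then have "N - k = (n - k) + (N - n)" using less.prems by auto
      then have "real K ^ (N - k) = K ^ (n - k) * K ^ (N - n)" by (simp add: power_add)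
      then show "?c k * (2 * K * M * (4 * (4 * M * K ^ (n - k)))) * K ^ (N - n)
         = ?c k * K ^ (N - k) * (32 * K * M * M)" by simp
    qed
    also have "\<dots> \<le> stack_mass t M N * (32 * K * M * M)"
    proof (rule mult_right_mono)
      have "(\<Sum>k\<le>n. ?c k * K ^ (N - k)) = real (\<Sum>k\<le>n. card {P \<in> sq k. fresh t M k P} * K ^ (N - k))"
        by simp
      also have "\<dots> \<le> stack_mass t M N" using sum_fresh_le[OF less.prems] by (simp only: of_nat_le_iff)
      finally show "(\<Sum>k\<le>n. ?c k * real (K ^ (N - k))) \<le> stack_mass t M N" .
    qed (use M in simp)
    also have "\<dots> = (stack_mass t M N * (16 * K * M)) * (2 * M)" by simp
    also have "\<dots> \<le> K ^ N * (2 * M)"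
      by (intro mult_right_mono sm) (use M in simp)
    also have "\<dots> = (2 * M * K ^ n) * K ^ (N - n)"
      using less.prems by (simp flip: power_add)
    finally show ?thesis using K0 by simp
  qed
  finally show ?case using M by simp
qed

section \<open>Measure of the projections under self-similar iteration\<close>

definition proj :: "real \<Rightarrow> nat \<Rightarrow> real set" where
  "proj t n = (\<Union>d\<in>sq n. {pos t d / K ^ n .. (pos t d + (1 + t)) / K ^ n})"

lemma lm_proj: "proj t n \<in> lmeasurable"
  unfolding proj_def by (intro fmeasurable.finite_UN) auto

lemma compact_proj: "compact (proj t n)"
  unfolding proj_def by (intro compact_UN) auto

lemma up_interval:
  assumes "t \<ge> 0" "k \<le> N" "d \<in> sq N"
  shows "pos t (up (N - k) d) / K ^ k \<le> pos t d / K ^ N"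
    "(pos t d + (1 + t)) / K ^ N \<le> (pos t (up (N - k) d) + (1 + t)) / K ^ k"
proof -
  let ?j = "N - k"
  have N: "real K ^ N = real K ^ k * real K ^ ?j" using assms by (simp flip: power_add)
  have K0: "real K ^ k > 0" "real K ^ ?j > 0" using K4 by auto
  have eq: "pos t d = K ^ ?j * pos t (up ?j d) + pos t (low ?j d)"
    by (metis join_up_low pos_join)
  have "low ?j d \<in> sq ?j" using sq_add_iff[of d k ?j] assms by simp
  then have b: "0 \<le> pos t (low ?j d)" "pos t (low ?j d) \<le> (real K ^ ?j - 1) * (1 + t)"
    using assms pos_le by (auto simp: pos_nonneg)
  have "pos t (up ?j d) / K ^ k = K ^ ?j * pos t (up ?j d) / K ^ N"
    using K0 N K4 by (simp add: field_simps)
  also have "\<dots> \<le> pos t d / K ^ N"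
    using b eq by (intro divide_right_mono) auto
  finally show "pos t (up ?j d) / K ^ k \<le> pos t d / K ^ N" .
  have "(pos t d + (1 + t)) / K ^ N \<le> (K ^ ?j * (pos t (up ?j d) + (1 + t))) / K ^ N"
    using b eq by (intro divide_right_mono) (auto simp: algebra_simps)
  also have "\<dots> = (pos t (up ?j d) + (1 + t)) / K ^ k"
    using K0 N K4 by (simp add: field_simps)
  finally show "(pos t d + (1 + t)) / K ^ N \<le> (pos t (up ?j d) + (1 + t)) / K ^ k" .
qed

definition stack_proj :: "real \<Rightarrow> real \<Rightarrow> nat \<Rightarrow> real set" where
  "stack_proj t M N = (\<Union>k\<in>{..N}. \<Union>P\<in>{P\<in>sq k. stacked t M k P}.
      {pos t P / K ^ k .. (pos t P + (1 + t)) / K ^ k})"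

lemma lm_stack_proj: "stack_proj t M N \<in> lmeasurable"
  unfolding stack_proj_def by (intro fmeasurable.finite_UN) auto

text \<open>A weak-type maximal inequality. The interval around the test point of a stack contains
  the descendants of at least \<open>M\<close> squares, all stacked, hence at least \<open>M\<close>
  times its natural share of mass. Vitali gives disjoint intervals whose fivefold enlargements cover
  the projection, so its measure is at most a constant times the stacked mass divided by
  \<open>M\<close>.\<close>

lemma measure_stack_proj:
  fixes M :: real
  assumes t: "t \<ge> 0" and M: "M > 1"
  shows "measure lebesgue (stack_proj t M N) \<le> 10 * (1 + t) * stack_mass t M N / (M * K ^ N)"
proof -
  have K0: "real K > 0" using K4 by simp
  define I where "I = {(k, P). k \<le> N \<and> P \<in> sq k \<and> M \<le> real (cover t k (pos t P))}"
  define a where "a = (\<lambda>(k::nat, P). pos t P / K ^ k)"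
  define r where "r = (\<lambda>(k::nat, P::nat\<times>nat). (1 + t) / real K ^ k)"
  have "I \<subseteq> (SIGMA k:{..N}. sq k)" by (auto simp: I_def)
  then have finI: "finite I" by (rule finite_subset) auto
  have r0: "0 < r i \<and> r i \<le> 1 + t" if "i \<in> I" for i
    using t K4 by (auto simp: r_def split: prod.split intro!: divide_pos_pos
        simp: divide_le_eq mult_le_cancel_left1)
  have sub: "stack_proj t M N \<subseteq> (\<Union>i\<in>I. cball (a i) (r i))"
  proof
    fix x assume "x \<in> stack_proj t M N"
    then obtain k P where kP: "k \<le> N" "P \<in> sq k" "stacked t M k P"
      "pos t P / K ^ k \<le> x" "x \<le> (pos t P + (1 + t)) / K ^ k"
      by (auto simp: stack_proj_def)
    then obtain P0 where P0: "P0 \<in> sq k" "pos t P \<le> pos t P0" "pos t P0 \<le> pos t P + (1 + t)"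
      "M \<le> real (cover t k (pos t P0))" by (auto simp: stacked_def)
    have Kk: "real K ^ k > 0" using K0 by simp
    have "pos t P \<le> x * K ^ k" "x * K ^ k \<le> pos t P + (1 + t)"
      using kP Kk by (auto simp: field_simps)
    then have "\<bar>pos t P0 - x * K ^ k\<bar> \<le> 1 + t" using P0 by linarith
    then have "\<bar>(pos t P0 - x * K ^ k) / K ^ k\<bar> \<le> (1 + t) / K ^ k"
      unfolding abs_divide using Kk by (intro divide_mono) auto
    then have "x \<in> cball (a (k, P0)) (r (k, P0))"
      using Kk K4 by (simp add: a_def r_def dist_real_def diff_divide_distrib)
    moreover have "(k, P0) \<in> I" using kP P0 by (auto simp: I_def)
    ultimately show "x \<in> (\<Union>i\<in>I. cball (a i) (r i))" by blast
  qed
  obtain C where C: "countable C" "C \<subseteq> I"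
     "pairwise (\<lambda>i j. disjnt (cball (a i) (r i)) (cball (a j) (r j))) C"
     "stack_proj t M N \<subseteq> (\<Union>i\<in>C. cball (a i) (5 * r i))"
    by (rule Vitali_covering_lemma_cballs[OF sub r0]) (assumption | rule that)+
  have finC: "finite C" using C(2) finI finite_subset by blast
  define W where "W i = {d\<in>sq N. \<exists>k\<le>N. stacked t M k (up (N - k) d)} \<inter> {d. pos t d / K ^ N \<in> cball (a i) (r i)}" for i
  have Wcard: "M * K ^ (N - fst i) \<le> card (W i)" if "i \<in> C" for i
  proof -
    obtain k P0 where i: "i = (k, P0)" by (rule prod.exhaust)
    then have I: "k \<le> N" "P0 \<in> sq k" "M \<le> real (cover t k (pos t P0))"
      using that C(2) by (auto simp: I_def)
    have Kk: "real K ^ k > 0" using K0 by simp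
    let ?Q = "\<lambda>P. pos t P \<le> pos t P0 \<and> pos t P0 \<le> pos t P + (1 + t)"
    have "{d \<in> sq N. ?Q (up (N - k) d)} \<subseteq> W i"
    proof
      fix d assume "d \<in> {d \<in> sq N. ?Q (up (N - k) d)}"
      then have d: "d \<in> sq N" "?Q (up (N - k) d)" by auto
      have upd: "up (N - k) d \<in> sq k" using up_sq'[OF d(1) I(1)] .
      have "stacked t M k (up (N - k) d)"
        unfolding stacked_def using d I by auto
      moreover have "pos t d / K ^ N \<in> cball (a i) (r i)"
      proof -
        note b = up_interval[OF t I(1) d(1)]
        have "(pos t P0 - (1 + t)) / K ^ k \<le> pos t (up (N - k) d) / K ^ k"
          using d Kk by (intro divide_right_mono) auto
        moreover have "(pos t (up (N - k) d) + (1 + t)) / K ^ k \<le> (pos t P0 + (1 + t)) / K ^ k"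
          using d Kk by (intro divide_right_mono) auto
        moreover have "pos t d / K ^ N \<le> (pos t d + (1 + t)) / K ^ N"
          using t K0 by (intro divide_right_mono) auto
        ultimately show ?thesis using b
          by (simp add: i a_def r_def dist_real_def diff_divide_distrib add_divide_distrib abs_le_iff)
      qed
      ultimately show "d \<in> W i" using d I by (auto simp: W_def)
    qed
    then have "card {d \<in> sq N. ?Q (up (N - k) d)} \<le> card (W i)"
      by (intro card_mono) (auto simp: W_def)
    then have "cover t k (pos t P0) * K ^ (N - k) \<le> card (W i)"
      using card_up_eq[OF I(1), of ?Q] by (simp add: cover_def)
    then have "real (cover t k (pos t P0)) * real K ^ (N - k) \<le> card (W i)"
      by (metis of_nat_le_iff of_nat_mult of_nat_power)
    moreover have "M * real K ^ (N - k) \<le> real (cover t k (pos t P0)) * real K ^ (N - k)"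
      by (intro mult_right_mono I) simp
    ultimately show ?thesis by (simp add: i)
  qed
  have "(\<Sum>i\<in>C. card (W i)) = card (\<Union>i\<in>C. W i)"
  proof (rule card_UN_disjoint[symmetric])
    show "\<forall>i\<in>C. \<forall>j\<in>C. i \<noteq> j \<longrightarrow> W i \<inter> W j = {}"
    proof (intro ballI impI)
      fix i j assume "i \<in> C" "j \<in> C" "i \<noteq> j"
      then have "disjnt (cball (a i) (r i)) (cball (a j) (r j))"
        using C(3) by (auto simp only: pairwise_def)
      then show "W i \<inter> W j = {}" unfolding W_def disjnt_def by blast
    qed
  qed (use finC in \<open>auto simp: W_def\<close>)
  also have "\<dots> \<le> stack_mass t M N"
    unfolding stack_mass_def by (intro card_mono) (auto simp: W_def)
  finally have sumW': "real (\<Sum>i\<in>C. card (W i)) \<le> real (stack_mass t M N)"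
    by (simp only: of_nat_le_iff)
  have "measure lebesgue (stack_proj t M N) \<le> measure lebesgue (\<Union>i\<in>C. cball (a i) (5 * r i))"
    by (intro measure_mono_fmeasurable C(4) fmeasurable.finite_UN finC fmeasurableD lm_stack_proj) auto
  also have "\<dots> \<le> (\<Sum>i\<in>C. measure lebesgue (cball (a i) (5 * r i)))"
    by (intro measure_UNION_le finC) auto
  also have "\<dots> = (\<Sum>i\<in>C. 10 * r i)"
    using r0 C(2) by (intro sum.cong refl) (force simp: cball_eq_atLeastAtMost)
  also have "\<dots> \<le> (\<Sum>i\<in>C. 10 * (1 + t) / (M * K ^ N) * card (W i))"
  proof (rule sum_mono)
    fix i assume iC: "i \<in> C"
    obtain k P0 where i: "i = (k, P0)" by (rule prod.exhaust)
    have k: "k \<le> N" using iC C(2) i by (auto simp: I_def)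
    have pw: "real K ^ N = K ^ k * K ^ (N - k)" using k by (simp flip: power_add)
    have "10 * r i = 10 * (1 + t) / (M * K ^ N) * (M * K ^ (N - k))"
      using M K0 by (simp add: i r_def pw field_simps)
    also have "\<dots> \<le> 10 * (1 + t) / (M * K ^ N) * card (W i)"
      by (intro mult_left_mono) (use Wcard[OF iC] i M K0 t in auto)
    finally show "10 * r i \<le> \<dots>" .
  qed
  also have "\<dots> = 10 * (1 + t) / (M * K ^ N) * real (\<Sum>i\<in>C. card (W i))"
    by (simp add: sum_distrib_left)
  also have "\<dots> \<le> 10 * (1 + t) / (M * K ^ N) * stack_mass t M N"
    by (rule mult_left_mono[OF sumW']) (use M t in auto)
  finally show ?thesis by simp
qed

text \<open>Squares without stacked ancestor number \<open>(1 - \<theta>) * K ^ N\<close>, and each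
  of them carries a copy of \<open>proj t i\<close> scaled by \<open>1 / K ^ N\<close>; everything
  else lies in \<open>stack_proj\<close>.\<close>

lemma measure_proj_step:
  fixes N :: nat and M :: real
  assumes t: "t \<ge> 0" and M: "M > 1"
  defines "\<theta> \<equiv> stack_mass t M N / K ^ N"
  shows "measure lebesgue (proj t (N + i)) \<le> 10 * (1 + t) * \<theta> / M + (1 - \<theta>) * measure lebesgue (proj t i)"
proof -
  have K0: "real K > 0" using K4 by simp
  let ?U = "{d \<in> sq N. \<not> (\<exists>k\<le>N. stacked t M k (up (N - k) d))}"
  let ?f = "\<lambda>x y. pos t x / K ^ N + (1 / K ^ N) * y"
  have sub: "proj t (N + i) \<subseteq> stack_proj t M N \<union> (\<Union>x\<in>?U. ?f x ` proj t i)"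
  proof
    fix z assume "z \<in> proj t (N + i)"
    then obtain d where d: "d \<in> sq (N + i)" "pos t d / K ^ (N + i) \<le> z"
      "z \<le> (pos t d + (1 + t)) / K ^ (N + i)" by (auto simp: proj_def)
    let ?x = "up i d" and ?y = "low i d"
    have xy: "?x \<in> sq N" "?y \<in> sq i" using d sq_add_iff by auto
    show "z \<in> stack_proj t M N \<union> (\<Union>x\<in>?U. ?f x ` proj t i)"
    proof (cases "\<exists>k\<le>N. stacked t M k (up (N - k) ?x)")
      case True
      then obtain k where k: "k \<le> N" "stacked t M k (up (N - k) ?x)" by blast
      have 1: "up (N - k) ?x = up (N + i - k) d" using k by (simp add: up_up)
      have 2: "up (N + i - k) d \<in> sq k" using up_sq'[OF d(1), of k] k by simp
      have "z \<in> {pos t (up (N + i - k) d) / K ^ k .. (pos t (up (N + i - k) d) + (1 + t)) / K ^ k}"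
        using up_interval[OF t _ d(1), of k] k d by simp
      then have "z \<in> stack_proj t M N"
        unfolding stack_proj_def using 1 2 k
        by (intro UN_I[of k] UN_I[of "up (N + i - k) d"]) auto
      then show ?thesis by blast
    next
      case False
      have eq: "pos t d = K ^ i * pos t ?x + pos t ?y"
        by (metis join_up_low pos_join)
      define w where "w = K ^ N * (z - pos t ?x / K ^ N)"
      have "z = ?f ?x w" using K0 by (simp add: w_def field_simps)
      moreover have "w \<in> proj t i"
      proof -
        have "K ^ i * w = K ^ (N + i) * z - K ^ i * pos t ?x"
          using K0 by (simp add: w_def power_add field_simps)
        moreover have "pos t d \<le> K ^ (N + i) * z" "K ^ (N + i) * z \<le> pos t d + (1 + t)"
          using d K0 by (auto simp: field_simps)
        ultimately have "pos t ?y \<le> K ^ i * w" "K ^ i * w \<le> pos t ?y + (1 + t)"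
          using eq by auto
        then have "pos t ?y / K ^ i \<le> w" "w \<le> (pos t ?y + (1 + t)) / K ^ i"
          using K0 by (auto simp: field_simps)
        then show ?thesis using xy by (auto simp: proj_def)
      qed
      ultimately have "z \<in> ?f ?x ` proj t i" by blast
      then show ?thesis using xy False by blast
    qed
  qed
  have lmi: "?f x ` proj t i \<in> lmeasurable" for x
    by (intro lmeasurable_compact compact_continuous_image compact_proj continuous_intros)
  have mi: "measure lebesgue (?f x ` proj t i) = measure lebesgue (proj t i) / K ^ N" for x
    using K0 measure_lebesgue_affine[of "1 / K ^ N" "pos t x / K ^ N" "proj t i"]
    by (simp add: add.commute)
  have cU: "real (card ?U) = (1 - \<theta>) * K ^ N"
  proof -
    have "card ?U + stack_mass t M N = card (sq N)"
    proof -
      define p where "p d = (\<exists>k\<le>N. stacked t M k (up (N - k) d))" for d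
      have "card {d \<in> sq N. \<not> p d} + card {d \<in> sq N. p d} = card ({d \<in> sq N. \<not> p d} \<union> {d \<in> sq N. p d})"
        by (rule card_Un_disjoint[symmetric]) auto
      also have "{d \<in> sq N. \<not> p d} \<union> {d \<in> sq N. p d} = sq N" by auto
      finally show ?thesis unfolding stack_mass_def p_def .
    qed
    then have "card ?U + stack_mass t M N = K ^ N" by (simp only: card_sq)
    then have "real (card ?U) + real (stack_mass t M N) = real (K ^ N)"
      by (simp only: of_nat_add[symmetric])
    moreover have "\<theta> * K ^ N = real (stack_mass t M N)" using K0 by (simp add: \<theta>_def)
    ultimately show ?thesis unfolding left_diff_distrib by linarith
  qed
  have "measure lebesgue (proj t (N + i)) \<le> measure lebesgue (stack_proj t M N \<union> (\<Union>x\<in>?U. ?f x ` proj t i))"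
    by (intro measure_mono_fmeasurable sub fmeasurable.Un fmeasurable.finite_UN lmi fmeasurableD lm_proj lm_stack_proj) auto
  also have "\<dots> \<le> measure lebesgue (stack_proj t M N) + measure lebesgue (\<Union>x\<in>?U. ?f x ` proj t i)"
    by (intro measure_Un_le fmeasurableD lm_stack_proj fmeasurable.finite_UN lmi) auto
  also have "measure lebesgue (\<Union>x\<in>?U. ?f x ` proj t i) \<le> (\<Sum>x\<in>?U. measure lebesgue (?f x ` proj t i))"
    by (intro measure_UNION_le fmeasurableD lmi) auto
  also have "\<dots> = (1 - \<theta>) * measure lebesgue (proj t i)"
    unfolding mi using cU K0 by simp
  also have "measure lebesgue (stack_proj t M N) \<le> 10 * (1 + t) * \<theta> / M"
    using measure_stack_proj[OF t M, of N] by (simp add: \<theta>_def field_simps)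
  finally show ?thesis by simp
qed

lemma measure_proj_le: "t \<ge> 0 \<Longrightarrow> measure lebesgue (proj t n) \<le> 1 + t"
proof -
  assume t: "t \<ge> 0"
  have K0: "real K ^ n > 0" using K4 by simp
  have "proj t n \<subseteq> {0..1 + t}"
  proof
    fix z assume "z \<in> proj t n"
    then obtain d where d: "d \<in> sq n" "pos t d / K ^ n \<le> z" "z \<le> (pos t d + (1 + t)) / K ^ n"
      by (auto simp: proj_def)
    have "0 \<le> pos t d / K ^ n" using pos_nonneg[OF t] K0 by simp
    moreover have "(pos t d + (1 + t)) / K ^ n \<le> 1 + t"
      using pos_le[OF t d(1)] K0 by (simp add: field_simps)
    ultimately show "z \<in> {0..1 + t}" using d by auto
  qed
  then have "measure lebesgue (proj t n) \<le> measure lebesgue {0..1 + t}"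
    by (intro measure_mono_fmeasurable) (auto simp: lm_proj fmeasurableD)
  then show ?thesis using t by simp
qed

text \<open>The recursion of \<open>measure_proj_step\<close> has the fixed point
  \<open>10 * (1 + t) / M\<close> and contracts towards it with ratio
  \<open>1 - \<theta>\<close>.\<close>

lemma measure_proj_iter:
  fixes N :: nat and M :: real
  assumes t: "t \<ge> 0" and M: "M > 1"
  defines "\<theta> \<equiv> stack_mass t M N / K ^ N"
  shows "measure lebesgue (proj t (L * N)) \<le> 10 * (1 + t) / M + (1 - \<theta>) ^ L * (1 + t)"
proof (induction L)
  case 0
  then show ?case using measure_proj_le[OF t, of 0] t M by (simp add: add_nonneg_nonneg add_increasing)
next
  case (Suc L)
  have "stack_mass t M N \<le> card (sq N)" unfolding stack_mass_def by (intro card_mono) auto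
  then have "real (stack_mass t M N) \<le> real (K ^ N)" by (simp only: card_sq of_nat_le_iff)
  then have \<theta>: "\<theta> \<le> 1" using K4 by (simp add: \<theta>_def)
  have "measure lebesgue (proj t (N + L * N)) \<le> 10 * (1 + t) * \<theta> / M + (1 - \<theta>) * measure lebesgue (proj t (L * N))"
    using measure_proj_step[OF t M] by (simp add: \<theta>_def)
  also have "\<dots> \<le> 10 * (1 + t) * \<theta> / M + (1 - \<theta>) * (10 * (1 + t) / M + (1 - \<theta>) ^ L * (1 + t))"
    by (intro add_left_mono mult_left_mono Suc.IH) (use \<theta> in auto)
  also have "\<dots> = 10 * (1 + t) / M + (1 - \<theta>) ^ Suc L * (1 + t)"
    using M by (simp add: field_simps)
  finally show ?case by simp
qed

text \<open>If the hypothesis of \<open>energy_bound\<close> fails, \<open>\<theta>\<close> is at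
  least \<open>1 / (16 * K * M)\<close>, and the lower bound on \<open>L\<close> is what brings
  \<open>(1 - \<theta>) ^ L\<close> below \<open>1 / M\<close>.\<close>

lemma stack_dichotomy:
  fixes M :: real
  assumes t: "t \<ge> 0" and M: "M > 1" and L: "real L \<ge> 16 * K * M * ln M"
  shows "(\<forall>n\<le>N. real (energy t n) \<le> 4 * M * K ^ n) \<or> measure lebesgue (proj t (L * N)) \<le> 11 * (1 + t) / M"
proof (cases "real (stack_mass t M N) * (16 * K * M) \<le> K ^ N")
  case True
  then show ?thesis using energy_bound[OF t M] by blast
next
  case False
  have K0: "real K ^ N > 0" "real K > 0" using K4 by auto
  define \<theta> where "\<theta> = stack_mass t M N / K ^ N"
  have th: "\<theta> * (16 * K * M) \<ge> 1"
    using False K0 by (simp add: \<theta>_def field_simps)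
  have "stack_mass t M N \<le> card (sq N)" unfolding stack_mass_def by (intro card_mono) auto
  then have "real (stack_mass t M N) \<le> real (K ^ N)" by (simp only: card_sq of_nat_le_iff)
  then have th1: "\<theta> \<le> 1" using K0 by (simp add: \<theta>_def)
  have th0: "\<theta> \<ge> 0" by (simp add: \<theta>_def)
  have "(1 - \<theta>) ^ L \<le> exp (- \<theta>) ^ L"
    by (intro power_mono) (use th1 exp_ge_add_one_self[of "-\<theta>"] in auto)
  also have "\<dots> = exp (- (\<theta> * L))" by (simp add: exp_of_nat_mult[symmetric] mult.commute)
  also have "\<dots> \<le> exp (- ln M)"
  proof -
    have "ln M \<le> (\<theta> * (16 * K * M)) * ln M" using th M by (simp add: mult_le_cancel_right1)
    also have "\<dots> = \<theta> * (16 * K * M * ln M)" by simp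
    also have "\<dots> \<le> \<theta> * L" by (intro mult_left_mono L th0)
    finally show ?thesis by simp
  qed
  also have "\<dots> = 1 / M" using M by (simp add: exp_minus inverse_eq_divide)
  finally have "(1 - \<theta>) ^ L * (1 + t) \<le> 1 / M * (1 + t)" by (intro mult_right_mono) (use t in auto)
  then have "measure lebesgue (proj t (L * N)) \<le> 10 * (1 + t) / M + 1 / M * (1 + t)"
    using measure_proj_iter[OF t M, of L N] by (simp add: \<theta>_def)
  also have "\<dots> = 11 * (1 + t) / M" by (simp add: add_divide_distrib[symmetric] algebra_simps)
  finally show ?thesis by blast
qed

end

section \<open>Trigonometric sums\<close>

text \<open>The weights are general because smearing changes the coefficients, see
  \<open>smear_trig\<close>. Constant weights give the squared modulus of the normalised exponential
  sum, see \<open>sqmod_expsum\<close>.\<close>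

definition trig_sum :: "nat set \<Rightarrow> (nat \<Rightarrow> nat \<Rightarrow> real) \<Rightarrow> real \<Rightarrow> real" where
  "trig_sum S w u = (\<Sum>b\<in>S. \<Sum>b'\<in>S. w b b' * cos (2 * pi * (real b - real b') * u))"

definition sqmod :: "nat set \<Rightarrow> real \<Rightarrow> real" where
  "sqmod S = trig_sum S (\<lambda>_ _. 1 / (real (card S))\<^sup>2)"

lemma continuous_trig_sum [continuous_intros]:
  fixes f :: "real \<Rightarrow> real"
  shows "continuous_on X f \<Longrightarrow> continuous_on X (\<lambda>x. trig_sum S w (f x))"
  unfolding trig_sum_def by (intro continuous_intros)

lemma continuous_sqmod [continuous_intros]:
  fixes f :: "real \<Rightarrow> real"
  shows "continuous_on X f \<Longrightarrow> continuous_on X (\<lambda>x. sqmod S (f x))"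
  unfolding sqmod_def by (intro continuous_intros)

definition expsum :: "nat set \<Rightarrow> real \<Rightarrow> complex" where
  "expsum S u = (\<Sum>b\<in>S. cis (2 * pi * real b * u))"

lemma cmod_sum_cis:
  "(cmod (\<Sum>d\<in>S. cis (2 * pi * p d * u)))\<^sup>2
    = (\<Sum>d\<in>S. \<Sum>d'\<in>S. cos (2 * pi * (p d - p d') * u))"
proof -
  have "complex_of_real ((cmod (\<Sum>d\<in>S. cis (2 * pi * p d * u)))\<^sup>2)
      = (\<Sum>d\<in>S. cis (2 * pi * p d * u)) * cnj (\<Sum>d\<in>S. cis (2 * pi * p d * u))"
    by (simp only: complex_norm_square)
  also have "\<dots> = (\<Sum>b\<in>S. \<Sum>b'\<in>S. cis (2 * pi * p b * u) * cis (- (2 * pi * p b' * u)))"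
    by (simp add: sum_product cis_cnj)
  also have "\<dots> = (\<Sum>b\<in>S. \<Sum>b'\<in>S. cis (2 * pi * (p b - p b') * u))"
    by (simp add: cis_mult algebra_simps)
  finally have "Re (complex_of_real ((cmod (\<Sum>d\<in>S. cis (2 * pi * p d * u)))\<^sup>2))
      = Re (\<Sum>b\<in>S. \<Sum>b'\<in>S. cis (2 * pi * (p b - p b') * u))" by (rule arg_cong)
  then show ?thesis by simp
qed

lemma cmod_expsum: "(cmod (expsum S u))\<^sup>2 = (\<Sum>b\<in>S. \<Sum>b'\<in>S. cos (2 * pi * (real b - real b') * u))"
  unfolding expsum_def by (rule cmod_sum_cis)

lemma sqmod_expsum: "sqmod S u = (cmod (expsum S u))\<^sup>2 / (real (card S))\<^sup>2"
  by (simp add: sqmod_def trig_sum_def cmod_expsum sum_divide_distrib)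

lemma sqmod_nonneg: "0 \<le> sqmod S u"
  by (simp add: sqmod_expsum)

lemma cmod_expsum_le: "cmod (expsum S u) \<le> card S"
  unfolding expsum_def by (rule order_trans[OF norm_sum]) simp

lemma sqmod_le_1: "sqmod S u \<le> 1"
proof (cases "card S = 0")
  case False
  have "(cmod (expsum S u))\<^sup>2 \<le> (real (card S))\<^sup>2"
    by (intro power_mono cmod_expsum_le) simp
  then show ?thesis using False by (simp add: sqmod_expsum)
qed (simp add: sqmod_expsum)

lemma cos_periodic_int: "cos (x + 2 * pi * of_int n) = cos x"
  by (simp add: cos_add cos_int_2pin sin_int_2pin)

lemma trig_sum_add_int: "trig_sum S w (u + of_int n) = trig_sum S w u"
proof -
  have "cos (2 * pi * (real b - real b') * (u + of_int n)) = cos (2 * pi * (real b - real b') * u)" for b b'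
  proof -
    have "2 * pi * (real b - real b') * (u + of_int n)
      = 2 * pi * (real b - real b') * u + 2 * pi * of_int ((int b - int b') * n)"
      by (simp add: algebra_simps)
    then show ?thesis by (simp only: cos_periodic_int)
  qed
  then show ?thesis by (simp add: trig_sum_def)
qed

lemma sqmod_add_int: "sqmod S (u + of_int n) = sqmod S u"
  by (simp add: sqmod_def trig_sum_add_int)

lemma sum_cis_roots:
  fixes j :: int and N :: nat
  assumes "N > 0" "\<not> int N dvd j"
  shows "(\<Sum>k<N. cis (2 * pi * j * k / N)) = 0"
proof -
  let ?z = "cis (2 * pi * j / N)"
  have pw: "cis (2 * pi * j * real k / N) = ?z ^ k" for k
    unfolding Complex.DeMoivre by (rule arg_cong[where f = cis]) simp
  have "?z ^ N = 1"
  proof -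
    have "?z ^ N = cis (2 * pi * j)" using assms by (simp add: Complex.DeMoivre)
    also have "\<dots> = 1" by (metis cis_multiple_2pi Ints_of_int mult.assoc)
    finally show ?thesis .
  qed
  moreover have "?z \<noteq> 1"
  proof
    assume "?z = 1"
    then have "cos (2 * pi * j / N) = 1" by (metis cis.sel(1) one_complex.sel(1))
    then obtain n :: int where n: "2 * pi * j / N = real_of_int n * 2 * pi"
      by (auto simp only: cos_one_2pi_int)
    then have "real_of_int j = n * N" using assms by (simp add: field_simps)
    then have "j = n * int N" by (metis of_int_eq_iff of_int_mult of_int_of_nat_eq)
    then show False using assms by simp
  qed
  ultimately have "(\<Sum>k<N. ?z ^ k) = 0" by (simp add: sum_gp_strict)
  then show ?thesis by (simp add: pw)
qed

lemma sum_cos_roots: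
  fixes j :: int and N :: nat
  assumes "N > 0" "\<not> int N dvd j"
  shows "(\<Sum>k<N. cos (2 * pi * j * ((x + real k) / N))) = 0"
proof -
  have "(\<Sum>k<N. cis (2 * pi * j * ((x + real k) / N))) = cis (2 * pi * j * x / N) * (\<Sum>k<N. cis (2 * pi * j * k / N))"
    unfolding sum_distrib_left cis_mult by (intro sum.cong refl arg_cong[where f = cis])
      (simp add: add_divide_distrib algebra_simps)
  also have "\<dots> = 0" using sum_cis_roots[OF assms] by simp
  finally have "Re (\<Sum>k<N. cis (2 * pi * j * ((x + real k) / N))) = 0" by simp
  then show ?thesis by simp
qed

text \<open>Averaging over \<open>N\<close> residues removes every off-diagonal term, because
  distinct digits differ by less than \<open>N\<close>.\<close>

lemma sum_trig_sum:
  assumes "S \<subseteq> {0..<N}"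
  shows "(\<Sum>k<N. trig_sum S w ((x + real k) / N)) = N * (\<Sum>b\<in>S. w b b)"
proof (cases "N = 0")
  case False
  have fin: "finite S" using assms finite_subset by blast
  have c: "(\<Sum>k<N. cos (2 * pi * (real b - real b') * ((x + real k) / N))) = (if b = b' then N else 0)"
    if "b \<in> S" "b' \<in> S" for b b'
  proof (cases "b = b'")
    case neq: False
    have "b < N" "b' < N" using that assms by auto
    then have "\<bar>int b - int b'\<bar> < int N" "int b - int b' \<noteq> 0" using neq by auto
    then have "\<not> int N dvd (int b - int b')"
      using zdvd_not_zless[of "\<bar>int b - int b'\<bar>" "int N"] by auto
    from sum_cos_roots[OF _ this, of x] show ?thesis using neq False by simp
  qed simp
  have "(\<Sum>k<N. trig_sum S w ((x + real k) / N))
     = (\<Sum>b\<in>S. \<Sum>b'\<in>S. w b b' * (\<Sum>k<N. cos (2 * pi * (real b - real b') * ((x + real k) / N))))"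
    unfolding trig_sum_def sum_distrib_left
    by (subst sum.swap, rule sum.cong[OF refl], rule sum.swap)
  also have "\<dots> = (\<Sum>b\<in>S. \<Sum>b'\<in>S. if b = b' then w b b' * N else 0)"
    by (intro sum.cong refl) (simp only: c split: if_split, simp)
  also have "\<dots> = (\<Sum>b\<in>S. w b b * N)"
    using fin by (simp add: sum.delta)
  finally show ?thesis by (simp add: sum_distrib_left mult.commute)
qed (use assms in auto)

lemma sum_sqmod:
  assumes "S \<subseteq> {0..<N}"
  shows "(\<Sum>k<N. sqmod S ((x + real k) / N)) = N / card S"
  unfolding sqmod_def sum_trig_sum[OF assms] by (simp add: power2_eq_square)

text \<open>The digits are independent: the last one contributes \<open>expsum S u\<close>, and the
  leading ones see the frequency multiplied by \<open>K\<close>.\<close>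

lemma expsum_digit_nums:
  assumes "S \<subseteq> {0..<K}"
  shows "expsum (digit_nums K S (Suc s)) u = expsum (digit_nums K S s) (K * u) * expsum S u"
proof -
  have inj: "inj_on (\<lambda>(x, a). K * x + a) (digit_nums K S s \<times> S)"
  proof (rule inj_onI, clarsimp)
    fix x a y b assume "a \<in> S" "b \<in> S" and eq: "K * x + a = K * y + b"
    then have "a < K" "b < K" using assms by auto
    then have "(K * x + a) div K = x" "(K * y + b) div K = y" by auto
    then show "x = y \<and> a = b" using eq by auto
  qed
  have "expsum (digit_nums K S (Suc s)) u
    = (\<Sum>(x, a)\<in>digit_nums K S s \<times> S. cis (2 * pi * real (K * x + a) * u))"
    unfolding expsum_def digit_nums.simps by (subst sum.reindex[OF inj]) (simp add: case_prod_beta o_def)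
  also have "\<dots> = (\<Sum>x\<in>digit_nums K S s. \<Sum>a\<in>S. cis (2 * pi * real x * (K * u)) * cis (2 * pi * real a * u))"
    by (simp add: sum.cartesian_product cis_mult algebra_simps)
  also have "\<dots> = expsum (digit_nums K S s) (K * u) * expsum S u"
    by (simp add: expsum_def sum_product)
  finally show ?thesis .
qed

lemma sqmod_digit_nums_Suc:
  assumes "S \<subseteq> {0..<K}"
  shows "sqmod (digit_nums K S (Suc s)) u = sqmod (digit_nums K S s) (K * u) * sqmod S u"
  by (simp only: sqmod_expsum expsum_digit_nums[OF assms] card_digit_nums[OF assms])
    (simp add: norm_mult power_mult_distrib)

lemma sqmod_digit_nums:
  assumes "S \<subseteq> {0..<K}" "card S > 0"
  shows "sqmod (digit_nums K S s) u = (\<Prod>l<s. sqmod S (K ^ l * u))"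
proof (induction s arbitrary: u)
  case 0
  then show ?case by (simp add: sqmod_expsum expsum_def)
next
  case (Suc s)
  show ?case
    unfolding sqmod_digit_nums_Suc[OF assms(1)] Suc.IH prod.lessThan_Suc_shift
    by (simp add: o_def mult.commute mult.left_commute power_commutes mult.assoc)
qed

section \<open>Positive definite functions\<close>

text \<open>By Bochner's theorem this characterises positive definiteness; the averaged form is closed
  under products with cosines, which is all that is needed.\<close>

definition fejer_pos :: "(real \<Rightarrow> real) \<Rightarrow> bool" where
  "fejer_pos f \<longleftrightarrow> continuous_on UNIV f \<and>
     (\<forall>L>0. \<forall>\<xi>. 0 \<le> integral {0..L} (\<lambda>z. (1 - z / L) * f z * cos (\<xi> * z)))"

lemma fejer_integral:
  fixes \<xi> :: real
  assumes "L > 0" "\<xi> \<noteq> 0"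
  shows "((\<lambda>z. (1 - z / L) * cos (\<xi> * z)) has_integral (1 - cos (\<xi> * L)) / (\<xi>\<^sup>2 * L)) {0..L}"
proof -
  define F where "F z = (1 - z / L) * sin (\<xi> * z) / \<xi> - cos (\<xi> * z) / (\<xi>\<^sup>2 * L)" for z
  have "((\<lambda>z. (1 - z / L) * cos (\<xi> * z)) has_integral F L - F 0) {0..L}"
  proof (rule fundamental_theorem_of_calculus)
    fix z assume "z \<in> {0..L}"
    have "(F has_real_derivative (1 - z / L) * cos (\<xi> * z)) (at z within {0..L})"
      unfolding F_def using assms
      by (auto intro!: derivative_eq_intros simp: field_simps power2_eq_square)
    then show "(F has_vector_derivative (1 - z / L) * cos (\<xi> * z)) (at z within {0..L})"
      by (simp add: has_real_derivative_iff_has_vector_derivative)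
  qed (use assms in simp)
  moreover have "F L - F 0 = (1 - cos (\<xi> * L)) / (\<xi>\<^sup>2 * L)"
    using assms by (simp add: F_def diff_divide_distrib)
  ultimately show ?thesis by simp
qed

lemma fejer_integral_0:
  fixes L :: real
  assumes "L > 0" shows "((\<lambda>z. 1 - z / L) has_integral L / 2) {0..L}"
proof -
  define F where "F z = z - z\<^sup>2 * (1 / (2 * L))" for z
  have "((\<lambda>z. 1 - z / L) has_integral F L - F 0) {0..L}"
  proof (rule fundamental_theorem_of_calculus)
    fix z assume "z \<in> {0..L}"
    have "(F has_real_derivative 1 - z / L) (at z within {0..L})"
      unfolding F_def using assms
      by (auto intro!: derivative_eq_intros simp: field_simps power2_eq_square)
    then show "(F has_vector_derivative 1 - z / L) (at z within {0..L})"
      by (simp add: has_real_derivative_iff_has_vector_derivative)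
  qed (use assms in simp)
  moreover have "F L - F 0 = L / 2"
    using assms by (simp add: F_def field_simps power2_eq_square)
  ultimately show ?thesis by simp
qed

lemma fejer_pos_1: "fejer_pos (\<lambda>_. 1)"
  unfolding fejer_pos_def
proof (intro conjI allI impI)
  fix L \<xi> :: real assume L: "L > 0"
  show "0 \<le> integral {0..L} (\<lambda>z. (1 - z / L) * 1 * cos (\<xi> * z))"
  proof (cases "\<xi> = 0")
    case True
    then show ?thesis using integral_unique[OF fejer_integral_0[OF L]] L by simp
  next
    case False
    then show ?thesis using integral_unique[OF fejer_integral[OF L False]] L by simp
  qed
qed simp

text \<open>Multiplication by a cosine only shifts \<open>\<xi>\<close>, so the right-hand side
  consists of integrals that \<open>fejer_pos f\<close> makes nonnegative.\<close>

lemma fejer_pos_mult_aux: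
  assumes f: "fejer_pos f" and L: "L > 0" and fin: "finite S"
  shows "integral {0..L} (\<lambda>z. (1 - z / L) * (f z * trig_sum S w (\<mu> * z)) * cos (\<xi> * z))
     = (\<Sum>b\<in>S. \<Sum>b'\<in>S. w b b' / 2 *
        (integral {0..L} (\<lambda>z. (1 - z / L) * f z * cos ((2 * pi * (real b - real b') * \<mu> + \<xi>) * z))
       + integral {0..L} (\<lambda>z. (1 - z / L) * f z * cos ((2 * pi * (real b - real b') * \<mu> - \<xi>) * z))))"
proof -
  have cf: "continuous_on T f" for T using f continuous_on_subset by (auto simp: fejer_pos_def)
  have int: "(\<lambda>z. (1 - z / L) * f z * cos (\<nu> * z)) integrable_on {0..L}" for \<nu>
    using L by (auto intro!: integrable_continuous_real continuous_intros cf)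
  have eq: "(1 - z / L) * (f z * trig_sum S w (\<mu> * z)) * cos (\<xi> * z)
    = (\<Sum>b\<in>S. \<Sum>b'\<in>S. w b b' / 2 *
        ((1 - z / L) * f z * cos ((2 * pi * (real b - real b') * \<mu> + \<xi>) * z)
       + (1 - z / L) * f z * cos ((2 * pi * (real b - real b') * \<mu> - \<xi>) * z)))" for z
  proof -
    have c: "cos (2 * pi * (real b - real b') * (\<mu> * z)) * cos (\<xi> * z) =
       (cos ((2 * pi * (real b - real b') * \<mu> + \<xi>) * z) + cos ((2 * pi * (real b - real b') * \<mu> - \<xi>) * z)) / 2"
      for b b'
      by (subst cos_times_cos) (simp add: algebra_simps)
    have "(1 - z / L) * (f z * trig_sum S w (\<mu> * z)) * cos (\<xi> * z)
      = (\<Sum>b\<in>S. \<Sum>b'\<in>S. w b b' * ((1 - z / L) * f z) * (cos (2 * pi * (real b - real b') * (\<mu> * z)) * cos (\<xi> * z)))"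
      unfolding trig_sum_def sum_distrib_left sum_distrib_right
      by (intro sum.cong refl) (simp add: algebra_simps)
    moreover have "w * a * ((x + y) / 2) = w / 2 * (a * x + a * y)" for w a x y :: real
      by (simp add: algebra_simps)
    ultimately show ?thesis by (simp only: c)
  qed
  show ?thesis unfolding eq
    by (intro integral_unique has_integral_sum has_integral_mult_right has_integral_add
        integrable_integral int fin)
qed

lemma fejer_pos_mult:
  assumes f: "fejer_pos f" and w: "\<And>b b'. b \<in> S \<Longrightarrow> b' \<in> S \<Longrightarrow> 0 \<le> w b b'"
    and fin: "finite S"
  shows "fejer_pos (\<lambda>z. f z * trig_sum S w (\<mu> * z))"
proof -
  have cf: "continuous_on T f" for T using f continuous_on_subset by (auto simp: fejer_pos_def)
  show ?thesis
    unfolding fejer_pos_def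
  proof (intro conjI allI impI)
    fix L \<xi> :: real assume L: "L > 0"
    show "0 \<le> integral {0..L} (\<lambda>z. (1 - z / L) * (f z * trig_sum S w (\<mu> * z)) * cos (\<xi> * z))"
      unfolding fejer_pos_mult_aux[OF f L fin]
      using f L by (intro sum_nonneg mult_nonneg_nonneg add_nonneg_nonneg divide_nonneg_nonneg w)
        (auto simp: fejer_pos_def)
  qed (intro continuous_intros cf)
qed

lemma fejer_pos_mult_ge:
  assumes f: "fejer_pos f" and w: "\<And>b b'. b \<in> S \<Longrightarrow> b' \<in> S \<Longrightarrow> 0 \<le> w b b'" and L: "L > 0"
    and fin: "finite S"
  shows "integral {0..L} (\<lambda>z. (1 - z / L) * (f z * trig_sum S w (\<mu> * z)))
     \<ge> (\<Sum>b\<in>S. w b b) * integral {0..L} (\<lambda>z. (1 - z / L) * f z)"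
proof -
  let ?I = "\<lambda>\<nu>. integral {0..L} (\<lambda>z. (1 - z / L) * f z * cos (\<nu> * z))"
  have I: "0 \<le> ?I \<nu>" for \<nu> using f L by (auto simp: fejer_pos_def)
  have "(\<Sum>b\<in>S. w b b) * integral {0..L} (\<lambda>z. (1 - z / L) * f z) = (\<Sum>b\<in>S. w b b * ?I 0)"
    by (simp add: sum_distrib_right)
  also have "\<dots> = (\<Sum>b\<in>S. \<Sum>b'\<in>S. if b = b' then w b b * ?I 0 else 0)"
    using fin by (simp add: sum.delta)
  also have "\<dots> \<le> (\<Sum>b\<in>S. \<Sum>b'\<in>S. w b b' / 2 * (?I (2 * pi * (real b - real b') * \<mu> + 0) + ?I (2 * pi * (real b - real b') * \<mu> - 0)))"
    by (intro sum_mono) (auto intro!: mult_nonneg_nonneg w I)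
  also have "\<dots> = integral {0..L} (\<lambda>z. (1 - z / L) * (f z * trig_sum S w (\<mu> * z)) * cos (0 * z))"
    by (rule fejer_pos_mult_aux[OF f L fin, symmetric])
  finally show ?thesis by simp
qed

lemma fejer_pos_sqmod: "finite S \<Longrightarrow> fejer_pos f \<Longrightarrow> fejer_pos (\<lambda>z. f z * sqmod S (\<mu> * z))"
  unfolding sqmod_def by (rule fejer_pos_mult) auto

lemma fejer_pos_sqmod_ge:
  assumes "fejer_pos f" "L > 0" "finite S"
  shows "integral {0..L} (\<lambda>z. (1 - z / L) * (f z * sqmod S (\<mu> * z)))
     \<ge> 1 / card S * integral {0..L} (\<lambda>z. (1 - z / L) * f z)"
  using fejer_pos_mult_ge[OF assms(1) _ assms(2,3), of "\<lambda>_ _. 1 / (real (card S))\<^sup>2" \<mu>]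
  by (simp add: sqmod_def power2_eq_square split: if_splits)

lemma integral_trig_sum:
  assumes "finite S"
  shows "(trig_sum S w has_integral (\<Sum>b\<in>S. w b b)) {0..1}"
proof -
  have c: "((\<lambda>u. cos (2 * pi * (real b - real b') * u)) has_integral (if b = b' then 1 else 0)) {0..1}" for b b' :: nat
  proof (cases "b = b'")
    case True
    then show ?thesis using has_integral_const_real[of 1 0 1] by simp
  next
    case False
    let ?m = "2 * pi * (real b - real b')"
    have m: "?m \<noteq> 0" using False by simp
    have "((\<lambda>u. cos (?m * u)) has_integral sin (?m * 1) / ?m - sin (?m * 0) / ?m) {0..1}"
    proof (rule fundamental_theorem_of_calculus)
      fix z :: real assume "z \<in> {0..1}"
      have "((\<lambda>u. sin (?m * u) / ?m) has_real_derivative cos (?m * z)) (at z within {0..1})"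
        using m by (auto intro!: derivative_eq_intros)
      then show "((\<lambda>u. sin (?m * u) / ?m) has_vector_derivative cos (?m * z)) (at z within {0..1})"
        by (simp add: has_real_derivative_iff_has_vector_derivative)
    qed simp
    moreover have "sin (?m * 1) = 0"
      using sin_int_2pin[of "int b - int b'"] by simp
    ultimately show ?thesis using False by simp
  qed
  have "(trig_sum S w has_integral (\<Sum>b\<in>S. \<Sum>b'\<in>S. w b b' * (if b = b' then 1 else 0))) {0..1}"
    unfolding trig_sum_def by (intro has_integral_sum has_integral_mult_right assms c)
  then show ?thesis using assms by (simp add: if_distrib cong: if_cong)
qed

lemma integral_sqmod:
  assumes "finite S" shows "(sqmod S has_integral 1 / card S) {0..1}"
  using integral_trig_sum[OF assms, of "\<lambda>_ _. 1 / (real (card S))\<^sup>2"]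
  by (simp add: sqmod_def power2_eq_square split: if_splits)

lemma has_integral_fejer_cos:
  fixes \<delta> :: real
  shows "((\<lambda>y. (1 - y / 2) * cos (2 * pi * \<delta> * y)) has_integral
      (if \<delta> = 0 then 1 else (1 - cos (4 * pi * \<delta>)) / (8 * pi\<^sup>2 * \<delta>\<^sup>2))) {0..2}"
proof (cases "\<delta> = 0")
  case True
  then show ?thesis using fejer_integral_0[of 2] by simp
next
  case False
  then show ?thesis using fejer_integral[of 2 "2 * pi * \<delta>"]
    by (simp add: power_mult_distrib mult.commute mult.left_commute)
qed

text \<open>A majorant of the Fejer kernel in terms of the cell offset. Offsets up to 1 allow
  arbitrarily close positions, where the kernel is bounded by 1.\<close>

definition decay :: "int \<Rightarrow> real" where
  "decay j = (if \<bar>j\<bar> \<le> 1 then 1 else 1 / (real_of_int \<bar>j\<bar> - 1)\<^sup>2)"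

text \<open>The remainder \<open>4 / (n + 1)\<close> is there for the induction: the two new terms
  are at most a difference of consecutive remainders.\<close>

lemma sum_decay: "(\<Sum>j\<in>{- int n - 1..int n + 1}. decay j) \<le> 7 - 4 / (real n + 1)"
proof (induction n)
  case 0
  have "{- int 0 - 1..int 0 + 1} = {-1, 0, 1}" by auto
  then show ?case by (simp add: decay_def)
next
  case (Suc n)
  have eq: "{- int (Suc n) - 1..int (Suc n) + 1} = insert (- int n - 2) (insert (int n + 2) {- int n - 1..int n + 1})"
    by auto
  have d: "decay (int n + 2) = 1 / (real n + 1)\<^sup>2" "decay (- int n - 2) = 1 / (real n + 1)\<^sup>2"
    by (auto simp: decay_def)
  have "(\<Sum>j\<in>{- int (Suc n) - 1..int (Suc n) + 1}. decay j) \<le> 2 / (real n + 1)\<^sup>2 + (7 - 4 / (real n + 1))"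
    unfolding eq using Suc d by simp
  also have "2 / (real n + 1)\<^sup>2 \<le> 4 / (real n + 1) - 4 / (real n + 2)"
  proof -
    have "4 / (real n + 1) - 4 / (real n + 2) = 4 / ((real n + 1) * (real n + 2))"
      by (simp add: field_simps)
    moreover have "2 / a\<^sup>2 = 4 / (a * (2 * a))" for a :: real
      by (cases "a = 0") (simp_all add: power2_eq_square field_simps)
    then have "2 / (real n + 1)\<^sup>2 = 4 / ((real n + 1) * (2 * (real n + 1)))" .
    moreover have "4 / ((real n + 1) * (2 * (real n + 1))) \<le> 4 / ((real n + 1) * (real n + 2))"
      by (intro divide_left_mono mult_left_mono) auto
    ultimately show ?thesis by simp
  qed
  finally show ?case by (simp add: algebra_simps)
qed

section \<open>The energy as a local square norm of the exponential sum\<close>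

context digit_pair begin

text \<open>The squared modulus of the normalised exponential sum over all positions
  \<open>pos t d\<close>, see \<open>wave_eq\<close>; it factors because the digit sets of the two
  coordinates are independent.\<close>

definition wave :: "real \<Rightarrow> nat \<Rightarrow> real \<Rightarrow> real" where
  "wave t s z = sqmod (digit_nums K A s) z * sqmod (digit_nums K B s) (t * z)"

lemma continuous_wave [continuous_intros]:
  fixes f :: "real \<Rightarrow> real"
  shows "continuous_on X f \<Longrightarrow> continuous_on X (\<lambda>x. wave t s (f x))"
  unfolding wave_def by (intro continuous_intros)

lemma wave_nonneg: "0 \<le> wave t s z"
  by (simp add: wave_def sqmod_nonneg)

lemma wave_eq: "wave t s z = (\<Sum>d\<in>sq s. \<Sum>d'\<in>sq s. cos (2 * pi * (pos t d - pos t d') * z)) / (real K ^ s)\<^sup>2"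
proof -
  have c: "real (card (digit_nums K A s)) * real (card (digit_nums K B s)) = real K ^ s"
    using card_AB by (simp add: card_digit_nums A_sub B_sub flip: power_mult_distrib of_nat_mult of_nat_power)
  have "expsum (digit_nums K A s) z * expsum (digit_nums K B s) (t * z)
      = (\<Sum>d\<in>sq s. cis (2 * pi * pos t d * z))"
    by (simp add: expsum_def sum_product sum.cartesian_product sq_def cis_mult pos_def
        algebra_simps case_prod_beta)
  then have "wave t s z = (cmod (\<Sum>d\<in>sq s. cis (2 * pi * pos t d * z)))\<^sup>2 / (real K ^ s)\<^sup>2"
    unfolding wave_def sqmod_expsum c[symmetric]
    by (simp add: norm_mult power_mult_distrib flip: \<open>expsum _ _ * expsum _ _ = _\<close>)
  then show ?thesis by (simp only: cmod_sum_cis)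
qed

lemma kernel_le_decay:
  fixes \<delta> :: real
  assumes t: "t \<ge> 0" and d: "\<delta> = pos t d - pos t d'"
  shows "(if \<delta> = 0 then 1 else (1 - cos (4 * pi * \<delta>)) / (8 * pi\<^sup>2 * \<delta>\<^sup>2)) \<le> decay (cell t d' - cell t d)"
proof (cases "\<bar>cell t d' - cell t d\<bar> \<le> 1")
  case True
  have "(1 - cos (4 * pi * \<delta>)) / (8 * pi\<^sup>2 * \<delta>\<^sup>2) \<le> 1" if "\<delta> \<noteq> 0"
  proof -
    have "1 - cos (4 * pi * \<delta>) = 2 * (sin (2 * pi * \<delta>))\<^sup>2"
      using cos_double_sin[of "2 * pi * \<delta>"] by (simp add: mult.assoc)
    also have "(sin (2 * pi * \<delta>))\<^sup>2 \<le> (2 * pi * \<delta>)\<^sup>2"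
      using abs_sin_x_le_abs_x[of "2 * pi * \<delta>"] by (simp add: abs_le_square_iff)
    finally have "1 - cos (4 * pi * \<delta>) \<le> 8 * pi\<^sup>2 * \<delta>\<^sup>2" by (simp add: power_mult_distrib)
    moreover have "8 * pi\<^sup>2 * \<delta>\<^sup>2 > 0" using that by simp
    ultimately show ?thesis by (simp only: divide_le_eq_1_pos)
  qed
  then show ?thesis using True by (simp add: decay_def)
next
  case False
  let ?j = "cell t d' - cell t d"
  have p: "1 + t > 0" "1 + t \<ge> 1" using t by auto
  have "real_of_int \<bar>?j\<bar> - 1 \<le> \<bar>pos t d / (1 + t) - pos t d' / (1 + t)\<bar>"
    unfolding cell_def by linarith
  also have "\<dots> = \<bar>\<delta>\<bar> / (1 + t)"
    using p d by (simp add: abs_divide flip: diff_divide_distrib)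
  also have "\<dots> \<le> \<bar>\<delta>\<bar>" using p by (simp add: divide_le_eq mult_le_cancel_left1)
  finally have j: "real_of_int \<bar>?j\<bar> - 1 \<le> \<bar>\<delta>\<bar>" .
  have j1: "real_of_int \<bar>?j\<bar> - 1 \<ge> 1" using False by linarith
  then have nz: "\<delta> \<noteq> 0" using j by auto
  have pi2: "2 \<le> 8 * pi\<^sup>2" using pi_gt3 by (simp add: power2_eq_square) (use mult_mono[of 1 pi 1 pi] in simp)
  have "(1 - cos (4 * pi * \<delta>)) / (8 * pi\<^sup>2 * \<delta>\<^sup>2) \<le> 2 / (2 * \<delta>\<^sup>2)"
  proof (rule frac_le)
    show "1 - cos (4 * pi * \<delta>) \<le> 2" using cos_ge_minus_one[of "4 * pi * \<delta>"] by linarith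
    show "2 * \<delta>\<^sup>2 \<le> 8 * pi\<^sup>2 * \<delta>\<^sup>2" using pi2 by (intro mult_right_mono) auto
  qed (use nz in auto)
  also have "\<dots> = 1 / \<delta>\<^sup>2" by simp
  also have "\<dots> \<le> 1 / (real_of_int \<bar>?j\<bar> - 1)\<^sup>2"
  proof (rule divide_left_mono)
    have "(real_of_int \<bar>?j\<bar> - 1)\<^sup>2 \<le> \<bar>\<delta>\<bar>\<^sup>2" using j j1 by (intro power_mono) auto
    then show "(real_of_int \<bar>?j\<bar> - 1)\<^sup>2 \<le> \<delta>\<^sup>2" by simp
  qed (use j1 nz in auto)
  finally show ?thesis using False nz by (simp add: decay_def)
qed

text \<open>Pairs at a fixed cell offset number at most \<open>energy t s\<close> by
  \<open>cell_shift\<close>, and the weights add up to at most 7.\<close>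

lemma sum_decay_energy:
  assumes "t \<ge> 0"
  shows "(\<Sum>d\<in>sq s. \<Sum>d'\<in>sq s. decay (cell t d' - cell t d)) \<le> 7 * energy t s"
proof -
  define n where "n = Max (insert 0 ((\<lambda>(d, d'). nat \<bar>cell t d' - cell t d\<bar>) ` (sq s \<times> sq s)))"
  let ?J = "{- int n - 1..int n + 1}"
  have J: "cell t d' - cell t d \<in> ?J" if "d \<in> sq s" "d' \<in> sq s" for d d'
  proof -
    have "nat \<bar>cell t d' - cell t d\<bar> \<le> n"
      unfolding n_def using that by (intro Max_ge) force+
    then show ?thesis by auto
  qed
  have "(\<Sum>d'\<in>sq s. decay (cell t d' - cell t d)) = (\<Sum>j\<in>?J. decay j * card {d'\<in>sq s. cell t d' = cell t d + j})"
    if d: "d \<in> sq s" for d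
  proof -
    have "(\<Sum>d'\<in>sq s. decay (cell t d' - cell t d))
       = (\<Sum>d'\<in>sq s. \<Sum>j\<in>?J. if cell t d' - cell t d = j then decay j else 0)"
      using J[OF d] by (intro sum.cong refl) (simp add: sum.delta')
    also have "\<dots> = (\<Sum>j\<in>?J. \<Sum>d'\<in>sq s. if cell t d' = cell t d + j then decay j else 0)"
      by (subst sum.swap) (intro sum.cong refl if_cong, auto)
    also have "\<dots> = (\<Sum>j\<in>?J. decay j * card {d'\<in>sq s. cell t d' = cell t d + j})"
      by (intro sum.cong refl) (simp add: sum.If_cases Int_def mult.commute)
    finally show ?thesis .
  qed
  then have "(\<Sum>d\<in>sq s. \<Sum>d'\<in>sq s. decay (cell t d' - cell t d))
     = (\<Sum>d\<in>sq s. \<Sum>j\<in>?J. decay j * card {d'\<in>sq s. cell t d' = cell t d + j})" by simp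
  also have "\<dots> = (\<Sum>j\<in>?J. decay j * real (\<Sum>d\<in>sq s. card {d'\<in>sq s. cell t d' = cell t d + j}))"
    by (subst sum.swap) (simp add: sum_distrib_left)
  also have "\<dots> \<le> (\<Sum>j\<in>?J. decay j * energy t s)"
    by (intro sum_mono mult_left_mono of_nat_mono cell_shift assms) (simp add: decay_def)
  also have "\<dots> = (\<Sum>j\<in>?J. decay j) * energy t s" by (simp add: sum_distrib_right)
  also have "\<dots> \<le> 7 * real (energy t s)"
    by (intro mult_right_mono order_trans[OF sum_decay]) auto
  finally show ?thesis by simp
qed

text \<open>After symmetrising about \<open>x\<close>, the indicator of \<open>[0, 1]\<close> is
  majorised by \<open>2 * (1 - y / 2)\<close> on \<open>[0, 2]\<close>, whose cosine transform is
  nonnegative. The phases depending on \<open>x\<close> can then be replaced by 1, which leaves a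
  weighted pair count independent of \<open>x\<close>.\<close>

lemma integral_wave_le:
  assumes t: "t \<ge> 0"
  shows "integral {0..1} (\<lambda>y. wave t s (x + y)) \<le> 28 * energy t s / (real K ^ s)\<^sup>2"
proof -
  let ?k = "\<lambda>\<delta>::real. (if \<delta> = 0 then 1 else (1 - cos (4 * pi * \<delta>)) / (8 * pi\<^sup>2 * \<delta>\<^sup>2))"
  let ?h = "\<lambda>y. (1 - y / 2) * (wave t s (x + y) + wave t s (x - y))"
  have kpos: "?k \<delta> \<ge> 0" for \<delta> by simp
  have h: "(?h has_integral
     (\<Sum>d\<in>sq s. \<Sum>d'\<in>sq s. 2 * cos (2 * pi * (pos t d - pos t d') * x) / (real K ^ s)\<^sup>2 * ?k (pos t d - pos t d'))) {0..2}"
  proof -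
    have "?h = (\<lambda>y. \<Sum>d\<in>sq s. \<Sum>d'\<in>sq s. 2 * cos (2 * pi * (pos t d - pos t d') * x) / (real K ^ s)\<^sup>2
        * ((1 - y / 2) * cos (2 * pi * (pos t d - pos t d') * y)))"
    proof
      fix y
      have c: "cos (2 * pi * \<delta> * (x + y)) + cos (2 * pi * \<delta> * (x - y)) = 2 * cos (2 * pi * \<delta> * x) * cos (2 * pi * \<delta> * y)"
        for \<delta> by (simp add: distrib_left right_diff_distrib cos_add cos_diff)
      have "?h y = (\<Sum>d\<in>sq s. \<Sum>d'\<in>sq s. (1 - y / 2) / (real K ^ s)\<^sup>2 *
         (cos (2 * pi * (pos t d - pos t d') * (x + y)) + cos (2 * pi * (pos t d - pos t d') * (x - y))))"
        by (simp only: wave_eq sum_divide_distrib sum_distrib_left distrib_left add_divide_distrib sum.distrib times_divide_eq_left times_divide_eq_right)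
      then show "?h y = (\<Sum>d\<in>sq s. \<Sum>d'\<in>sq s. 2 * cos (2 * pi * (pos t d - pos t d') * x) / (real K ^ s)\<^sup>2
        * ((1 - y / 2) * cos (2 * pi * (pos t d - pos t d') * y)))"
        unfolding c by (simp only: times_divide_eq_left times_divide_eq_right mult.assoc mult.left_commute mult.commute)
    qed
    then show ?thesis
      by (simp only:) (intro has_integral_sum has_integral_mult_right has_integral_fejer_cos finite_sq)
  qed
  have "integral {0..1} (\<lambda>y. wave t s (x + y)) \<le> integral {0..1} (\<lambda>y. 2 * ?h y)"
  proof (rule integral_le)
    fix y :: real assume y: "y \<in> {0..1}"
    have "1 * wave t s (x + y) \<le> (2 * (1 - y / 2)) * wave t s (x + y)"
      using y by (intro mult_right_mono wave_nonneg) auto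
    also have "\<dots> \<le> (2 * (1 - y / 2)) * (wave t s (x + y) + wave t s (x - y))"
      using y wave_nonneg[of t s "x - y"] by (intro mult_left_mono) auto
    finally show "wave t s (x + y) \<le> 2 * ?h y" by (simp only: mult.assoc)
  qed (intro integrable_continuous_real continuous_intros; simp)+
  also have "\<dots> \<le> integral {0..2} (\<lambda>y. 2 * ?h y)"
    by (rule integral_subset_le)
      (auto intro!: integrable_continuous_real continuous_intros mult_nonneg_nonneg add_nonneg_nonneg wave_nonneg)
  also have "\<dots> = 2 * (\<Sum>d\<in>sq s. \<Sum>d'\<in>sq s. 2 * cos (2 * pi * (pos t d - pos t d') * x) / (real K ^ s)\<^sup>2 * ?k (pos t d - pos t d'))"
    by (rule integral_unique has_integral_mult_right h)+
  also have "\<dots> \<le> 2 * (\<Sum>d\<in>sq s. \<Sum>d'\<in>sq s. 2 / (real K ^ s)\<^sup>2 * decay (cell t d' - cell t d))"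
  proof (intro mult_left_mono sum_mono mult_mono divide_right_mono)
    fix d d'
    show "2 * cos (2 * pi * (pos t d - pos t d') * x) \<le> 2" by simp
    show "?k (pos t d - pos t d') \<le> decay (cell t d' - cell t d)"
      by (rule kernel_le_decay[OF t refl])
  qed (use kpos in auto)
  also have "\<dots> = 4 / (real K ^ s)\<^sup>2 * (\<Sum>d\<in>sq s. \<Sum>d'\<in>sq s. decay (cell t d' - cell t d))"
    by (simp add: sum_distrib_left mult.assoc)
  also have "\<dots> \<le> 4 / (real K ^ s)\<^sup>2 * (7 * energy t s)"
    by (intro mult_left_mono sum_decay_energy t) simp
  finally show ?thesis by simp
qed

end

section \<open>Smearing near and far from the roots\<close>

lemma norm_prod_one_plus:
  fixes a :: "nat \<Rightarrow> complex"
  assumes "\<And>i. i < n \<Longrightarrow> cmod (a i) \<le> \<rho>" "\<rho> \<le> 1" "0 \<le> \<rho>"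
  shows "cmod ((\<Prod>i<n. 1 + a i) - 1) \<le> 2 ^ n * \<rho> \<and>
    cmod ((\<Prod>i<n. 1 + a i) - 1 - (\<Sum>i<n. a i)) \<le> 2 ^ n * \<rho>\<^sup>2"
  using assms(1)
proof (induction n)
  case 0
  then show ?case using assms by simp
next
  case (Suc n)
  define P where "P = (\<Prod>i<n. 1 + a i)"
  define s where "s = (\<Sum>i<n. a i)"
  have an: "cmod (a n) \<le> \<rho>" using Suc.prems by simp
  have IH: "cmod (P - 1) \<le> 2 ^ n * \<rho>" "cmod (P - 1 - s) \<le> 2 ^ n * \<rho>\<^sup>2"
    using Suc.IH Suc.prems unfolding P_def s_def by auto
  have "cmod P \<le> (\<Prod>i<n. cmod (1 + a i))" unfolding P_def by (simp add: prod_norm)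
  also have "\<dots> \<le> (\<Prod>i<n. 2)"
  proof (intro prod_mono conjI)
    fix i assume "i \<in> {..<n}"
    then have "cmod (a i) \<le> 1" using Suc.prems[of i] assms by simp
    then show "cmod (1 + a i) \<le> 2" using norm_triangle_ineq[of 1 "a i"] by simp
  qed simp
  finally have P2: "cmod P \<le> 2 ^ n" by simp
  have e1: "(\<Prod>i<Suc n. 1 + a i) - 1 = (P - 1) + P * a n"
    unfolding P_def by (simp add: algebra_simps)
  have e2: "(\<Prod>i<Suc n. 1 + a i) - 1 - (\<Sum>i<Suc n. a i) = (P - 1 - s) + (P - 1) * a n"
    unfolding P_def s_def by (simp add: algebra_simps)
  have "cmod ((P - 1) + P * a n) \<le> 2 ^ n * \<rho> + 2 ^ n * \<rho>"
    by (intro norm_triangle_le add_mono IH) (simp add: norm_mult mult_mono P2 an)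
  moreover have "cmod ((P - 1 - s) + (P - 1) * a n) \<le> 2 ^ n * \<rho>\<^sup>2 + (2 ^ n * \<rho>) * \<rho>"
    unfolding norm_mult[symmetric]
    by (intro norm_triangle_le add_mono IH) (use mult_mono[OF IH(1) an] assms in \<open>simp add: norm_mult\<close>)
  ultimately show ?case
    by (intro conjI, unfold e2, unfold e1) (simp_all only: power2_eq_square power_Suc mult.assoc mult_2 distrib_right distrib_left)
qed

lemma sqnorm_near_one:
  fixes P s :: complex
  assumes "cmod (P - 1) \<le> c * \<rho>" "cmod (P - 1 - s) \<le> c * \<rho>\<^sup>2" "c \<ge> 1" "\<rho> \<ge> 0"
  shows "\<bar>(cmod P)\<^sup>2 - 1 - 2 * Re s\<bar> \<le> 3 * c\<^sup>2 * \<rho>\<^sup>2"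
proof -
  have "(cmod P)\<^sup>2 = 1 + 2 * Re (P - 1) + (cmod (P - 1))\<^sup>2"
    by (simp add: cmod_power2) (simp add: power2_eq_square algebra_simps)
  then have eq: "(cmod P)\<^sup>2 - 1 - 2 * Re s = 2 * Re (P - 1 - s) + (cmod (P - 1))\<^sup>2" by simp
  have "\<bar>Re (P - 1 - s)\<bar> \<le> c * \<rho>\<^sup>2" using abs_Re_le_cmod[of "P - 1 - s"] assms by linarith
  moreover have "(cmod (P - 1))\<^sup>2 \<le> (c * \<rho>)\<^sup>2" using assms by (intro power_mono) auto
  moreover have "c * \<rho>\<^sup>2 \<le> c\<^sup>2 * \<rho>\<^sup>2" using assms by (intro mult_right_mono) (auto simp: power2_eq_square)
  moreover have "0 \<le> (cmod (P - 1))\<^sup>2" by simp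
  ultimately show ?thesis unfolding eq power_mult_distrib abs_le_iff by linarith
qed

lemma cmod_cis_minus_1: "cmod (cis t - 1) = 2 * \<bar>sin (t / 2)\<bar>"
  by (simp add: cis_conv_exp dist_exp_i_1)

lemma cmod_cis_minus_1_le: "cmod (cis t - 1) \<le> \<bar>t\<bar>"
  unfolding cmod_cis_minus_1 using abs_sin_x_le_abs_x[of "t / 2"] by simp

text \<open>The bound \<open>2 * pi <= 7\<close> is the origin of the radius \<open>7 * X\<close>
  that separates points near a root from points far from all roots.\<close>

lemma cmod_cis_2pi_minus_1_le: 
  assumes "0 \<le> X" shows "cmod (cis (2 * pi * X) - 1) \<le> 7 * X" "cmod (cis (- (2 * pi * X)) - 1) \<le> 7 * X"
proof -
  have "2 * pi * X \<le> 7 * X" using pi_approx assms by (intro mult_right_mono) auto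
  then show "cmod (cis (2 * pi * X) - 1) \<le> 7 * X" "cmod (cis (- (2 * pi * X)) - 1) \<le> 7 * X"
    using cmod_cis_minus_1_le[of "2 * pi * X"] cmod_cis_minus_1_le[of "- (2 * pi * X)"] assms
    by auto
qed

text \<open>Away from the roots the two-sided average cancels the linear term of the logarithmic
  expansion, which leaves a relative error of second order in \<open>X / d\<close>.\<close>

lemma smear_far_poly:
  fixes c :: complex and r :: "nat \<Rightarrow> complex"
  assumes n: "n > 0" and p: "\<And>w. P w = c * (\<Prod>i<n. w - r i)"
  shows "\<exists>C\<ge>0. \<forall>X\<ge>0. \<forall>w. cmod w = 1 \<longrightarrow> (\<forall>i<n. cmod (w - r i) \<ge> 7 * X \<and> w \<noteq> r i) \<longrightarrow>
    (((cmod (P (w * cis (2 * pi * X))))\<^sup>2 + (cmod (P (w * cis (- (2 * pi * X)))))\<^sup>2) / 2 - (cmod (P w))\<^sup>2)\<^sup>2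
      \<le> C * X ^ 4 * (\<Sum>i<n. 1 / (cmod (w - r i))\<^sup>2) * (cmod (P w))\<^sup>2 \<and>
    ((cmod (P (w * cis (2 * pi * X))))\<^sup>2 + (cmod (P (w * cis (- (2 * pi * X)))))\<^sup>2) / 2 \<le> C * (cmod (P w))\<^sup>2"
proof -
  define D where "D = 1 + (\<Sum>i<n. cmod (r i))"
  define C1 where "C1 = 49 * (real n * D + 3 * (2 ^ n)\<^sup>2)"
  define C where "C = (cmod c)\<^sup>2 * D ^ (2 * n) * C1\<^sup>2 + C1 + 1"
  have D1: "D \<ge> 1" by (simp add: D_def sum_nonneg)
  have C1: "C1 \<ge> 0" using D1 by (simp add: C1_def)
  have "(((cmod (P (w * cis (2 * pi * X))))\<^sup>2 + (cmod (P (w * cis (- (2 * pi * X)))))\<^sup>2) / 2 - (cmod (P w))\<^sup>2)\<^sup>2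
      \<le> C * X ^ 4 * (\<Sum>i<n. 1 / (cmod (w - r i))\<^sup>2) * (cmod (P w))\<^sup>2 \<and>
    ((cmod (P (w * cis (2 * pi * X))))\<^sup>2 + (cmod (P (w * cis (- (2 * pi * X)))))\<^sup>2) / 2 \<le> C * (cmod (P w))\<^sup>2"
    if X: "X \<ge> 0" and w: "cmod w = 1" and far: "\<And>i. i < n \<Longrightarrow> cmod (w - r i) \<ge> 7 * X"
      and ne: "\<And>i. i < n \<Longrightarrow> w \<noteq> r i" for X w
  proof -
    define d where "d = Min ((\<lambda>i. cmod (w - r i)) ` {..<n})"
    have dI: "d \<in> (\<lambda>i. cmod (w - r i)) ` {..<n}" unfolding d_def using n by (intro Min_in) auto
    then obtain m where m: "m < n" "d = cmod (w - r m)" by auto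
    have d_le: "d \<le> cmod (w - r i)" if "i < n" for i unfolding d_def using that by simp
    have d: "d > 0" "7 * X \<le> d" using m ne[OF m(1)] far[OF m(1)] by auto
    have wr_le: "cmod (w - r i) \<le> D" if "i < n" for i
    proof -
      have "cmod (r i) \<le> (\<Sum>i<n. cmod (r i))" using that by (intro member_le_sum) auto
      then show ?thesis using norm_triangle_ineq4[of w "r i"] w by (simp add: D_def)
    qed
    define \<rho> where "\<rho> = 7 * X / d"
    have \<rho>: "0 \<le> \<rho>" "\<rho> \<le> 1" using d X by (auto simp: \<rho>_def)
    define y where "y i = w / (w - r i)" for i
    have y: "cmod (y i) \<le> 1 / d" if "i < n" for i
      unfolding y_def norm_divide w using d_le[OF that] d by (intro divide_left_mono mult_pos_pos) auto
    define s where "s = (\<Sum>i<n. y i)"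
    have s: "cmod s \<le> real n / d"
      unfolding s_def by (rule order_trans[OF norm_sum]) (use sum_mono[of "{..<n}" "\<lambda>i. cmod (y i)" "\<lambda>_. 1 / d"] y in simp)
    have main: "\<bar>(cmod (P (w * \<epsilon>)))\<^sup>2 - (cmod (P w))\<^sup>2 - 2 * Re ((\<epsilon> - 1) * s) * (cmod (P w))\<^sup>2\<bar>
        \<le> 3 * (2 ^ n)\<^sup>2 * \<rho>\<^sup>2 * (cmod (P w))\<^sup>2" if e: "cmod (\<epsilon> - 1) \<le> 7 * X" for \<epsilon>
    proof -
      let ?Q = "\<Prod>i<n. 1 + (\<epsilon> - 1) * y i"
      have "w * \<epsilon> - r i = (w - r i) * (1 + (\<epsilon> - 1) * y i)" if "i < n" for i
        using ne[OF that] by (simp add: y_def field_simps)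
      then have PQ: "P (w * \<epsilon>) = P w * ?Q" unfolding p by (simp add: prod.distrib)
      have a: "cmod ((\<epsilon> - 1) * y i) \<le> \<rho>" if "i < n" for i
        using mult_mono[OF e y[OF that]] X by (simp add: norm_mult \<rho>_def)
      from norm_prod_one_plus[OF a \<rho>(2,1)]
      have "\<bar>(cmod ?Q)\<^sup>2 - 1 - 2 * Re (\<Sum>i<n. (\<epsilon> - 1) * y i)\<bar> \<le> 3 * (2 ^ n)\<^sup>2 * \<rho>\<^sup>2"
        by (intro sqnorm_near_one \<rho>) auto
      then have "\<bar>(cmod ?Q)\<^sup>2 - 1 - 2 * Re ((\<epsilon> - 1) * s)\<bar> * (cmod (P w))\<^sup>2 \<le> 3 * (2 ^ n)\<^sup>2 * \<rho>\<^sup>2 * (cmod (P w))\<^sup>2"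
        by (intro mult_right_mono) (auto simp: s_def sum_distrib_left)
      moreover have "\<bar>(cmod ?Q)\<^sup>2 - 1 - 2 * Re ((\<epsilon> - 1) * s)\<bar> * (cmod (P w))\<^sup>2
         = \<bar>((cmod ?Q)\<^sup>2 - 1 - 2 * Re ((\<epsilon> - 1) * s)) * (cmod (P w))\<^sup>2\<bar>" by (simp add: abs_mult)
      ultimately show ?thesis unfolding PQ norm_mult power_mult_distrib
        by (simp add: algebra_simps)
    qed
    let ?p = "cis (2 * pi * X)" and ?m = "cis (- (2 * pi * X))"
    define N where "N = (cmod (P w))\<^sup>2"
    have N0: "N \<ge> 0" by (simp add: N_def)
    define V where "V = ((cmod (P (w * ?p)))\<^sup>2 + (cmod (P (w * ?m)))\<^sup>2) / 2 - N"
    \<comment> \<open>The first-order terms of the two shifts nearly cancel, since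
      \<open>?p + ?m - 2\<close> is real and of order \<open>X ^ 2\<close>.\<close>
    have re: "\<bar>Re ((?p - 1) * s) + Re ((?m - 1) * s)\<bar> \<le> (7 * X)\<^sup>2 * (real n / d)"
    proof -
      have "?p - 1 + (?m - 1) = - complex_of_real (2 * (1 - cos (2 * pi * X)))"
        by (simp add: complex_eq_iff)
      also have "2 * (1 - cos (2 * pi * X)) = (2 * \<bar>sin (2 * pi * X / 2)\<bar>)\<^sup>2"
        using cos_double_sin[of "pi * X"] by (simp add: power_mult_distrib mult.assoc)
      also have "\<dots> = (cmod (?p - 1))\<^sup>2" by (simp only: cmod_cis_minus_1)
      finally have "cmod (?p - 1 + (?m - 1)) = (cmod (?p - 1))\<^sup>2"
        by (simp add: norm_power)
      also have "\<dots> \<le> (7 * X)\<^sup>2" using cmod_cis_2pi_minus_1_le[OF X] by (intro power_mono) auto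
      finally have "cmod (?p - 1 + (?m - 1)) * cmod s \<le> (7 * X)\<^sup>2 * (real n / d)"
        by (intro mult_mono s) auto
      moreover have "Re ((?p - 1) * s) + Re ((?m - 1) * s) = Re ((?p - 1 + (?m - 1)) * s)"
        by (simp only: distrib_right plus_complex.sel)
      ultimately show ?thesis using abs_Re_le_cmod[of "(?p - 1 + (?m - 1)) * s"]
        by (simp only: norm_mult)
    qed
    have V_le: "\<bar>V\<bar> \<le> C1 * X\<^sup>2 / d\<^sup>2 * N"
    proof -
      let ?e = "3 * (2 ^ n)\<^sup>2 * \<rho>\<^sup>2 * N"
      have mp: "\<bar>(cmod (P (w * ?p)))\<^sup>2 - N - 2 * Re ((?p - 1) * s) * N\<bar> \<le> ?e"
        and mm: "\<bar>(cmod (P (w * ?m)))\<^sup>2 - N - 2 * Re ((?m - 1) * s) * N\<bar> \<le> ?e"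
        unfolding N_def by (intro main cmod_cis_2pi_minus_1_le X)+
      have "\<bar>V - (Re ((?p - 1) * s) + Re ((?m - 1) * s)) * N\<bar> \<le> ?e"
      proof -
        have "\<bar>(p + m) / 2 - N - (a + b) * N\<bar> \<le> e"
          if "\<bar>p - N - 2 * a * N\<bar> \<le> e" "\<bar>m - N - 2 * b * N\<bar> \<le> e" for p m a b e :: real
          using that unfolding abs_le_iff by (simp add: field_simps)
        then show ?thesis using mp mm unfolding V_def by blast
      qed
      moreover have "\<bar>(Re ((?p - 1) * s) + Re ((?m - 1) * s)) * N\<bar> \<le> (7 * X)\<^sup>2 * (real n / d) * N"
        unfolding abs_mult abs_of_nonneg[OF N0] by (intro mult_right_mono re N0)
      ultimately have "\<bar>V\<bar> \<le> (7 * X)\<^sup>2 * (real n / d) * N + ?e" by linarith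
      also have "(7 * X)\<^sup>2 * (real n / d) \<le> (7 * X)\<^sup>2 * (real n * D / d\<^sup>2)"
      proof (rule mult_left_mono)
        have "real n / d = real n * d / d\<^sup>2" using d by (simp add: power2_eq_square)
        also have "\<dots> \<le> real n * D / d\<^sup>2"
          using wr_le[OF m(1)] m(2) by (intro divide_right_mono mult_left_mono) auto
        finally show "real n / d \<le> real n * D / d\<^sup>2" .
      qed simp
      finally have "\<bar>V\<bar> \<le> (7 * X)\<^sup>2 * (real n * D / d\<^sup>2) * N + ?e" using N0 by (simp add: mult_right_mono)
      also have "\<dots> = C1 * X\<^sup>2 / d\<^sup>2 * N"
        by (simp add: C1_def \<rho>_def power_mult_distrib power_divide algebra_simps add_divide_distrib)
      finally show ?thesis .
    qed
    \<comment> \<open>The nearest root gives \<open>N\<close> a factor \<open>d ^ 2\<close>. One of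
      the two factors \<open>N\<close> in the bound for \<open>V ^ 2\<close> is spent on it, which
      lowers the singularity from \<open>1 / d ^ 4\<close> to \<open>1 / d ^ 2\<close>.\<close>
    have N_le: "N \<le> (cmod c)\<^sup>2 * D ^ (2 * n) * d\<^sup>2"
    proof -
      have "(\<Prod>i<n. cmod (w - r i)) = d * (\<Prod>i\<in>{..<n} - {m}. cmod (w - r i))"
        using m by (simp add: prod.remove)
      also have "\<dots> \<le> d * (\<Prod>i\<in>{..<n} - {m}. D)"
        using d by (intro mult_left_mono prod_mono) (auto intro: wr_le)
      also have "\<dots> \<le> d * D ^ n" using d D1 card_Diff1_le[of "{..<n}" m]
        by (intro mult_left_mono) (auto intro!: power_increasing simp del: card_Diff1_le)
      finally have "cmod (P w) \<le> cmod c * (d * D ^ n)"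
        unfolding p norm_mult prod_norm[symmetric] by (intro mult_left_mono) auto
      then have "N \<le> (cmod c * (d * D ^ n))\<^sup>2" unfolding N_def by (intro power_mono) auto
      then show ?thesis by (simp add: power_mult_distrib power_mult mult.commute mult.left_commute)
    qed
    have "V\<^sup>2 \<le> (C1 * X\<^sup>2 / d\<^sup>2 * N)\<^sup>2" using power_mono[OF V_le, of 2] by simp
    also have "\<dots> = C1\<^sup>2 * X ^ 4 / d ^ 4 * N * N" by (simp add: power_mult_distrib power_divide power2_eq_square power4_eq_xxxx mult.assoc mult.left_commute)
    also have "\<dots> \<le> C1\<^sup>2 * X ^ 4 / d ^ 4 * ((cmod c)\<^sup>2 * D ^ (2 * n) * d\<^sup>2) * N"
      using N0 N_le C1 d X by (intro mult_right_mono mult_left_mono) auto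
    also have "\<dots> = (cmod c)\<^sup>2 * D ^ (2 * n) * C1\<^sup>2 * (X ^ 4 * (1 / d\<^sup>2) * N)"
      using d by (simp add: power2_eq_square power4_eq_xxxx field_simps)
    also have "\<dots> \<le> C * (X ^ 4 * (1 / d\<^sup>2) * N)"
      using C1 N0 X by (intro mult_right_mono) (auto simp: C_def)
    also have "\<dots> = C * X ^ 4 * (1 / d\<^sup>2) * N" by simp
    also have "\<dots> \<le> C * X ^ 4 * (\<Sum>i<n. 1 / (cmod (w - r i))\<^sup>2) * N"
    proof (intro mult_right_mono mult_left_mono N0)
      show "1 / d\<^sup>2 \<le> (\<Sum>i<n. 1 / (cmod (w - r i))\<^sup>2)"
        unfolding m(2) using m(1) by (intro member_le_sum) auto
    qed (use D1 X C1 in \<open>auto simp: C_def\<close>)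
    finally have first: "V\<^sup>2 \<le> C * X ^ 4 * (\<Sum>i<n. 1 / (cmod (w - r i))\<^sup>2) * N" .
    have "C1 * X\<^sup>2 / d\<^sup>2 * N \<le> C1 * 1 * N"
    proof (intro mult_right_mono N0)
      have "X\<^sup>2 \<le> d\<^sup>2" using d X by (intro power_mono) auto
      then have "X\<^sup>2 / d\<^sup>2 \<le> 1" using d by simp
      then have "C1 * (X\<^sup>2 / d\<^sup>2) \<le> C1 * 1" using C1 by (rule mult_left_mono)
      then show "C1 * X\<^sup>2 / d\<^sup>2 \<le> C1 * 1" by simp
    qed
    then have "V + N \<le> C1 * N + N" using V_le by linarith
    also have "\<dots> = (C1 + 1) * N" by (simp add: algebra_simps)
    also have "\<dots> \<le> C * N" by (intro mult_right_mono N0) (simp add: C_def)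
    finally show ?thesis using first unfolding V_def N_def by simp
  qed
  moreover have "C \<ge> 0" using D1 C1 by (simp add: C_def)
  ultimately show ?thesis by (intro exI[of _ C]) blast
qed

text \<open>At a root of order \<open>e\<close> the smeared value is \<open>O(X ^ (2 * e))\<close>
  and the original one is comparable to \<open>cmod (w - z) ^ (2 * e)\<close>. For
  \<open>e <= 2\<close> the powers missing up to 4 come from \<open>cmod (w - z) < 7 * X\<close>;
  for \<open>e >= 3\<close> the smeared value is already \<open>O(X ^ 6)\<close>.\<close>

lemma smear_near_poly:
  fixes p :: "complex poly"
  assumes p0: "p \<noteq> 0" and z: "poly p z = 0"
  shows "\<exists>X0>0. \<exists>C\<ge>0. \<forall>X w. 0 < X \<and> X < X0 \<and> cmod w = 1 \<and> cmod (w - z) < 7 * X \<longrightarrow>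
    (let a = ((cmod (poly p (w * cis (2 * pi * X))))\<^sup>2 + (cmod (poly p (w * cis (- (2 * pi * X)))))\<^sup>2) / 2;
         f = (cmod (poly p w))\<^sup>2
     in f \<le> C * X\<^sup>2 \<and> a \<le> C * X\<^sup>2 \<and> (a * cmod (w - z) ^ 4 \<le> C * X ^ 4 * f \<or> a \<le> C * X ^ 6))"
proof -
  define e where "e = order z p"
  obtain Q where Q: "p = [:- z, 1:] ^ e * Q" "\<not> [:- z, 1:] dvd Q"
    using order_decomp[OF p0] unfolding e_def by blast
  have e1: "e \<ge> 1" using z p0 order_root[of p z] by (simp add: e_def)
  define q where "q = cmod (poly Q z)"
  have q: "q > 0" using Q(2) poly_eq_0_iff_dvd[of Q z] by (simp add: q_def)
  have P: "cmod (poly p w) = cmod (w - z) ^ e * cmod (poly Q w)" for w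
    by (subst Q(1)) (simp add: norm_mult norm_power)
  have "isCont (poly Q) z" by simp
  then obtain \<delta> where \<delta>: "\<delta> > 0" "\<And>w. dist w z < \<delta> \<Longrightarrow> dist (poly Q w) (poly Q z) < q / 2"
    using q unfolding continuous_at_eps_delta by (meson half_gt_zero)
  have Qb: "q / 2 \<le> cmod (poly Q w)" "cmod (poly Q w) \<le> 2 * q" if "cmod (w - z) < \<delta>" for w
    using \<delta>(2)[of w] that norm_triangle_ineq2[of "poly Q w" "poly Q z"]
      norm_triangle_ineq3[of "poly Q w" "poly Q z"] unfolding q_def dist_norm by linarith+
  \<comment> \<open>Shifted points lie within \<open>14 * X\<close> of \<open>z\<close>, and there
    \<open>Q\<close> has to be comparable to its value at \<open>z\<close>.\<close>
  define X0 where "X0 = min (\<delta> / 14) 1"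
  define C0 where "C0 = 14 ^ (2 * e) * 4 * q\<^sup>2"
  define C where "C = C0 + C0 * (4 / q\<^sup>2) * 7 ^ 4"
  have C0: "C0 \<ge> 0" by (simp add: C0_def)
  have CC: "C0 \<le> C" "C0 * (4 / q\<^sup>2) * 7 ^ 4 \<le> C" "C \<ge> 0" using C0 by (auto simp: C_def)
  have main: "(let a = ((cmod (poly p (w * cis (2 * pi * X))))\<^sup>2 + (cmod (poly p (w * cis (- (2 * pi * X)))))\<^sup>2) / 2;
         f = (cmod (poly p w))\<^sup>2
     in f \<le> C * X\<^sup>2 \<and> a \<le> C * X\<^sup>2 \<and> (a * cmod (w - z) ^ 4 \<le> C * X ^ 4 * f \<or> a \<le> C * X ^ 6))"
    if X: "0 < X" "X < X0" and w: "cmod w = 1" "cmod (w - z) < 7 * X" for X w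
  proof -
    have X1: "X < 1" "14 * X < \<delta>" using X by (auto simp: X0_def)
    have bd: "(cmod (poly p w'))\<^sup>2 \<le> C0 * X ^ (2 * e)" if "cmod (w' - z) \<le> 14 * X" for w'
    proof -
      have "cmod (poly p w') \<le> (14 * X) ^ e * (2 * q)"
        unfolding P using that X X1 Qb[of w'] by (intro mult_mono power_mono zero_le_power) auto
      then have "(cmod (poly p w'))\<^sup>2 \<le> ((14 * X) ^ e * (2 * q))\<^sup>2" by (intro power_mono) auto
      also have "\<dots> = C0 * X ^ (2 * e)"
        by (simp add: C0_def power_mult_distrib power_mult[symmetric] mult.commute mult.left_commute)
      finally show ?thesis .
    qed
    have sh: "cmod (w * \<epsilon> - z) \<le> 14 * X" if "cmod (\<epsilon> - 1) \<le> 7 * X" for \<epsilon>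
    proof -
      have "w * \<epsilon> - z = w * (\<epsilon> - 1) + (w - z)" by (simp add: algebra_simps)
      then have "cmod (w * \<epsilon> - z) \<le> cmod (w * (\<epsilon> - 1)) + cmod (w - z)" by (metis norm_triangle_ineq)
      then show ?thesis using w that by (simp add: norm_mult)
    qed
    define a where "a = ((cmod (poly p (w * cis (2 * pi * X))))\<^sup>2 + (cmod (poly p (w * cis (- (2 * pi * X)))))\<^sup>2) / 2"
    define f where "f = (cmod (poly p w))\<^sup>2"
    define d where "d = cmod (w - z)"
    have d: "0 \<le> d" "d < 7 * X" using w by (auto simp: d_def)
    have a: "a \<le> C0 * X ^ (2 * e)"
      using bd[OF sh[OF cmod_cis_2pi_minus_1_le(1)]] bd[OF sh[OF cmod_cis_2pi_minus_1_le(2)]] X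
      unfolding a_def by force
    have f: "f \<le> C0 * X ^ (2 * e)" using bd[of w] w X unfolding f_def by auto
    have le: "C0 * X ^ (2 * e) \<le> C * X ^ k" if "k \<le> 2 * e" for k
      using X X1 CC C0 that by (intro mult_mono power_decreasing) auto
    have "a * d ^ 4 \<le> C * X ^ 4 * f \<or> a \<le> C * X ^ 6"
    proof (cases "e \<ge> 3")
      case True
      then show ?thesis using a le[of 6] by auto
    next
      case False
      have fd: "d ^ (2 * e) \<le> (4 / q\<^sup>2) * f"
      proof -
        have "d ^ e * (q / 2) \<le> cmod (poly p w)"
          unfolding P d_def using X1 X w Qb[of w] by (intro mult_left_mono) auto
        then have "(d ^ e * (q / 2))\<^sup>2 \<le> f" unfolding f_def using d q by (intro power_mono) auto
        then have "d ^ (2 * e) * (q\<^sup>2 / 4) \<le> f"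
          by (simp add: power_mult_distrib power_mult[symmetric] power_divide mult.commute)
        then show ?thesis using q by (simp add: field_simps)
      qed
      have "a * d ^ 4 = a * (d ^ (2 * e) * d ^ (4 - 2 * e))"
        using False by (simp flip: power_add)
      also have "\<dots> \<le> (C0 * X ^ (2 * e)) * (((4 / q\<^sup>2) * f) * (7 * X) ^ (4 - 2 * e))"
        using a fd d X C0 by (intro mult_mono power_mono) (auto simp: f_def)
      also have "\<dots> = C0 * (4 / q\<^sup>2) * 7 ^ (4 - 2 * e) * (X ^ (2 * e) * X ^ (4 - 2 * e)) * f"
        by (simp add: power_mult_distrib)
      also have "X ^ (2 * e) * X ^ (4 - 2 * e) = X ^ 4" using False by (simp flip: power_add)
      also have "C0 * (4 / q\<^sup>2) * 7 ^ (4 - 2 * e) * X ^ 4 * f \<le> C0 * (4 / q\<^sup>2) * 7 ^ 4 * X ^ 4 * f"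
        using C0 X by (intro mult_right_mono mult_left_mono power_increasing) (auto simp: f_def)
      also have "\<dots> \<le> C * X ^ 4 * f" using CC X by (intro mult_right_mono) (auto simp: f_def)
      finally show ?thesis by blast
    qed
    moreover have "f \<le> C * X\<^sup>2" "a \<le> C * X\<^sup>2" using f a le[of 2] e1 by auto
    ultimately show ?thesis unfolding Let_def a_def f_def d_def by blast
  qed
  show ?thesis
    using main \<delta>(1) CC(3) by (intro exI[of _ X0] conjI exI[of _ C]) (auto simp: X0_def)
qed

definition smear :: "nat set \<Rightarrow> real \<Rightarrow> real \<Rightarrow> real" where
  "smear S X u = (sqmod S (u + X) + sqmod S (u - X)) / 2"

text \<open>\<open>Z\<close> is the root set of the polynomial whose value at
  \<open>cis (2 * pi * u)\<close> is \<open>expsum S u\<close>. Since it is finite, the constants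
  can be chosen uniformly in \<open>u\<close>; passing from roots with multiplicity to
  \<open>Z\<close> costs the degree as a factor.\<close>

theorem smear_local:
  assumes fin: "finite S" and card: "card S > 1"
  shows "\<exists>Z C X0. finite Z \<and> C \<ge> 1 \<and> X0 > 0 \<and> (\<forall>X u. 0 < X \<and> X < X0 \<longrightarrow>
     ((\<forall>z\<in>Z. cmod (cis (2 * pi * u) - z) \<ge> 7 * X) \<longrightarrow>
        sqmod S u > 0 \<and> smear S X u \<le> C * sqmod S u \<and>
        (smear S X u - sqmod S u)\<^sup>2 \<le> C * X ^ 4 * (\<Sum>z\<in>Z. 1 / (cmod (cis (2 * pi * u) - z))\<^sup>2) * sqmod S u) \<and>
     (\<forall>z\<in>Z. cmod (cis (2 * pi * u) - z) < 7 * X \<longrightarrow>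
        sqmod S u \<le> C * X\<^sup>2 \<and> smear S X u \<le> C * X\<^sup>2 \<and>
        (smear S X u * cmod (cis (2 * pi * u) - z) ^ 4 \<le> C * X ^ 4 * sqmod S u \<or> smear S X u \<le> C * X ^ 6)))"
proof -
  define p where "p = (\<Sum>b\<in>S. monom (1::complex) b)"
  define b where "b = real (card S)"
  have b: "b > 1" using card by (simp add: b_def)
  have pe: "poly p (cis (2 * pi * u)) = expsum S u" for u
    by (simp add: p_def poly_sum poly_monom expsum_def Complex.DeMoivre mult.commute mult.left_commute)
  have sm: "sqmod S u = (cmod (poly p (cis (2 * pi * u))))\<^sup>2 / b\<^sup>2" for u
    by (simp add: sqmod_expsum pe b_def)
  have coeff: "coeff p k = (if k \<in> S then 1 else 0)" for k
    using fin by (simp add: p_def coeff_sum coeff_monom sum.delta')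
  obtain k where k: "k \<in> S" "k > 0"
  proof -
    have "\<not> S \<subseteq> {0}" using card card_mono[of "{0::nat}" S] by auto
    then show ?thesis using that by auto
  qed
  have p0: "p \<noteq> 0" using coeff[of k] k by auto
  have deg: "degree p > 0" using le_degree[of p k] coeff[of k] k by auto
  define Z where "Z = {z. poly p z = 0}"
  have Z: "finite Z" unfolding Z_def using p0 by (rule poly_roots_finite)
  define n where "n = degree p"
  obtain r where r: "smult (lead_coeff p) (\<Prod>i<n. [:- r i, 1:]) = p"
    using complex_poly_decompose'[of p] unfolding n_def by blast
  have pw: "poly p w = lead_coeff p * (\<Prod>i<n. w - r i)" for w
    by (subst r[symmetric]) (simp add: poly_prod)
  have rZ: "r i \<in> Z" if "i < n" for i
    using that unfolding Z_def pw by auto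
  obtain C1 where C1: "C1 \<ge> 0" and far: "\<And>X w. X \<ge> 0 \<Longrightarrow> cmod w = 1 \<Longrightarrow>
      (\<forall>i<n. cmod (w - r i) \<ge> 7 * X \<and> w \<noteq> r i) \<Longrightarrow>
    (((cmod (poly p (w * cis (2 * pi * X))))\<^sup>2 + (cmod (poly p (w * cis (- (2 * pi * X)))))\<^sup>2) / 2 - (cmod (poly p w))\<^sup>2)\<^sup>2
      \<le> C1 * X ^ 4 * (\<Sum>i<n. 1 / (cmod (w - r i))\<^sup>2) * (cmod (poly p w))\<^sup>2 \<and>
    ((cmod (poly p (w * cis (2 * pi * X))))\<^sup>2 + (cmod (poly p (w * cis (- (2 * pi * X)))))\<^sup>2) / 2
      \<le> C1 * (cmod (poly p w))\<^sup>2"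
    using smear_far_poly[OF deg[folded n_def] pw] by blast
  have "\<forall>z\<in>Z. \<exists>x. fst x > 0 \<and> snd x \<ge> 0 \<and> (\<forall>X w. 0 < X \<and> X < fst x \<and> cmod w = 1 \<and> cmod (w - z) < 7 * X \<longrightarrow>
    (let a = ((cmod (poly p (w * cis (2 * pi * X))))\<^sup>2 + (cmod (poly p (w * cis (- (2 * pi * X)))))\<^sup>2) / 2;
         f = (cmod (poly p w))\<^sup>2
     in f \<le> snd x * X\<^sup>2 \<and> a \<le> snd x * X\<^sup>2 \<and> (a * cmod (w - z) ^ 4 \<le> snd x * X ^ 4 * f \<or> a \<le> snd x * X ^ 6)))"
    using smear_near_poly[OF p0] unfolding Z_def by simp
  then obtain x where x: "\<And>z. z \<in> Z \<Longrightarrow> fst (x z) > 0" "\<And>z. z \<in> Z \<Longrightarrow> snd (x z) \<ge> 0"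
    and near: "\<And>z X w. z \<in> Z \<Longrightarrow> 0 < X \<Longrightarrow> X < fst (x z) \<Longrightarrow> cmod w = 1 \<Longrightarrow> cmod (w - z) < 7 * X \<Longrightarrow>
    (let a = ((cmod (poly p (w * cis (2 * pi * X))))\<^sup>2 + (cmod (poly p (w * cis (- (2 * pi * X)))))\<^sup>2) / 2;
         f = (cmod (poly p w))\<^sup>2
     in f \<le> snd (x z) * X\<^sup>2 \<and> a \<le> snd (x z) * X\<^sup>2 \<and> (a * cmod (w - z) ^ 4 \<le> snd (x z) * X ^ 4 * f \<or> a \<le> snd (x z) * X ^ 6))"
    by (subst (asm) bchoice_iff) blast
  define X0 where "X0 = Min (insert 1 ((\<lambda>z. fst (x z)) ` Z))"
  have X0: "X0 > 0" unfolding X0_def using Z x by (subst Min_gr_iff) auto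
  have X0_le: "X0 \<le> fst (x z)" if "z \<in> Z" for z unfolding X0_def using Z that by (intro Min_le) auto
  define Cz where "Cz = (\<Sum>z\<in>Z. snd (x z))"
  have Cz: "snd (x z) \<le> Cz" if "z \<in> Z" for z unfolding Cz_def using Z that x by (intro member_le_sum) auto
  have Cz0: "Cz \<ge> 0" unfolding Cz_def using x by (intro sum_nonneg) auto
  define C where "C = C1 * n + Cz + C1 + 1"
  have C: "C \<ge> 1" "Cz \<le> C" "C1 * n \<le> C" "C1 \<le> C" "C \<ge> 0" using C1 Cz0 by (auto simp: C_def)
  have b2: "1 / b\<^sup>2 \<le> 1" "b\<^sup>2 > 0" using b by (auto simp: divide_le_eq_1 power2_eq_square less_1_mult less_imp_le)
  have main: "((\<forall>z\<in>Z. cmod (cis (2 * pi * u) - z) \<ge> 7 * X) \<longrightarrow>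
        sqmod S u > 0 \<and> smear S X u \<le> C * sqmod S u \<and>
        (smear S X u - sqmod S u)\<^sup>2 \<le> C * X ^ 4 * (\<Sum>z\<in>Z. 1 / (cmod (cis (2 * pi * u) - z))\<^sup>2) * sqmod S u) \<and>
     (\<forall>z\<in>Z. cmod (cis (2 * pi * u) - z) < 7 * X \<longrightarrow>
        sqmod S u \<le> C * X\<^sup>2 \<and> smear S X u \<le> C * X\<^sup>2 \<and>
        (smear S X u * cmod (cis (2 * pi * u) - z) ^ 4 \<le> C * X ^ 4 * sqmod S u \<or> smear S X u \<le> C * X ^ 6))"
    if X: "0 < X" "X < X0" for X u
  proof -
    define w where "w = cis (2 * pi * u)"
    define a where "a = ((cmod (poly p (w * cis (2 * pi * X))))\<^sup>2 + (cmod (poly p (w * cis (- (2 * pi * X)))))\<^sup>2) / 2"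
    define f where "f = (cmod (poly p w))\<^sup>2"
    have w1: "cmod w = 1" by (simp add: w_def)
    have "cis (2 * pi * (u + X)) = w * cis (2 * pi * X)" "cis (2 * pi * (u - X)) = w * cis (- (2 * pi * X))"
      by (simp_all add: w_def cis_mult algebra_simps)
    then have ga: "smear S X u = a / b\<^sup>2" unfolding smear_def sm a_def by (simp add: add_divide_distrib)
    have sf: "sqmod S u = f / b\<^sup>2" unfolding sm f_def w_def ..
    have f0: "f \<ge> 0" by (simp add: f_def)
    have F: "sqmod S u > 0 \<and> smear S X u \<le> C * sqmod S u \<and>
        (smear S X u - sqmod S u)\<^sup>2 \<le> C * X ^ 4 * (\<Sum>z\<in>Z. 1 / (cmod (w - z))\<^sup>2) * sqmod S u"
      if d: "\<And>z. z \<in> Z \<Longrightarrow> cmod (w - z) \<ge> 7 * X"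
    proof -
      have ne: "w \<noteq> z" if "z \<in> Z" for z using d[OF that] X by auto
      then have "w \<notin> Z" by blast
      then have fp: "f > 0" by (simp add: f_def Z_def)
      have "(\<Sum>i<n. 1 / (cmod (w - r i))\<^sup>2) \<le> (\<Sum>i<n. \<Sum>z\<in>Z. 1 / (cmod (w - z))\<^sup>2)"
        using rZ by (intro sum_mono member_le_sum Z) auto
      then have s: "(\<Sum>i<n. 1 / (cmod (w - r i))\<^sup>2) \<le> n * (\<Sum>z\<in>Z. 1 / (cmod (w - z))\<^sup>2)" by simp
      have fr: "(a - f)\<^sup>2 \<le> C1 * X ^ 4 * (\<Sum>i<n. 1 / (cmod (w - r i))\<^sup>2) * f \<and> a \<le> C1 * f"
        unfolding a_def f_def using X d ne rZ w1 by (intro far) auto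
      have "a \<le> C * f" using fr mult_right_mono[OF C(4) f0] by linarith
      then have aC: "a / b\<^sup>2 \<le> C * (f / b\<^sup>2)" using b2 by (simp add: divide_right_mono)
      have "(a - f)\<^sup>2 \<le> C1 * X ^ 4 * (\<Sum>i<n. 1 / (cmod (w - r i))\<^sup>2) * f" using fr by blast
      also have "\<dots> \<le> C1 * X ^ 4 * (n * (\<Sum>z\<in>Z. 1 / (cmod (w - z))\<^sup>2)) * f"
        using C1 X f0 by (intro mult_right_mono mult_left_mono s) auto
      also have "\<dots> = (C1 * n) * (X ^ 4 * (\<Sum>z\<in>Z. 1 / (cmod (w - z))\<^sup>2) * f)" by simp
      also have "\<dots> \<le> C * (X ^ 4 * (\<Sum>z\<in>Z. 1 / (cmod (w - z))\<^sup>2) * f)"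
        using C f0 by (intro mult_right_mono mult_nonneg_nonneg sum_nonneg) auto
      finally have af: "(a - f)\<^sup>2 \<le> C * X ^ 4 * (\<Sum>z\<in>Z. 1 / (cmod (w - z))\<^sup>2) * f" by (simp add: mult.assoc)
      have "(a / b\<^sup>2 - f / b\<^sup>2)\<^sup>2 = (a - f)\<^sup>2 * (1 / b\<^sup>2) * (1 / b\<^sup>2)"
        by (simp add: diff_divide_distrib[symmetric] power_divide power2_eq_square)
      also have "\<dots> \<le> (a - f)\<^sup>2 * (1 / b\<^sup>2) * 1"
        using b2 by (intro mult_left_mono) auto
      also have "\<dots> \<le> C * X ^ 4 * (\<Sum>z\<in>Z. 1 / (cmod (w - z))\<^sup>2) * f * (1 / b\<^sup>2)"
        unfolding mult_1_right using b2 by (intro mult_right_mono af) auto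
      finally show ?thesis unfolding ga sf using fp b2 aC by simp
    qed
    have N: "sqmod S u \<le> C * X\<^sup>2 \<and> smear S X u \<le> C * X\<^sup>2 \<and>
        (smear S X u * cmod (w - z) ^ 4 \<le> C * X ^ 4 * sqmod S u \<or> smear S X u \<le> C * X ^ 6)"
      if z: "z \<in> Z" "cmod (w - z) < 7 * X" for z
    proof -
      have nr: "f \<le> snd (x z) * X\<^sup>2 \<and> a \<le> snd (x z) * X\<^sup>2 \<and> (a * cmod (w - z) ^ 4 \<le> snd (x z) * X ^ 4 * f \<or> a \<le> snd (x z) * X ^ 6)"
        using near[OF z(1) X(1) _ w1 z(2)] X X0_le[OF z(1)] unfolding Let_def a_def f_def by linarith
      have sC: "snd (x z) \<le> C" using Cz[OF z(1)] C by linarith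
      have up: "snd (x z) * y \<le> C * y" if "y \<ge> 0" for y using sC that by (rule mult_right_mono)
      have "y / b\<^sup>2 \<le> c" if "y \<le> c" "c \<ge> 0" for y c :: real
      proof -
        have "y * (1 / b\<^sup>2) \<le> c * (1 / b\<^sup>2)" using that b2 by (intro mult_right_mono) auto
        also have "\<dots> \<le> c * 1" using that b2 by (intro mult_left_mono) auto
        finally show ?thesis by simp
      qed note dv = this
      have "f \<le> C * X\<^sup>2" "a \<le> C * X\<^sup>2" using nr up[of "X\<^sup>2"] by auto
      moreover have "a * cmod (w - z) ^ 4 \<le> C * X ^ 4 * f \<or> a \<le> C * X ^ 6"
      proof -
        have "snd (x z) * (X ^ 4 * f) \<le> C * (X ^ 4 * f)" "snd (x z) * X ^ 6 \<le> C * X ^ 6"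
          using f0 X by (intro up mult_nonneg_nonneg zero_le_power; simp)+
        then show ?thesis using nr unfolding mult.assoc by linarith
      qed
      then have "a / b\<^sup>2 * cmod (w - z) ^ 4 \<le> C * X ^ 4 * (f / b\<^sup>2) \<or> a / b\<^sup>2 \<le> C * X ^ 6"
        using b2 C X dv[of a "C * X ^ 6"] by (auto simp: divide_right_mono)
      ultimately show ?thesis unfolding ga sf using dv C by simp
    qed
    show ?thesis using F N unfolding w_def by blast
  qed
  show ?thesis using Z C(1) X0 main by blast
qed

section \<open>Averages over blocks of scales\<close>

text \<open>The iterated transfer operator of multiplication by \<open>K\<close> on the circle, with
  weight \<open>f l\<close> on scale \<open>l\<close>, applied to the constant 1. It appears when an
  integral over \<open>[0, K ^ n)\<close> is folded onto the unit interval, see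
  \<open>nn_integral_bsum\<close>.\<close>

definition bsum :: "nat \<Rightarrow> nat \<Rightarrow> (nat \<Rightarrow> real \<Rightarrow> real) \<Rightarrow> real \<Rightarrow> real" where
  "bsum K n f x = (\<Sum>k<K ^ n. \<Prod>l\<in>{1..n}. f l ((x + real k) / real K ^ l))"

lemma sum_lessThan_mult:
  fixes F :: "nat \<Rightarrow> 'a :: comm_monoid_add"
  shows "(\<Sum>k<m * n. F k) = (\<Sum>i<m. \<Sum>q<n. F (i + m * q))"
proof -
  have "(\<Sum>k<m * n. F k) = (\<Sum>q<n. \<Sum>i\<in>{q * m..<q * m + m}. F i)"
    by (simp add: sum.nat_group mult.commute)
  also have "\<dots> = (\<Sum>q<n. \<Sum>i<m. F (i + m * q))"
  proof (rule sum.cong[OF refl])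
    fix q
    show "(\<Sum>i\<in>{q * m..<q * m + m}. F i) = (\<Sum>i<m. F (i + m * q))"
      using sum.shift_bounds_nat_ivl[of F 0 "q * m" m]
      by (simp add: atLeast0LessThan add.commute mult.commute)
  qed
  also have "\<dots> = (\<Sum>i<m. \<Sum>q<n. F (i + m * q))" by (rule sum.swap)
  finally show ?thesis .
qed

text \<open>By periodicity the first \<open>n\<close> factors depend on the index modulo
  \<open>K ^ n\<close> only, so its remaining digits can be summed first.\<close>

lemma bsum_add:
  assumes K: "K > 0" and per: "\<And>l u (j::int). 1 \<le> l \<Longrightarrow> l \<le> n \<Longrightarrow> f l (u + of_int j) = f l u"
  shows "bsum K (n + m) f x
    = (\<Sum>k<K ^ n. (\<Prod>l\<in>{1..n}. f l ((x + real k) / real K ^ l)) *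
         bsum K m (\<lambda>l. f (n + l)) ((x + real k) / real K ^ n))"
proof -
  have "(\<Prod>l\<in>{1..n + m}. f l ((x + real (k + K ^ n * q)) / real K ^ l))
     = (\<Prod>l\<in>{1..n}. f l ((x + real k) / real K ^ l)) *
       (\<Prod>l\<in>{1..m}. f (n + l) (((x + real k) / real K ^ n + real q) / real K ^ l))" for k q
  proof -
    have "(\<Prod>l\<in>{1..n + m}. f l ((x + real (k + K ^ n * q)) / real K ^ l))
       = (\<Prod>l\<in>{1..n}. f l ((x + real (k + K ^ n * q)) / real K ^ l)) *
         (\<Prod>l\<in>{Suc n..n + m}. f l ((x + real (k + K ^ n * q)) / real K ^ l))"
      by (subst prod.union_disjoint[symmetric]) (auto intro!: prod.cong)
    also have "(\<Prod>l\<in>{1..n}. f l ((x + real (k + K ^ n * q)) / real K ^ l))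
       = (\<Prod>l\<in>{1..n}. f l ((x + real k) / real K ^ l))"
    proof (intro prod.cong refl)
      fix l assume l: "l \<in> {1..n}"
      have "(x + real (k + K ^ n * q)) / real K ^ l = (x + real k) / real K ^ l + of_int (int (K ^ (n - l) * q))"
        using l K by (simp add: field_simps flip: power_add)
      then show "f l ((x + real (k + K ^ n * q)) / real K ^ l) = f l ((x + real k) / real K ^ l)"
        by (simp only:) (rule per, use l in auto)
    qed
    also have "(\<Prod>l\<in>{Suc n..n + m}. f l ((x + real (k + K ^ n * q)) / real K ^ l))
       = (\<Prod>l\<in>{1..m}. f (n + l) (((x + real k) / real K ^ n + real q) / real K ^ l))"
    proof -
      have "(\<Prod>l\<in>{1 + n..m + n}. f l ((x + real (k + K ^ n * q)) / real K ^ l))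
        = (\<Prod>l\<in>{1..m}. f (l + n) ((x + real (k + K ^ n * q)) / real K ^ (l + n)))"
        by (rule prod.shift_bounds_cl_nat_ivl)
      also have "\<dots> = (\<Prod>l\<in>{1..m}. f (n + l) (((x + real k) / real K ^ n + real q) / real K ^ l))"
        by (intro prod.cong refl arg_cong2[where f = f]) (use K in \<open>auto simp: field_simps power_add\<close>)
      finally show ?thesis by (simp add: add.commute)
    qed
    finally show ?thesis .
  qed
  then show ?thesis
    unfolding bsum_def power_add sum_lessThan_mult sum_distrib_left by simp
qed

lemma bsum_add_le:
  assumes K: "K > 0" and per: "\<And>l u (j::int). 1 \<le> l \<Longrightarrow> l \<le> n \<Longrightarrow> f l (u + of_int j) = f l u"
    and nn: "\<And>l u. 1 \<le> l \<Longrightarrow> l \<le> n \<Longrightarrow> 0 \<le> f l u"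
    and le: "\<And>y. bsum K m (\<lambda>l. f (n + l)) y \<le> c"
  shows "bsum K (n + m) f x \<le> bsum K n f x * c"
proof -
  have "bsum K (n + m) f x \<le> (\<Sum>k<K ^ n. (\<Prod>l\<in>{1..n}. f l ((x + real k) / real K ^ l)) * c)"
    by (subst bsum_add[OF K per]) (auto intro!: sum_mono mult_left_mono le prod_nonneg nn)
  then show ?thesis by (simp add: bsum_def sum_distrib_right)
qed

text \<open>Summing out the last scale first leaves a constant that factors out.\<close>

lemma bsum_eq_prod:
  assumes K: "K > 0" and per: "\<And>l u (j::int). 1 \<le> l \<Longrightarrow> l < n \<Longrightarrow> f l (u + of_int j) = f l u"
    and av: "\<And>l y. 1 \<le> l \<Longrightarrow> l \<le> n \<Longrightarrow> (\<Sum>q<K. f l ((y + real q) / real K)) = c l"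
  shows "bsum K n f x = (\<Prod>l\<in>{1..n}. c l)"
  using per av
proof (induction n)
  case 0
  then show ?case by (simp add: bsum_def)
next
  case (Suc n)
  have "bsum K (n + 1) f x = (\<Sum>k<K ^ n. (\<Prod>l\<in>{1..n}. f l ((x + real k) / real K ^ l)) * bsum K 1 (\<lambda>l. f (n + l)) ((x + real k) / real K ^ n))"
    by (rule bsum_add[OF K]) (use Suc.prems in auto)
  also have "bsum K 1 (\<lambda>l. f (n + l)) y = c (Suc n)" for y
    using Suc.prems(2)[of "Suc n" y] by (simp add: bsum_def)
  then have "(\<Sum>k<K ^ n. (\<Prod>l\<in>{1..n}. f l ((x + real k) / real K ^ l)) * bsum K 1 (\<lambda>l. f (n + l)) ((x + real k) / real K ^ n))
     = bsum K n f x * c (Suc n)" by (simp add: bsum_def sum_distrib_right)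
  also have "bsum K n f x = (\<Prod>l\<in>{1..n}. c l)" using Suc by auto
  finally show ?case by (simp add: mult.commute)
qed

lemma smear_add_int: "smear S X (u + of_int j) = smear S X u"
proof -
  have "u + of_int j + X = (u + X) + of_int j" "u + of_int j - X = (u - X) + of_int j" by auto
  then show ?thesis by (simp only: smear_def sqmod_add_int)
qed

lemma smear_nonneg: "0 \<le> smear S X u"
  by (simp add: smear_def sqmod_nonneg)

lemma sum_smear:
  assumes "S \<subseteq> {0..<K}" "K > 0"
  shows "(\<Sum>q<K. smear S X ((y + real q) / K)) = K / card S"
proof -
  have "(y + real q) / K + X = ((y + K * X) + real q) / K" "(y + real q) / K - X = ((y - K * X) + real q) / K" for q
    using assms by (auto simp: field_simps)
  then show ?thesis
    using sum_sqmod[OF assms(1), of "y + K * X"] sum_sqmod[OF assms(1), of "y - K * X"]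
    by (simp add: smear_def sum.distrib flip: sum_divide_distrib)
qed

lemma sin_ge_half: 
  fixes y :: real
  assumes "0 \<le> y" "y \<le> 1 / 2"
  shows "sin (pi * y) \<ge> 2 * y"
proof -
  have "concave_on {0..pi / 2} sin"
  proof (rule f''_le0_imp_concave)
    show "(sin has_real_derivative cos x) (at x)" for x :: real by (rule DERIV_sin)
    show "(cos has_real_derivative - sin x) (at x)" for x :: real by (rule DERIV_cos)
    show "- sin x \<le> 0" if "x \<in> {0..pi / 2}" for x using that sin_ge_zero[of x] pi_gt_zero by auto
  qed auto
  then have "sin ((1 - 2 * y) *\<^sub>R 0 + (2 * y) *\<^sub>R (pi / 2)) \<ge> (1 - 2 * y) * sin 0 + (2 * y) * sin (pi / 2)"
    using assms by (intro concave_onD) auto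
  then show ?thesis by (simp add: mult.commute)
qed

lemma cis_separated:
  fixes q q' N :: nat
  assumes "q < N" "q' < N" "q \<noteq> q'"
  shows "cmod (cis (2 * pi * (u + real q / N)) - cis (2 * pi * (u + real q' / N))) \<ge> 4 / N"
proof -
  have main: "cmod (cis (2 * pi * (u + real q / N)) - cis (2 * pi * (u + real q' / N))) \<ge> 4 / N"
    if lt: "q' < q" "q < N" for q q' :: nat
  proof -
    define y where "y = (real q - real q') / N"
    have N: "real N > 0" using lt by simp
    have y: "1 / N \<le> y" "y \<le> 1 - 1 / N"
    proof -
      have "1 \<le> real q - real q'" "real q - real q' \<le> real N - 1" using lt by auto
      then have "1 / N \<le> y" "y \<le> (real N - 1) / N" unfolding y_def using N by (auto intro: divide_right_mono)
      then show "1 / N \<le> y" "y \<le> 1 - 1 / N" using N by (auto simp: diff_divide_distrib)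
    qed
    have "0 \<le> 1 / real N" by simp
    then have y01: "0 \<le> y" "y \<le> 1" using y by linarith+
    have "cis (2 * pi * (u + real q / N)) = cis (2 * pi * (u + real q' / N)) * cis (2 * pi * y)"
      unfolding cis_mult y_def by (intro arg_cong[where f = cis]) (simp add: algebra_simps diff_divide_distrib)
    then have "cis (2 * pi * (u + real q / N)) - cis (2 * pi * (u + real q' / N))
      = cis (2 * pi * (u + real q' / N)) * (cis (2 * pi * y) - 1)" by (simp add: algebra_simps)
    then have "cmod (cis (2 * pi * (u + real q / N)) - cis (2 * pi * (u + real q' / N))) = 2 * \<bar>sin (pi * y)\<bar>"
      by (simp add: norm_mult cmod_cis_minus_1)
    moreover have "2 / N \<le> sin (pi * y)"
    proof (cases "y \<le> 1 / 2")
      case True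
      then show ?thesis using sin_ge_half[of y] y y01 by simp
    next
      case False
      have "sin (pi * (1 - y)) = sin (pi * y)" by (simp add: algebra_simps)
      then show ?thesis using sin_ge_half[of "1 - y"] y y01 False by simp
    qed
    ultimately show ?thesis by simp
  qed
  show ?thesis
  proof (cases "q' < q")
    case False
    then show ?thesis using main[of q q'] assms by (simp add: norm_minus_commute)
  qed (use main assms in auto)
qed

context digit_pair begin

text \<open>The weights of the finest \<open>g\<close> scales of a block of length \<open>Suc g\<close>, normalised such that the
  average of \<open>sqmod B\<close> on the remaining coarsest scale is \<open>1\<close>.\<close>

definition wgt :: "nat \<Rightarrow> real \<Rightarrow> nat \<Rightarrow> real" where
  "wgt g x k = (real (card B) / K) ^ Suc g * (\<Prod>l\<in>{1..g}. sqmod B ((x + real k) / real K ^ l))"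

lemma wgt_nonneg: "0 \<le> wgt g x k"
  by (simp add: wgt_def prod_nonneg sqmod_nonneg)

lemma bsum_block:
  "(real (card B) / K) ^ Suc g * bsum K (Suc g) (\<lambda>l. if l = Suc g then h else sqmod B) x
     = (\<Sum>k<K ^ Suc g. wgt g x k * h ((x + real k) / real K ^ Suc g))"
proof -
  have "(\<Prod>l\<in>{1..Suc g}. (if l = Suc g then h else sqmod B) ((x + real k) / real K ^ l))
     = (\<Prod>l\<in>{1..g}. sqmod B ((x + real k) / real K ^ l)) * h ((x + real k) / real K ^ Suc g)" for k
  proof -
    have "(\<Prod>l\<in>{1..g}. (if l = Suc g then h else sqmod B) ((x + real k) / real K ^ l))
      = (\<Prod>l\<in>{1..g}. sqmod B ((x + real k) / real K ^ l))" by (intro prod.cong) auto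
    then show ?thesis by simp
  qed
  then show ?thesis unfolding bsum_def wgt_def sum_distrib_left by (simp only: mult.assoc)
qed

lemma ratio: "real (card B) / K = 1 / card A" "(real (card B) / K) * (real K / card B) = 1"
proof -
  have "real (card A) * real (card B) = real K" using card_AB by (metis of_nat_mult)
  then show "real (card B) / K = 1 / card A" "(real (card B) / K) * (real K / card B) = 1"
    using card_A card_B K4 by (auto simp: field_simps)
qed

lemma bsum_sqmod: "bsum K n (\<lambda>_. sqmod B) x = (real K / card B) ^ n"
  using bsum_eq_prod[of K n "\<lambda>_. sqmod B" "\<lambda>_. real K / card B" x] K4 sum_sqmod[OF B_sub] sqmod_add_int
  by simp

lemma sum_wgt_avg:
  assumes "\<And>y. (\<Sum>q<K. h ((y + real q) / real K)) = c"
  shows "(\<Sum>k<K ^ Suc g. wgt g x k * h ((x + real k) / real K ^ Suc g)) = (card B / K) * c"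
proof -
  let ?f = "\<lambda>l. if l = Suc g then h else sqmod B"
  have "bsum K (Suc g) ?f x = (\<Prod>l\<in>{1..Suc g}. if l = Suc g then c else real K / card B)"
    by (rule bsum_eq_prod) (use K4 sum_sqmod[OF B_sub] sqmod_add_int assms in auto)
  also have "\<dots> = c * (\<Prod>l\<in>{1..g}. if l = Suc g then c else real K / card B)" by simp
  also have "(\<Prod>l\<in>{1..g}. if l = Suc g then c else real K / card B) = (\<Prod>l\<in>{1..g}. real K / card B)"
    by (intro prod.cong) auto
  also have "c * \<dots> = c * (real K / card B) ^ g" by simp
  finally show ?thesis unfolding bsum_block[symmetric]
    using ratio(2) by (simp add: mult.assoc mult.left_commute flip: power_mult_distrib)
qed

lemma sum_wgt_sqmod: "(\<Sum>k<K ^ Suc g. wgt g x k * sqmod B ((x + real k) / real K ^ Suc g)) = 1"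
  using sum_wgt_avg[of "sqmod B" "real K / card B"] sum_sqmod[OF B_sub] ratio(2) by simp

lemma sum_wgt_smear: "(\<Sum>k<K ^ Suc g. wgt g x k * smear B X ((x + real k) / real K ^ Suc g)) = 1"
  using sum_wgt_avg[of "smear B X" "real K / card B"] sum_smear[OF B_sub] K4 ratio(2) by simp

lemma sum_wgt: "(\<Sum>k<K ^ Suc g. wgt g x k) = card B"
  using sum_wgt_avg[of "\<lambda>_. 1" "real K" g x] K4 by simp

text \<open>A Frostman condition: the weight within \<open>1 / K ^ j\<close> of \<open>z\<close> is
  at most this distance raised to the power \<open>ln (card A) / ln K\<close>. Indices with equal
  residue modulo \<open>K ^ n\<close> belong to points at mutual distance at least
  \<open>4 / K ^ j\<close>, so near \<open>z\<close> the residue determines the index. Bounding the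
  factors beyond scale \<open>n\<close> by 1 leaves a complete average over the residues.\<close>

lemma sum_wgt_near:
  assumes j: "1 \<le> j" "j \<le> g"
  shows "(\<Sum>k | k < K ^ Suc g \<and> cmod (cis (2 * pi * ((x + real k) / real K ^ Suc g)) - z) \<le> 1 / real K ^ j. wgt g x k)
    \<le> (1 / real (card A)) ^ j"
proof -
  define n where "n = Suc g - j"
  have n: "n \<le> g" "n + j = Suc g" using j by (auto simp: n_def)
  define D where "D = {k. k < K ^ Suc g \<and> cmod (cis (2 * pi * ((x + real k) / real K ^ Suc g)) - z) \<le> 1 / real K ^ j}"
  have Kn: "real K ^ n > 0" "real K ^ j > 0" "K > 0" using K4 by auto
  have u: "(x + real k) / real K ^ Suc g = (x + real (k mod K ^ n)) / real K ^ Suc g + real (k div K ^ n) / real (K ^ j)" for k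
  proof -
    have "real k = real (k mod K ^ n) + real K ^ n * real (k div K ^ n)"
      by (metis mod_mult_div_eq of_nat_add of_nat_mult of_nat_power)
    then show ?thesis unfolding n(2)[symmetric] power_add using Kn by (simp add: field_simps)
  qed
  have inj: "inj_on (\<lambda>k. k mod K ^ n) D"
  proof (rule inj_onI)
    fix k k' assume k: "k \<in> D" "k' \<in> D" "k mod K ^ n = k' mod K ^ n"
    have lt: "k div K ^ n < K ^ j" "k' div K ^ n < K ^ j"
      using k Kn unfolding D_def n(2)[symmetric] power_add by (auto simp: less_mult_imp_div_less mult.commute)
    show "k = k'"
    proof (rule ccontr)
      assume "k \<noteq> k'"
      then have ne: "k div K ^ n \<noteq> k' div K ^ n" using k(3) by (metis mod_mult_div_eq)
      let ?e = "\<lambda>k. cis (2 * pi * ((x + real k) / real K ^ Suc g))"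
      have "4 / real (K ^ j) \<le> cmod (?e k - ?e k')"
        unfolding u[of k] u[of k'] k(3) by (rule cis_separated[OF lt ne])
      also have "\<dots> \<le> cmod (?e k - z) + cmod (?e k' - z)"
        using norm_triangle_ineq4[of "?e k - z" "?e k' - z"] by simp
      also have "\<dots> \<le> 2 / real K ^ j" using k unfolding D_def by auto
      finally show False using Kn by (simp add: divide_le_cancel)
    qed
  qed
  have "(\<Sum>k\<in>D. wgt g x k) \<le> (\<Sum>k\<in>D. (real (card B) / K) ^ Suc g * (\<Prod>l\<in>{1..n}. sqmod B ((x + real (k mod K ^ n)) / real K ^ l)))"
  proof (rule sum_mono)
    fix k
    have "(\<Prod>l\<in>{1..g}. sqmod B ((x + real k) / real K ^ l)) = (\<Prod>l\<in>{1..n}. sqmod B ((x + real k) / real K ^ l)) * (\<Prod>l\<in>{Suc n..g}. sqmod B ((x + real k) / real K ^ l))"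
      using n by (subst prod.union_disjoint[symmetric]) (auto intro!: prod.cong)
    also have "\<dots> \<le> (\<Prod>l\<in>{1..n}. sqmod B ((x + real k) / real K ^ l)) * 1"
      by (intro mult_left_mono prod_le_1 prod_nonneg conjI) (auto simp: sqmod_nonneg sqmod_le_1)
    also have "(\<Prod>l\<in>{1..n}. sqmod B ((x + real k) / real K ^ l)) = (\<Prod>l\<in>{1..n}. sqmod B ((x + real (k mod K ^ n)) / real K ^ l))"
    proof (intro prod.cong refl)
      fix l assume l: "l \<in> {1..n}"
      have "real k = real (k mod K ^ n) + real K ^ n * real (k div K ^ n)"
        by (metis mod_mult_div_eq of_nat_add of_nat_mult of_nat_power)
      then have "(x + real k) / real K ^ l = (x + real (k mod K ^ n)) / real K ^ l + of_int (int (K ^ (n - l) * (k div K ^ n)))"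
        using l Kn by (simp add: field_simps flip: power_add)
      then show "sqmod B ((x + real k) / real K ^ l) = sqmod B ((x + real (k mod K ^ n)) / real K ^ l)"
        by (simp only: sqmod_add_int)
    qed
    finally show "wgt g x k \<le> (real (card B) / K) ^ Suc g * (\<Prod>l\<in>{1..n}. sqmod B ((x + real (k mod K ^ n)) / real K ^ l))"
      unfolding wgt_def by (intro mult_left_mono) auto
  qed
  also have "\<dots> = (\<Sum>k\<in>(\<lambda>k. k mod K ^ n) ` D. (real (card B) / K) ^ Suc g * (\<Prod>l\<in>{1..n}. sqmod B ((x + real k) / real K ^ l)))"
    by (subst sum.reindex[OF inj]) (simp add: o_def)
  also have "\<dots> \<le> (\<Sum>k<K ^ n. (real (card B) / K) ^ Suc g * (\<Prod>l\<in>{1..n}. sqmod B ((x + real k) / real K ^ l)))"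
    using Kn by (intro sum_mono2 mult_nonneg_nonneg prod_nonneg sqmod_nonneg) auto
  also have "\<dots> = (real (card B) / K) ^ Suc g * (real K / card B) ^ n"
    unfolding bsum_sqmod[symmetric, of n x] bsum_def by (simp add: sum_distrib_left)
  also have "\<dots> = (real (card B) / K) ^ j * ((real (card B) / K) * (real K / card B)) ^ n"
    unfolding n(2)[symmetric] power_add power_mult_distrib by simp
  also have "\<dots> = (1 / real (card A)) ^ j" by (simp only: ratio(2)) (simp add: ratio(1))
  finally show ?thesis by (simp only: D_def)
qed

text \<open>The term \<open>\<kappa> ^ Suc j\<close> dominates the power on the layer between
  \<open>1 / K ^ Suc j\<close> and \<open>1 / K ^ j\<close>, and the summand 1 covers
  \<open>y > 1\<close>.\<close>

lemma powr_le_layers: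
  fixes \<kappa> :: real
  assumes \<kappa>: "\<kappa> = real K powr \<theta>" and \<theta>: "\<theta> > 0"
  shows "1 / real K ^ g \<le> y \<Longrightarrow> y powr (- \<theta>) \<le> 1 + (\<Sum>j\<le>g. \<kappa> ^ Suc j * of_bool (y \<le> 1 / real K ^ j))"
proof (induction g)
  case 0
  then have "y powr (- \<theta>) \<le> 1 powr (- \<theta>)" using \<theta> by (intro powr_mono2') auto
  moreover have "0 \<le> real K powr \<theta>" by simp
  moreover have "0 \<le> \<kappa> ^ Suc 0 * of_bool (y \<le> 1 / real K ^ 0)" using \<kappa> by simp
  moreover have "(\<Sum>j\<le>0. \<kappa> ^ Suc j * of_bool (y \<le> 1 / real K ^ j)) = \<kappa> ^ Suc 0 * of_bool (y \<le> 1 / real K ^ 0)"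
    by simp
  ultimately show ?case by (simp only: powr_one_eq_one)
next
  case (Suc g)
  have k0: "\<kappa> > 0" using \<kappa> K4 by simp
  have K0: "real K > 0" using K4 by simp
  have "0 \<le> \<kappa> ^ Suc (Suc g) * of_bool (y \<le> 1 / real K ^ Suc g)" using k0 by simp
  then have mono: "(\<Sum>j\<le>g. \<kappa> ^ Suc j * of_bool (y \<le> 1 / real K ^ j))
     \<le> (\<Sum>j\<le>Suc g. \<kappa> ^ Suc j * of_bool (y \<le> 1 / real K ^ j))" by (simp only: sum.atMost_Suc)
  show ?case
  proof (cases "1 / real K ^ g \<le> y")
    case True
    then show ?thesis using Suc.IH mono by linarith
  next
    case False
    have "y powr (- \<theta>) \<le> (1 / real K ^ Suc g) powr (- \<theta>)"
      using Suc.prems K0 \<theta> by (intro powr_mono2') auto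
    also have "\<dots> = (real K ^ Suc g) powr \<theta>" using K0 by (simp add: powr_minus powr_divide)
    also have "\<dots> = \<kappa> ^ Suc g" using K0 unfolding \<kappa> by (simp add: powr_realpow[symmetric] powr_powr mult.commute del: power_Suc)
    also have "\<dots> \<le> (\<Sum>j\<le>g. \<kappa> ^ Suc j * of_bool (y \<le> 1 / real K ^ j))"
    proof -
      have "\<kappa> ^ Suc g = \<kappa> ^ Suc g * of_bool (y \<le> 1 / real K ^ g)" using False by simp
      also have "\<dots> \<le> (\<Sum>j\<le>g. \<kappa> ^ Suc j * of_bool (y \<le> 1 / real K ^ j))"
        using k0 by (intro member_le_sum) auto
      finally show ?thesis .
    qed
    finally show ?thesis using mono by linarith
  qed
qed

text \<open>Three quarters of the dimension of the Cantor set of \<open>A\<close>: any smaller exponent makes the layers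
  in \<open>layer_cake\<close> summable.\<close>

definition codim :: real where
  "codim = 3 / 4 * (ln (card A) / ln K)"

lemma codim_bounds: "0 < codim" "codim < 3 / 4" "real K powr codim < card A"
proof -
  have b1: "1 * card A < card B * card A" using card_A card_B by (intro mult_strict_right_mono) auto
  then have aK: "real (card A) < real K" using card_AB by (simp add: mult.commute)
  have l: "0 < ln (real (card A))" "ln (real (card A)) < ln (real K)" using card_A aK by auto
  then have q: "0 < ln (real (card A)) / ln (real K)" "ln (real (card A)) / ln (real K) < 1" by auto
  then show "0 < codim" "codim < 3 / 4" unfolding codim_def by auto
  have "codim * ln (real K) < ln (real (card A))" using l unfolding codim_def by simp
  then have "exp (codim * ln (real K)) < exp (ln (real (card A)))" by simp
  then show "real K powr codim < card A" using card_A K4 by (simp add: powr_def)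
qed

text \<open>The layers form a geometric series with ratio \<open>K powr codim / card A < 1\<close>.
  The distance is truncated at \<open>1 / K ^ g\<close> because \<open>sum_wgt_near\<close> gives no
  decay below that resolution.\<close>

lemma layer_cake:
  "\<exists>C\<ge>1. \<forall>g x z. (\<Sum>k<K ^ Suc g. wgt g x k *
      max (cmod (cis (2 * pi * ((x + real k) / real K ^ Suc g)) - z)) (1 / real K ^ g) powr (- codim)) \<le> C"
proof -
  define \<kappa> where "\<kappa> = real K powr codim"
  define r where "r = \<kappa> / card A"
  have k0: "\<kappa> > 0" unfolding \<kappa>_def using K4 by simp
  have r: "0 \<le> r" "r < 1" using codim_bounds(3) card_A k0 by (auto simp: r_def \<kappa>_def)
  define C where "C = card B + \<kappa> * card B + \<kappa> * (1 / (1 - r))"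
  have C1: "C \<ge> 1" unfolding C_def using card_B k0 r by (simp add: add_increasing2)
  have "(\<Sum>k<K ^ Suc g. wgt g x k *
      max (cmod (cis (2 * pi * ((x + real k) / real K ^ Suc g)) - z)) (1 / real K ^ g) powr (- codim)) \<le> C" for g x z
  proof -
    let ?d = "\<lambda>k. cmod (cis (2 * pi * ((x + real k) / real K ^ Suc g)) - z)"
    let ?y = "\<lambda>k. max (?d k) (1 / real K ^ g)"
    have "(\<Sum>k<K ^ Suc g. wgt g x k * ?y k powr (- codim))
      \<le> (\<Sum>k<K ^ Suc g. wgt g x k * (1 + (\<Sum>j\<le>g. \<kappa> ^ Suc j * of_bool (?y k \<le> 1 / real K ^ j))))"
      by (intro sum_mono mult_left_mono wgt_nonneg powr_le_layers \<kappa>_def codim_bounds) auto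
    also have "\<dots> = (\<Sum>k<K ^ Suc g. wgt g x k) + (\<Sum>j\<le>g. \<kappa> ^ Suc j * (\<Sum>k<K ^ Suc g. wgt g x k * of_bool (?y k \<le> 1 / real K ^ j)))"
      unfolding distrib_left sum.distrib sum_distrib_left
      by (subst sum.swap) (simp add: mult.left_commute)
    also have "\<dots> \<le> card B + (\<kappa> * card B + (\<Sum>j\<in>{1..g}. \<kappa> * r ^ j))"
    proof (intro add_mono)
      have "(\<Sum>k<K ^ Suc g. wgt g x k * of_bool (?y k \<le> 1 / real K ^ j)) \<le> (\<Sum>k<K ^ Suc g. wgt g x k)" for j
        by (intro sum_mono) (auto simp: wgt_nonneg)
      then have j0: "(\<Sum>k<K ^ Suc g. wgt g x k * of_bool (?y k \<le> 1 / real K ^ j)) \<le> card B" for j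
        by (simp only: sum_wgt)
      have j1: "(\<Sum>k<K ^ Suc g. wgt g x k * of_bool (?y k \<le> 1 / real K ^ j)) \<le> (1 / real (card A)) ^ j"
        if "j \<in> {1..g}" for j
      proof -
        have "(\<Sum>k<K ^ Suc g. wgt g x k * of_bool (?y k \<le> 1 / real K ^ j))
          \<le> (\<Sum>k<K ^ Suc g. if ?d k \<le> 1 / real K ^ j then wgt g x k else 0)"
          by (intro sum_mono) (auto simp: wgt_nonneg)
        also have "\<dots> = (\<Sum>k | k < K ^ Suc g \<and> ?d k \<le> 1 / real K ^ j. wgt g x k)"
          by (subst sum.inter_filter[symmetric]) (auto intro!: sum.cong)
        also have "\<dots> \<le> (1 / real (card A)) ^ j" by (rule sum_wgt_near) (use that in auto)
        finally show ?thesis .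
      qed
      have "{..g} = insert 0 {1..g}" by auto
      then have "(\<Sum>j\<le>g. \<kappa> ^ Suc j * (\<Sum>k<K ^ Suc g. wgt g x k * of_bool (?y k \<le> 1 / real K ^ j)))
         = \<kappa> ^ Suc 0 * (\<Sum>k<K ^ Suc g. wgt g x k * of_bool (?y k \<le> 1 / real K ^ 0))
           + (\<Sum>j\<in>{1..g}. \<kappa> ^ Suc j * (\<Sum>k<K ^ Suc g. wgt g x k * of_bool (?y k \<le> 1 / real K ^ j)))" 
        by (simp only:) (subst sum.insert, auto)
      also have "\<dots> \<le> \<kappa> ^ Suc 0 * card B + (\<Sum>j\<in>{1..g}. \<kappa> ^ Suc j * (1 / real (card A)) ^ j)"
        using k0 by (intro add_mono mult_left_mono sum_mono j0 j1) auto
      also have "\<dots> = \<kappa> * card B + (\<Sum>j\<in>{1..g}. \<kappa> * r ^ j)"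
        by (simp add: r_def power_divide)
      finally show "(\<Sum>j\<le>g. \<kappa> ^ Suc j * (\<Sum>k<K ^ Suc g. wgt g x k * of_bool (?y k \<le> 1 / real K ^ j)))
        \<le> \<kappa> * card B + (\<Sum>j\<in>{1..g}. \<kappa> * r ^ j)" .
    qed (simp only: sum_wgt)
    also have "(\<Sum>j\<in>{1..g}. \<kappa> * r ^ j) \<le> \<kappa> * (1 / (1 - r))"
    proof -
      have "(\<Sum>j\<in>{1..g}. r ^ j) \<le> (\<Sum>j<Suc g. r ^ j)" using r by (intro sum_mono2) auto
      also have "\<dots> = (1 - r ^ Suc g) / (1 - r)" using r by (simp only: sum_gp_strict) simp
      also have "\<dots> \<le> 1 / (1 - r)" using r by (intro divide_right_mono) auto
      finally show ?thesis unfolding sum_distrib_left[symmetric] using k0 by (intro mult_left_mono) auto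
    qed
    finally show ?thesis by (simp add: C_def)
  qed
  then show ?thesis using C1 by blast
qed

end

text \<open>Bernoulli's inequality for exponents in \<open>[0, 1]\<close>, obtained from convexity
  of \<open>exp\<close> between 0 and \<open>ln x\<close>.\<close>

lemma powr_le_tangent:
  fixes x \<sigma> :: real
  assumes "x \<ge> 0" "0 \<le> \<sigma>" "\<sigma> \<le> 1"
  shows "x powr \<sigma> \<le> 1 + \<sigma> * (x - 1)"
proof (cases "x = 0")
  case False
  then have x: "x > 0" using assms by simp
  have "exp ((1 - \<sigma>) *\<^sub>R 0 + \<sigma> *\<^sub>R ln x) \<le> (1 - \<sigma>) * exp 0 + \<sigma> * exp (ln x)"
    by (rule convex_onD[OF exp_convex]) (use assms in auto)
  then show ?thesis using x by (simp add: powr_def algebra_simps)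
qed (use assms in auto)

context digit_pair begin

text \<open>The splitting behind a Chebyshev argument: \<open>tame\<close> carries the moment of
  order \<open>\<sigma>\<close> of the quotient where it is at most \<open>T\<close>, and
  \<open>wild\<close> keeps the rest. Testing \<open>smear <= T * sqmod\<close> instead of the
  quotient makes a zero of \<open>sqmod B\<close> with positive smeared value wild.\<close>

definition tame :: "real \<Rightarrow> real \<Rightarrow> real \<Rightarrow> real \<Rightarrow> real" where
  "tame X T \<sigma> u = (if smear B X u \<le> T * sqmod B u
      then smear B X u * (smear B X u / sqmod B u) powr \<sigma> else 0)"

definition wild :: "real \<Rightarrow> real \<Rightarrow> real \<Rightarrow> real" where
  "wild X T u = (if smear B X u \<le> T * sqmod B u then 0 else smear B X u)"

text \<open>Chosen such that \<open>T powr expo = X powr - (4 + 2 * codim / 3)\<close> for \<open>T = X powr (- 18 / codim)\<close>.\<close>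

definition expo :: real where
  "expo = codim * (4 + 2 * codim / 3) / 18"

lemma expo_bounds: "0 < expo" "expo \<le> 1" "4 * expo \<le> codim"
proof -
  show "0 < expo" unfolding expo_def using codim_bounds by (intro divide_pos_pos mult_pos_pos add_pos_pos) auto
  have "4 + 2 * codim / 3 \<le> 18 / 4" using codim_bounds by simp
  then have "codim * (4 + 2 * codim / 3) \<le> codim * (18 / 4)" using codim_bounds by (intro mult_left_mono) auto
  then show "4 * expo \<le> codim" unfolding expo_def by linarith
  then show "expo \<le> 1" using codim_bounds by simp
qed

lemma tame_nonneg: "0 \<le> tame X T \<sigma> u" and wild_nonneg: "0 \<le> wild X T u"
  by (simp_all add: tame_def wild_def smear_nonneg)

lemma tame_le:
  assumes "T \<ge> 0" "\<sigma> \<ge> 0" shows "tame X T \<sigma> u \<le> smear B X u * T powr \<sigma>"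
proof (cases "smear B X u \<le> T * sqmod B u")
  case True
  have "smear B X u / sqmod B u \<le> T"
  proof (cases "sqmod B u = 0")
    case False
    then have "sqmod B u > 0" using sqmod_nonneg[of B u] by simp
    then show ?thesis using True by (simp add: divide_le_eq)
  qed (use assms in simp)
  then show ?thesis unfolding tame_def using True assms
    by (auto intro!: mult_left_mono powr_mono2 smear_nonneg divide_nonneg_nonneg sqmod_nonneg)
qed (simp add: tame_def smear_nonneg)

text \<open>Near a root of order at most two the singularity of the smeared quotient is integrable against
  the block weights; near a root of higher order the factor \<open>X ^ 6\<close> already suffices.\<close>

theorem block_bounds:
  "\<exists>C\<ge>1. \<exists>X0>0. \<forall>X g x. 0 < X \<and> X < X0 \<and> 1 / real K ^ g \<le> X powr (1 + 4 / codim) \<longrightarrow>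
    (\<Sum>k<K ^ Suc g. wgt g x k * tame X (X powr (- 18 / codim)) expo ((x + real k) / real K ^ Suc g))
       \<le> 1 + C * X powr (2 + codim / 3) \<and>
    (\<Sum>k<K ^ Suc g. wgt g x k * wild X (X powr (- 18 / codim)) ((x + real k) / real K ^ Suc g))
       \<le> C * X powr (6 + codim)"
proof -
  define \<theta> where "\<theta> = codim"
  define \<sigma> where "\<sigma> = expo"
  have \<theta>: "0 < \<theta>" "\<theta> < 3 / 4" using codim_bounds by (auto simp: \<theta>_def)
  have \<sigma>: "0 < \<sigma>" "\<sigma> \<le> 1" "4 * \<sigma> \<le> \<theta>" using expo_bounds by (auto simp: \<sigma>_def \<theta>_def)
  obtain Z Cs X1 where Z: "finite Z" and Cs: "Cs \<ge> 1" and X1: "X1 > 0" and loc: "\<And>X u. 0 < X \<Longrightarrow> X < X1 \<Longrightarrow>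
     ((\<forall>z\<in>Z. cmod (cis (2 * pi * u) - z) \<ge> 7 * X) \<longrightarrow>
        sqmod B u > 0 \<and> smear B X u \<le> Cs * sqmod B u \<and>
        (smear B X u - sqmod B u)\<^sup>2 \<le> Cs * X ^ 4 * (\<Sum>z\<in>Z. 1 / (cmod (cis (2 * pi * u) - z))\<^sup>2) * sqmod B u) \<and>
     (\<forall>z\<in>Z. cmod (cis (2 * pi * u) - z) < 7 * X \<longrightarrow>
        sqmod B u \<le> Cs * X\<^sup>2 \<and> smear B X u \<le> Cs * X\<^sup>2 \<and>
        (smear B X u * cmod (cis (2 * pi * u) - z) ^ 4 \<le> Cs * X ^ 4 * sqmod B u \<or> smear B X u \<le> Cs * X ^ 6))"
    using smear_local[OF finB card_B] by blast
  obtain CL where CL: "CL \<ge> 1" and lc: "\<And>g x z. (\<Sum>k<K ^ Suc g. wgt g x k *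
      max (cmod (cis (2 * pi * ((x + real k) / real K ^ Suc g)) - z)) (1 / real K ^ g) powr (- \<theta>)) \<le> CL"
    using layer_cake unfolding \<theta>_def by blast
  define c7 where "c7 = 7 powr \<theta>"
  have c7: "c7 \<ge> 1" unfolding c7_def using \<theta> by (intro ge_one_powr_ge_zero) auto
  define C' where "C' = 3 * Cs + 3 * (Cs * c7) + Cs * Cs * c7"
  have C'p: "C' \<ge> 0" "2 * Cs * c7 \<le> C'" unfolding C'_def using Cs c7 by (auto simp: mult_nonneg_nonneg)
  define C where "C = 1 + real (card Z) * C' * CL"
  have C: "C \<ge> 1" "real (card Z) * C' * CL \<le> C" unfolding C_def using C'p CL by auto
  define X0 where "X0 = min X1 (1 / Cs)"
  have X0: "X0 > 0" using X1 Cs by (simp add: X0_def)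
  have "(\<Sum>k<K ^ Suc g. wgt g x k * tame X (X powr (- 18 / codim)) expo ((x + real k) / real K ^ Suc g))
       \<le> 1 + C * X powr (2 + codim / 3) \<and>
    (\<Sum>k<K ^ Suc g. wgt g x k * wild X (X powr (- 18 / codim)) ((x + real k) / real K ^ Suc g))
       \<le> C * X powr (6 + codim)"
    if X: "0 < X" "X < X0" and g: "1 / real K ^ g \<le> X powr (1 + 4 / codim)" for X g x
  proof -
    have XX: "X < X1" "X \<le> 1" "X * Cs \<le> 1"
    proof -
      have "X < X1" "X < 1 / Cs" using X by (auto simp: X0_def)
      then show "X < X1" "X * Cs \<le> 1" using Cs by (auto simp: field_simps)
      have "1 / Cs \<le> 1" using Cs by simp
      then show "X \<le> 1" using \<open>X < 1 / Cs\<close> by linarith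
    qed
    define T where "T = X powr (- 18 / \<theta>)"
    \<comment> \<open>At this distance \<open>s1 powr \<theta> = X powr (\<theta> + 4)\<close>,
      which improves a bound of order \<open>X ^ 2\<close> to one of order
      \<open>X powr (6 + \<theta>)\<close>.\<close>
    define s1 where "s1 = X powr (1 + 4 / \<theta>)"
    define s0 where "s0 = 1 / real K ^ g"
    have s0: "0 < s0" "s0 \<le> s1" using g K4 by (auto simp: s0_def s1_def \<theta>_def)
    have s1: "0 < s1" "s1 \<le> X"
    proof -
      show "s1 \<le> X" unfolding s1_def using powr_mono'[of 1 "1 + 4 / \<theta>" X] X XX \<theta> by simp
    qed (use s0 in linarith)
    \<comment> \<open>\<open>T >= Cs\<close> keeps points far from the roots out of the wild part;
      the last inequality confines wild points at a root of order at most two to distance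
      \<open>s1\<close> from it.\<close>
    have T1: "T \<ge> 1" "T \<ge> Cs" "Cs * X ^ 4 \<le> T * s1 ^ 4"
    proof -
      have up: "Cs \<le> X powr (- a)" if "a \<ge> 1" for a
      proof -
        have "Cs \<le> 1 / X" using XX X by (simp add: field_simps)
        also have "\<dots> = X powr (- 1)" using X by (simp add: powr_minus_divide)
        also have "\<dots> \<le> X powr (- a)" using X XX that by (intro powr_mono') auto
        finally show ?thesis .
      qed
      have t18: "18 / \<theta> \<ge> 1" "2 / \<theta> \<ge> 1" using \<theta> by (auto simp: field_simps)
      show "T \<ge> Cs" unfolding T_def using up[OF t18(1)] by simp
      then show "T \<ge> 1" using Cs by linarith
      have "T * s1 ^ 4 = X powr (- 18 / \<theta>) * X powr (4 * (1 + 4 / \<theta>))"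
        unfolding T_def s1_def using X by (simp add: powr_power mult.commute)
      also have "\<dots> = X powr (4 - 2 / \<theta>)" proof -
        have "- 18 / \<theta> + 4 * (1 + 4 / \<theta>) = 4 - 2 / \<theta>" by (simp add: distrib_left)
        then show ?thesis by (simp only: powr_add[symmetric])
      qed
      also have "\<dots> = X powr (- (2 / \<theta>)) * X ^ 4"       proof -
        have "X ^ 4 = X powr 4" "4 - 2 / \<theta> = - (2 / \<theta>) + 4" using X by auto
        then show ?thesis by (simp only: powr_add)
      qed
      finally show "Cs * X ^ 4 \<le> T * s1 ^ 4" using up[OF t18(2)] X by (simp add: mult_right_mono)
    qed
    have Ts: "T powr \<sigma> = X powr (- (4 + 2 * \<theta> / 3))"
      unfolding T_def powr_powr using \<theta> by (intro arg_cong2[where f = "(powr)"] refl) (simp add: \<sigma>_def expo_def \<theta>_def field_simps)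
    define e where "e u = cis (2 * pi * u)" for u
    define d where "d z u = cmod (e u - z)" for z u
    define y where "y z u = max (d z u) s0" for z u
    have y: "y z u > 0" for z u using s0 by (simp add: y_def less_max_iff_disj)
    define G where "G = smear B X"
    define F where "F = sqmod B"
    have GF: "0 \<le> G u" "0 \<le> F u" for u by (simp_all add: G_def F_def smear_nonneg sqmod_nonneg)
    have far: "F u > 0 \<and> G u \<le> Cs * F u \<and> (G u - F u)\<^sup>2 \<le> Cs * X ^ 4 * (\<Sum>z\<in>Z. 1 / (d z u)\<^sup>2) * F u"
      if "\<forall>z\<in>Z. d z u \<ge> 7 * X" for u
      using loc[OF X(1) XX(1), of u] that unfolding G_def F_def d_def e_def by blast
    have near: "F u \<le> Cs * X\<^sup>2 \<and> G u \<le> Cs * X\<^sup>2 \<and> (G u * d z u ^ 4 \<le> Cs * X ^ 4 * F u \<or> G u \<le> Cs * X ^ 6)"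
      if "z \<in> Z" "d z u < 7 * X" for z u
      using loc[OF X(1) XX(1), of u] that unfolding G_def F_def d_def e_def by blast
    \<comment> \<open>The device that turns pointwise constants into integrable singularities: a
      point within \<open>a\<close> of a root pays \<open>a powr \<theta>\<close> for the factor
      \<open>b powr (- \<theta>)\<close>, whose block average is bounded by
      \<open>layer_cake\<close>.\<close>
    have one_le: "1 \<le> a powr \<theta> * b powr (- \<theta>)" if "0 < b" "b \<le> a" for a b
    proof -
      have "1 = b powr \<theta> * b powr (- \<theta>)" using that by (simp add: powr_add[symmetric])
      also have "\<dots> \<le> a powr \<theta> * b powr (- \<theta>)" using that \<theta> by (intro mult_right_mono powr_mono2) auto
      finally show ?thesis .
    qed
    have y7: "y z u \<le> 7 * X" if "d z u < 7 * X" for z u using that s0 s1 X by (auto simp: y_def)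
    have X7: "(7 * X) powr \<theta> = c7 * X powr \<theta>" using X by (simp add: powr_mult c7_def)
    have s1t: "s1 powr \<theta> = X powr (\<theta> + 4)"
    proof -
      have "(1 + 4 / \<theta>) * \<theta> = \<theta> + 4" using \<theta> by (simp add: distrib_right)
      then show ?thesis unfolding s1_def powr_powr by (simp only:)
    qed
    have member: "q * y z u powr (- \<theta>) \<le> (\<Sum>z\<in>Z. q * y z u powr (- \<theta>))" if "z \<in> Z" "q \<ge> 0" for q z u
      by (rule member_le_sum) (use that Z in auto)
    have mk: "a \<le> q * p" if "a \<le> q" "1 \<le> p" "0 \<le> q" for a p q :: real
      using that mult_left_mono[of 1 p q] by linarith
    have avg: "(\<Sum>k<K ^ Suc g. wgt g x k * (\<Sum>z\<in>Z. q * y z ((x + real k) / real K ^ Suc g) powr (- \<theta>))) \<le> q * (card Z * CL)"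
      if "q \<ge> 0" for q
    proof -
      have "(\<Sum>k<K ^ Suc g. wgt g x k * (\<Sum>z\<in>Z. q * y z ((x + real k) / real K ^ Suc g) powr (- \<theta>)))
        = (\<Sum>z\<in>Z. q * (\<Sum>k<K ^ Suc g. wgt g x k * y z ((x + real k) / real K ^ Suc g) powr (- \<theta>)))"
        unfolding sum_distrib_left by (subst sum.swap) (simp add: mult.left_commute)
      also have "\<dots> \<le> (\<Sum>z\<in>Z. q * CL)"
        using lc that unfolding y_def d_def e_def s0_def by (intro sum_mono mult_left_mono) auto
      finally show ?thesis by (simp add: mult.commute mult.left_commute)
    qed
    define q2 where "q2 = Cs * X\<^sup>2 * s1 powr \<theta> + Cs * X ^ 6 * (7 * X) powr \<theta>"
    have q2_nn: "0 \<le> Cs * X\<^sup>2 * s1 powr \<theta>" "0 \<le> Cs * X ^ 6 * (7 * X) powr \<theta>"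
      using Cs X by (auto intro!: mult_nonneg_nonneg)
    have wild_le: "wild X T u \<le> (\<Sum>z\<in>Z. q2 * y z u powr (- \<theta>))" for u
    proof (cases "G u \<le> T * F u")
      case True
      then show ?thesis using q2_nn by (auto simp: wild_def G_def F_def q2_def intro!: sum_nonneg mult_nonneg_nonneg)
    next
      case False
      have w: "wild X T u = G u" using False by (simp add: wild_def G_def F_def)
      have "\<not> (\<forall>z\<in>Z. d z u \<ge> 7 * X)"
      proof
        assume "\<forall>z\<in>Z. d z u \<ge> 7 * X"
        then have "G u \<le> Cs * F u" using far by blast
        also have "\<dots> \<le> T * F u" using T1 GF by (intro mult_right_mono) auto
        finally show False using False by simp
      qed
      then obtain z where z: "z \<in> Z" "d z u < 7 * X" by (auto simp: not_le)
      have "G u \<le> q2 * y z u powr (- \<theta>)"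
      proof (cases "G u \<le> Cs * X ^ 6")
        case True
        have "G u \<le> Cs * X ^ 6 * ((7 * X) powr \<theta> * y z u powr (- \<theta>))"
          by (rule mk[OF True one_le[OF y y7[OF z(2)]]]) (use Cs X in auto)
        also have "\<dots> \<le> q2 * y z u powr (- \<theta>)"
          unfolding q2_def distrib_right mult.assoc[symmetric] using q2_nn(1) by simp
        finally show ?thesis .
      next
        case G6: False
        then have gd: "G u * d z u ^ 4 \<le> Cs * X ^ 4 * F u" and g2: "G u \<le> Cs * X\<^sup>2"
          using near[OF z] by auto
        have "d z u \<le> s1"
        proof (rule ccontr)
          assume "\<not> d z u \<le> s1"
          then have ds: "s1 ^ 4 < d z u ^ 4" using s1 by (intro power_strict_mono) auto
          have "0 \<le> T * F u" using T1 GF by simp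
          then have Gp: "G u > 0" using False by linarith
          have "Cs * X ^ 4 * F u \<le> T * s1 ^ 4 * F u" using T1 GF by (intro mult_right_mono) auto
          also have "\<dots> = T * F u * s1 ^ 4" by simp
          also have "\<dots> \<le> G u * s1 ^ 4" using False s1 by (intro mult_right_mono) auto
          also have "\<dots> < G u * d z u ^ 4" using ds Gp by (rule mult_strict_left_mono)
          finally show False using gd by simp
        qed
        then have ys: "y z u \<le> s1" using s0 by (simp add: y_def)
        have "G u \<le> Cs * X\<^sup>2 * (s1 powr \<theta> * y z u powr (- \<theta>))"
          by (rule mk[OF g2 one_le[OF y ys]]) (use Cs X in auto)
        also have "\<dots> \<le> q2 * y z u powr (- \<theta>)"
          unfolding q2_def distrib_right mult.assoc[symmetric] using q2_nn(2) by simp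
        finally show ?thesis .
      qed
      also have "\<dots> \<le> (\<Sum>z\<in>Z. q2 * y z u powr (- \<theta>))"
        using z q2_nn by (intro member) (auto simp: q2_def)
      finally show ?thesis using w by simp
    qed
    have q2_le: "q2 \<le> C' * X powr (6 + \<theta>)"
    proof -
      have "q2 = Cs * X powr (6 + \<theta>) + Cs * c7 * X powr (6 + \<theta>)"
      proof -
        have X2: "X\<^sup>2 = X powr 2" "X ^ 6 = X powr 6" "2 + (\<theta> + 4) = 6 + \<theta>" using X by auto
        have "q2 = Cs * (X powr 2 * X powr (\<theta> + 4)) + Cs * c7 * (X powr 6 * X powr \<theta>)"
          unfolding q2_def s1t X7 X2 by simp
        then show ?thesis by (simp only: powr_add[symmetric] X2)
      qed
      also have "\<dots> = (Cs + Cs * c7) * X powr (6 + \<theta>)" by (simp add: distrib_right)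
      also have "\<dots> \<le> C' * X powr (6 + \<theta>)"
        unfolding C'_def using Cs c7 by (intro mult_right_mono) (auto simp: mult_nonneg_nonneg)
      finally show ?thesis .
    qed
    have second: "(\<Sum>k<K ^ Suc g. wgt g x k * wild X T ((x + real k) / real K ^ Suc g)) \<le> C * X powr (6 + \<theta>)"
    proof -
      have "(\<Sum>k<K ^ Suc g. wgt g x k * wild X T ((x + real k) / real K ^ Suc g))
        \<le> (\<Sum>k<K ^ Suc g. wgt g x k * (\<Sum>z\<in>Z. q2 * y z ((x + real k) / real K ^ Suc g) powr (- \<theta>)))"
        by (intro sum_mono mult_left_mono wild_le wgt_nonneg)
      also have "\<dots> \<le> q2 * (card Z * CL)" using q2_nn by (intro avg) (simp add: q2_def)
      also have "\<dots> \<le> C' * X powr (6 + \<theta>) * (card Z * CL)" using CL by (intro mult_right_mono q2_le) auto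
      also have "\<dots> = (real (card Z) * C' * CL) * X powr (6 + \<theta>)" by simp
      also have "\<dots> \<le> C * X powr (6 + \<theta>)" by (intro mult_right_mono C) simp
      finally show ?thesis .
    qed
    \<comment> \<open>The five sources of error: \<open>t1\<close> the second-order term away from
      the roots, \<open>t2\<close> the value of \<open>sqmod B\<close> near a root,
      \<open>t3\<close> roots of high order, \<open>t4\<close> points closer than the resolution
      \<open>s0\<close> to a root of order at most two, \<open>t5\<close> points near such a root
      beyond that resolution.\<close>
    define t1 where "t1 = Cs * X powr (2 + \<theta>)"
    define t2 where "t2 = Cs * X\<^sup>2 * (7 * X) powr \<theta>"
    define t3 where "t3 = Cs * X ^ 6 * T powr \<sigma> * (7 * X) powr \<theta>"
    define t4 where "t4 = Cs * X\<^sup>2 * T powr \<sigma> * s1 powr \<theta>"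
    define t5 where "t5 = Cs * Cs * X\<^sup>2 * (7 * X) powr \<theta>"
    have tn: "0 \<le> t1" "0 \<le> t2" "0 \<le> t3" "0 \<le> t4" "0 \<le> t5"
      unfolding t1_def t2_def t3_def t4_def t5_def using Cs X by (auto intro!: mult_nonneg_nonneg)
    define q1 where "q1 = t1 + t2 + t3 + t4 + t5"
    have q1: "0 \<le> q1" "t1 \<le> q1" "t2 + t3 \<le> q1" "t2 + t4 \<le> q1" "t2 + t5 \<le> q1" using tn by (auto simp: q1_def)
    have tame_bd: "tame X T \<sigma> u \<le> G u + \<sigma> * (G u - F u) + (\<Sum>z\<in>Z. q1 * y z u powr (- \<theta>))" for u
    proof (cases "\<forall>z\<in>Z. d z u \<ge> 7 * X")
      case True
      have f: "F u > 0" "(G u - F u)\<^sup>2 \<le> Cs * X ^ 4 * (\<Sum>z\<in>Z. 1 / (d z u)\<^sup>2) * F u"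
        using far[OF True] by auto
      have "tame X T \<sigma> u \<le> G u * (G u / F u) powr \<sigma>"
        using GF by (auto simp: tame_def G_def F_def)
      \<comment> \<open>The tangent bound isolates a term linear in \<open>G u - F u\<close>. Its
        block average vanishes because \<open>G\<close> and \<open>F\<close> both have average 1, so
        only the quadratic term remains.\<close>
      also have "\<dots> \<le> G u * (1 + \<sigma> * (G u / F u - 1))"
        using GF \<sigma> by (intro mult_left_mono powr_le_tangent) auto
      also have "\<dots> = G u + \<sigma> * (G u - F u) + \<sigma> * ((G u - F u)\<^sup>2 / F u)"
        using f by (simp add: field_simps power2_eq_square)
      also have "\<sigma> * ((G u - F u)\<^sup>2 / F u) \<le> 1 * (Cs * X ^ 4 * (\<Sum>z\<in>Z. 1 / (d z u)\<^sup>2))"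
        using \<sigma> f by (intro mult_mono) (auto simp: divide_le_eq)
      also have "\<dots> = (\<Sum>z\<in>Z. Cs * X ^ 4 * (1 / (d z u)\<^sup>2))" by (simp add: sum_distrib_left)
      also have "\<dots> \<le> (\<Sum>z\<in>Z. q1 * y z u powr (- \<theta>))"
      proof (rule sum_mono)
        fix z assume "z \<in> Z"
        then have dz: "d z u \<ge> 7 * X" using True by blast
        then have dy: "y z u = d z u" "X \<le> d z u" "0 < d z u" using s0 s1 X by (auto simp: y_def)
        have "1 / (d z u)\<^sup>2 = d z u powr (- \<theta>) * d z u powr (- (2 - \<theta>))"
        proof -
          have "- \<theta> + - (2 - \<theta>) = - 2" by simp
          then have "d z u powr (- \<theta>) * d z u powr (- (2 - \<theta>)) = d z u powr (- 2)"
            by (simp only: powr_add[symmetric])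
          then show ?thesis using dy by (simp add: powr_minus_divide)
        qed
        also have "\<dots> \<le> d z u powr (- \<theta>) * X powr (- (2 - \<theta>))"
          using dy X \<theta> by (intro mult_left_mono powr_mono2') auto
        finally have "Cs * X ^ 4 * (1 / (d z u)\<^sup>2) \<le> Cs * X ^ 4 * (d z u powr (- \<theta>) * X powr (- (2 - \<theta>)))"
          using Cs X by (intro mult_left_mono) auto
        also have "\<dots> = Cs * (X powr 4 * X powr (- (2 - \<theta>))) * d z u powr (- \<theta>)" using X by simp
        also have "X powr 4 * X powr (- (2 - \<theta>)) = X powr (2 + \<theta>)" by (simp add: powr_add[symmetric])
        also have "Cs * X powr (2 + \<theta>) * d z u powr (- \<theta>) \<le> q1 * y z u powr (- \<theta>)"
          unfolding dy using q1(2) unfolding t1_def by (intro mult_right_mono) auto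
        finally show "Cs * X ^ 4 * (1 / (d z u)\<^sup>2) \<le> q1 * y z u powr (- \<theta>)" .
      qed
      finally show ?thesis by simp
    next
      case False
      then obtain z where z: "z \<in> Z" "d z u < 7 * X" by (auto simp: not_le)
      have f2: "F u \<le> Cs * X\<^sup>2" and g2: "G u \<le> Cs * X\<^sup>2" using near[OF z] by auto
      let ?p = "y z u powr (- \<theta>)"
      have p1: "1 \<le> (7 * X) powr \<theta> * ?p" by (rule one_le[OF y y7[OF z(2)]])
      have fb: "F u \<le> t2 * ?p"
        using mk[OF f2 p1] Cs X by (simp add: t2_def mult.assoc)
      have Gt: "tame X T \<sigma> u \<le> G u * T powr \<sigma>"
        unfolding G_def using T1 \<sigma> by (intro tame_le) auto
      have "tame X T \<sigma> u \<le> max t3 (max t4 t5) * ?p"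
      proof -
        consider (a) "G u \<le> Cs * X ^ 6" | (b) "G u * d z u ^ 4 \<le> Cs * X ^ 4 * F u" using near[OF z] by blast
        then show ?thesis
        proof cases
          case a
          have "tame X T \<sigma> u \<le> Cs * X ^ 6 * T powr \<sigma>" by (rule order_trans[OF Gt]) (intro mult_right_mono a, simp)
          then have "tame X T \<sigma> u \<le> (Cs * X ^ 6 * T powr \<sigma>) * ((7 * X) powr \<theta> * ?p)"
            by (rule mk[OF _ p1]) (use Cs X in auto)
          also have "\<dots> = t3 * ?p" by (simp add: t3_def mult.assoc)
          also have "\<dots> \<le> max t3 (max t4 t5) * ?p" by (intro mult_right_mono) auto
          finally show ?thesis .
        next
          case b
          show ?thesis
          proof (cases "d z u < s0")
            case True
            then have ys: "y z u \<le> s1" using s0 by (simp add: y_def)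
            have "tame X T \<sigma> u \<le> Cs * X\<^sup>2 * T powr \<sigma>" by (rule order_trans[OF Gt]) (intro mult_right_mono g2, simp)
            then have "tame X T \<sigma> u \<le> (Cs * X\<^sup>2 * T powr \<sigma>) * (s1 powr \<theta> * ?p)"
              by (rule mk[OF _ one_le[OF y ys]]) (use Cs X in auto)
            also have "\<dots> = t4 * ?p" by (simp add: t4_def mult.assoc)
            also have "\<dots> \<le> max t3 (max t4 t5) * ?p" by (intro mult_right_mono) auto
            finally show ?thesis .
          next
            case ds: False
            then have yd: "y z u = d z u" "0 < d z u" using s0 by (auto simp: y_def)
            have r: "G u / F u \<le> Cs * X ^ 4 / d z u ^ 4"
            proof (cases "F u = 0")
              case True
              then show ?thesis using Cs X yd by simp
            next
              case F0: False
              then have "F u > 0" using GF[of u] by simp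
              then show ?thesis using b yd by (simp add: field_simps)
            qed
            have r7: "1 \<le> 7 * X / d z u" using z yd by simp
            have "(G u / F u) powr \<sigma> \<le> (Cs * X ^ 4 / d z u ^ 4) powr \<sigma>"
              using r GF \<sigma> by (intro powr_mono2) auto
            also have "\<dots> \<le> (Cs * (7 * X / d z u) ^ 4) powr \<sigma>"
            proof (intro powr_mono2)
              have "Cs * X ^ 4 \<le> Cs * (7 * X) ^ 4" using Cs X by (intro mult_left_mono power_mono) auto
              then have "Cs * X ^ 4 / d z u ^ 4 \<le> Cs * (7 * X) ^ 4 / d z u ^ 4" by (intro divide_right_mono) auto
              then show "Cs * X ^ 4 / d z u ^ 4 \<le> Cs * (7 * X / d z u) ^ 4" by (simp only: power_divide times_divide_eq_right)
            qed (use \<sigma> Cs X in auto)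
            also have "\<dots> = Cs powr \<sigma> * (7 * X / d z u) powr (4 * \<sigma>)"
            proof -
              have "(Cs * r ^ 4) powr \<sigma> = Cs powr \<sigma> * r powr (4 * \<sigma>)" if "r \<ge> 1" for r
              proof -
                have r4: "r ^ 4 = r powr 4" using that by simp
                show ?thesis unfolding r4 using Cs by (subst powr_mult) (auto simp only: powr_powr)
              qed
              then show ?thesis using r7 by blast
            qed
            \<comment> \<open>Here \<open>4 * \<sigma> <= \<theta>\<close> enters: the power of the
              quotient is no more singular than what \<open>layer_cake\<close> can
              integrate.\<close>
            also have "\<dots> \<le> Cs powr 1 * (7 * X / d z u) powr \<theta>"
              using Cs r7 \<sigma> by (intro mult_mono powr_mono) auto
            also have "\<dots> = Cs * ((7 * X) powr \<theta> * d z u powr (- \<theta>))"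
              using Cs X yd by (simp add: powr_divide powr_minus_divide)
            finally have "G u * (G u / F u) powr \<sigma> \<le> (Cs * X\<^sup>2) * (Cs * ((7 * X) powr \<theta> * d z u powr (- \<theta>)))"
              using g2 GF Cs by (intro mult_mono) auto
            moreover have "tame X T \<sigma> u \<le> G u * (G u / F u) powr \<sigma>"
              using GF by (auto simp: tame_def G_def F_def)
            ultimately have "tame X T \<sigma> u \<le> t5 * ?p" unfolding yd(1) t5_def by (simp add: mult.assoc mult.left_commute)
            also have "\<dots> \<le> max t3 (max t4 t5) * ?p" by (intro mult_right_mono) auto
            finally show ?thesis .
          qed
        qed
      qed
      then have "tame X T \<sigma> u + F u \<le> (t2 + max t3 (max t4 t5)) * ?p" using fb by (simp add: distrib_right)
      also have "\<dots> \<le> q1 * ?p" using q1 by (intro mult_right_mono) auto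
      also have "\<dots> \<le> (\<Sum>z\<in>Z. q1 * y z u powr (- \<theta>))" using z q1 by (intro member) auto
      finally have A: "tame X T \<sigma> u + F u \<le> (\<Sum>z\<in>Z. q1 * y z u powr (- \<theta>))" .
      \<comment> \<open>The linear term may be negative near a root; the extra \<open>F u\<close> in
        the estimate \<open>A\<close> compensates for it.\<close>
      have "\<sigma> * F u \<le> 1 * F u" using \<sigma> GF by (intro mult_right_mono) auto
      moreover have "0 \<le> \<sigma> * G u" using \<sigma> GF by simp
      ultimately have "- F u \<le> G u + \<sigma> * (G u - F u)" using GF[of u] by (simp add: right_diff_distrib)
      then show ?thesis using A by linarith
    qed
    have q1_le: "q1 \<le> C' * X powr (2 + \<theta> / 3)"
    proof -
      have X2: "X\<^sup>2 = X powr 2" "X ^ 6 = X powr 6" using X by auto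
      have m: "X powr (2 + \<theta>) \<le> X powr (2 + \<theta> / 3)" using X XX \<theta> by (intro powr_mono') auto
      have e1: "t1 \<le> Cs * X powr (2 + \<theta> / 3)" unfolding t1_def using Cs m by (intro mult_left_mono) auto
      have "t2 = Cs * c7 * X powr (2 + \<theta>)" unfolding t2_def X7 X2 by (simp add: powr_add)
      then have e2: "t2 \<le> Cs * c7 * X powr (2 + \<theta> / 3)" using Cs c7 m by (auto intro!: mult_left_mono)
      have "t5 = Cs * Cs * c7 * X powr (2 + \<theta>)" unfolding t5_def X7 X2 by (simp add: powr_add)
      then have e5: "t5 \<le> Cs * Cs * c7 * X powr (2 + \<theta> / 3)" using Cs c7 m by (auto intro!: mult_left_mono)
      have "t3 = Cs * c7 * (X powr 6 * X powr (- (4 + 2 * \<theta> / 3)) * X powr \<theta>)" unfolding t3_def X7 X2 Ts by simp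
      then have e3: "t3 = Cs * c7 * X powr (2 + \<theta> / 3)" by (simp add: powr_add[symmetric] add.commute)
      have "t4 = Cs * (X powr 2 * X powr (- (4 + 2 * \<theta> / 3)) * X powr (\<theta> + 4))" unfolding t4_def s1t X2 Ts by simp
      then have e4: "t4 = Cs * X powr (2 + \<theta> / 3)" by (simp add: powr_add[symmetric] add.commute)
      have "q1 \<le> (2 * Cs + 2 * (Cs * c7) + Cs * Cs * c7) * X powr (2 + \<theta> / 3)"
        unfolding q1_def distrib_right using e1 e2 e3 e4 e5 by linarith
      also have "\<dots> \<le> C' * X powr (2 + \<theta> / 3)"
        unfolding C'_def using Cs c7 by (intro mult_right_mono) (auto simp: mult_nonneg_nonneg)
      finally show ?thesis .
    qed
    let ?u = "\<lambda>k. (x + real k) / real K ^ Suc g"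
    have "(\<Sum>k<K ^ Suc g. wgt g x k * tame X T \<sigma> (?u k))
        \<le> (\<Sum>k<K ^ Suc g. wgt g x k * (G (?u k) + \<sigma> * (G (?u k) - F (?u k)) + (\<Sum>z\<in>Z. q1 * y z (?u k) powr (- \<theta>))))"
      by (intro sum_mono mult_left_mono tame_bd wgt_nonneg)
    also have "\<dots> = (\<Sum>k<K ^ Suc g. wgt g x k * G (?u k)) + \<sigma> * ((\<Sum>k<K ^ Suc g. wgt g x k * G (?u k)) - (\<Sum>k<K ^ Suc g. wgt g x k * F (?u k)))
        + (\<Sum>k<K ^ Suc g. wgt g x k * (\<Sum>z\<in>Z. q1 * y z (?u k) powr (- \<theta>)))"
      by (simp only: distrib_left right_diff_distrib sum.distrib sum_subtractf sum_distrib_left mult.left_commute)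
    also have "\<dots> \<le> 1 + q1 * (card Z * CL)"
      using avg[OF q1(1)] unfolding G_def F_def sum_wgt_sqmod sum_wgt_smear by simp
    also have "q1 * (card Z * CL) \<le> C' * X powr (2 + \<theta> / 3) * (card Z * CL)" using CL by (intro mult_right_mono q1_le) auto
    also have "\<dots> = (real (card Z) * C' * CL) * X powr (2 + \<theta> / 3)" by simp
    also have "\<dots> \<le> C * X powr (2 + \<theta> / 3)" by (intro mult_right_mono C) simp
    finally have "(\<Sum>k<K ^ Suc g. wgt g x k * tame X T \<sigma> (?u k)) \<le> 1 + C * X powr (2 + \<theta> / 3)" by simp
    then show ?thesis using second unfolding T_def \<theta>_def \<sigma>_def by simp
  qed
  then show ?thesis using C(1) X0 by blast
qed

end

section \<open>Folding integrals onto the unit interval, and tails of the products\<close>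

lemma nn_integral_Icc_continuous:
  fixes f :: "real \<Rightarrow> real"
  assumes f: "continuous_on {a..b} f" and nn: "\<And>x. x \<in> {a..b} \<Longrightarrow> 0 \<le> f x"
  shows "(\<integral>\<^sup>+x. ennreal (f x) * indicator {a..b} x \<partial>lborel) = ennreal (integral {a..b} f)"
proof -
  have i: "set_integrable lborel {a..b} f" by (rule borel_integrable_atLeastAtMost'[OF f])
  have "(\<integral>\<^sup>+x. ennreal (f x) * indicator {a..b} x \<partial>lborel) = (\<integral>\<^sup>+x. ennreal (indicator {a..b} x *\<^sub>R f x) \<partial>lborel)"
    by (intro nn_integral_cong) (auto split: split_indicator)
  also have "\<dots> = ennreal (LINT x:{a..b}|lborel. f x)"
    unfolding set_lebesgue_integral_def
    by (rule nn_integral_eq_integral) (use i nn in \<open>auto simp: set_integrable_def split: split_indicator\<close>)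
  also have "\<dots> = ennreal (integral {a..b} f)" using set_borel_integral_eq_integral(2)[OF i] by simp
  finally show ?thesis .
qed

lemma nn_integral_Ioc_eq_Icc:
  fixes F :: "real \<Rightarrow> ennreal"
  shows "(\<integral>\<^sup>+x. F x * indicator {a<..b} x \<partial>lborel) = (\<integral>\<^sup>+x. F x * indicator {a..b} x \<partial>lborel)"
proof (rule nn_integral_cong_AE)
  show "AE x in lborel. F x * indicator {a<..b} x = F x * indicator {a..b} x"
    using AE_lborel_singleton[of a] by eventually_elim (auto split: split_indicator)
qed

lemma nn_integral_Ico_eq_Icc:
  fixes F :: "real \<Rightarrow> ennreal"
  shows "(\<integral>\<^sup>+x. F x * indicator {a..<b} x \<partial>lborel) = (\<integral>\<^sup>+x. F x * indicator {a..b} x \<partial>lborel)"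
proof (rule nn_integral_cong_AE)
  show "AE x in lborel. F x * indicator {a..<b} x = F x * indicator {a..b} x"
    using AE_lborel_singleton[of b] by eventually_elim (auto split: split_indicator)
qed

lemma nn_integral_fold:
  fixes F :: "real \<Rightarrow> ennreal"
  assumes [measurable]: "F \<in> borel_measurable borel"
  shows "(\<integral>\<^sup>+u. F u * indicator {0..<real N} u \<partial>lborel)
    = (\<Sum>k<N. \<integral>\<^sup>+x. F (x + real k) * indicator {0..<1} x \<partial>lborel)"
proof (induction N)
  case (Suc N)
  have "(\<integral>\<^sup>+u. F u * indicator {0..<real (Suc N)} u \<partial>lborel)
      = (\<integral>\<^sup>+u. (F u * indicator {0..<real N} u + F u * indicator {real N..<real N + 1} u) \<partial>lborel)"
    by (intro nn_integral_cong) (auto split: split_indicator)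
  also have "\<dots> = (\<integral>\<^sup>+u. F u * indicator {0..<real N} u \<partial>lborel) + (\<integral>\<^sup>+u. F u * indicator {real N..<real N + 1} u \<partial>lborel)"
    by (rule nn_integral_add) auto
  also have "(\<integral>\<^sup>+u. F u * indicator {real N..<real N + 1} u \<partial>lborel)
      = (\<integral>\<^sup>+x. F (real N + 1 * x) * indicator {real N..<real N + 1} (real N + 1 * x) \<partial>lborel)"
    by (subst nn_integral_real_affine[where c = 1 and t = "real N"]) auto
  also have "\<dots> = (\<integral>\<^sup>+x. F (x + real N) * indicator {0..<1} x \<partial>lborel)"
    by (intro nn_integral_cong) (auto split: split_indicator simp: add.commute)
  finally show ?case using Suc by simp
qed simp

lemma nn_integral_scale:
  fixes F :: "real \<Rightarrow> ennreal"
  assumes [measurable]: "F \<in> borel_measurable borel" and c: "c > 0"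
  shows "(\<integral>\<^sup>+u. F u * indicator {c * a<..c * b} u \<partial>lborel) = ennreal c * (\<integral>\<^sup>+x. F (c * x) * indicator {a<..b} x \<partial>lborel)"
proof -
  have "(\<integral>\<^sup>+u. F u * indicator {c * a<..c * b} u \<partial>lborel)
     = ennreal \<bar>c\<bar> * (\<integral>\<^sup>+x. F (0 + c * x) * indicator {c * a<..c * b} (0 + c * x) \<partial>lborel)"
    by (rule nn_integral_real_affine) (use c in auto)
  also have "(\<integral>\<^sup>+x. F (0 + c * x) * indicator {c * a<..c * b} (0 + c * x) \<partial>lborel) = (\<integral>\<^sup>+x. F (c * x) * indicator {a<..b} x \<partial>lborel)"
    using c by (intro nn_integral_cong) (auto split: split_indicator)
  finally show ?thesis using c by simp
qed

text \<open>The factor \<open>q\<close> has period 1, so it stays outside the sum over the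
  \<open>K ^ n\<close> translates, which is \<open>bsum\<close>.\<close>

lemma nn_integral_bsum:
  assumes K: "K > 0" and q [measurable]: "q \<in> borel_measurable borel" and f [measurable]: "\<And>l. f l \<in> borel_measurable borel"
    and qp: "\<And>u (j::int). q (u + of_int j) = q u" and qn: "\<And>u. 0 \<le> q u" and fn: "\<And>l u. 0 \<le> f l u"
  shows "(\<integral>\<^sup>+u. ennreal (q u * (\<Prod>l\<in>{1..n}. f l (u / real K ^ l))) * indicator {0..<real (K ^ n)} u \<partial>lborel)
     = (\<integral>\<^sup>+x. ennreal (q x * bsum K n f x) * indicator {0..<1} x \<partial>lborel)"
proof -
  have p: "q (x + real k) = q x" for x k using qp[of x "int k"] by simp
  have "(\<integral>\<^sup>+u. ennreal (q u * (\<Prod>l\<in>{1..n}. f l (u / real K ^ l))) * indicator {0..<real (K ^ n)} u \<partial>lborel)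
    = (\<Sum>k<K ^ n. \<integral>\<^sup>+x. ennreal (q (x + real k) * (\<Prod>l\<in>{1..n}. f l ((x + real k) / real K ^ l))) * indicator {0..<1} x \<partial>lborel)"
    by (rule nn_integral_fold) simp
  also have "\<dots> = (\<integral>\<^sup>+x. (\<Sum>k<K ^ n. ennreal (q (x + real k) * (\<Prod>l\<in>{1..n}. f l ((x + real k) / real K ^ l))) * indicator {0..<1} x) \<partial>lborel)"
    by (rule nn_integral_sum[symmetric]) simp
  also have "\<dots> = (\<integral>\<^sup>+x. ennreal (q x * bsum K n f x) * indicator {0..<1} x \<partial>lborel)"
    unfolding bsum_def sum_distrib_left p sum_distrib_right[symmetric]
    by (subst sum_ennreal) (auto intro!: mult_nonneg_nonneg qn prod_nonneg fn)
  finally show ?thesis .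
qed

lemma nn_integral_bsum_le:
  assumes K: "K > 0" and q [measurable]: "q \<in> borel_measurable borel" and f [measurable]: "\<And>l. f l \<in> borel_measurable borel"
    and qp: "\<And>u (j::int). q (u + of_int j) = q u" and qn: "\<And>u. 0 \<le> q u" and fn: "\<And>l u. 0 \<le> f l u"
    and le: "\<And>x. bsum K n f x \<le> c" and c: "0 \<le> c" and q1: "(q has_integral r) {0..1}" "continuous_on {0..1} q"
  shows "(\<integral>\<^sup>+u. ennreal (q u * (\<Prod>l\<in>{1..n}. f l (u / real K ^ l))) * indicator {0..<real (K ^ n)} u \<partial>lborel)
     \<le> ennreal (c * r)"
proof -
  have "(\<integral>\<^sup>+x. ennreal (q x * bsum K n f x) * indicator {0..<1} x \<partial>lborel) \<le> (\<integral>\<^sup>+x. ennreal c * (ennreal (q x) * indicator {0..<1} x) \<partial>lborel)"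
  proof (rule nn_integral_mono)
    fix x
    have "q x * bsum K n f x \<le> c * q x" using mult_left_mono[OF le qn] by (simp add: mult.commute)
    then show "ennreal (q x * bsum K n f x) * indicator {0..<1} x \<le> ennreal c * (ennreal (q x) * indicator {0..<1} x)"
      by (auto split: split_indicator simp: ennreal_mult[symmetric] c qn intro!: ennreal_leI)
  qed
  also have "\<dots> = ennreal c * (\<integral>\<^sup>+x. ennreal (q x) * indicator {0..<1} x \<partial>lborel)"
    by (rule nn_integral_cmult) simp
  also have "(\<integral>\<^sup>+x. ennreal (q x) * indicator {0..<1} x \<partial>lborel) = ennreal r"
    unfolding nn_integral_Ico_eq_Icc using nn_integral_Icc_continuous[OF q1(2) qn] integral_unique[OF q1(1)] by simp
  finally show ?thesis unfolding nn_integral_bsum[OF assms(1-6)] using c by (simp add: ennreal_mult'[symmetric])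
qed

text \<open>Weierstrass's product inequality.\<close>

lemma one_minus_sum_le_prod:
  fixes x :: "'a \<Rightarrow> real"
  assumes "finite I" "\<And>i. i \<in> I \<Longrightarrow> 0 \<le> x i" "\<And>i. i \<in> I \<Longrightarrow> x i \<le> 1"
  shows "1 - (\<Sum>i\<in>I. 1 - x i) \<le> (\<Prod>i\<in>I. x i)"
  using assms
proof (induction I)
  case (insert i I)
  let ?P = "\<Prod>i\<in>I. x i"
  have P: "0 \<le> ?P" "?P \<le> 1" using insert.prems by (auto intro!: prod_nonneg prod_le_1)
  have IH: "1 - (\<Sum>i\<in>I. 1 - x i) \<le> ?P" using insert by auto
  have "(1 - x i) * ?P \<le> (1 - x i) * 1" using P insert.prems by (intro mult_left_mono) auto
  then have "?P - (1 - x i) \<le> x i * ?P" by (simp add: algebra_simps)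
  then show ?case using IH insert.hyps by simp
qed simp

lemma sqmod_ge:
  assumes S: "S \<subseteq> {0..<K}" "card S > 0"
  shows "1 - sqmod S u \<le> 20 * (real K * u)\<^sup>2"
proof -
  have fin: "finite S" using S card_ge_0_finite by blast
  have c: "1 - cos x \<le> x\<^sup>2 / 2" for x :: real
  proof -
    have "1 - cos x = 2 * (sin (x / 2))\<^sup>2" using cos_double_sin[of "x / 2"] by simp
    also have "(sin (x / 2))\<^sup>2 \<le> (x / 2)\<^sup>2" using abs_sin_x_le_abs_x[of "x / 2"] by (simp only: abs_le_square_iff)
    finally show ?thesis by (simp add: power_divide)
  qed
  have pi10: "pi\<^sup>2 \<le> 10"
  proof -
    have "pi * pi \<le> 3.15 * 3.15" using pi_approx pi_gt_zero by (intro mult_mono) auto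
    then show ?thesis by (simp add: power2_eq_square)
  qed
  have ge: "1 - 20 * (real K * u)\<^sup>2 \<le> cos (2 * pi * (real b - real b') * u)" if "b \<in> S" "b' \<in> S" for b b'
  proof -
    have "b < K" "b' < K" using that S by auto
    then have "\<bar>real b - real b'\<bar> \<le> real K" by auto
    then have "\<bar>(real b - real b') * u\<bar> \<le> \<bar>real K * u\<bar>" by (simp add: abs_mult mult_right_mono)
    then have "((real b - real b') * u)\<^sup>2 \<le> (real K * u)\<^sup>2" by (simp add: abs_le_square_iff)
    then have "pi\<^sup>2 * ((real b - real b') * u)\<^sup>2 \<le> 10 * (real K * u)\<^sup>2" using pi10 by (intro mult_mono) auto
    moreover have "(2 * pi * (real b - real b') * u)\<^sup>2 / 2 = 2 * (pi\<^sup>2 * ((real b - real b') * u)\<^sup>2)"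
      by (simp add: power_mult_distrib)
    ultimately show ?thesis using c[of "2 * pi * (real b - real b') * u"] by linarith
  qed
  let ?n = "real (card S)"
  have n: "?n > 0" using S by simp
  have "?n * ?n * (1 - 20 * (real K * u)\<^sup>2) = (\<Sum>b\<in>S. \<Sum>b'\<in>S. 1 - 20 * (real K * u)\<^sup>2)" by (simp add: mult.assoc)
  also have "\<dots> \<le> (\<Sum>b\<in>S. \<Sum>b'\<in>S. cos (2 * pi * (real b - real b') * u))" by (intro sum_mono ge)
  also have "\<dots> = ?n * ?n * sqmod S u"
    using n by (simp add: sqmod_def trig_sum_def power2_eq_square sum_divide_distrib[symmetric])
  finally have "1 - 20 * (real K * u)\<^sup>2 \<le> sqmod S u" using n by (simp add: mult_le_cancel_left_pos)
  then show ?thesis by simp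
qed

text \<open>Beyond scale \<open>n + 2\<close> the deviations of the factors from 1 are dominated by
  a geometric series of ratio \<open>1 / K ^ 2\<close>. Its first term is \<open>20 / K ^ 4\<close>,
  and \<open>K >= 4\<close> puts the total below 1 / 4; this is why two additional scales are
  kept.\<close>

lemma sqmod_tail:
  assumes S: "S \<subseteq> {0..<K}" "card S > 0" and K: "K \<ge> 4" and u: "\<bar>u\<bar> \<le> real K ^ n" and I: "finite I" "I \<subseteq> {n + 3..}"
  shows "3 / 4 \<le> (\<Prod>l\<in>I. sqmod S (u / real K ^ l))"
proof -
  obtain r where r: "I \<subseteq> {n + 3..<n + 3 + r}"
  proof -
    obtain m where "\<forall>i\<in>I. i < m" using I(1) finite_nat_bounded[of I] by (auto simp: subset_iff)
    then have "I \<subseteq> {n + 3..<n + 3 + m}" using I(2) by force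
    then show ?thesis by (rule that)
  qed
  have K0: "real K > 0" "real K \<ge> 4" using K by auto
  define \<rho> where "\<rho> = 1 / (real K)\<^sup>2"
  have "4\<^sup>2 \<le> (real K)\<^sup>2" using K0 by (intro power_mono) auto
  then have K16: "16 \<le> (real K)\<^sup>2" by simp
  have \<rho>: "0 < \<rho>" "\<rho> \<le> 1 / 16" using K16 K0 by (auto simp: \<rho>_def field_simps)
  have tm: "1 - sqmod S (u / real K ^ l) \<le> 20 * \<rho>\<^sup>2 * \<rho> ^ (l - (n + 3))" if "l \<in> I" for l
  proof -
    have l: "l = n + 3 + (l - (n + 3))" using that I(2) by auto
    define j where "j = l - (n + 3)"
    have "\<bar>real K * (u / real K ^ l)\<bar> \<le> real K * (real K ^ n / real K ^ l)"
      using u K0 by (simp add: abs_mult abs_divide divide_right_mono)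
    also have "\<dots> = 1 / (real K)\<^sup>2 * (1 / real K) ^ j"
      using K0 by (subst l) (simp add: j_def[symmetric] power_add power2_eq_square power3_eq_cube power_divide)
    finally have a: "\<bar>real K * (u / real K ^ l)\<bar> \<le> \<rho> * (1 / real K) ^ j" by (simp only: \<rho>_def)
    have "(real K * (u / real K ^ l))\<^sup>2 = \<bar>real K * (u / real K ^ l)\<bar>\<^sup>2" by (simp only: power2_abs)
    also have "\<dots> \<le> (\<rho> * (1 / real K) ^ j)\<^sup>2" by (intro power_mono a) simp
    also have "\<dots> = \<rho>\<^sup>2 * \<rho> ^ j" 
      by (simp add: power_mult_distrib \<rho>_def power_divide flip: power_mult) (simp add: mult.commute)
    finally show ?thesis using sqmod_ge[OF S, of "u / real K ^ l"] by (simp add: j_def)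
  qed
  have "(\<Sum>l\<in>I. 1 - sqmod S (u / real K ^ l)) \<le> (\<Sum>l\<in>I. 20 * \<rho>\<^sup>2 * \<rho> ^ (l - (n + 3)))" by (intro sum_mono tm)
  also have "\<dots> \<le> (\<Sum>l\<in>{n + 3..<n + 3 + r}. 20 * \<rho>\<^sup>2 * \<rho> ^ (l - (n + 3)))" using r \<rho> by (intro sum_mono2) auto
  also have "\<dots> = 20 * \<rho>\<^sup>2 * (\<Sum>j<r. \<rho> ^ j)"
  proof -
    have "(\<Sum>l\<in>{0 + (n + 3)..<r + (n + 3)}. \<rho> ^ (l - (n + 3))) = (\<Sum>j\<in>{0..<r}. \<rho> ^ (j + (n + 3) - (n + 3)))"
      by (rule sum.shift_bounds_nat_ivl)
    then show ?thesis by (simp add: sum_distrib_left[symmetric] add.commute atLeast0LessThan)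
  qed
  also have "(\<Sum>j<r. \<rho> ^ j) = (1 - \<rho> ^ r) / (1 - \<rho>)" using \<rho> by (simp add: sum_gp_strict)
  also have "\<dots> \<le> 1 / (1 / 2)" using \<rho> by (intro frac_le) auto
  finally have "(\<Sum>l\<in>I. 1 - sqmod S (u / real K ^ l)) \<le> 20 * \<rho>\<^sup>2 * 2" using \<rho> by (simp add: mult_left_mono)
  also have "\<rho>\<^sup>2 \<le> (1 / 16)\<^sup>2" using \<rho> by (intro power_mono) auto
  then have "20 * \<rho>\<^sup>2 * 2 \<le> 1 / 4" by (simp add: power2_eq_square)
  finally have "3 / 4 \<le> 1 - (\<Sum>l\<in>I. 1 - sqmod S (u / real K ^ l))" by simp
  also have "\<dots> \<le> (\<Prod>l\<in>I. sqmod S (u / real K ^ l))"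
    by (rule one_minus_sum_le_prod) (auto simp: I sqmod_nonneg sqmod_le_1)
  finally show ?thesis .
qed

lemma smear_trig: "smear S X = trig_sum S (\<lambda>b b'. cos (2 * pi * (real b - real b') * X) / (real (card S))\<^sup>2)"
proof
  fix u
  have c: "cos (d * (u + X)) + cos (d * (u - X)) = 2 * (cos (d * X) * cos (d * u))" for d :: real
    by (simp add: distrib_left right_diff_distrib cos_add cos_diff)
  have "smear S X u = (\<Sum>b\<in>S. \<Sum>b'\<in>S. (cos (2 * pi * (real b - real b') * (u + X)) + cos (2 * pi * (real b - real b') * (u - X))) / 2 / (real (card S))\<^sup>2)"
    by (simp add: smear_def sqmod_def trig_sum_def sum.distrib[symmetric] add_divide_distrib sum_divide_distrib mult.commute)
  then show "smear S X u = trig_sum S (\<lambda>b b'. cos (2 * pi * (real b - real b') * X) / (real (card S))\<^sup>2) u"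
    unfolding c by (simp add: trig_sum_def)
qed

text \<open>The condition on \<open>X\<close> keeps all phases within a quarter period. This is what
  makes smearing preserve positive definiteness.\<close>

lemma smear_weight_nonneg:
  assumes "S \<subseteq> {0..<K}" "b \<in> S" "b' \<in> S" "0 \<le> X" "real K * X \<le> 1 / 4"
  shows "0 \<le> cos (2 * pi * (real b - real b') * X) / (real (card S))\<^sup>2"
proof -
  have "b < K" "b' < K" using assms(1-3) by auto
  then have "\<bar>real b - real b'\<bar> \<le> real K" by auto
  then have "\<bar>real b - real b'\<bar> * X \<le> 1 / 4" using assms by (meson mult_right_mono order_trans)
  then have "2 * pi * (\<bar>real b - real b'\<bar> * X) \<le> 2 * pi * (1 / 4)" by (intro mult_left_mono) auto
  then have "\<bar>2 * pi * (real b - real b') * X\<bar> \<le> pi / 2" using assms by (simp add: abs_mult)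
  then have "0 \<le> cos (2 * pi * (real b - real b') * X)" by (intro cos_ge_zero) linarith+
  then show ?thesis by simp
qed

text \<open>A cosine sum with nonnegative weights is largest at 0, where the smeared sum equals
  \<open>sqmod S X\<close>. The bound is uniform in \<open>u\<close> and is the source of the
  damping.\<close>

lemma smear_le_sqmod:
  assumes "S \<subseteq> {0..<K}" "0 \<le> X" "real K * X \<le> 1 / 4"
  shows "smear S X u \<le> sqmod S X"
proof -
  have "smear S X u \<le> (\<Sum>b\<in>S. \<Sum>b'\<in>S. cos (2 * pi * (real b - real b') * X) / (real (card S))\<^sup>2 * 1)"
    unfolding smear_trig trig_sum_def
    by (intro sum_mono mult_left_mono smear_weight_nonneg[OF assms(1) _ _ assms(2,3)]) auto
  then show ?thesis by (simp add: sqmod_def trig_sum_def)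
qed

lemma borel_measurable_sqmod [measurable]: "sqmod S \<in> borel_measurable borel"
  by (intro borel_measurable_continuous_onI continuous_intros)

lemma continuous_smear [continuous_intros]:
  fixes f :: "real \<Rightarrow> real"
  shows "continuous_on A f \<Longrightarrow> continuous_on A (\<lambda>x. smear S X (f x))"
  unfolding smear_def by (intro continuous_intros) auto

lemma borel_measurable_smear [measurable]: "smear S X \<in> borel_measurable borel"
  by (intro borel_measurable_continuous_onI continuous_intros)

section \<open>The smeared product\<close>

text \<open>Among the scales \<open>1, \<dots>, m + 2\<close> the multiples of \<open>G\<close> up to \<open>m = n1 * G\<close> are smeared. The two
  additional scales make the product over the remaining ones comparable to \<open>1\<close> on \<open>[0, K ^ m]\<close>.\<close>

locale smeared = digit_pair +
  fixes X T \<sigma> \<epsilon> \<omega> :: real and g n1 :: nat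
  assumes X: "0 < X" "real K * X \<le> 1 / 4" and T: "2 \<le> T" and \<sigma>: "0 < \<sigma>" "\<sigma> \<le> 1"
    and tame_block: "\<And>x. (\<Sum>k<K ^ Suc g. wgt g x k * tame X T \<sigma> ((x + real k) / real K ^ Suc g)) \<le> 1 + \<epsilon>"
    and wild_block: "\<And>x. (\<Sum>k<K ^ Suc g. wgt g x k * wild X T ((x + real k) / real K ^ Suc g)) \<le> \<omega>"
    and eps: "0 \<le> \<epsilon>" "0 \<le> \<omega>"
begin

definition "G = Suc g"
definition "m = n1 * G"

text \<open>A common template for the smeared product and its tame and wild variants, so that the
  single block estimate \<open>bsum_fam_le\<close> serves all three.\<close>

definition fam :: "(nat \<Rightarrow> real \<Rightarrow> real) \<Rightarrow> nat \<Rightarrow> real \<Rightarrow> real" where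
  "fam h l = (if G dvd l \<and> 1 \<le> l \<and> l \<le> m then h l else sqmod B)"

definition famS :: "nat \<Rightarrow> real \<Rightarrow> real" where "famS = fam (\<lambda>_. smear B X)"
definition famT :: "nat \<Rightarrow> real \<Rightarrow> real" where "famT = fam (\<lambda>_. tame X T \<sigma>)"
definition famW :: "nat \<Rightarrow> nat \<Rightarrow> real \<Rightarrow> real" where
  "famW j = fam (\<lambda>l. if l = j * G then wild X T else smear B X)"

definition prodB :: "(nat \<Rightarrow> real \<Rightarrow> real) \<Rightarrow> real \<Rightarrow> real" where
  "prodB f u = (\<Prod>l\<in>{1..m + 2}. f l (u / real K ^ l))"

definition prodA :: "real \<Rightarrow> real" where
  "prodA u = (\<Prod>l\<in>{1..m + 2}. sqmod A (u / real K ^ l))"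

lemma smear_le_1: "smear B X u \<le> 1"
  using smear_le_sqmod[OF B_sub, of X u] X sqmod_le_1[of B X] by simp

lemma wild_le_smear: "wild X T u \<le> smear B X u"
  by (simp add: wild_def smear_nonneg)

lemma fam_nonneg: "0 \<le> famS l u" "0 \<le> famT l u" "0 \<le> famW j l u"
  by (simp_all add: famS_def famT_def famW_def fam_def smear_nonneg sqmod_nonneg tame_nonneg wild_nonneg)

lemma fam_le_1: "famS l u \<le> 1" "famW j l u \<le> 1"
  using smear_le_1[of u] wild_le_smear[of u] sqmod_le_1[of B u]
  by (auto simp: famS_def famW_def fam_def)

lemma tame_add_int: "tame X T \<sigma> (u + of_int j) = tame X T \<sigma> u"
  and wild_add_int: "wild X T (u + of_int j) = wild X T u"
  by (simp_all add: tame_def wild_def smear_add_int sqmod_add_int)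

lemma measurable_tame [measurable]: "tame X T \<sigma> \<in> borel_measurable borel"
  unfolding tame_def by measurable

lemma measurable_wild [measurable]: "wild X T \<in> borel_measurable borel"
  unfolding wild_def by measurable

lemma measurable_fam [measurable]: "famS l \<in> borel_measurable borel" "famT l \<in> borel_measurable borel"
  "famW j l \<in> borel_measurable borel"
  unfolding famS_def famT_def famW_def fam_def by (auto intro: measurable_tame measurable_wild borel_measurable_smear borel_measurable_sqmod)

text \<open>Either some smeared factor exceeds \<open>T\<close> times the original one, or all quotients are at most
  \<open>T\<close>, in which case their product is at most \<open>T\<close> unless Chebyshev's inequality with exponent
  \<open>\<sigma>\<close> gains the factor \<open>T powr - \<sigma>\<close>.\<close>

lemma prodB_smear_le:
  "prodB famS u \<le> T * prodB (\<lambda>_. sqmod B) u + T powr (- \<sigma>) * prodB famT u + (\<Sum>j\<in>{1..n1}. prodB (famW j) u)"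
proof -
  have nn: "0 \<le> prodB (\<lambda>_. sqmod B) u" "0 \<le> prodB famT u" "0 \<le> prodB famS u" "\<And>j. 0 \<le> prodB (famW j) u"
    unfolding prodB_def by (rule prod_nonneg, rule fam_nonneg sqmod_nonneg)+
  then have nn2: "0 \<le> T * prodB (\<lambda>_. sqmod B) u" "0 \<le> T powr (- \<sigma>) * prodB famT u" "0 \<le> (\<Sum>j\<in>{1..n1}. prodB (famW j) u)"
    using T by (auto intro!: sum_nonneg)
  let ?u = "\<lambda>l. u / real K ^ l"
  let ?S = "\<lambda>l. G dvd l \<and> 1 \<le> l \<and> l \<le> m"
  let ?I = "{1..m + 2}"
  show ?thesis
  proof (cases "\<exists>j\<in>{1..n1}. \<not> smear B X (?u (j * G)) \<le> T * sqmod B (?u (j * G))")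
    case True
    then obtain j where j: "j \<in> {1..n1}" "\<not> smear B X (?u (j * G)) \<le> T * sqmod B (?u (j * G))" by blast
    have "prodB famS u = prodB (famW j) u"
      unfolding prodB_def by (intro prod.cong refl) (use j in \<open>auto simp: famS_def famW_def fam_def wild_def\<close>)
    also have "\<dots> \<le> (\<Sum>j\<in>{1..n1}. prodB (famW j) u)" using j nn by (intro member_le_sum) auto
    finally show ?thesis using nn2 by linarith
  next
    case False
    have tm: "smear B X (?u l) \<le> T * sqmod B (?u l)" if sl: "?S l" for l
    proof -
      obtain j where j: "l = j * G" using sl by (auto simp: dvd_def mult.commute)
      have "G > 0" by (simp add: G_def)
      then have "j \<in> {1..n1}" using sl j by (auto simp: m_def Suc_le_eq)
      then show ?thesis using False j by auto
    qed
    define r where "r l = (if ?S l then smear B X (?u l) / sqmod B (?u l) else 1)" for l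
    have r: "0 \<le> r l" for l by (simp add: r_def smear_nonneg sqmod_nonneg)
    show ?thesis
    proof (cases "\<exists>l. ?S l \<and> sqmod B (?u l) = 0")
      \<comment> \<open>If the original factor vanishes on a smeared scale, \<open>tm\<close> makes
        the smeared factor vanish as well. Afterwards the quotients \<open>r l\<close> can be formed
        without division by 0.\<close>
      case True
      then obtain l where l: "?S l" "sqmod B (?u l) = 0" by blast
      then have "smear B X (?u l) = 0" using tm[OF l(1)] smear_nonneg[of B X "?u l"] by simp
      then have "famS l (?u l) = 0" using l by (simp add: famS_def fam_def)
      then have "prodB famS u = 0" unfolding prodB_def using l by (intro prod_zero) auto
      then show ?thesis using nn2 by linarith
    next
      case nz: False
      have S: "famS l (?u l) = r l * sqmod B (?u l)" for l
        using nz by (auto simp: famS_def fam_def r_def)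
      have TT: "famT l (?u l) = famS l (?u l) * r l powr \<sigma>" for l
        using tm by (auto simp: famS_def famT_def fam_def r_def tame_def)
      let ?P = "\<Prod>l\<in>?I. r l"
      have P1: "prodB famS u = ?P * prodB (\<lambda>_. sqmod B) u" unfolding prodB_def S prod.distrib ..
      have P2: "prodB famT u = prodB famS u * ?P powr \<sigma>" unfolding prodB_def TT prod.distrib prod_powr_distrib ..
      show ?thesis
      proof (cases "?P \<le> T")
        case True
        then have "prodB famS u \<le> T * prodB (\<lambda>_. sqmod B) u" unfolding P1 using nn by (intro mult_right_mono) auto
        then show ?thesis using nn2 by linarith
      next
        case False
        have "T powr \<sigma> \<le> ?P powr \<sigma>" using False T \<sigma> by (intro powr_mono2) auto
        then have "prodB famS u * T powr \<sigma> \<le> prodB famT u" unfolding P2 using nn by (intro mult_left_mono) auto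
        then have "T powr (- \<sigma>) * (prodB famS u * T powr \<sigma>) \<le> T powr (- \<sigma>) * prodB famT u" by (intro mult_left_mono) auto
        moreover have "T powr (- \<sigma>) * (prodB famS u * T powr \<sigma>) = prodB famS u"
          using T by (simp add: powr_minus)
        ultimately show ?thesis using nn2 by linarith
      qed
    qed
  qed
qed

lemma bsum_cong: "(\<And>l. 1 \<le> l \<Longrightarrow> l \<le> n \<Longrightarrow> f l = f' l) \<Longrightarrow> bsum K n f x = bsum K n f' x"
  unfolding bsum_def by (intro sum.cong prod.cong refl) auto

text \<open>The scales split into blocks of length \<open>G\<close> whose last scale is the smeared
  one. Complete blocks contribute their averages, and \<open>min n1 (I div G)\<close> counts those
  among the first \<open>I\<close> scales.\<close>

lemma bsum_fam_le:
  assumes per: "\<And>l u (j::int). h l (u + of_int j) = h l u" and nn: "\<And>l u. 0 \<le> h l u" and c: "\<And>j. 0 \<le> c j"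
    and block: "\<And>j x. 1 \<le> j \<Longrightarrow> j \<le> n1 \<Longrightarrow> (\<Sum>k<K ^ Suc g. wgt g x k * h (j * G) ((x + real k) / real K ^ Suc g)) \<le> c j"
  shows "bsum K I (fam h) x \<le> (real K / card B) ^ I * (\<Prod>j\<in>{1..min n1 (I div G)}. c j)"
proof -
  have K0: "K > 0" using K4 by simp
  have G0: "G > 0" by (simp add: G_def)
  have fper: "fam h l (u + of_int j) = fam h l u" for l u and j :: int by (simp add: fam_def per sqmod_add_int)
  have fnn: "0 \<le> fam h l u" for l u by (simp add: fam_def nn sqmod_nonneg)
  have blocks: "q \<le> n1 \<Longrightarrow> bsum K (q * G) (fam h) x \<le> (real K / card B) ^ (q * G) * (\<Prod>j\<in>{1..q}. c j)" for q
  proof (induction q)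
    case 0
    then show ?case by (simp add: bsum_def)
  next
    case (Suc q)
    have inner: "bsum K G (\<lambda>l. fam h (q * G + l)) y \<le> (real K / card B) ^ G * c (Suc q)" for y
    proof -
      have "bsum K G (\<lambda>l. fam h (q * G + l)) y = bsum K (Suc g) (\<lambda>l. if l = Suc g then h (Suc q * G) else sqmod B) y"
        unfolding G_def[symmetric]
      proof (rule bsum_cong)
        fix l assume l: "1 \<le> l" "l \<le> G"
        have "Suc q * G \<le> n1 * G" using Suc.prems by (intro mult_right_mono) auto
        then show "fam h (q * G + l) = (if l = G then h (Suc q * G) else sqmod B)"
          using l G0 by (auto simp: fam_def m_def add.commute dvd_imp_le intro: dvd_imp_le dest!: dvd_imp_le)
      qed
      moreover have "(real (card B) / K) ^ Suc g * bsum K (Suc g) (\<lambda>l. if l = Suc g then h (Suc q * G) else sqmod B) y \<le> c (Suc q)"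
        unfolding bsum_block using block[of "Suc q"] Suc.prems by simp
      ultimately have "(real (card B) / K) ^ G * bsum K G (\<lambda>l. fam h (q * G + l)) y \<le> c (Suc q)" by (simp only: G_def)
      then have "(real K / card B) ^ G * ((real (card B) / K) ^ G * bsum K G (\<lambda>l. fam h (q * G + l)) y) \<le> (real K / card B) ^ G * c (Suc q)"
        by (intro mult_left_mono) auto
      moreover have "(real K / card B) ^ G * (real (card B) / K) ^ G = 1"
        using ratio(2) by (simp add: power_mult_distrib[symmetric] mult.commute)
      ultimately show ?thesis by (simp only: mult.assoc[symmetric] mult_1_left)
    qed
    have "bsum K (q * G + G) (fam h) x \<le> bsum K (q * G) (fam h) x * ((real K / card B) ^ G * c (Suc q))"
      by (rule bsum_add_le[OF K0 fper fnn inner])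
    also have "\<dots> \<le> ((real K / card B) ^ (q * G) * (\<Prod>j\<in>{1..q}. c j)) * ((real K / card B) ^ G * c (Suc q))"
      using Suc c by (intro mult_right_mono) auto
    finally show ?case by (simp add: power_add ac_simps)
  qed
  define q where "q = min n1 (I div G)"
  define r where "r = I - q * G"
  have "q * G \<le> I" unfolding q_def by (metis div_times_less_eq_dividend le_trans min.cobounded2 mult_le_mono1)
  then have I: "I = q * G + r" by (simp add: r_def)
  have inner: "bsum K r (\<lambda>l. fam h (q * G + l)) y \<le> (real K / card B) ^ r" for y
  proof -
    have "bsum K r (\<lambda>l. fam h (q * G + l)) y = bsum K r (\<lambda>_. sqmod B) y"
    proof (rule bsum_cong)
      fix l assume l: "1 \<le> l" "l \<le> r"
      \<comment> \<open>After \<open>q\<close> blocks either all \<open>n1\<close> smeared scales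
        have been used or fewer than \<open>G\<close> scales remain.\<close>
      have "\<not> (G dvd (q * G + l) \<and> q * G + l \<le> m)"
      proof
        assume a: "G dvd (q * G + l) \<and> q * G + l \<le> m"
        then have dl: "G \<le> l" using l by (auto simp: dvd_add_right_iff dest!: dvd_imp_le)
        show False
        proof (cases "n1 \<le> I div G")
          case True
          then show False using a l by (simp add: q_def m_def)
        next
          case False
          then have "r = I mod G" by (simp add: r_def q_def minus_div_mult_eq_mod)
          then show False using dl l mod_less_divisor[OF G0, of I] by simp
        qed
      qed
      then show "fam h (q * G + l) = sqmod B" by (auto simp: fam_def)
    qed
    then show ?thesis by (simp add: bsum_sqmod)
  qed
  have "bsum K I (fam h) x \<le> bsum K (q * G) (fam h) x * (real K / card B) ^ r"
    unfolding I by (rule bsum_add_le[OF K0 fper fnn inner])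
  also have "\<dots> \<le> ((real K / card B) ^ (q * G) * (\<Prod>j\<in>{1..q}. c j)) * (real K / card B) ^ r"
    using blocks[of q] by (intro mult_right_mono) (auto simp: q_def)
  finally show ?thesis by (simp add: I[symmetric] power_add mult.commute mult.left_commute q_def[symmetric]) (simp add: I power_add mult.commute mult.left_commute)
qed

lemma bsum_famT_le: "bsum K I famT x \<le> (real K / card B) ^ I * (1 + \<epsilon>) ^ n1"
proof -
  have "bsum K I famT x \<le> (real K / card B) ^ I * (\<Prod>j\<in>{1..min n1 (I div G)}. 1 + \<epsilon>)"
    unfolding famT_def
    by (rule bsum_fam_le) (use tame_block eps in \<open>auto simp: tame_add_int tame_nonneg\<close>)
  also have "\<dots> \<le> (real K / card B) ^ I * (1 + \<epsilon>) ^ n1"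
    using eps by (intro mult_left_mono) (auto intro!: power_increasing)
  finally show ?thesis .
qed

lemma bsum_famW_le:
  assumes j: "1 \<le> j" "j \<le> n1" "j * G \<le> I"
  shows "bsum K I (famW j) x \<le> (real K / card B) ^ I * \<omega>"
proof -
  have G0: "G > 0" by (simp add: G_def)
  have "bsum K I (famW j) x \<le> (real K / card B) ^ I * (\<Prod>i\<in>{1..min n1 (I div G)}. if i = j then \<omega> else 1)"
    unfolding famW_def
  proof (rule bsum_fam_le)
    fix i x assume "1 \<le> i" "i \<le> n1"
    have "i * G = j * G \<longleftrightarrow> i = j" using G0 by simp
    then show "(\<Sum>k<K ^ Suc g. wgt g x k * (if i * G = j * G then wild X T else smear B X) ((x + real k) / real K ^ Suc g)) \<le> (if i = j then \<omega> else 1)"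
      using wild_block sum_wgt_smear by simp
  qed (use eps in \<open>auto simp: wild_add_int smear_add_int wild_nonneg smear_nonneg\<close>)
  also have "(\<Prod>i\<in>{1..min n1 (I div G)}. if i = j then \<omega> else 1) = \<omega>"
  proof -
    have "j \<le> I div G" using j(3) G0 by (simp add: less_eq_div_iff_mult_less_eq)
    then show ?thesis using j by (simp add: prod.delta)
  qed
  finally show ?thesis .
qed

lemma sqmod_small: "\<bar>u\<bar> \<le> real K ^ n \<Longrightarrow> n + 3 \<le> l \<Longrightarrow> 3 / 4 \<le> sqmod B (u / real K ^ l)"
  using sqmod_tail[OF B_sub _ K4, of u n "{l}"] card_B by simp

text \<open>Tame factors may exceed 1. Comparing them with inverses of original factors lets
  \<open>sqmod_tail\<close> bound their product over the tail.\<close>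

lemma famT_le_inverse:
  assumes "3 / 4 \<le> sqmod B u"
  shows "famT l u \<le> 1 / sqmod B u"
proof -
  have q: "0 < sqmod B u" "sqmod B u \<le> 1" using assms sqmod_le_1[of B u] by auto
  have i1: "1 \<le> 1 / sqmod B u" using q by simp
  have "tame X T \<sigma> u \<le> 1 / sqmod B u"
  proof -
    have "smear B X u * (smear B X u / sqmod B u) powr \<sigma> \<le> 1 * (1 / sqmod B u) powr \<sigma>"
      using smear_le_1 smear_nonneg[of B X u] q \<sigma> by (intro mult_mono powr_mono2 divide_right_mono) auto
    also have "\<dots> \<le> (1 / sqmod B u) powr 1" unfolding mult_1_left using i1 \<sigma> by (intro powr_mono) auto
    finally have "smear B X u * (smear B X u / sqmod B u) powr \<sigma> \<le> 1 / sqmod B u" using q by simp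
    then show ?thesis using q by (simp add: tame_def)
  qed
  moreover have "sqmod B u \<le> 1 / sqmod B u" using i1 q by linarith
  ultimately show ?thesis by (simp add: famT_def fam_def)
qed

lemma prodB_famT_le:
  assumes u: "\<bar>u\<bar> \<le> real K ^ n" and n: "n \<le> m"
  shows "prodB famT u \<le> 2 * (\<Prod>l\<in>{1..n + 2}. famT l (u / real K ^ l))"
proof -
  have "{1..m + 2} = {1..n + 2} \<union> {n + 3..m + 2}" "{1..n + 2} \<inter> {n + 3..m + 2} = {}" using n by auto
  then have eq: "prodB famT u = (\<Prod>l\<in>{1..n + 2}. famT l (u / real K ^ l)) * (\<Prod>l\<in>{n + 3..m + 2}. famT l (u / real K ^ l))"
    unfolding prodB_def by (simp add: prod.union_disjoint)
  have q: "3 / 4 \<le> sqmod B (u / real K ^ l)" if "l \<in> {n + 3..m + 2}" for l using sqmod_small[OF u] that by auto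
  have "(\<Prod>l\<in>{n + 3..m + 2}. famT l (u / real K ^ l)) \<le> (\<Prod>l\<in>{n + 3..m + 2}. 1 / sqmod B (u / real K ^ l))"
    by (intro prod_mono conjI fam_nonneg famT_le_inverse q)
  also have "\<dots> = 1 / (\<Prod>l\<in>{n + 3..m + 2}. sqmod B (u / real K ^ l))" by (simp add: prod_dividef)
  also have "\<dots> \<le> 1 / (3 / 4)"
    using sqmod_tail[OF B_sub _ K4 u, of "{n + 3..m + 2}"] card_B by (intro divide_left_mono) auto
  also have "\<dots> \<le> 2" by simp
  finally have "(\<Prod>l\<in>{1..n + 2}. famT l (u / real K ^ l)) * (\<Prod>l\<in>{n + 3..m + 2}. famT l (u / real K ^ l))
      \<le> (\<Prod>l\<in>{1..n + 2}. famT l (u / real K ^ l)) * 2"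
    by (intro mult_left_mono prod_nonneg fam_nonneg)
  then show ?thesis unfolding eq by simp
qed

text \<open>Beyond scale \<open>n + 2\<close> the original factor is at least 3 / 4, so the quotient
  stays below \<open>T >= 2\<close> and no wild factor survives there.\<close>

lemma prodB_famW_le:
  assumes u: "\<bar>u\<bar> \<le> real K ^ n" and n: "n \<le> m" and j: "1 \<le> j" "j \<le> n1"
  shows "prodB (famW j) u \<le> (if j * G \<le> n + 2 then \<Prod>l\<in>{1..n + 2}. famW j l (u / real K ^ l) else 0)"
proof (cases "j * G \<le> n + 2")
  case True
  have "{1..m + 2} = {1..n + 2} \<union> {n + 3..m + 2}" "{1..n + 2} \<inter> {n + 3..m + 2} = {}" using n by auto
  then have eq: "prodB (famW j) u = (\<Prod>l\<in>{1..n + 2}. famW j l (u / real K ^ l)) * (\<Prod>l\<in>{n + 3..m + 2}. famW j l (u / real K ^ l))"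
    unfolding prodB_def by (simp add: prod.union_disjoint)
  have "\<dots> \<le> (\<Prod>l\<in>{1..n + 2}. famW j l (u / real K ^ l)) * 1"
    by (intro mult_left_mono prod_le_1 prod_nonneg conjI fam_nonneg fam_le_1)
  then show ?thesis using True eq by simp
next
  case False
  have jm: "j * G \<le> m" unfolding m_def using j by simp
  have q: "3 / 4 \<le> sqmod B (u / real K ^ (j * G))" using False by (intro sqmod_small[OF u]) auto
  have "smear B X (u / real K ^ (j * G)) \<le> 2 * sqmod B (u / real K ^ (j * G))"
    using smear_le_1[of "u / real K ^ (j * G)"] q by linarith
  also have "\<dots> \<le> T * sqmod B (u / real K ^ (j * G))" using T q by (intro mult_right_mono) auto
  finally have "wild X T (u / real K ^ (j * G)) = 0" by (simp add: wild_def)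
  moreover have "1 \<le> j * G" using j by (simp add: G_def)
  ultimately have "famW j (j * G) (u / real K ^ (j * G)) = 0"
    using jm by (simp add: famW_def fam_def)
  moreover have "j * G \<in> {1..m + 2}" using jm j by (auto simp: G_def)
  ultimately have "prodB (famW j) u = 0" unfolding prodB_def by (intro prod_zero) auto
  then show ?thesis using False by simp
qed

definition err :: "real \<Rightarrow> real" where
  "err u = T powr (- \<sigma>) * prodB famT u + (\<Sum>j\<in>{1..n1}. prodB (famW j) u)"

text \<open>A bound for the mean of \<open>err\<close> relative to that of the unsmeared product,
  see \<open>integral_err_le\<close>; the 2 comes from the tail in
  \<open>prodB_famT_le\<close>.\<close>

definition loss :: real where
  "loss = 2 * T powr (- \<sigma>) * (1 + \<epsilon>) ^ n1 + real n1 * \<omega>"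

lemma err_nonneg: "0 \<le> err u" 
  unfolding err_def prodB_def using T by (auto intro!: add_nonneg_nonneg mult_nonneg_nonneg sum_nonneg prod_nonneg fam_nonneg)

lemma loss_nonneg: "0 \<le> loss"
  unfolding loss_def using T eps by auto

lemma measurable_prodB [measurable (raw)]:
  assumes f: "\<And>l. f l \<in> borel_measurable borel"
  shows "prodB f \<in> borel_measurable borel"
proof -
  have "(\<lambda>u. f l (u / real K ^ l)) \<in> borel_measurable borel" for l
    by (rule measurable_compose[OF _ f]) simp
  then show ?thesis unfolding prodB_def[abs_def] by (intro borel_measurable_prod)
qed

lemma measurable_err [measurable]: "err \<in> borel_measurable borel"
  unfolding err_def by measurable

lemma measurable_prodA [measurable]: "prodA \<in> borel_measurable borel"
  unfolding prodA_def by measurable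

lemma sqmod_digit_integral:
  assumes "S \<subseteq> {0..<K}"
  shows "(sqmod (digit_nums K S s) has_integral 1 / real (card S) ^ s) {0..1}"
  using integral_sqmod[of "digit_nums K S s"] finite_digit_nums[of S K s] card_digit_nums[OF assms, of s] assms
    finite_subset[OF assms] by simp

text \<open>On \<open>[0, K ^ n]\<close> the scales beyond \<open>n + 2\<close> cost at most a
  factor 2. Folding turns the product over the others into \<open>bsum\<close>, and the periodic
  factor of generation \<open>s\<close> contributes its mean \<open>1 / card B ^ s\<close>.\<close>

lemma integral_err_le:
  assumes n: "n \<le> m"
  shows "(\<integral>\<^sup>+u. ennreal (sqmod (digit_nums K B s) u * err u) * indicator {0..real K ^ n} u \<partial>lborel)
    \<le> ennreal ((real K / card B) ^ (n + 2) * (1 / real (card B) ^ s) * loss)"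
proof -
  let ?q = "sqmod (digit_nums K B s)"
  let ?I = "n + 2"
  let ?D = "{0..<real (K ^ ?I)}"
  let ?T = "\<lambda>u. \<Prod>l\<in>{1..?I}. famT l (u / real K ^ l)"
  let ?W = "\<lambda>j u. \<Prod>l\<in>{1..?I}. famW j l (u / real K ^ l)"
  let ?b = "(real K / card B) ^ ?I"
  let ?r = "1 / real (card B) ^ s"
  have K0: "K > 0" using K4 by simp
  have Tn: "0 \<le> ?T u" "0 \<le> ?W j u" for u j by (rule prod_nonneg, rule fam_nonneg)+
  have q0: "0 \<le> ?q u" for u by (rule sqmod_nonneg)
  have cq: "continuous_on {0..1} ?q" by (intro continuous_intros)
  have pw: "?q u * err u \<le> 2 * T powr (- \<sigma>) * (?q u * ?T u) + (\<Sum>j\<in>{1..n1}. if j * G \<le> ?I then ?q u * ?W j u else 0)"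
    if u: "\<bar>u\<bar> \<le> real K ^ n" for u
  proof -
    have "err u \<le> T powr (- \<sigma>) * (2 * ?T u) + (\<Sum>j\<in>{1..n1}. if j * G \<le> ?I then ?W j u else 0)"
      unfolding err_def
      by (intro add_mono mult_left_mono prodB_famT_le[OF u n] sum_mono prodB_famW_le[OF u n]) auto
    then have "?q u * err u \<le> ?q u * (T powr (- \<sigma>) * (2 * ?T u) + (\<Sum>j\<in>{1..n1}. if j * G \<le> ?I then ?W j u else 0))"
      by (intro mult_left_mono q0)
    also have "\<dots> = 2 * T powr (- \<sigma>) * (?q u * ?T u) + (\<Sum>j\<in>{1..n1}. if j * G \<le> ?I then ?q u * ?W j u else 0)"
      by (simp add: distrib_left sum_distrib_left if_distrib mult.left_commute cong: if_cong)
    finally show ?thesis .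
  qed
  have "(\<integral>\<^sup>+u. ennreal (?q u * err u) * indicator {0..real K ^ n} u \<partial>lborel)
    \<le> (\<integral>\<^sup>+u. (ennreal (2 * T powr (- \<sigma>)) * (ennreal (?q u * ?T u) * indicator ?D u) +
         (\<Sum>j\<in>{1..n1}. if j * G \<le> ?I then ennreal (?q u * ?W j u) * indicator ?D u else 0)) \<partial>lborel)"
  proof (rule nn_integral_mono)
    fix u
    show "ennreal (?q u * err u) * indicator {0..real K ^ n} u \<le> ennreal (2 * T powr (- \<sigma>)) * (ennreal (?q u * ?T u) * indicator ?D u) +
         (\<Sum>j\<in>{1..n1}. if j * G \<le> ?I then ennreal (?q u * ?W j u) * indicator ?D u else 0)"
    proof (cases "u \<in> {0..real K ^ n}")
      case True
      have "real K ^ n < real K ^ ?I" using K4 by (intro power_strict_increasing) auto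
      then have D: "u \<in> ?D" using True by auto
      have "ennreal (?q u * err u) \<le> ennreal (2 * T powr (- \<sigma>) * (?q u * ?T u) + (\<Sum>j\<in>{1..n1}. if j * G \<le> ?I then ?q u * ?W j u else 0))"
        by (intro ennreal_leI pw) (use True in auto)
      also have "\<dots> = ennreal (2 * T powr (- \<sigma>)) * ennreal (?q u * ?T u) + (\<Sum>j\<in>{1..n1}. if j * G \<le> ?I then ennreal (?q u * ?W j u) else 0)"
      proof -
        have "ennreal (\<Sum>j\<in>{1..n1}. if j * G \<le> ?I then ?q u * ?W j u else 0) = (\<Sum>j\<in>{1..n1}. ennreal (if j * G \<le> ?I then ?q u * ?W j u else 0))"
          by (rule sum_ennreal[symmetric]) (auto intro!: mult_nonneg_nonneg q0 prod_nonneg fam_nonneg)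
        also have "\<dots> = (\<Sum>j\<in>{1..n1}. if j * G \<le> ?I then ennreal (?q u * ?W j u) else 0)"
          by (intro sum.cong) auto
        finally have s: "ennreal (\<Sum>j\<in>{1..n1}. if j * G \<le> ?I then ?q u * ?W j u else 0) = (\<Sum>j\<in>{1..n1}. if j * G \<le> ?I then ennreal (?q u * ?W j u) else 0)" .
        have a: "0 \<le> 2 * T powr (- \<sigma>)" by simp
        have "ennreal (2 * T powr (- \<sigma>) * (?q u * ?T u)) = ennreal (2 * T powr (- \<sigma>)) * ennreal (?q u * ?T u)"
          by (rule ennreal_mult'[OF a])
        moreover have "0 \<le> 2 * T powr (- \<sigma>) * (?q u * ?T u)" by (intro mult_nonneg_nonneg a q0 Tn)
        moreover have "0 \<le> (\<Sum>j\<in>{1..n1}. if j * G \<le> ?I then ?q u * ?W j u else 0)"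
          by (rule sum_nonneg) (simp only: if_distrib mult_nonneg_nonneg[OF q0 Tn(2)] order_refl split: if_split, simp)
        ultimately show ?thesis by (simp only: ennreal_plus s)
      qed
      finally show ?thesis using True D by (simp cong: if_cong)
    qed simp
  qed
  also have "\<dots> = ennreal (2 * T powr (- \<sigma>)) * (\<integral>\<^sup>+u. ennreal (?q u * ?T u) * indicator ?D u \<partial>lborel)
     + (\<Sum>j\<in>{1..n1}. if j * G \<le> ?I then \<integral>\<^sup>+u. ennreal (?q u * ?W j u) * indicator ?D u \<partial>lborel else 0)"
  proof -
    have "(\<integral>\<^sup>+u. (\<Sum>j\<in>{1..n1}. if j * G \<le> ?I then ennreal (?q u * ?W j u) * indicator ?D u else 0) \<partial>lborel)
      = (\<Sum>j\<in>{1..n1}. \<integral>\<^sup>+u. (if j * G \<le> ?I then ennreal (?q u * ?W j u) * indicator ?D u else 0) \<partial>lborel)"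
      by (rule nn_integral_sum) auto
    also have "\<dots> = (\<Sum>j\<in>{1..n1}. if j * G \<le> ?I then \<integral>\<^sup>+u. ennreal (?q u * ?W j u) * indicator ?D u \<partial>lborel else 0)"
      by (intro sum.cong refl) auto
    finally have s: "(\<integral>\<^sup>+u. (\<Sum>j\<in>{1..n1}. if j * G \<le> ?I then ennreal (?q u * ?W j u) * indicator ?D u else 0) \<partial>lborel) = \<dots>" .
    have m1: "(\<lambda>u. ennreal (?q u * ?T u) * indicator ?D u) \<in> borel_measurable lborel" by measurable
    have m2: "(\<lambda>u. ennreal (2 * T powr (- \<sigma>)) * (ennreal (?q u * ?T u) * indicator ?D u)) \<in> borel_measurable lborel"
      by measurable
    have m3: "(\<lambda>u. \<Sum>j\<in>{1..n1}. if j * G \<le> ?I then ennreal (?q u * ?W j u) * indicator ?D u else 0) \<in> borel_measurable lborel"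
      by measurable
    show ?thesis unfolding nn_integral_add[OF m2 m3] s nn_integral_cmult[OF m1] ..
  qed
  also have "\<dots> \<le> ennreal (2 * T powr (- \<sigma>)) * ennreal (?b * (1 + \<epsilon>) ^ n1 * ?r) + (\<Sum>j\<in>{1..n1}. ennreal (?b * \<omega> * ?r))"
  proof (intro add_mono mult_left_mono sum_mono)
    show "(\<integral>\<^sup>+u. ennreal (?q u * ?T u) * indicator ?D u \<partial>lborel) \<le> ennreal (?b * (1 + \<epsilon>) ^ n1 * ?r)"
      by (rule nn_integral_bsum_le[OF K0 _ _ _ _ _ bsum_famT_le _ sqmod_digit_integral[OF B_sub] cq])
        (use eps in \<open>auto simp: sqmod_add_int sqmod_nonneg fam_nonneg\<close>)
    fix j assume j: "j \<in> {1..n1}"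
    show "(if j * G \<le> ?I then \<integral>\<^sup>+u. ennreal (?q u * ?W j u) * indicator ?D u \<partial>lborel else 0) \<le> ennreal (?b * \<omega> * ?r)"
    proof (cases "j * G \<le> ?I")
      case True
      have "(\<integral>\<^sup>+u. ennreal (?q u * ?W j u) * indicator ?D u \<partial>lborel) \<le> ennreal (?b * \<omega> * ?r)"
        by (rule nn_integral_bsum_le[OF K0 _ _ _ _ _ bsum_famW_le _ sqmod_digit_integral[OF B_sub] cq])
          (use eps j True in \<open>auto simp: sqmod_add_int sqmod_nonneg fam_nonneg\<close>)
      then show ?thesis using True by simp
    qed simp
  qed simp
  also have "\<dots> = ennreal (2 * T powr (- \<sigma>) * (?b * (1 + \<epsilon>) ^ n1 * ?r) + real n1 * (?b * \<omega> * ?r))"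
    using eps by (simp add: ennreal_mult'[symmetric] ennreal_plus[symmetric] ennreal_of_nat_eq_real_of_nat del: ennreal_plus)
  also have "2 * T powr (- \<sigma>) * (?b * (1 + \<epsilon>) ^ n1 * ?r) + real n1 * (?b * \<omega> * ?r) = ?b * ?r * loss"
  proof -
    have "2 * a * (b * c * r) + n * (b * w * r) = b * r * (2 * a * c + n * w)" for a b c r n w :: real
      by (simp add: algebra_simps)
    then show ?thesis unfolding loss_def .
  qed
  finally show ?thesis .
qed

end

context digit_pair begin

lemma prod_sqmod_digit_nums:
  assumes "S \<subseteq> {0..<K}" "card S > 0"
  shows "(\<Prod>l\<in>{1..r}. sqmod S (u / real K ^ l)) = sqmod (digit_nums K S r) (u / real K ^ r)"
proof -
  have K0: "real K \<noteq> 0" using K4 by simp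
  have "(\<Prod>l\<in>{1..r}. sqmod S (u / real K ^ l)) = (\<Prod>i<r. sqmod S (real K ^ i * (u / real K ^ r)))"
  proof (rule prod.reindex_bij_witness[where i = "\<lambda>i. r - i" and j = "\<lambda>l. r - l"])
    fix l assume "l \<in> {1..r}"
    then have "real K ^ r = real K ^ (r - l) * real K ^ l" by (simp flip: power_add)
    then show "sqmod S (real K ^ (r - l) * (u / real K ^ r)) = sqmod S (u / real K ^ l)" using K0 by simp
  qed auto
  then show ?thesis by (simp only: sqmod_digit_nums[OF assms] of_nat_power)
qed

lemma sqmod_digit_nums_add:
  assumes "S \<subseteq> {0..<K}"
  shows "sqmod (digit_nums K S (s + r)) u = sqmod (digit_nums K S s) (real K ^ r * u) * sqmod (digit_nums K S r) u"
proof (induction r arbitrary: u)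
  case 0
  then show ?case by (simp add: sqmod_expsum expsum_def)
next
  case (Suc r)
  show ?case
    by (simp only: add_Suc_right sqmod_digit_nums_Suc[OF assms] Suc.IH) (simp add: mult.assoc mult.left_commute mult.commute)
qed

lemma wave_add: "wave t (s + r) z = wave t s (real K ^ r * z) * wave t r z"
  by (simp add: wave_def sqmod_digit_nums_add A_sub B_sub mult.assoc mult.left_commute mult.commute)

lemma wave_prod: "wave t r (\<zeta> / real K ^ r)
    = (\<Prod>l\<in>{1..r}. sqmod A (\<zeta> / real K ^ l)) * (\<Prod>l\<in>{1..r}. sqmod B (t * \<zeta> / real K ^ l))"
proof -
  have "card A > 0" "card B > 0" using card_A card_B by auto
  then show ?thesis
    by (simp only: wave_def prod_sqmod_digit_nums[OF A_sub] prod_sqmod_digit_nums[OF B_sub] times_divide_eq_right)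
qed

lemma measurable_wave [measurable]: "wave t s \<in> borel_measurable borel"
  unfolding wave_def by measurable

lemma nn_integral_wave_le:
  assumes "t \<ge> 0"
  shows "(\<integral>\<^sup>+z. ennreal (wave t s z) * indicator {0..1} z \<partial>lborel) \<le> ennreal (28 * energy t s / (real K ^ s)\<^sup>2)"
proof -
  have "continuous_on {0..1} (wave t s)" by (intro continuous_intros)
  then show ?thesis using integral_wave_le[OF assms, of s 0]
    by (subst nn_integral_Icc_continuous) (auto simp: wave_nonneg intro!: ennreal_leI)
qed

end

context smeared begin

lemma prodA_nonneg: "0 \<le> prodA u" and prodA_le_1: "prodA u \<le> 1"
  unfolding prodA_def by (auto intro!: prod_nonneg prod_le_1 simp: sqmod_nonneg sqmod_le_1 simp del: prod.cl_ivl_Suc)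

lemma prodB_famS_nonneg: "0 \<le> prodB famS u" and prodB_sqmod_nonneg: "0 \<le> prodB (\<lambda>_. sqmod B) u"
  unfolding prodB_def by (rule prod_nonneg, rule fam_nonneg sqmod_nonneg)+

lemma sum_indicator_shells:
  fixes b :: "nat \<Rightarrow> real" and x :: real
  assumes "\<And>i. b i \<le> b (Suc i)"
  shows "(\<Sum>i<n. indicator {b i<..b (Suc i)} x :: ennreal) = indicator {b 0<..b n} x"
proof (induction n)
  case (Suc n)
  have "b 0 \<le> b n" by (induction n) (use assms order_trans in auto)
  then show ?case using Suc assms[of n] by (auto split: split_indicator)
qed simp

text \<open>The integrand is arranged as a function of \<open>\<zeta>\<close> times a function of
  \<open>t * \<zeta>\<close>, in preparation for integrating over \<open>t\<close>.\<close>

definition errint :: "nat \<Rightarrow> real \<Rightarrow> ennreal" where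
  "errint s t = (\<integral>\<^sup>+\<zeta>. ennreal (real K ^ s * (sqmod (digit_nums K A s) \<zeta> * prodA \<zeta>)) *
      ennreal (sqmod (digit_nums K B s) (t * \<zeta>) * err (t * \<zeta>)) * indicator {1<..real K ^ m} \<zeta> \<partial>lborel)"

lemma measurable_errint [measurable]: "errint s \<in> borel_measurable borel"
  unfolding errint_def by measurable

text \<open>The substitution \<open>u = t * \<zeta>\<close> replaces the slope by a variable
  independent of \<open>\<zeta>\<close>, with Jacobian at most \<open>1 / a\<close>.\<close>

lemma inner_integral_le:
  fixes \<Psi> :: "real \<Rightarrow> ennreal"
  assumes [measurable]: "\<Psi> \<in> borel_measurable borel" and \<zeta>: "0 < a" "a \<le> \<zeta>" "\<zeta> \<le> b"
  shows "(\<integral>\<^sup>+t. \<Psi> (t * \<zeta>) * indicator {0..1} t \<partial>lborel) \<le> ennreal (1 / a) * (\<integral>\<^sup>+u. \<Psi> u * indicator {0..b} u \<partial>lborel)"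
proof -
  have "ennreal a * (\<integral>\<^sup>+t. \<Psi> (t * \<zeta>) * indicator {0..1} t \<partial>lborel) \<le> ennreal \<bar>\<zeta>\<bar> * (\<integral>\<^sup>+t. \<Psi> (t * \<zeta>) * indicator {0..1} t \<partial>lborel)"
    using \<zeta> by (intro mult_right_mono ennreal_leI) auto
  also have "\<dots> = ennreal \<bar>\<zeta>\<bar> * (\<integral>\<^sup>+t. \<Psi> (0 + \<zeta> * t) * indicator {0..\<zeta>} (0 + \<zeta> * t) \<partial>lborel)"
    using \<zeta> by (intro arg_cong2[where f = "(*)"] nn_integral_cong refl)
      (auto split: split_indicator simp: mult.commute zero_le_mult_iff mult_le_cancel_left1)
  also have "\<dots> = (\<integral>\<^sup>+u. \<Psi> u * indicator {0..\<zeta>} u \<partial>lborel)"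
    by (rule nn_integral_real_affine[symmetric]) (use \<zeta> in auto)
  also have "\<dots> \<le> (\<integral>\<^sup>+u. \<Psi> u * indicator {0..b} u \<partial>lborel)"
    using \<zeta> by (intro nn_integral_mono) (auto split: split_indicator)
  finally have "ennreal (1 / a) * (ennreal a * (\<integral>\<^sup>+t. \<Psi> (t * \<zeta>) * indicator {0..1} t \<partial>lborel))
      \<le> ennreal (1 / a) * (\<integral>\<^sup>+u. \<Psi> u * indicator {0..b} u \<partial>lborel)" by (rule mult_left_mono) simp
  moreover have "ennreal (1 / a) * ennreal a = 1" using \<zeta> by (simp add: ennreal_mult'[symmetric])
  ultimately show ?thesis by (simp only: mult.assoc[symmetric] mult_1_left)
qed

lemma integral_A_le:
  assumes "i < m"
  shows "(\<integral>\<^sup>+\<zeta>. ennreal (real K ^ s * (sqmod (digit_nums K A s) \<zeta> * prodA \<zeta>)) * indicator {real K ^ i<..real K ^ Suc i} \<zeta> \<partial>lborel)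
    \<le> ennreal (real K ^ s * ((real K / card A) ^ (i + 3) * (1 / real (card A) ^ s)))"
proof -
  let ?q = "sqmod (digit_nums K A s)"
  let ?P = "\<lambda>\<zeta>. \<Prod>l\<in>{1..i + 3}. sqmod A (\<zeta> / real K ^ l)"
  let ?D = "{0..<real (K ^ (i + 3))}"
  have K0: "K > 0" using K4 by simp
  have cq: "continuous_on {0..1} ?q" by (intro continuous_intros)
  have bA: "bsum K n (\<lambda>_. sqmod A) x = (real K / card A) ^ n" for n x
    using bsum_eq_prod[of K n "\<lambda>_. sqmod A" "\<lambda>_. real K / card A" x] K4 sum_sqmod[OF A_sub] sqmod_add_int
    by simp
  have "(\<integral>\<^sup>+\<zeta>. ennreal (real K ^ s * (?q \<zeta> * prodA \<zeta>)) * indicator {real K ^ i<..real K ^ Suc i} \<zeta> \<partial>lborel)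
    \<le> (\<integral>\<^sup>+\<zeta>. ennreal (real K ^ s) * (ennreal (?q \<zeta> * ?P \<zeta>) * indicator ?D \<zeta>) \<partial>lborel)"
  proof (rule nn_integral_mono)
    fix \<zeta>
    have "{1..m + 2} = {1..i + 3} \<union> {i + 4..m + 2}" "{1..i + 3} \<inter> {i + 4..m + 2} = {}" using assms by auto
    then have "prodA \<zeta> = ?P \<zeta> * (\<Prod>l\<in>{i + 4..m + 2}. sqmod A (\<zeta> / real K ^ l))"
      unfolding prodA_def by (simp add: prod.union_disjoint del: prod.cl_ivl_Suc)
    also have "\<dots> \<le> ?P \<zeta> * 1"
      by (intro mult_left_mono prod_le_1 prod_nonneg conjI sqmod_nonneg sqmod_le_1)
    finally have "?q \<zeta> * prodA \<zeta> \<le> ?q \<zeta> * ?P \<zeta>" by (intro mult_left_mono sqmod_nonneg) simp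
    then have "ennreal (real K ^ s * (?q \<zeta> * prodA \<zeta>)) \<le> ennreal (real K ^ s) * ennreal (?q \<zeta> * ?P \<zeta>)"
      by (subst ennreal_mult'[symmetric]) (auto intro!: ennreal_leI mult_left_mono)
    moreover have "\<zeta> \<in> ?D" if "\<zeta> \<in> {real K ^ i<..real K ^ Suc i}"
    proof -
      have "real K ^ Suc i < real K ^ (i + 3)" using K4 by (intro power_strict_increasing) auto
      moreover have "0 \<le> real K ^ i" by simp
      ultimately show ?thesis using that unfolding of_nat_power atLeastLessThan_iff greaterThanAtMost_iff by linarith
    qed
    ultimately show "ennreal (real K ^ s * (?q \<zeta> * prodA \<zeta>)) * indicator {real K ^ i<..real K ^ Suc i} \<zeta>
        \<le> ennreal (real K ^ s) * (ennreal (?q \<zeta> * ?P \<zeta>) * indicator ?D \<zeta>)"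
      by (cases "\<zeta> \<in> {real K ^ i<..real K ^ Suc i}") (simp_all del: power_Suc prod.cl_ivl_Suc)
  qed
  also have "\<dots> = ennreal (real K ^ s) * (\<integral>\<^sup>+\<zeta>. ennreal (?q \<zeta> * ?P \<zeta>) * indicator ?D \<zeta> \<partial>lborel)"
    by (rule nn_integral_cmult) measurable
  also have "\<dots> \<le> ennreal (real K ^ s) * ennreal ((real K / card A) ^ (i + 3) * (1 / real (card A) ^ s))"
    by (intro mult_left_mono nn_integral_bsum_le[OF K0 _ _ _ _ _ _ _ sqmod_digit_integral[OF A_sub] cq])
      (auto simp: sqmod_add_int sqmod_nonneg bA simp del: power_Suc)
  finally show ?thesis by (simp only: ennreal_mult'[symmetric] zero_le_power of_nat_0_le_iff)
qed

text \<open>On the shell \<open>K ^ i < \<zeta> <= K ^ Suc i\<close> integration over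
  \<open>t\<close> decouples the \<open>A\<close>-factor from the \<open>B\<close>-factor. Their
  integrals grow like \<open>(K / card A) ^ i\<close> and \<open>(K / card B) ^ i\<close>, together
  \<open>K ^ i\<close>, which the Jacobian cancels; likewise the two means of generation
  \<open>s\<close> cancel \<open>K ^ s\<close>. Every one of the \<open>m\<close> shells thus costs
  the same.\<close>

lemma integral_errint_le:
  "(\<integral>\<^sup>+t. errint s t * indicator {0..1} t \<partial>lborel) \<le> ennreal (real m * (real K ^ 3 * loss))"
proof -
  let ?\<Phi> = "\<lambda>\<zeta>. ennreal (real K ^ s * (sqmod (digit_nums K A s) \<zeta> * prodA \<zeta>))"
  let ?\<Psi> = "\<lambda>u. ennreal (sqmod (digit_nums K B s) u * err u)"
  let ?S = "\<lambda>i. {real K ^ i<..real K ^ Suc i}"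
  have K1: "real K \<ge> 1" "real K > 0" using K4 by auto
  have ind: "(indicator {1<..real K ^ m} \<zeta> :: ennreal) = (\<Sum>i<m. indicator (?S i) \<zeta>)" for \<zeta>
    using sum_indicator_shells[where b = "\<lambda>i. real K ^ i" and n = m and x = \<zeta>] K1 by simp
  have shell: "(\<integral>\<^sup>+t. (\<integral>\<^sup>+\<zeta>. ?\<Phi> \<zeta> * ?\<Psi> (t * \<zeta>) * indicator (?S i) \<zeta> * indicator {0..1} t \<partial>lborel) \<partial>lborel) \<le> ennreal (real K ^ 3 * loss)"
    if i: "i < m" for i
  proof -
    let ?IB = "\<integral>\<^sup>+u. ?\<Psi> u * indicator {0..real K ^ Suc i} u \<partial>lborel"
    have "(\<integral>\<^sup>+t. (\<integral>\<^sup>+\<zeta>. ?\<Phi> \<zeta> * ?\<Psi> (t * \<zeta>) * indicator (?S i) \<zeta> * indicator {0..1} t \<partial>lborel) \<partial>lborel)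
      = (\<integral>\<^sup>+\<zeta>. (\<integral>\<^sup>+t. ?\<Phi> \<zeta> * ?\<Psi> (t * \<zeta>) * indicator (?S i) \<zeta> * indicator {0..1} t \<partial>lborel) \<partial>lborel)"
      by (rule lborel_pair.Fubini') measurable
    also have "\<dots> = (\<integral>\<^sup>+\<zeta>. ?\<Phi> \<zeta> * indicator (?S i) \<zeta> * (\<integral>\<^sup>+t. ?\<Psi> (t * \<zeta>) * indicator {0..1} t \<partial>lborel) \<partial>lborel)"
    proof (rule nn_integral_cong)
      fix \<zeta>
      have "(\<integral>\<^sup>+t. ?\<Phi> \<zeta> * ?\<Psi> (t * \<zeta>) * indicator (?S i) \<zeta> * indicator {0..1} t \<partial>lborel)
         = (\<integral>\<^sup>+t. (?\<Phi> \<zeta> * indicator (?S i) \<zeta>) * (?\<Psi> (t * \<zeta>) * indicator {0..1} t) \<partial>lborel)"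
        by (intro nn_integral_cong) (simp only: mult.assoc mult.left_commute mult.commute)
      also have "\<dots> = ?\<Phi> \<zeta> * indicator (?S i) \<zeta> * (\<integral>\<^sup>+t. ?\<Psi> (t * \<zeta>) * indicator {0..1} t \<partial>lborel)"
        by (rule nn_integral_cmult) measurable
      finally show "(\<integral>\<^sup>+t. ?\<Phi> \<zeta> * ?\<Psi> (t * \<zeta>) * indicator (?S i) \<zeta> * indicator {0..1} t \<partial>lborel) = \<dots>" .
    qed
    also have "\<dots> \<le> (\<integral>\<^sup>+\<zeta>. ?\<Phi> \<zeta> * indicator (?S i) \<zeta> * (ennreal (1 / real K ^ i) * ?IB) \<partial>lborel)"
    proof (rule nn_integral_mono)
      fix \<zeta>
      show "?\<Phi> \<zeta> * indicator (?S i) \<zeta> * (\<integral>\<^sup>+t. ?\<Psi> (t * \<zeta>) * indicator {0..1} t \<partial>lborel)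
         \<le> ?\<Phi> \<zeta> * indicator (?S i) \<zeta> * (ennreal (1 / real K ^ i) * ?IB)"
      proof (cases "\<zeta> \<in> ?S i")
        case True
        have "(\<integral>\<^sup>+t. ?\<Psi> (t * \<zeta>) * indicator {0..1} t \<partial>lborel) \<le> ennreal (1 / real K ^ i) * ?IB"
          by (rule inner_integral_le) (use True K1 in \<open>auto simp del: power_Suc\<close>)
        then show ?thesis by (rule mult_left_mono) simp
      qed simp
    qed
    also have "\<dots> = (\<integral>\<^sup>+\<zeta>. ?\<Phi> \<zeta> * indicator (?S i) \<zeta> \<partial>lborel) * (ennreal (1 / real K ^ i) * ?IB)"
      by (rule nn_integral_multc) measurable
    also have "\<dots> \<le> ennreal (real K ^ s * ((real K / card A) ^ (i + 3) * (1 / real (card A) ^ s))) *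
       (ennreal (1 / real K ^ i) * ennreal ((real K / card B) ^ (Suc i + 2) * (1 / real (card B) ^ s) * loss))"
      by (intro mult_mono integral_A_le[OF i] integral_err_le order_refl mult_nonneg_nonneg) (use i in auto)
    also have "\<dots> = ennreal (real K ^ s * ((real K / card A) ^ (i + 3) * (1 / real (card A) ^ s)) *
       (1 / real K ^ i * ((real K / card B) ^ (Suc i + 2) * (1 / real (card B) ^ s) * loss)))"
      using loss_nonneg by (simp add: ennreal_mult'[symmetric] del: power_Suc)
    also have "real K ^ s * ((real K / card A) ^ (i + 3) * (1 / real (card A) ^ s)) *
       (1 / real K ^ i * ((real K / card B) ^ (Suc i + 2) * (1 / real (card B) ^ s) * loss)) = real K ^ 3 * loss"
    proof -
      have ab: "real (card A) * real (card B) = real K" using card_AB by (metis of_nat_mult)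
      have "(real K / card A) ^ (i + 3) * (real K / card B) ^ (i + 3) = real K ^ (i + 3)"
        using ab K1 by (simp only: power_mult_distrib[symmetric] times_divide_times_eq) simp
      moreover have "(1 / real (card A) ^ s) * (1 / real (card B) ^ s) = 1 / real K ^ s"
        using ab by (simp flip: power_mult_distrib)
      moreover have "ks * (pa * ra) * (ki * (pb * rb * lo)) = ks * (ra * rb) * (ki * (pa * pb)) * lo" for ks pa ra ki pb rb lo :: real
        by (simp add: ac_simps)
      moreover have "Suc i + 2 = i + 3" by simp
      moreover have "real K ^ s * (1 / real K ^ s) * (1 / real K ^ i * real K ^ (i + 3)) = real K ^ 3"
        using K1 by (simp add: power_add)
      ultimately show ?thesis by (simp only:)
    qed
    finally show ?thesis .
  qed
  have "(\<integral>\<^sup>+t. errint s t * indicator {0..1} t \<partial>lborel)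
     = (\<integral>\<^sup>+t. (\<Sum>i<m. \<integral>\<^sup>+\<zeta>. ?\<Phi> \<zeta> * ?\<Psi> (t * \<zeta>) * indicator (?S i) \<zeta> * indicator {0..1} t \<partial>lborel) \<partial>lborel)"
  proof (rule nn_integral_cong)
    fix t
    have "errint s t * indicator {0..1} t = (\<integral>\<^sup>+\<zeta>. ?\<Phi> \<zeta> * ?\<Psi> (t * \<zeta>) * indicator {1<..real K ^ m} \<zeta> * indicator {0..1} t \<partial>lborel)"
      unfolding errint_def by (rule nn_integral_multc[symmetric]) measurable
    also have "\<dots> = (\<integral>\<^sup>+\<zeta>. (\<Sum>i<m. ?\<Phi> \<zeta> * ?\<Psi> (t * \<zeta>) * indicator (?S i) \<zeta> * indicator {0..1} t) \<partial>lborel)"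
      unfolding ind sum_distrib_left sum_distrib_right ..
    also have "\<dots> = (\<Sum>i<m. \<integral>\<^sup>+\<zeta>. ?\<Phi> \<zeta> * ?\<Psi> (t * \<zeta>) * indicator (?S i) \<zeta> * indicator {0..1} t \<partial>lborel)"
      by (rule nn_integral_sum) measurable
    finally show "errint s t * indicator {0..1} t = \<dots>" .
  qed
  also have "\<dots> = (\<Sum>i<m. \<integral>\<^sup>+t. (\<integral>\<^sup>+\<zeta>. ?\<Phi> \<zeta> * ?\<Psi> (t * \<zeta>) * indicator (?S i) \<zeta> * indicator {0..1} t \<partial>lborel) \<partial>lborel)"
    by (rule nn_integral_sum) measurable
  also have "\<dots> \<le> (\<Sum>i<m. ennreal (real K ^ 3 * loss))" by (intro sum_mono shell) auto
  also have "\<dots> = ennreal (real m * (real K ^ 3 * loss))"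
    using loss_nonneg by (simp add: ennreal_of_nat_eq_real_of_nat ennreal_mult'[symmetric])
  finally show ?thesis .
qed

end

section \<open>Lower bounds for the smeared mass and upper bounds for the bands\<close>

context digit_pair begin

lemma fejer_wave:
  assumes L: "L > 0"
  shows "fejer_pos (wave t s) \<and> integral {0..L} (\<lambda>z. (1 - z / L) * wave t s z) \<ge> L / 2 * (1 / real K ^ s)"
proof -
  have abs: "1 / real (card A) ^ s * (1 / real (card B) ^ s) = 1 / real K ^ s"
    using card_AB by (simp flip: power_mult_distrib of_nat_mult)
  let ?A = "digit_nums K A s" and ?B = "digit_nums K B s"
  have fA: "finite ?A" "finite ?B" using finite_digit_nums finA finB by auto
  have cA: "real (card ?A) = real (card A) ^ s" "real (card ?B) = real (card B) ^ s"
    using card_digit_nums[OF A_sub] card_digit_nums[OF B_sub] by auto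
  have 1: "fejer_pos (\<lambda>z. 1 * sqmod ?A (1 * z))" by (rule fejer_pos_sqmod[OF fA(1) fejer_pos_1])
  have 2: "fejer_pos (\<lambda>z. 1 * sqmod ?A (1 * z) * sqmod ?B (t * z))" by (rule fejer_pos_sqmod[OF fA(2) 1])
  have "L / 2 * (1 / real K ^ s) = 1 / real (card ?B) * (1 / real (card ?A) * (L / 2))"
    unfolding cA abs[symmetric] by simp
  also have "1 / real (card ?A) * (L / 2) \<le> integral {0..L} (\<lambda>z. (1 - z / L) * (1 * sqmod ?A (1 * z)))"
    using fejer_pos_sqmod_ge[OF fejer_pos_1 L fA(1), of 1] integral_unique[OF fejer_integral_0[OF L]] by simp
  then have "1 / real (card ?B) * (1 / real (card ?A) * (L / 2))
      \<le> 1 / real (card ?B) * integral {0..L} (\<lambda>z. (1 - z / L) * (1 * sqmod ?A (1 * z)))"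
    by (rule mult_left_mono) simp
  also have "\<dots> \<le> integral {0..L} (\<lambda>z. (1 - z / L) * (1 * sqmod ?A (1 * z) * sqmod ?B (t * z)))"
    by (rule fejer_pos_sqmod_ge[OF 1 L fA(2)])
  finally show ?thesis using 2 by (simp add: wave_def[abs_def])
qed

end

context smeared begin

definition peak :: "nat \<Rightarrow> real \<Rightarrow> real \<Rightarrow> real" where
  "peak s t \<zeta> = wave t s \<zeta> * (prodA \<zeta> * prodB famS (t * \<zeta>))"

lemma continuous_famS [continuous_intros]:
  fixes f :: "real \<Rightarrow> real"
  shows "continuous_on S f \<Longrightarrow> continuous_on S (\<lambda>x. famS l (f x))"
  unfolding famS_def fam_def by (auto intro: continuous_intros)

lemma continuous_peak [continuous_intros]: "continuous_on S (peak s t)"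
  unfolding peak_def prodA_def prodB_def
  by (intro continuous_intros) (use K4 in auto)

lemma peak_nonneg: "0 \<le> peak s t \<zeta>"
  unfolding peak_def by (intro mult_nonneg_nonneg wave_nonneg prodA_nonneg prodB_famS_nonneg)

text \<open>Smearing leaves the diagonal weights unchanged, so a smeared factor costs no more than
  an original one in the positive definite lower bound.\<close>

lemma fejer_famS:
  assumes f: "fejer_pos f"
  shows "fejer_pos (\<lambda>z. f z * famS l (\<mu> * z))"
    and "L > 0 \<Longrightarrow> integral {0..L} (\<lambda>z. (1 - z / L) * (f z * famS l (\<mu> * z)))
     \<ge> 1 / card B * integral {0..L} (\<lambda>z. (1 - z / L) * f z)"
proof -
  let ?w = "\<lambda>b b'. cos (2 * pi * (real b - real b') * X) / (real (card B))\<^sup>2"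
  have w: "0 \<le> ?w b b'" if "b \<in> B" "b' \<in> B" for b b'
    using smear_weight_nonneg[OF B_sub that] X by simp
  have d: "(\<Sum>b\<in>B. ?w b b) = 1 / card B" by (simp add: power2_eq_square)
  have s: "fejer_pos (\<lambda>z. f z * smear B X (\<mu> * z))"
    unfolding smear_trig by (rule fejer_pos_mult[OF f w finB])
  have s': "integral {0..L} (\<lambda>z. (1 - z / L) * (f z * smear B X (\<mu> * z)))
     \<ge> 1 / card B * integral {0..L} (\<lambda>z. (1 - z / L) * f z)" if "L > 0"
    unfolding smear_trig d[symmetric] by (rule fejer_pos_mult_ge[OF f w that finB])
  show "fejer_pos (\<lambda>z. f z * famS l (\<mu> * z))"
    using s fejer_pos_sqmod[OF finB f] by (simp add: famS_def fam_def)
  show "integral {0..L} (\<lambda>z. (1 - z / L) * (f z * famS l (\<mu> * z)))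
     \<ge> 1 / card B * integral {0..L} (\<lambda>z. (1 - z / L) * f z)" if "L > 0"
    using s'[OF that] fejer_pos_sqmod_ge[OF f that finB] by (simp add: famS_def fam_def)
qed

text \<open>Induction over the scales: each multiplies the lower bound by
  \<open>1 / card A * (1 / card B) = 1 / K\<close>.\<close>

lemma fejer_peak:
  assumes L: "L > 0"
  shows "integral {0..L} (\<lambda>z. (1 - z / L) * peak s t z) \<ge> L / 2 * (1 / real K ^ s) * (1 / real K ^ (m + 2))"
proof -
  let ?F = "\<lambda>n z. wave t s z * (\<Prod>l\<in>{1..n}. sqmod A (1 / real K ^ l * z) * famS l (t / real K ^ l * z))"
  have ab: "1 / real (card A) * (1 / real (card B)) = 1 / real K"
    using card_AB by (simp flip: of_nat_mult)
  have P: "fejer_pos (?F n) \<and> integral {0..L} (\<lambda>z. (1 - z / L) * ?F n z) \<ge> L / 2 * (1 / real K ^ s) * (1 / real K ^ n)" for n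
  proof (induction n)
    case 0
    show ?case using fejer_wave[OF L, of t s] by simp
  next
    case (Suc n)
    let ?l = "Suc n"
    have 1: "fejer_pos (\<lambda>z. ?F n z * sqmod A (1 / real K ^ ?l * z))"
      by (rule fejer_pos_sqmod[OF finA]) (use Suc in blast)
    have 2: "fejer_pos (\<lambda>z. ?F n z * sqmod A (1 / real K ^ ?l * z) * famS ?l (t / real K ^ ?l * z))"
      by (rule fejer_famS(1)[OF 1])
    have eq: "?F ?l z = ?F n z * sqmod A (1 / real K ^ ?l * z) * famS ?l (t / real K ^ ?l * z)" for z
      by (subst prod.cl_ivl_Suc) (simp only: if_False Suc_le_mono le0 One_nat_def not_less_eq_eq mult.assoc simp_thms less_Suc_eq_0_disj, auto)
    have "L / 2 * (1 / real K ^ s) * (1 / real K ^ ?l) = 1 / card B * (1 / card A * (L / 2 * (1 / real K ^ s) * (1 / real K ^ n)))"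
    proof -
      have "1 / real K ^ ?l = 1 / real (card A) * (1 / real (card B)) * (1 / real K ^ n)" unfolding ab by simp
      then show ?thesis by (simp only: mult.assoc mult.left_commute mult.commute)
    qed
    also have "\<dots> \<le> 1 / card B * (1 / card A * integral {0..L} (\<lambda>z. (1 - z / L) * ?F n z))"
      using Suc by (intro mult_left_mono) auto
    also have "\<dots> \<le> 1 / card B * integral {0..L} (\<lambda>z. (1 - z / L) * (?F n z * sqmod A (1 / real K ^ ?l * z)))"
      using Suc L finA by (intro mult_left_mono fejer_pos_sqmod_ge) auto
    also have "\<dots> \<le> integral {0..L} (\<lambda>z. (1 - z / L) * (?F n z * sqmod A (1 / real K ^ ?l * z) * famS ?l (t / real K ^ ?l * z)))"
      by (rule fejer_famS(2)[OF 1 L])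
    finally show ?case using 2 unfolding eq by blast
  qed
  have "?F (m + 2) z = peak s t z" for z
    unfolding peak_def prodA_def prodB_def prod.distrib[symmetric] by (simp del: prod.cl_ivl_Suc power_Suc)
  then show ?thesis using P[of "m + 2"] by simp
qed

lemma prodB_famS_le: "prodB famS u \<le> sqmod B X ^ n1"
proof -
  let ?J = "(\<lambda>j. j * G) ` {1..n1}"
  have G0: "G > 0" by (simp add: G_def)
  have J: "?J \<subseteq> {1..m + 2}"
  proof
    fix l assume "l \<in> ?J"
    then obtain j where "l = j * G" "j \<in> {1..n1}" by blast
    then have j: "l = j * G" "1 \<le> j" "j \<le> n1" by simp_all
    have "j * G \<le> n1 * G" using j by (intro mult_right_mono) auto
    moreover have "1 \<le> j * G" using j G0 by (simp add: Suc_le_eq)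
    ultimately show "l \<in> {1..m + 2}" unfolding j(1) m_def atLeastAtMost_iff by linarith
  qed
  have inj: "inj_on (\<lambda>j. j * G) {1..n1}" using G0 by (auto simp: inj_on_def)
  have "prodB famS u = (\<Prod>l\<in>{1..m + 2} - ?J. famS l (u / real K ^ l)) * (\<Prod>l\<in>?J. famS l (u / real K ^ l))"
    unfolding prodB_def using J by (intro prod.subset_diff) auto
  also have "\<dots> \<le> 1 * (\<Prod>l\<in>?J. sqmod B X)"
  proof (intro mult_mono prod_mono prod_le_1 prod_nonneg conjI fam_nonneg fam_le_1)
    fix l assume "l \<in> ?J"
    then have "famS l = smear B X" using J by (auto simp: famS_def fam_def m_def)
    then show "famS l (u / real K ^ l) \<le> sqmod B X" using smear_le_sqmod[OF B_sub] X by simp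
  qed auto
  also have "\<dots> = sqmod B X ^ n1" using card_image[OF inj] by simp
  finally show ?thesis .
qed

lemma peak_near_zero:
  assumes "t \<ge> 0"
  shows "integral {0..1} (peak s t) \<le> sqmod B X ^ n1 * (28 * energy t s / (real K ^ s)\<^sup>2)"
proof -
  have "integral {0..1} (peak s t) \<le> integral {0..1} (\<lambda>z. sqmod B X ^ n1 * wave t s z)"
  proof (rule integral_le)
    fix z
    have "prodA z * prodB famS (t * z) \<le> 1 * sqmod B X ^ n1"
      by (intro mult_mono prodA_le_1 prodB_famS_le prodB_famS_nonneg) auto
    then have "wave t s z * (prodA z * prodB famS (t * z)) \<le> wave t s z * (1 * sqmod B X ^ n1)"
      by (intro mult_left_mono wave_nonneg)
    then show "peak s t z \<le> sqmod B X ^ n1 * wave t s z" by (simp add: peak_def mult.commute)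
  qed (intro integrable_continuous_real continuous_intros)+
  also have "\<dots> = sqmod B X ^ n1 * integral {0..1} (\<lambda>y. wave t s (0 + y))" by simp
  also have "\<dots> \<le> sqmod B X ^ n1 * (28 * energy t s / (real K ^ s)\<^sup>2)"
    by (intro mult_left_mono integral_wave_le assms zero_le_power sqmod_nonneg)
  finally show ?thesis .
qed

lemma measurable_prodB_sqmod [measurable]: "prodB (\<lambda>_. sqmod B) \<in> borel_measurable borel"
  by (intro measurable_prodB borel_measurable_sqmod)

definition band :: "nat \<Rightarrow> real \<Rightarrow> ennreal" where
  "band s t = (\<integral>\<^sup>+\<zeta>. ennreal (real K ^ s * (wave t s \<zeta> * (prodA \<zeta> * prodB (\<lambda>_. sqmod B) (t * \<zeta>))))
     * indicator {1<..real K ^ m} \<zeta> \<partial>lborel)"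

text \<open>On \<open>[0, K ^ m]\<close> positive definiteness gives \<open>1 / (2 * K ^ 2)\<close>
  after scaling by \<open>K ^ s\<close>. By \<open>nz\<close> the damped part on
  \<open>[0, 1]\<close> accounts for at most half of it.\<close>

lemma peak_lower:
  fixes M :: real
  assumes t: "t \<ge> 0" and en: "real (energy t s) \<le> 4 * M * real K ^ s"
    and nz: "sqmod B X ^ n1 * (112 * M) \<le> 1 / (4 * (real K)\<^sup>2)" and m: "m > 0"
  shows "1 / (4 * (real K)\<^sup>2) \<le> real K ^ s * integral {1..real K ^ m} (peak s t)"
proof -
  let ?L = "real K ^ m"
  have K0: "real K > 0" "real K \<ge> 1" using K4 by auto
  have L: "?L \<ge> 1" "?L > 0" using K0 by (auto intro: one_le_power)
  have ii: "peak s t integrable_on {a..b}" for a b by (intro integrable_continuous_real continuous_intros)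
  have "?L / 2 * (1 / real K ^ s) * (1 / real K ^ (m + 2)) \<le> integral {0..?L} (\<lambda>z. (1 - z / ?L) * peak s t z)"
    by (rule fejer_peak[OF L(2)])
  also have "\<dots> \<le> integral {0..?L} (peak s t)"
  proof (rule integral_le)
    show "(\<lambda>z. (1 - z / ?L) * peak s t z) integrable_on {0..?L}"
      using L by (intro integrable_continuous_real continuous_intros) auto
    fix z assume "z \<in> {0..?L}"
    then have "1 - z / ?L \<le> 1" using L by simp
    then show "(1 - z / ?L) * peak s t z \<le> peak s t z" using mult_right_mono[OF _ peak_nonneg, of "1 - z / ?L" 1] by simp
  qed (rule ii)
  also have "\<dots> = integral {0..1} (peak s t) + integral {1..?L} (peak s t)"
    using L Henstock_Kurzweil_Integration.integral_combine[where a = 0 and c = 1 and b = ?L and f = "peak s t"] ii by simp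
  finally have "real K ^ s * (?L / 2 * (1 / real K ^ s) * (1 / real K ^ (m + 2)))
     \<le> real K ^ s * (integral {0..1} (peak s t) + integral {1..?L} (peak s t))" by (intro mult_left_mono) auto
  moreover have "real K ^ s * (?L / 2 * (1 / real K ^ s) * (1 / real K ^ (m + 2))) = 1 / (2 * (real K)\<^sup>2)"
    using K0 by (simp add: power_add power2_eq_square)
  moreover have "real K ^ s * integral {0..1} (peak s t) \<le> 1 / (4 * (real K)\<^sup>2)"
  proof -
    have "real K ^ s * integral {0..1} (peak s t) \<le> real K ^ s * (sqmod B X ^ n1 * (28 * energy t s / (real K ^ s)\<^sup>2))"
      by (intro mult_left_mono peak_near_zero t) auto
    also have "\<dots> = sqmod B X ^ n1 * (28 * (energy t s / real K ^ s))"
      using K0 by (simp add: power2_eq_square)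
    also have "\<dots> \<le> sqmod B X ^ n1 * (28 * (4 * M))"
      using en K0 by (intro mult_left_mono zero_le_power sqmod_nonneg) (auto simp: divide_le_eq)
    also have "\<dots> \<le> 1 / (4 * (real K)\<^sup>2)" using nz by simp
    finally show ?thesis .
  qed
  ultimately have "1 / (2 * (real K)\<^sup>2) - 1 / (4 * (real K)\<^sup>2) \<le> real K ^ s * integral {1..?L} (peak s t)"
    by (simp add: distrib_left)
  moreover have "1 / (2 * (real K)\<^sup>2) - 1 / (4 * (real K)\<^sup>2) = 1 / (4 * (real K)\<^sup>2)"
    using K0 by (simp add: field_simps)
  ultimately show ?thesis by simp
qed

lemma peak_le_band_err:
  fixes M :: real
  assumes t: "t \<ge> 0" and en: "real (energy t s) \<le> 4 * M * real K ^ s"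
    and nz: "sqmod B X ^ n1 * (112 * M) \<le> 1 / (4 * (real K)\<^sup>2)" and m: "m > 0"
  shows "ennreal (1 / (4 * (real K)\<^sup>2)) \<le> ennreal T * band s t + errint s t"
proof -
  let ?L = "real K ^ m"
  let ?P = "\<lambda>\<zeta>. prodB (\<lambda>_. sqmod B) (t * \<zeta>)"
  have L: "?L \<ge> 1" using K4 by (intro one_le_power) auto
  have m1: "(\<lambda>\<zeta>. ennreal (real K ^ s * (wave t s \<zeta> * (prodA \<zeta> * ?P \<zeta>))) * indicator {1<..?L} \<zeta>) \<in> borel_measurable lborel"
    by measurable
  have m2: "(\<lambda>\<zeta>. ennreal T * (ennreal (real K ^ s * (wave t s \<zeta> * (prodA \<zeta> * ?P \<zeta>))) * indicator {1<..?L} \<zeta>)) \<in> borel_measurable lborel"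
    by measurable
  have m3: "(\<lambda>\<zeta>. ennreal (real K ^ s * (sqmod (digit_nums K A s) \<zeta> * prodA \<zeta>)) *
      ennreal (sqmod (digit_nums K B s) (t * \<zeta>) * err (t * \<zeta>)) * indicator {1<..?L} \<zeta>) \<in> borel_measurable lborel"
    by measurable
  have pw: "ennreal (real K ^ s * peak s t \<zeta>) \<le> ennreal T * ennreal (real K ^ s * (wave t s \<zeta> * (prodA \<zeta> * ?P \<zeta>)))
      + ennreal (real K ^ s * (sqmod (digit_nums K A s) \<zeta> * prodA \<zeta>)) * ennreal (sqmod (digit_nums K B s) (t * \<zeta>) * err (t * \<zeta>))" for \<zeta>
  proof -
    have "prodB famS (t * \<zeta>) \<le> T * ?P \<zeta> + err (t * \<zeta>)"
      using prodB_smear_le[of "t * \<zeta>"] by (simp add: err_def)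
    then have "real K ^ s * (wave t s \<zeta> * (prodA \<zeta> * prodB famS (t * \<zeta>))) \<le> real K ^ s * (wave t s \<zeta> * (prodA \<zeta> * (T * ?P \<zeta> + err (t * \<zeta>))))"
      by (intro mult_left_mono wave_nonneg prodA_nonneg) auto
    also have "\<dots> = T * (real K ^ s * (wave t s \<zeta> * (prodA \<zeta> * ?P \<zeta>)))
      + real K ^ s * (sqmod (digit_nums K A s) \<zeta> * prodA \<zeta>) * (sqmod (digit_nums K B s) (t * \<zeta>) * err (t * \<zeta>))"
      by (simp add: wave_def algebra_simps)
    finally have "ennreal (real K ^ s * peak s t \<zeta>) \<le> ennreal (T * (real K ^ s * (wave t s \<zeta> * (prodA \<zeta> * ?P \<zeta>)))
      + real K ^ s * (sqmod (digit_nums K A s) \<zeta> * prodA \<zeta>) * (sqmod (digit_nums K B s) (t * \<zeta>) * err (t * \<zeta>)))"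
      unfolding peak_def by (rule ennreal_leI)
    also have "\<dots> = ennreal T * ennreal (real K ^ s * (wave t s \<zeta> * (prodA \<zeta> * ?P \<zeta>)))
      + ennreal (real K ^ s * (sqmod (digit_nums K A s) \<zeta> * prodA \<zeta>)) * ennreal (sqmod (digit_nums K B s) (t * \<zeta>) * err (t * \<zeta>))"
    proof -
      have n: "0 \<le> T" "0 \<le> real K ^ s * (wave t s \<zeta> * (prodA \<zeta> * ?P \<zeta>))"
        "0 \<le> real K ^ s * (sqmod (digit_nums K A s) \<zeta> * prodA \<zeta>)" "0 \<le> sqmod (digit_nums K B s) (t * \<zeta>) * err (t * \<zeta>)"
        using T by (auto intro!: mult_nonneg_nonneg wave_nonneg prodA_nonneg prodB_sqmod_nonneg sqmod_nonneg err_nonneg)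
      show ?thesis
        unfolding ennreal_mult'[OF n(1), symmetric] ennreal_mult'[OF n(3), symmetric]
        by (rule ennreal_plus) (intro mult_nonneg_nonneg[OF n(1) n(2)] mult_nonneg_nonneg[OF n(3) n(4)])+
    qed
    finally show ?thesis .
  qed
  have "ennreal (1 / (4 * (real K)\<^sup>2)) \<le> ennreal (real K ^ s * integral {1..?L} (peak s t))"
    by (intro ennreal_leI peak_lower[OF assms])
  also have "real K ^ s * integral {1..?L} (peak s t) = integral {1..?L} (\<lambda>\<zeta>. real K ^ s * peak s t \<zeta>)" by simp
  also have "ennreal (integral {1..?L} (\<lambda>\<zeta>. real K ^ s * peak s t \<zeta>)) = (\<integral>\<^sup>+\<zeta>. ennreal (real K ^ s * peak s t \<zeta>) * indicator {1<..?L} \<zeta> \<partial>lborel)"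
    unfolding nn_integral_Ioc_eq_Icc
    by (rule nn_integral_Icc_continuous[symmetric]) (auto intro!: continuous_intros mult_nonneg_nonneg peak_nonneg)
  also have "\<dots> \<le> (\<integral>\<^sup>+\<zeta>. (ennreal T * (ennreal (real K ^ s * (wave t s \<zeta> * (prodA \<zeta> * ?P \<zeta>))) * indicator {1<..?L} \<zeta>)
      + ennreal (real K ^ s * (sqmod (digit_nums K A s) \<zeta> * prodA \<zeta>)) * ennreal (sqmod (digit_nums K B s) (t * \<zeta>) * err (t * \<zeta>)) * indicator {1<..?L} \<zeta>) \<partial>lborel)"
  proof (rule nn_integral_mono)
    fix \<zeta>
    show "ennreal (real K ^ s * peak s t \<zeta>) * indicator {1<..?L} \<zeta> \<le> (ennreal T * (ennreal (real K ^ s * (wave t s \<zeta> * (prodA \<zeta> * ?P \<zeta>))) * indicator {1<..?L} \<zeta>)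
      + ennreal (real K ^ s * (sqmod (digit_nums K A s) \<zeta> * prodA \<zeta>)) * ennreal (sqmod (digit_nums K B s) (t * \<zeta>) * err (t * \<zeta>)) * indicator {1<..?L} \<zeta>)"
      using pw[of \<zeta>] by (cases "\<zeta> \<in> {1<..?L}") auto
  qed
  also have "\<dots> = ennreal T * band s t + errint s t"
    unfolding band_def errint_def nn_integral_add[OF m2 m3] nn_integral_cmult[OF m1] ..
  finally show ?thesis .
qed

text \<open>The omitted scales contribute a factor of at least 3 / 4 to each of the two products, so
  these can be completed to the wave of generation \<open>N\<close>. Rescaling by
  \<open>K ^ r\<close> then moves the bands of different starting scales to different parts of
  \<open>[0, 1]\<close>.\<close>

lemma band_le:
  assumes t: "0 \<le> t" "t \<le> 1" and r: "s + r = N" "m + 2 \<le> r"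
  shows "band s t \<le> ennreal (2 * real K ^ N) * (\<integral>\<^sup>+z. ennreal (wave t N z) * indicator {1 / real K ^ r<..real K ^ m / real K ^ r} z \<partial>lborel)"
proof -
  have K0: "real K ^ r > 0" using K4 by simp
  have t34: "prodA \<zeta> * prodB (\<lambda>_. sqmod B) (t * \<zeta>) \<le> 2 * wave t r (\<zeta> / real K ^ r)"
    if z: "\<bar>\<zeta>\<bar> \<le> real K ^ m" "\<bar>t * \<zeta>\<bar> \<le> real K ^ m" for \<zeta>
  proof -
    have s: "{1..r} = {1..m + 2} \<union> {m + 3..r}" "{1..m + 2} \<inter> {m + 3..r} = {}" using r by auto
    let ?a = "\<Prod>l\<in>{m + 3..r}. sqmod A (\<zeta> / real K ^ l)" and ?b = "\<Prod>l\<in>{m + 3..r}. sqmod B (t * \<zeta> / real K ^ l)"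
    have eq: "wave t r (\<zeta> / real K ^ r) = (prodA \<zeta> * ?a) * (prodB (\<lambda>_. sqmod B) (t * \<zeta>) * ?b)"
      unfolding wave_prod prodA_def prodB_def s(1) by (subst (1 2) prod.union_disjoint) (use s in auto)
    have a: "3 / 4 \<le> ?a" using sqmod_tail[OF A_sub _ K4 z(1), of "{m + 3..r}"] card_A by auto
    have b: "3 / 4 \<le> ?b" using sqmod_tail[OF B_sub _ K4 z(2), of "{m + 3..r}"] card_B by auto
    have ab: "3 / 4 * (3 / 4) \<le> ?a * ?b" using a b by (intro mult_mono) auto
    have P0: "0 \<le> prodA \<zeta> * prodB (\<lambda>_. sqmod B) (t * \<zeta>)" by (intro mult_nonneg_nonneg prodA_nonneg prodB_sqmod_nonneg)
    have "prodA \<zeta> * prodB (\<lambda>_. sqmod B) (t * \<zeta>) * 1 \<le> prodA \<zeta> * prodB (\<lambda>_. sqmod B) (t * \<zeta>) * (2 * (?a * ?b))"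
      using ab by (intro mult_left_mono P0) simp
    then show ?thesis unfolding eq by (simp add: ac_simps)
  qed
  have wz: "wave t s \<zeta> * wave t r (\<zeta> / real K ^ r) = wave t N (\<zeta> / real K ^ r)" for \<zeta>
    unfolding r(1)[symmetric] wave_add using K0 by simp
  have "band s t \<le> (\<integral>\<^sup>+\<zeta>. ennreal (2 * real K ^ s) * (ennreal (wave t N (\<zeta> / real K ^ r)) * indicator {1<..real K ^ m} \<zeta>) \<partial>lborel)"
    unfolding band_def
  proof (rule nn_integral_mono)
    fix \<zeta>
    show "ennreal (real K ^ s * (wave t s \<zeta> * (prodA \<zeta> * prodB (\<lambda>_. sqmod B) (t * \<zeta>)))) * indicator {1<..real K ^ m} \<zeta>
       \<le> ennreal (2 * real K ^ s) * (ennreal (wave t N (\<zeta> / real K ^ r)) * indicator {1<..real K ^ m} \<zeta>)"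
    proof (cases "\<zeta> \<in> {1<..real K ^ m}")
      case True
      have "t * \<zeta> \<le> 1 * \<zeta>" using t True by (intro mult_right_mono) auto
      then have "\<bar>t * \<zeta>\<bar> \<le> \<zeta>" using True t by (simp add: abs_mult)
      then have z: "\<bar>\<zeta>\<bar> \<le> real K ^ m" "\<bar>t * \<zeta>\<bar> \<le> real K ^ m" using True by auto
      have "real K ^ s * (wave t s \<zeta> * (prodA \<zeta> * prodB (\<lambda>_. sqmod B) (t * \<zeta>)))
         \<le> real K ^ s * (wave t s \<zeta> * (2 * wave t r (\<zeta> / real K ^ r)))"
        by (intro mult_left_mono t34 z wave_nonneg) auto
      also have "\<dots> = 2 * real K ^ s * wave t N (\<zeta> / real K ^ r)" unfolding wz[symmetric] by simp
      finally have "ennreal (real K ^ s * (wave t s \<zeta> * (prodA \<zeta> * prodB (\<lambda>_. sqmod B) (t * \<zeta>))))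
         \<le> ennreal (2 * real K ^ s) * ennreal (wave t N (\<zeta> / real K ^ r))"
        by (subst ennreal_mult'[symmetric]) (auto intro: ennreal_leI)
      then show ?thesis using True by simp
    qed simp
  qed
  also have "\<dots> = ennreal (2 * real K ^ s) * (\<integral>\<^sup>+\<zeta>. ennreal (wave t N (\<zeta> / real K ^ r)) * indicator {1<..real K ^ m} \<zeta> \<partial>lborel)"
    by (rule nn_integral_cmult) measurable
  also have "(\<integral>\<^sup>+\<zeta>. ennreal (wave t N (\<zeta> / real K ^ r)) * indicator {1<..real K ^ m} \<zeta> \<partial>lborel)
     = ennreal (real K ^ r) * (\<integral>\<^sup>+z. ennreal (wave t N z) * indicator {1 / real K ^ r<..real K ^ m / real K ^ r} z \<partial>lborel)"
    using nn_integral_scale[of "\<lambda>\<zeta>. ennreal (wave t N (\<zeta> / real K ^ r))" "real K ^ r" "1 / real K ^ r" "real K ^ m / real K ^ r"] K0 K4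
    by simp
  also have "ennreal (2 * real K ^ s) * (ennreal (real K ^ r) * I) = ennreal (2 * real K ^ N) * I" for I
  proof -
    have "ennreal (2 * real K ^ s) * ennreal (real K ^ r) = ennreal (2 * real K ^ N)"
      unfolding r(1)[symmetric] by (subst ennreal_mult'[symmetric]) (auto simp: power_add mult.assoc)
    then show ?thesis by (simp only: mult.assoc[symmetric])
  qed
  finally show ?thesis .
qed

text \<open>The rescaled bands at multiples of \<open>m\<close> occupy adjacent intervals inside
  \<open>[0, 1]\<close>, so together they cost one integral of \<open>wave t N\<close>, which the
  energy bounds. The constant is \<open>2 * 28 * 4\<close>.\<close>

lemma sum_band_le:
  fixes M :: real
  assumes t: "0 \<le> t" "t \<le> 1" and N: "N = R * m + 2" and en: "real (energy t N) \<le> 4 * M * real K ^ N"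
  shows "(\<Sum>i<R. band (i * m) t) \<le> ennreal (224 * M)"
proof -
  have K0: "real K ^ n > 0" "real K \<ge> 1" for n using K4 by auto
  let ?b = "\<lambda>i. real K ^ (i * m) / real K ^ N"
  have "band (i * m) t \<le> ennreal (2 * real K ^ N) * (\<integral>\<^sup>+z. ennreal (wave t N z) * indicator {?b i<..?b (Suc i)} z \<partial>lborel)"
    if i: "i < R" for i
  proof -
    have "Suc i * m \<le> R * m" using i by (intro mult_right_mono) auto
    then have r: "i * m + (N - i * m) = N" "m + 2 \<le> N - i * m" by (auto simp: N)
    have "real K ^ N = real K ^ (i * m) * real K ^ (N - i * m)" unfolding power_add[symmetric] r(1) ..
    then have "?b i = 1 / real K ^ (N - i * m)" "?b (Suc i) = real K ^ m / real K ^ (N - i * m)"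
      using K0 by (auto simp: power_add)
    then show ?thesis using band_le[OF t r] by simp
  qed
  then have "(\<Sum>i<R. band (i * m) t) \<le> (\<Sum>i<R. ennreal (2 * real K ^ N) * (\<integral>\<^sup>+z. ennreal (wave t N z) * indicator {?b i<..?b (Suc i)} z \<partial>lborel))"
    by (intro sum_mono) auto
  also have "\<dots> = ennreal (2 * real K ^ N) * (\<integral>\<^sup>+z. (\<Sum>i<R. ennreal (wave t N z) * indicator {?b i<..?b (Suc i)} z) \<partial>lborel)"
  proof -
    have "(\<integral>\<^sup>+z. (\<Sum>i<R. ennreal (wave t N z) * indicator {?b i<..?b (Suc i)} z) \<partial>lborel)
      = (\<Sum>i<R. \<integral>\<^sup>+z. ennreal (wave t N z) * indicator {?b i<..?b (Suc i)} z \<partial>lborel)"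
      by (rule nn_integral_sum) measurable
    then show ?thesis by (simp only: sum_distrib_left)
  qed
  also have "\<dots> \<le> ennreal (2 * real K ^ N) * (\<integral>\<^sup>+z. ennreal (wave t N z) * indicator {0..1} z \<partial>lborel)"
  proof (intro mult_left_mono nn_integral_mono)
    fix z
    have "?b i \<le> ?b (Suc i)" for i using K0 by (intro divide_right_mono power_increasing) auto
    then have "(\<Sum>i<R. indicator {?b i<..?b (Suc i)} z :: ennreal) = indicator {?b 0<..?b R} z"
      by (rule sum_indicator_shells)
    moreover have "?b 0 \<ge> 0" using K0 by simp
    moreover have "?b R \<le> 1" proof -
      have "real K ^ (R * m) \<le> real K ^ N" using K0 by (intro power_increasing) (auto simp: N)
      then show ?thesis using K0(1)[of N] by (simp only: divide_le_eq_1_pos)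
    qed
    moreover have "(indicator {p<..q} z :: ennreal) \<le> indicator {0..1} z" if "0 \<le> p" "q \<le> 1" for p q :: real
      using that by (auto split: split_indicator)
    ultimately have "(\<Sum>i<R. indicator {?b i<..?b (Suc i)} z :: ennreal) \<le> indicator {0..1} z"
      by (simp only:)
    then show "(\<Sum>i<R. ennreal (wave t N z) * indicator {?b i<..?b (Suc i)} z) \<le> ennreal (wave t N z) * indicator {0..1} z"
      unfolding sum_distrib_left[symmetric] by (rule mult_left_mono) simp
  qed simp
  also have "\<dots> \<le> ennreal (2 * real K ^ N) * ennreal (28 * energy t N / (real K ^ N)\<^sup>2)"
    by (intro mult_left_mono nn_integral_wave_le t) simp
  also have "\<dots> = ennreal (56 * (energy t N / real K ^ N))"
    using K0 by (subst ennreal_mult'[symmetric]) (auto simp: power2_eq_square)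
  also have "\<dots> \<le> ennreal (224 * M)"
    using en K0(1)[of N] by (intro ennreal_leI) (simp add: divide_le_eq)
  finally show ?thesis .
qed

text \<open>Add up \<open>peak_le_band_err\<close> over \<open>R\<close> starting scales. The bands
  contribute \<open>O(M * T)\<close> in total, so for larger \<open>R\<close> the errors must supply
  at least half of the sum, and Markov's inequality bounds the set of slopes where they do.\<close>

theorem bad_slopes:
  fixes M :: real
  assumes nz: "sqmod B X ^ n1 * (112 * M) \<le> 1 / (4 * (real K)\<^sup>2)" and n1: "n1 > 0" and M: "M \<ge> 0"
    and R: "R > 0" "8 * (real K)\<^sup>2 * (224 * M * T) < real R"
  shows "\<exists>Bad\<in>sets borel. emeasure lborel Bad \<le> ennreal (8 * real K ^ 5 * real m * loss) \<and>
    (\<forall>t. 0 \<le> t \<longrightarrow> t \<le> 1 \<longrightarrow> (\<forall>n\<le>R * m + 2. real (energy t n) \<le> 4 * M * real K ^ n) \<longrightarrow> t \<in> Bad)"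
proof -
  have m0: "m > 0" using n1 by (simp add: m_def G_def)
  have K0: "real K > 0" using K4 by simp
  define F where "F t = (\<Sum>i<R. errint (i * m) t)" for t
  have mF [measurable]: "F \<in> borel_measurable borel" unfolding F_def by measurable
  define c where "c = 8 * (real K)\<^sup>2 / R"
  have c: "c > 0" using K0 R by (simp add: c_def)
  define Bad where "Bad = {t\<in>{0..1}. 1 \<le> ennreal c * F t}"
  have "Bad \<in> sets borel" unfolding Bad_def by measurable
  moreover have "emeasure lborel Bad \<le> ennreal (8 * real K ^ 5 * real m * loss)"
  proof -
    have "emeasure lborel Bad \<le> ennreal c * (\<integral>\<^sup>+t. F t * indicator {0..1} t \<partial>lborel)"
      unfolding Bad_def by (rule nn_integral_Markov_inequality) measurable
    also have "(\<integral>\<^sup>+t. F t * indicator {0..1} t \<partial>lborel) = (\<Sum>i<R. \<integral>\<^sup>+t. errint (i * m) t * indicator {0..1} t \<partial>lborel)"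
      unfolding F_def sum_distrib_right by (rule nn_integral_sum) measurable
    also have "\<dots> \<le> (\<Sum>i<R. ennreal (real m * (real K ^ 3 * loss)))" by (intro sum_mono integral_errint_le)
    also have "\<dots> = ennreal (real R * (real m * (real K ^ 3 * loss)))"
      using loss_nonneg by (simp add: ennreal_of_nat_eq_real_of_nat ennreal_mult'[symmetric])
    finally have "emeasure lborel Bad \<le> ennreal c * ennreal (real R * (real m * (real K ^ 3 * loss)))"
      by (simp add: mult_left_mono)
    also have "\<dots> = ennreal (8 * real K ^ 5 * real m * loss)"
    proof -
      have "c * (real R * (real m * (real K ^ 3 * loss))) = 8 * ((real K)\<^sup>2 * real K ^ 3) * real m * loss"
        using R by (simp add: c_def)
      also have "(real K)\<^sup>2 * real K ^ 3 = real K ^ 5" by (simp flip: power_add)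
      finally show ?thesis using c by (simp only: ennreal_mult'[symmetric] less_imp_le)
    qed
    finally show ?thesis .
  qed
  moreover have "t \<in> Bad" if t: "0 \<le> t" "t \<le> 1" and en: "\<And>n. n \<le> R * m + 2 \<Longrightarrow> real (energy t n) \<le> 4 * M * real K ^ n" for t
  proof (rule ccontr)
    assume "t \<notin> Bad"
    then have "ennreal c * F t < 1" using t by (auto simp: Bad_def)
    have Ffin: "F t < ennreal (1 / c)"
    proof (rule ccontr)
      assume "\<not> F t < ennreal (1 / c)"
      then have "ennreal c * ennreal (1 / c) \<le> ennreal c * F t" by (intro mult_left_mono) auto
      then show False using \<open>ennreal c * F t < 1\<close> c by (simp add: ennreal_mult'[symmetric])
    qed
    have "(\<Sum>i<R. ennreal (1 / (4 * (real K)\<^sup>2))) \<le> (\<Sum>i<R. ennreal T * band (i * m) t + errint (i * m) t)"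
    proof (rule sum_mono)
      fix i assume "i \<in> {..<R}"
      then have "i * m \<le> R * m" by (intro mult_right_mono) auto
      then show "ennreal (1 / (4 * (real K)\<^sup>2)) \<le> ennreal T * band (i * m) t + errint (i * m) t"
        by (intro peak_le_band_err[OF t(1) en nz m0]) linarith
    qed
    also have "\<dots> = ennreal T * (\<Sum>i<R. band (i * m) t) + F t"
      by (simp add: sum.distrib sum_distrib_left F_def)
    also have "\<dots> \<le> ennreal T * ennreal (224 * M) + ennreal (1 / c)"
      using Ffin by (intro add_mono mult_left_mono sum_band_le[OF t refl] en) auto
    finally have "ennreal (R * (1 / (4 * (real K)\<^sup>2))) \<le> ennreal (T * (224 * M) + 1 / c)"
      using T M c by (simp add: ennreal_of_nat_eq_real_of_nat ennreal_mult'[symmetric] ennreal_plus[symmetric] del: ennreal_plus)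
    then have "R * (1 / (4 * (real K)\<^sup>2)) \<le> T * (224 * M) + 1 / c"
      using T M c by (subst (asm) ennreal_le_iff) auto
    moreover have "1 / c = R / (8 * (real K)\<^sup>2)" by (simp add: c_def)
    moreover have "R * (1 / (4 * (real K)\<^sup>2)) = R / (8 * (real K)\<^sup>2) + R / (8 * (real K)\<^sup>2)"
      by simp
    ultimately have "R / (8 * (real K)\<^sup>2) \<le> T * (224 * M)" by linarith
    then have "real R \<le> T * (224 * M) * (8 * (real K)\<^sup>2)" using K0 by (simp add: divide_le_eq)
    then show False using R(2) by (simp add: ac_simps)
  qed
  ultimately show ?thesis by blast
qed

end

section \<open>Choice of parameters\<close>

text \<open>For absorbing powers of \<open>J\<close>, which are logarithms of \<open>M\<close>; the
  cube is the highest power that occurs.\<close>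

lemma cube_exp_bound:
  fixes c :: real
  assumes "c > 0"
  shows "real J ^ 3 * exp (- (c * real J)) \<le> (3 / c) ^ 3"
proof -
  have "c * real J / 3 \<le> exp (c * real J / 3)"
    using exp_ge_add_one_self[of "c * real J / 3"] by linarith
  then have "(c * real J / 3) ^ 3 \<le> exp (c * real J / 3) ^ 3" using assms by (intro power_mono) auto
  also have "\<dots> = exp (c * real J)" by (simp add: exp_of_nat_mult[symmetric])
  finally have "(c / 3) ^ 3 * real J ^ 3 \<le> exp (c * real J)" by (simp add: power_mult_distrib power_divide)
  then have "real J ^ 3 \<le> exp (c * real J) * (3 / c) ^ 3" using assms by (simp add: power_divide field_simps)
  then have "real J ^ 3 * exp (- (c * real J)) \<le> exp (c * real J) * (3 / c) ^ 3 * exp (- (c * real J))"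
    by (intro mult_right_mono) auto
  also have "\<dots> = (3 / c) ^ 3 * (exp (c * real J) * exp (- (c * real J)))" by (simp only: ac_simps)
  also have "\<dots> = (3 / c) ^ 3" by (simp only: exp_add[symmetric]) simp
  finally show ?thesis .
qed

context digit_pair begin

text \<open>Every ordered pair of different digits loses at least \<open>8 * X ^ 2\<close>, and
  there are at least two such pairs. This damping rate decides how many scales have to be
  smeared.\<close>

lemma sqmod_smear_point_le:
  assumes X: "0 \<le> X" "real K * X \<le> 1 / 4"
  shows "sqmod B X \<le> 1 - 16 / (real (card B))\<^sup>2 * X\<^sup>2"
proof -
  let ?n = "real (card B)"
  have n: "?n > 0" using card_B by simp
  have ge: "(if b = b' then 0 else 8 * X\<^sup>2) \<le> 1 - cos (2 * pi * (real b - real b') * X)" if "b \<in> B" "b' \<in> B" for b b'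
  proof (cases "b = b'")
    case False
    define y where "y = \<bar>real b - real b'\<bar> * X"
    have "b < K" "b' < K" using that B_sub by auto
    then have d: "\<bar>real b - real b'\<bar> \<le> real K" "1 \<le> \<bar>real b - real b'\<bar>" using False by auto
    have y: "X \<le> y" "y \<le> 1 / 4"
      unfolding y_def using X d mult_right_mono[OF d(1) X(1)] mult_right_mono[OF d(2) X(1)] by auto
    have s: "2 * y \<le> sin (pi * y)" using y X by (intro sin_ge_half) auto
    have "cos (2 * pi * (real b - real b') * X) = cos (2 * (pi * y))"
    proof -
      have "\<bar>2 * pi * (real b - real b') * X\<bar> = 2 * (pi * y)" using X by (simp add: y_def abs_mult)
      then show ?thesis by (metis cos_abs_real)
    qed
    also have "\<dots> = 1 - 2 * (sin (pi * y))\<^sup>2" by (rule cos_double_sin)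
    finally have e: "1 - cos (2 * pi * (real b - real b') * X) = 2 * (sin (pi * y))\<^sup>2" by simp
    have "(2 * X)\<^sup>2 \<le> (sin (pi * y))\<^sup>2" using s y X by (intro power_mono) auto
    then show ?thesis using e False by (simp add: power_mult_distrib)
  qed simp
  have B2: "2 \<le> ?n * ?n - ?n"
  proof -
    have "2 * (2 - 1) \<le> ?n * (?n - 1)" using card_B by (intro mult_mono) auto
    then show ?thesis by (simp add: algebra_simps)
  qed
  have "16 * X\<^sup>2 \<le> (?n * ?n - ?n) * (8 * X\<^sup>2)" using mult_right_mono[OF B2, of "8 * X\<^sup>2"] by simp
  also have "\<dots> = (\<Sum>b\<in>B. \<Sum>b'\<in>B. if b = b' then 0 else 8 * X\<^sup>2)"
  proof -
    have "(\<Sum>b'\<in>B. if b = b' then 0 else 8 * X\<^sup>2) = (?n - 1) * (8 * X\<^sup>2)" if "b \<in> B" for b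
    proof -
      have "(\<Sum>b'\<in>B. if b = b' then 0 else 8 * X\<^sup>2) = (\<Sum>b'\<in>B. 8 * X\<^sup>2 - (if b = b' then 8 * X\<^sup>2 else 0))"
        by (intro sum.cong) auto
      then show ?thesis using that finB by (simp add: sum_subtractf algebra_simps)
    qed
    then have "(\<Sum>b\<in>B. \<Sum>b'\<in>B. if b = b' then 0 else 8 * X\<^sup>2) = (\<Sum>b\<in>B. (?n - 1) * (8 * X\<^sup>2))"
      by (rule sum.cong[OF refl])
    also have "\<dots> = (?n * ?n - ?n) * (8 * X\<^sup>2)" by (simp add: algebra_simps)
    finally show ?thesis by simp
  qed
  also have "\<dots> \<le> (\<Sum>b\<in>B. \<Sum>b'\<in>B. 1 - cos (2 * pi * (real b - real b') * X))" by (intro sum_mono ge)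
  also have "\<dots> = ?n * ?n * (1 - sqmod B X)"
    using n by (simp add: sqmod_def trig_sum_def sum_subtractf sum_divide_distrib[symmetric] power2_eq_square field_simps)
  finally have "16 / (?n * ?n) * X\<^sup>2 \<le> 1 - sqmod B X" using n by (simp add: field_simps)
  then show ?thesis by (simp add: power2_eq_square)
qed

text \<open>With \<open>X = K ^ - J\<close> the stacking threshold is \<open>M = X powr - 2\<close>, smearing takes place on
  \<open>O(J * M)\<close> blocks of length \<open>O(J)\<close>, and \<open>M powr (3 + 9 / codim)\<close> generations suffice up to
  powers of \<open>J\<close>.\<close>

theorem parameter_choice:
  "\<exists>C\<ge>1. \<exists>J0\<ge>1. \<forall>J\<ge>J0. \<exists>n0 Bad. real n0 \<le> C * real K powr (real J * (12 + 18 / codim)) \<and>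
     Bad \<in> sets borel \<and> emeasure lborel Bad \<le> ennreal (C * real K powr (- 2 * real J)) \<and>
     (\<forall>t. 0 \<le> t \<longrightarrow> t \<le> 1 \<longrightarrow> t \<notin> Bad \<longrightarrow> measure lebesgue (proj t n0) \<le> C * real K powr (- 2 * real J))"
proof -
  define \<theta> where "\<theta> = codim"
  have \<theta>: "0 < \<theta>" "\<theta> < 3 / 4" using codim_bounds by (auto simp: \<theta>_def)
  define k where "k = real K"
  have k: "k \<ge> 4" using K4 by (simp add: k_def)
  have lnk: "ln k > 0" using k by simp
  obtain C1 X0 where C1: "C1 \<ge> 1" and X0: "X0 > 0" and block: "\<And>X g x. 0 < X \<Longrightarrow> X < X0 \<Longrightarrow> 1 / real K ^ g \<le> X powr (1 + 4 / \<theta>) \<Longrightarrow>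
    (\<Sum>k<K ^ Suc g. wgt g x k * tame X (X powr (- 18 / \<theta>)) expo ((x + real k) / real K ^ Suc g))
       \<le> 1 + C1 * X powr (2 + \<theta> / 3) \<and>
    (\<Sum>k<K ^ Suc g. wgt g x k * wild X (X powr (- 18 / \<theta>)) ((x + real k) / real K ^ Suc g))
       \<le> C1 * X powr (6 + \<theta>)"
    using block_bounds unfolding \<theta>_def by blast
  \<comment> \<open>A block of \<open>J * h\<close> scales must reach the resolution
    \<open>X powr (1 + 4 / \<theta>)\<close> that \<open>block_bounds\<close> asks for.\<close>
  define h where "h = nat \<lceil>1 + 4 / \<theta>\<rceil>"
  have h: "1 + 4 / \<theta> \<le> real h" unfolding h_def using \<theta> by (simp add: real_nat_ceiling_ge)
  define c where "c = 16 / (real (card B))\<^sup>2"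
  have c: "c > 0" using card_B by (simp add: c_def)
  \<comment> \<open>448 is \<open>4 * 112\<close>: the damping \<open>exp (- (l0 * j))\<close> then
    beats both the factor \<open>112 * M\<close> and the target \<open>1 / (4 * K ^ 2)\<close> in
    \<open>nz\<close>.\<close>
  define l0 where "l0 = ln (448 * k\<^sup>2) + 2 * ln k"
  have l0: "l0 > 0" 
  proof -
    have "1 < 448 * k\<^sup>2" using k by (simp add: less_1_mult power2_eq_square)
    then have "0 < ln (448 * k\<^sup>2)" by (rule ln_gt_zero)
    then show ?thesis unfolding l0_def using lnk by linarith
  qed
  define C2 where "C2 = l0 / c + 1"
  have C2: "C2 \<ge> 1" using l0 c by (simp add: C2_def)
  define C3 where "C3 = (3 / (\<theta> / 3 * ln k)) ^ 3"
  have C3: "C3 \<ge> 0" using \<theta> lnk by (simp add: C3_def)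
  define C4 where "C4 = real h + 1"
  define E where "E = exp (C1 * C2 * C3)"
  have E: "E \<ge> 1" unfolding E_def using C1 C2 C3 by simp
  define C5 where "C5 = 2 * E + C2 * C1"
  have C5: "C5 \<ge> 1" unfolding C5_def using E C1 C2 by (simp add: add_increasing2)
  define C7 where "C7 = 8 * k ^ 5 * (C2 * C4 * C5) * C3"
  define C8 where "C8 = 1792 * k\<^sup>2 + 2"
  define C9 where "C9 = C8 * C2 * C4 + 2"
  define C10 where "C10 = 32 * k * ln k + 1"
  define C11 where "C11 = C10 * C9"
  define C6 where "C6 = (3 / (6 * ln k)) ^ 3"
  define C where "C = 22 + C7 + C11 * C6"
  have pos: "C4 \<ge> 1" "C7 \<ge> 0" "C8 \<ge> 1" "C9 \<ge> 1" "C10 \<ge> 1" "C11 \<ge> 1" "C6 \<ge> 0"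
  proof -
    show C4: "C4 \<ge> 1" by (simp add: C4_def)
    show "C7 \<ge> 0" unfolding C7_def using C4 C2 C5 C3 k by simp
    show C8: "C8 \<ge> 1" by (simp add: C8_def)
    show C9: "C9 \<ge> 1" unfolding C9_def using C8 C2 C4 by (simp add: add_increasing)
    show C10: "C10 \<ge> 1" unfolding C10_def using k lnk by simp
    show "C11 \<ge> 1" unfolding C11_def using mult_mono[OF C10 C9] C10 by simp
    show "C6 \<ge> 0" using lnk by (simp add: C6_def)
  qed
  have C: "C \<ge> 22" "C \<ge> C7" "C \<ge> C11 * C6" "C \<ge> 1" using pos by (auto simp: C_def)
  obtain J1 :: nat where J1: "real J1 > 1 / X0" using reals_Archimedean2 by blast
  define J0 where "J0 = max 2 J1"
  have main: "\<exists>n0 Bad. real n0 \<le> C * k powr (real J * (12 + 18 / \<theta>)) \<and>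
     Bad \<in> sets borel \<and> emeasure lborel Bad \<le> ennreal (C * k powr (- 2 * real J)) \<and>
     (\<forall>t. 0 \<le> t \<longrightarrow> t \<le> 1 \<longrightarrow> t \<notin> Bad \<longrightarrow> measure lebesgue (proj t n0) \<le> C * k powr (- 2 * real J))"
    if J: "J \<ge> J0" for J
  proof -
    have J2: "J \<ge> 2" "J \<ge> J1" using J by (auto simp: J0_def)
    define j where "j = real J"
    have j: "j \<ge> 1" "j > 0" using J2 by (auto simp: j_def)
    have decay: "j ^ 3 * k powr (- (d * j)) \<le> (3 / (d * ln k)) ^ 3" if "d > 0" for d
      using cube_exp_bound[of "d * ln k" J] that lnk k by (simp add: powr_def j_def ac_simps)
    define X where "X = k powr (- j)"
    define M where "M = k powr (2 * j)"
    have X: "X > 0" unfolding X_def using k by simp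
    have Xpow: "X powr a = k powr (- (a * j))" for a by (simp add: X_def powr_powr mult.commute)
    have kJ: "k powr j = k ^ J" using k by (simp add: j_def powr_realpow)
    have XJ: "X = 1 / k ^ J" unfolding X_def powr_minus_divide kJ ..
    have Xlt: "X < X0"
    proof -
      have "real J < k ^ J"
      proof -
        have "J < 2 ^ J" by (rule less_exp)
        also have "\<dots> \<le> K ^ J" using K4 by (intro power_mono) auto
        finally have "J < K ^ J" .
        then show ?thesis unfolding k_def by (metis of_nat_less_iff of_nat_power)
      qed
      then have "1 / X0 < k ^ J" using J1 J2 by (meson less_le_trans of_nat_le_iff order_less_trans less_trans)
      then show ?thesis using X0 k unfolding XJ by (simp add: field_simps)
    qed
    have KX: "real K * X \<le> 1 / 4"
    proof -
      have "k * (4::real) \<le> k * k" using k by simp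
      also have "k * k = k ^ 2" by (simp add: power2_eq_square)
      also have "\<dots> \<le> k ^ J" using k J2 by (intro power_increasing) auto
      finally show ?thesis unfolding XJ k_def[symmetric] using k by (simp add: field_simps)
    qed
    have M2: "M = 1 / X\<^sup>2" using X k by (simp add: M_def X_def powr_minus_divide power_divide powr_power mult.commute)
    have M1: "M > 1" unfolding M_def using k j by (intro gr_one_powr) auto
    have MX: "M * X powr a = k powr ((2 - a) * j)" for a
      unfolding M_def Xpow powr_add[symmetric] by (simp add: algebra_simps)
    have lnM: "ln M = 2 * j * ln k" unfolding M_def using k by (simp add: ln_powr)
    define T where "T = X powr (- 18 / \<theta>)"
    have Tk: "T = k powr (18 / \<theta> * j)" unfolding T_def Xpow by simp
    define \<sigma> where "\<sigma> = expo"
    have \<sigma>: "0 < \<sigma>" "\<sigma> \<le> 1" using expo_bounds by (auto simp: \<sigma>_def)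
    have T2: "T \<ge> 2"
    proof -
      have "k powr 1 \<le> k powr (18 / \<theta> * j)"
      proof (rule powr_mono)
        have "1 \<le> 18 / \<theta>" using \<theta> by (simp add: field_simps)
        then have "1 * 1 \<le> 18 / \<theta> * j" using j by (intro mult_mono) linarith+
        then show "1 \<le> 18 / \<theta> * j" by (simp only: mult_1_left)
      qed (use k in simp)
      then show ?thesis unfolding Tk using k by simp
    qed
    have Ts: "T powr (- \<sigma>) = X powr (4 + 2 * \<theta> / 3)"
      unfolding T_def powr_powr using \<theta> by (intro arg_cong2[where f = "(powr)"] refl) (simp add: \<sigma>_def expo_def \<theta>_def field_simps)
    define g where "g = J * h"
    have g: "1 / real K ^ g \<le> X powr (1 + 4 / \<theta>)"
    proof -
      have "k powr ((1 + 4 / \<theta>) * j) \<le> k powr (real h * j)" using k j h by (intro powr_mono mult_right_mono) auto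
      also have "\<dots> = k ^ g" using k by (simp add: g_def j_def powr_realpow[symmetric] mult.commute)
      finally show ?thesis unfolding Xpow powr_minus_divide k_def[symmetric] using k by (intro divide_left_mono) auto
    qed
    define \<epsilon> where "\<epsilon> = C1 * X powr (2 + \<theta> / 3)"
    define \<omega> where "\<omega> = C1 * X powr (6 + \<theta>)"
    \<comment> \<open>One smeared scale damps the peak by \<open>exp (- c / M)\<close>, so this many
      give \<open>exp (- (l0 * j))\<close>.\<close>
    define n1 where "n1 = nat \<lceil>M * (l0 / c) * j\<rceil>"
    have n1_pos: "M * (l0 / c) * j > 0" using M1 l0 c j by simp
    have n1: "M * (l0 / c) * j \<le> real n1" "real n1 \<le> C2 * (j * M)" "n1 > 0"
    proof -
      show "M * (l0 / c) * j \<le> real n1" unfolding n1_def by (rule real_nat_ceiling_ge)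
      then show "n1 > 0" using n1_pos by linarith
      have "real n1 \<le> M * (l0 / c) * j + 1" unfolding n1_def using n1_pos by (simp add: of_nat_nat)
      also have "1 \<le> j * M" using j M1 mult_mono[of 1 j 1 M] by simp
      then have "M * (l0 / c) * j + 1 \<le> M * (l0 / c) * j + j * M" by simp
      finally show "real n1 \<le> C2 * (j * M)" by (simp add: C2_def algebra_simps)
    qed
    interpret smeared K A B X T \<sigma> \<epsilon> \<omega> g n1
    proof unfold_locales
      show "0 < X" "real K * X \<le> 1 / 4" "2 \<le> T" "0 < \<sigma>" "\<sigma> \<le> 1" using X KX T2 \<sigma> by auto
      show "0 \<le> \<epsilon>" "0 \<le> \<omega>" using C1 by (auto simp: \<epsilon>_def \<omega>_def)
      show "(\<Sum>k<K ^ Suc g. wgt g x k * tame X T \<sigma> ((x + real k) / real K ^ Suc g)) \<le> 1 + \<epsilon>"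
        "(\<Sum>k<K ^ Suc g. wgt g x k * wild X T ((x + real k) / real K ^ Suc g)) \<le> \<omega>" for x
        using block[OF X Xlt g, of x] unfolding T_def \<sigma>_def \<epsilon>_def \<omega>_def by auto
    qed
    have nz: "sqmod B X ^ n1 * (112 * M) \<le> 1 / (4 * (real K)\<^sup>2)"
    proof -
      have "sqmod B X \<le> 1 - c * X\<^sup>2" using sqmod_smear_point_le[of X] X KX unfolding c_def by simp
      also have "\<dots> \<le> exp (- (c * X\<^sup>2))" using exp_ge_add_one_self[of "- (c * X\<^sup>2)"] by simp
      finally have "sqmod B X ^ n1 \<le> exp (- (c * X\<^sup>2)) ^ n1" by (intro power_mono sqmod_nonneg)
      also have "\<dots> = exp (- (real n1 * (c * X\<^sup>2)))" by (simp add: exp_of_nat_mult[symmetric])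
      also have "\<dots> \<le> exp (- (l0 * j))"
      proof -
        have "M * (l0 / c) * j * (c * X\<^sup>2) \<le> real n1 * (c * X\<^sup>2)" using n1(1) c by (intro mult_right_mono) auto
        moreover have "M * (l0 / c) * j * (c * X\<^sup>2) = l0 * j" using c X unfolding M2 by simp
        ultimately show ?thesis by simp
      qed
      also have "\<dots> \<le> exp (- (ln (448 * k\<^sup>2) + 2 * j * ln k))"
      proof -
        have "0 \<le> ln (448 * k\<^sup>2)" using k by (intro ln_ge_zero) (simp add: power2_eq_square, use mult_mono[of 1 k 1 k] in linarith)
        then have "ln (448 * k\<^sup>2) * 1 \<le> ln (448 * k\<^sup>2) * j" using j by (intro mult_left_mono) auto
        then show ?thesis by (simp add: l0_def algebra_simps)
      qed
      also have "\<dots> = 1 / (448 * k\<^sup>2 * M)"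
      proof -
        have "exp (ln (448 * k\<^sup>2) + 2 * j * ln k) = 448 * k\<^sup>2 * M"
          using k M1 by (simp add: exp_add lnM[symmetric])
        then show ?thesis by (simp only: exp_minus inverse_eq_divide)
      qed
      finally have "sqmod B X ^ n1 * (112 * M) \<le> 1 / (448 * k\<^sup>2 * M) * (112 * M)" using M1 by (intro mult_right_mono) auto
      also have "\<dots> = 1 / (4 * (real K)\<^sup>2)" using M1 k unfolding k_def by simp
      finally show ?thesis .
    qed
    have m_le: "real m \<le> C2 * C4 * (j\<^sup>2 * M)"
    proof -
      have "real G \<le> C4 * j" unfolding G_def using j J2 by (simp add: g_def C4_def j_def algebra_simps)
      then have "real m \<le> C2 * (j * M) * (C4 * j)" unfolding m_def of_nat_mult using n1 C2 j M1 by (intro mult_mono) auto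
      then show ?thesis by (simp add: power2_eq_square ac_simps)
    qed
    have loss_le: "loss \<le> C5 * (j * X powr (4 + 2 * \<theta> / 3))"
    proof -
      have "(1 + \<epsilon>) ^ n1 \<le> exp \<epsilon> ^ n1" using eps by (intro power_mono) (auto simp: exp_ge_add_one_self)
      also have "\<dots> = exp (real n1 * \<epsilon>)" by (simp add: exp_of_nat_mult[symmetric])
      also have "\<dots> \<le> exp (C1 * C2 * C3)"
      proof -
        have "real n1 * \<epsilon> \<le> C2 * (j * M) * \<epsilon>" using n1 eps by (intro mult_right_mono) auto
        also have "\<dots> = C1 * C2 * (j * (M * X powr (2 + \<theta> / 3)))" by (simp add: \<epsilon>_def)
        \<comment> \<open>The balance \<open>M = X powr - 2\<close> is used here: the surplus
          \<open>\<theta> / 3\<close> in the exponent pays for the factor \<open>j\<close>, and the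
          errors of all blocks together stay bounded.\<close>
        also have "M * X powr (2 + \<theta> / 3) = k powr (- (\<theta> / 3 * j))" unfolding MX by simp
        also have "j * k powr (- (\<theta> / 3 * j)) \<le> j ^ 3 * k powr (- (\<theta> / 3 * j))"
          using j power_increasing[of 1 3 j] by (intro mult_right_mono) auto
        also have "\<dots> \<le> C3" unfolding C3_def using \<theta> by (intro decay) auto
        finally have "real n1 * \<epsilon> \<le> C1 * C2 * C3" using C1 C2 by (simp add: mult_left_mono)
        then show ?thesis by simp
      qed
      finally have e: "(1 + \<epsilon>) ^ n1 \<le> E" by (simp add: E_def)
      have "2 * T powr (- \<sigma>) * (1 + \<epsilon>) ^ n1 \<le> 2 * X powr (4 + 2 * \<theta> / 3) * E"
        unfolding Ts by (intro mult_left_mono e) auto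
      also have "\<dots> \<le> 2 * X powr (4 + 2 * \<theta> / 3) * E * j"
      proof -
        have "0 \<le> 2 * X powr (4 + 2 * \<theta> / 3) * E" using E by simp
        from mult_left_mono[OF j(1) this] show ?thesis by simp
      qed
      finally have a: "2 * T powr (- \<sigma>) * (1 + \<epsilon>) ^ n1 \<le> 2 * E * (j * X powr (4 + 2 * \<theta> / 3))" by (simp add: ac_simps)
      have "real n1 * \<omega> \<le> C2 * (j * M) * \<omega>" using n1 eps by (intro mult_right_mono) auto
      also have "\<dots> = C2 * C1 * (j * (M * X powr (6 + \<theta>)))" by (simp add: \<omega>_def)
      also have "M * X powr (6 + \<theta>) = X powr (4 + \<theta>)"
      proof -
        have "(2 - (6 + \<theta>)) * j = - ((4 + \<theta>) * j)" by (simp add: algebra_simps)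
        then show ?thesis by (simp only: MX) (simp only: Xpow)
      qed
      also have "C2 * C1 * (j * X powr (4 + \<theta>)) \<le> C2 * C1 * (j * X powr (4 + 2 * \<theta> / 3))"
        using C1 C2 j X k \<theta> by (intro mult_left_mono powr_mono') (auto simp: XJ)
      finally show ?thesis using a unfolding loss_def C5_def by (simp add: distrib_right)
    qed
    have bad_le: "8 * real K ^ 5 * real m * loss \<le> C7 * k powr (- 2 * j)"
    proof -
      have "8 * real K ^ 5 * real m * loss \<le> 8 * real K ^ 5 * (C2 * C4 * (j\<^sup>2 * M)) * (C5 * (j * X powr (4 + 2 * \<theta> / 3)))"
        using loss_nonneg m_le C2 C4_def M1 by (intro mult_mono mult_left_mono loss_le) auto
      also have "\<dots> = 8 * k ^ 5 * (C2 * C4 * C5) * (j ^ 3 * (M * X powr (4 + 2 * \<theta> / 3)))"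
        by (simp add: k_def power2_eq_square power3_eq_cube ac_simps)
      also have "M * X powr (4 + 2 * \<theta> / 3) = k powr (- (2 * \<theta> / 3 * j)) * k powr (- 2 * j)"
        unfolding MX powr_add[symmetric] by (simp add: algebra_simps)
      also have "j ^ 3 * (k powr (- (2 * \<theta> / 3 * j)) * k powr (- 2 * j)) \<le> C3 * k powr (- 2 * j)"
      proof -
        have "j ^ 3 * k powr (- (2 * \<theta> / 3 * j)) \<le> j ^ 3 * k powr (- (\<theta> / 3 * j))"
          using k \<theta> j by (intro mult_left_mono powr_mono) auto
        also have "\<dots> \<le> C3" unfolding C3_def using \<theta> by (intro decay) auto
        finally have "j ^ 3 * k powr (- (2 * \<theta> / 3 * j)) * k powr (- 2 * j) \<le> C3 * k powr (- 2 * j)" by (intro mult_right_mono) auto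
        then show ?thesis by (simp only: mult.assoc)
      qed
      finally have "8 * real K ^ 5 * real m * loss \<le> 8 * k ^ 5 * (C2 * C4 * C5) * (C3 * k powr (- 2 * j))"
        using k C2 C5 pos by (simp add: mult_left_mono)
      then show ?thesis by (simp add: C7_def ac_simps)
    qed
    define R where "R = nat \<lceil>8 * (real K)\<^sup>2 * (224 * M * T)\<rceil> + 1"
    have R: "R > 0" "8 * (real K)\<^sup>2 * (224 * M * T) < real R" "real R \<le> C8 * (M * T)"
    proof -
      have p: "0 \<le> 8 * (real K)\<^sup>2 * (224 * M * T)" using M1 T2 by simp
      show "R > 0" by (simp add: R_def)
      show "8 * (real K)\<^sup>2 * (224 * M * T) < real R"
        using real_nat_ceiling_ge[of "8 * (real K)\<^sup>2 * (224 * M * T)"] by (simp add: R_def)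
      have "real (nat \<lceil>8 * (real K)\<^sup>2 * (224 * M * T)\<rceil>) \<le> 8 * (real K)\<^sup>2 * (224 * M * T) + 1"
        using p by (simp add: of_nat_nat)
      then have "real R \<le> 8 * (real K)\<^sup>2 * (224 * M * T) + 2 * 1" by (simp add: R_def)
      also have "1 \<le> M * T" using M1 T2 mult_mono[of 1 M 1 T] by simp
      then have "8 * (real K)\<^sup>2 * (224 * M * T) + 2 * 1 \<le> 8 * (real K)\<^sup>2 * (224 * M * T) + 2 * (M * T)" by simp
      finally show "real R \<le> C8 * (M * T)" by (simp add: C8_def k_def algebra_simps)
    qed
    define N where "N = R * m + 2"
    have MT1: "1 \<le> M * T" using M1 T2 mult_mono[of 1 M 1 T] by simp
    have N_le: "real N \<le> C9 * (j\<^sup>2 * M * (M * T))"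
    proof -
      have "real R * real m \<le> C8 * (M * T) * (C2 * C4 * (j\<^sup>2 * M))"
        using R m_le pos M1 T2 by (intro mult_mono) auto
      moreover have "1 \<le> j\<^sup>2 * M * (M * T)"
      proof -
        have "1 \<le> j\<^sup>2" using j by simp
        then have "1 * 1 \<le> j\<^sup>2 * M" using M1 by (intro mult_mono) auto
        then have "1 * 1 \<le> j\<^sup>2 * M * (M * T)" using MT1 by (intro mult_mono) auto
        then show ?thesis by simp
      qed
      ultimately show ?thesis by (simp add: N_def C9_def algebra_simps)
    qed
    define L where "L = nat \<lceil>16 * real K * M * ln M\<rceil>"
    have L: "16 * real K * M * ln M \<le> real L" "real L \<le> C10 * (j * M)"
    proof -
      have p: "0 \<le> 16 * real K * M * ln M" using M1 by simp
      show "16 * real K * M * ln M \<le> real L" unfolding L_def by (rule real_nat_ceiling_ge)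
      have "real L \<le> 16 * real K * M * ln M + 1" unfolding L_def using p by (simp add: of_nat_nat)
      also have "1 \<le> j * M" using j M1 mult_mono[of 1 j 1 M] by simp
      then have "16 * real K * M * ln M + 1 \<le> 16 * real K * M * ln M + j * M" by simp
      finally show "real L \<le> C10 * (j * M)" by (simp add: C10_def lnM k_def algebra_simps)
    qed
    have n0: "real (L * N) \<le> C * k powr (j * (12 + 18 / \<theta>))"
    proof -
      have "real (L * N) \<le> C10 * (j * M) * (C9 * (j\<^sup>2 * M * (M * T)))"
        unfolding of_nat_mult using L N_le pos j M1 by (intro mult_mono) auto
      also have "\<dots> = C11 * (j ^ 3 * (M * M * M * T))" by (simp add: C11_def power2_eq_square power3_eq_cube ac_simps)
      \<comment> \<open>Allowing \<open>M ^ 6\<close> instead of \<open>M ^ 3\<close> leaves the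
        factor \<open>k powr (- (6 * j))\<close>, which absorbs \<open>j ^ 3\<close>.\<close>
      also have "M * M * M * T = k powr (- (6 * j)) * k powr (j * (12 + 18 / \<theta>))"
        unfolding M_def Tk powr_add[symmetric] by (simp add: algebra_simps)
      also have "j ^ 3 * (k powr (- (6 * j)) * k powr (j * (12 + 18 / \<theta>))) \<le> C6 * k powr (j * (12 + 18 / \<theta>))"
        unfolding mult.assoc[symmetric] C6_def by (intro mult_right_mono decay) auto
      finally have "real (L * N) \<le> C11 * (C6 * k powr (j * (12 + 18 / \<theta>)))" using pos by (simp add: mult_left_mono)
      also have "\<dots> \<le> C * k powr (j * (12 + 18 / \<theta>))" unfolding mult.assoc[symmetric] using C by (intro mult_right_mono) auto
      finally show ?thesis .
    qed
    obtain Bad where Bad: "Bad \<in> sets borel" "emeasure lborel Bad \<le> ennreal (8 * real K ^ 5 * real m * loss)"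
      "\<And>t. 0 \<le> t \<Longrightarrow> t \<le> 1 \<Longrightarrow> (\<forall>n\<le>N. real (energy t n) \<le> 4 * M * real K ^ n) \<Longrightarrow> t \<in> Bad"
      using bad_slopes[OF nz n1(3) _ R(1,2)] M1 unfolding N_def by auto
    have "emeasure lborel Bad \<le> ennreal (C * k powr (- 2 * j))"
    proof (rule order_trans[OF Bad(2)], rule ennreal_leI, rule order_trans[OF bad_le])
      show "C7 * k powr (- 2 * j) \<le> C * k powr (- 2 * j)" using C by (intro mult_right_mono) auto
    qed
    moreover have "measure lebesgue (proj t (L * N)) \<le> C * k powr (- 2 * j)" if t: "0 \<le> t" "t \<le> 1" "t \<notin> Bad" for t
    proof -
      have "\<not> (\<forall>n\<le>N. real (energy t n) \<le> 4 * M * K ^ n)" using Bad(3)[OF t(1,2)] t(3) by auto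
      then have "measure lebesgue (proj t (L * N)) \<le> 11 * (1 + t) / M"
        using stack_dichotomy[OF t(1) M1, of L N] L(1) by auto
      also have "\<dots> \<le> 22 / M" using t M1 by (intro divide_right_mono) auto
      also have "\<dots> = 22 * k powr (- 2 * j)" by (simp add: M_def powr_minus_divide)
      also have "\<dots> \<le> C * k powr (- 2 * j)" using C by (intro mult_right_mono) auto
      finally show ?thesis .
    qed
    ultimately show ?thesis using n0 Bad(1) unfolding j_def by blast
  qed
  show ?thesis
    by (intro exI[of _ C] conjI exI[of _ J0] C) (use main in \<open>auto simp: J0_def k_def \<theta>_def\<close>)
qed

lemma proj_antimono:
  assumes "t \<ge> 0" "k \<le> N" shows "proj t N \<subseteq> proj t k"
proof
  fix x assume "x \<in> proj t N"
  then obtain d where d: "d \<in> sq N" "x \<in> {pos t d / K ^ N .. (pos t d + (1 + t)) / K ^ N}" by (auto simp: proj_def)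
  have "x \<in> {pos t (up (N - k) d) / K ^ k .. (pos t (up (N - k) d) + (1 + t)) / K ^ k}"
    using d(2) up_interval[OF assms d(1)] by auto
  then show "x \<in> proj t k" using up_sq'[OF d(1) assms(2)] by (auto simp: proj_def)
qed

lemma measure_proj_antimono:
  assumes "t \<ge> 0" "k \<le> N" shows "measure lebesgue (proj t N) \<le> measure lebesgue (proj t k)"
  by (intro measure_mono_fmeasurable proj_antimono assms lm_proj fmeasurableD)

text \<open>The admissible generations of \<open>parameter_choice\<close> grow geometrically in
  \<open>J\<close>. For arbitrary \<open>n\<close> the largest \<open>J\<close> that fits loses only
  a constant factor, because the projections decrease in \<open>n\<close>. Small \<open>n\<close>
  are covered by the trivial bound 2.\<close>

theorem slope_bound:
  assumes p: "p \<ge> 6 + 9 / codim"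
  shows "\<exists>C\<ge>0. \<forall>n\<ge>1. \<exists>Bad\<in>sets borel. emeasure lborel Bad \<le> ennreal (C * real n powr (- 1 / p)) \<and>
    (\<forall>t. 0 \<le> t \<longrightarrow> t \<le> 1 \<longrightarrow> t \<notin> Bad \<longrightarrow> measure lebesgue (proj t n) \<le> C * real n powr (- 1 / p))"
proof -
  define k where "k = real K"
  have k: "k \<ge> 4" using K4 by (simp add: k_def)
  have lnk: "ln k > 0" using k by simp
  define P where "P = 12 + 18 / codim"
  have c0: "codim > 0" by (rule codim_bounds)
  have P: "P > 12" "2 * p \<ge> P" using c0 p by (auto simp: P_def)
  obtain C J0 where C: "C \<ge> 1" and J0: "J0 \<ge> 1" and par: "\<And>J. J \<ge> J0 \<Longrightarrow> \<exists>n0 Bad. real n0 \<le> C * k powr (real J * P) \<and>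
     Bad \<in> sets borel \<and> emeasure lborel Bad \<le> ennreal (C * k powr (- 2 * real J)) \<and>
     (\<forall>t. 0 \<le> t \<longrightarrow> t \<le> 1 \<longrightarrow> t \<notin> Bad \<longrightarrow> measure lebesgue (proj t n0) \<le> C * k powr (- 2 * real J))"
    using parameter_choice unfolding k_def P_def by blast
  define D where "D = C * k powr (real J0 * P)"
  have "1 \<le> k powr (real J0 * P)" using k P by (intro ge_one_powr_ge_zero) auto
  then have D: "D \<ge> 1" unfolding D_def using C mult_mono[of 1 C 1 "k powr (real J0 * P)"] by simp
  define C' where "C' = 2 * D + C * k\<^sup>2 * C powr (2 / P)"
  have C': "C' \<ge> 2 * D" "C' \<ge> C * k\<^sup>2 * C powr (2 / P)" "C' \<ge> 0" unfolding C'_def using C D by auto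
  have "\<exists>Bad\<in>sets borel. emeasure lborel Bad \<le> ennreal (C' * real n powr (- 1 / p)) \<and>
    (\<forall>t. 0 \<le> t \<longrightarrow> t \<le> 1 \<longrightarrow> t \<notin> Bad \<longrightarrow> measure lebesgue (proj t n) \<le> C' * real n powr (- 1 / p))"
    if n: "n \<ge> 1" for n
  proof (cases "real n < D")
    case True
    have "D powr (- 1) \<le> real n powr (- 1)" using n True by (intro powr_mono2') auto
    also have "\<dots> \<le> real n powr (- 1 / p)" using n P by (intro powr_mono) (auto simp: field_simps)
    finally have "1 / D \<le> real n powr (- 1 / p)" using D by (simp add: powr_minus_divide)
    then have "2 * D * (1 / D) \<le> C' * real n powr (- 1 / p)" using C' D by (intro mult_mono) auto
    then have two: "2 \<le> C' * real n powr (- 1 / p)" using D by simp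
    have "measure lebesgue (proj t n) \<le> C' * real n powr (- 1 / p)" if "0 \<le> t" "t \<le> 1" for t
      using measure_proj_le[OF that(1), of n] that two by linarith
    then show ?thesis by (intro bexI[of _ "{}"]) auto
  next
    case False
    have n0: "real n > 0" using n by simp
    define y where "y = log k (real n / C) / P"
    define J where "J = nat \<lfloor>y\<rfloor>"
    have nC: "real n / C = k powr (y * P)"
      using P k n0 C by (simp add: y_def)
    have yJ0: "real J0 \<le> y"
    proof (rule ccontr)
      assume "\<not> real J0 \<le> y"
      then have "y * P < real J0 * P" using P by (intro mult_strict_right_mono) auto
      then have "k powr (y * P) < k powr (real J0 * P)" using k by (intro powr_less_mono) auto
      then have "real n < D" unfolding nC[symmetric] D_def using C by (simp add: divide_less_eq mult.commute)
      then show False using False by simp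
    qed
    then have J: "real J \<le> y" "y < real J + 1" "J \<ge> J0" unfolding J_def by linarith+
    obtain n0' Bad where nb: "real n0' \<le> C * k powr (real J * P)" "Bad \<in> sets borel"
      "emeasure lborel Bad \<le> ennreal (C * k powr (- 2 * real J))"
      and pr: "\<And>t. 0 \<le> t \<Longrightarrow> t \<le> 1 \<Longrightarrow> t \<notin> Bad \<Longrightarrow> measure lebesgue (proj t n0') \<le> C * k powr (- 2 * real J)"
      using par[OF J(3)] by blast
    have "real n0' \<le> real n"
    proof -
      have "C * k powr (real J * P) \<le> C * k powr (y * P)" using C k J P by (intro mult_left_mono powr_mono mult_right_mono) auto
      also have "\<dots> = real n" unfolding nC[symmetric] using C by simp
      finally show ?thesis using nb(1) by linarith
    qed
    then have nn: "n0' \<le> n" by simp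
    have bound: "C * k powr (- 2 * real J) \<le> C' * real n powr (- 1 / p)"
    proof -
      have "k powr (- 2 * real J) \<le> k powr (2 + - 2 * y)" using k J by (intro powr_mono) auto
      also have "\<dots> = k\<^sup>2 * k powr (- 2 * y)" unfolding powr_add using k by simp
      also have "k powr (- 2 * y) = (real n / C) powr (- (2 / P))"
        unfolding nC powr_powr using P by (simp add: mult.commute)
      also have "\<dots> = real n powr (- (2 / P)) * C powr (2 / P)"
        using n0 C by (simp add: powr_divide powr_minus field_simps)
      also have "real n powr (- (2 / P)) \<le> real n powr (- 1 / p)" using n P by (intro powr_mono) (auto simp: field_simps)
      finally have "k powr (- 2 * real J) \<le> k\<^sup>2 * (real n powr (- 1 / p) * C powr (2 / P))" by (simp add: mult_left_mono mult_right_mono)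
      then have "C * k powr (- 2 * real J) \<le> C * (k\<^sup>2 * (real n powr (- 1 / p) * C powr (2 / P)))" using C by (intro mult_left_mono) auto
      also have "\<dots> = C * k\<^sup>2 * C powr (2 / P) * real n powr (- 1 / p)" by simp
      also have "\<dots> \<le> C' * real n powr (- 1 / p)" by (intro mult_right_mono C') simp
      finally show ?thesis .
    qed
    have "emeasure lborel Bad \<le> ennreal (C' * real n powr (- 1 / p))"
      using nb(3) ennreal_leI[OF bound] by (rule order_trans)
    moreover have "measure lebesgue (proj t n) \<le> C' * real n powr (- 1 / p)" if "0 \<le> t" "t \<le> 1" "t \<notin> Bad" for t
      using measure_proj_antimono[OF that(1) nn] pr[OF that] bound by linarith
    ultimately show ?thesis using nb(2) by blast
  qed
  then show ?thesis using C'(3) by blast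
qed

end

section \<open>Rationality of slopes with large projections\<close>

text \<open>Once the distance of \<open>K ^ i * x\<close> to the integers stays below
  \<open>1 / (2 * K)\<close>, each step multiplies it by exactly \<open>K\<close>. Being bounded, it
  must then be 0.\<close>

lemma int_multiple_of_cos_tendsto:
  fixes K :: nat and x :: real
  assumes K: "K \<ge> 2" and lim: "(\<lambda>i. cos (2 * pi * (real K ^ i * x))) \<longlonglongrightarrow> 1"
  shows "\<exists>i. real K ^ i * x \<in> \<int>"
proof -
  define r where "r i = real K ^ i * x - of_int (round (real K ^ i * x))" for i
  have r_half: "\<bar>r i\<bar> \<le> 1 / 2" for i
    using of_int_round_abs_le[of "real K ^ i * x"] by (simp add: r_def abs_minus_commute)
  have K0: "real K \<ge> 2" using K by simp
  have cr: "cos (2 * pi * r i) = cos (2 * pi * (real K ^ i * x))" for i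
  proof -
    have "2 * pi * (real K ^ i * x) = 2 * pi * r i + 2 * pi * of_int (round (real K ^ i * x))"
      by (simp add: r_def algebra_simps)
    then show ?thesis by (simp only: cos_periodic_int)
  qed
  have "cos (pi / real K) < 1"
  proof -
    have "cos (pi / real K) < cos 0" using K0 by (intro cos_monotone_0_pi) (auto simp: divide_le_eq)
    then show ?thesis by simp
  qed
  from order_tendstoD(1)[OF lim this] obtain i0 where i0: "\<And>i. i \<ge> i0 \<Longrightarrow> cos (pi / real K) < cos (2 * pi * (real K ^ i * x))"
    unfolding eventually_sequentially by blast
  have small: "\<bar>r i\<bar> < 1 / (2 * real K)" if "i \<ge> i0" for i
  proof (rule ccontr)
    assume "\<not> \<bar>r i\<bar> < 1 / (2 * real K)"
    then have "2 * pi * (1 / (2 * real K)) \<le> 2 * pi * \<bar>r i\<bar>" by (intro mult_left_mono) auto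
    then have "pi / real K \<le> \<bar>2 * pi * r i\<bar>" by (simp add: abs_mult)
    moreover have "\<bar>2 * pi * r i\<bar> \<le> pi" using r_half[of i] by (simp add: abs_mult)
    ultimately have "cos \<bar>2 * pi * r i\<bar> \<le> cos (pi / real K)" using K0 by (intro cos_monotone_0_pi_le) auto
    then have "cos (2 * pi * r i) \<le> cos (pi / real K)" by (simp only: cos_abs_real)
    then show False using i0[OF that] cr[of i] by linarith
  qed
  have step: "r (Suc i) = real K * r i" if "i \<ge> i0" for i
  proof -
    have e: "real K ^ Suc i * x = real K * r i + of_int (int K * round (real K ^ i * x))"
      by (simp add: r_def algebra_simps)
    have "\<bar>real K * r i\<bar> < 1 / 2" using small[OF that] K0 by (simp add: abs_mult field_simps)
    then have "round (real K ^ Suc i * x) = int K * round (real K ^ i * x)"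
      unfolding e by (intro round_unique') (simp add: abs_minus_commute)
    then show ?thesis using e by (simp add: r_def)
  qed
  have pw: "r (i0 + n) = real K ^ n * r i0" for n
    by (induction n) (simp_all add: step)
  have "r i0 = 0"
  proof (rule ccontr)
    assume "r i0 \<noteq> 0"
    then have pos: "\<bar>r i0\<bar> > 0" by simp
    obtain n :: nat where n: "1 / \<bar>r i0\<bar> < 2 ^ n" using real_arch_pow[of 2 "1 / \<bar>r i0\<bar>"] by auto
    have "(2::real) ^ n \<le> real K ^ n" using K0 by (intro power_mono) auto
    then have "2 ^ n * \<bar>r i0\<bar> \<le> real K ^ n * \<bar>r i0\<bar>" by (rule mult_right_mono) simp
    moreover have "1 < 2 ^ n * \<bar>r i0\<bar>" using n pos by (simp add: divide_less_eq)
    ultimately have "1 < real K ^ n * \<bar>r i0\<bar>" by linarith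
    also have "\<dots> = \<bar>r (i0 + n)\<bar>" by (simp add: pw abs_mult)
    finally show False using r_half[of "i0 + n"] by simp
  qed
  then have "real K ^ i0 * x = of_int (round (real K ^ i0 * x))" by (simp add: r_def)
  then show ?thesis by (metis Ints_of_int)
qed

text \<open>\<open>1 - sqmod S u\<close> is the average of the nonnegative terms
  \<open>1 - cos\<close>, so it controls each of them.\<close>

lemma one_minus_cos_le_sqmod:
  assumes "finite S" "b \<in> S" "b' \<in> S"
  shows "1 - cos (2 * pi * (real b - real b') * u) \<le> (real (card S))\<^sup>2 * (1 - sqmod S u)"
proof -
  have n: "real (card S) > 0" using assms by (auto simp: card_gt_0_iff)
  have "1 - cos (2 * pi * (real b - real b') * u) \<le> (\<Sum>b'\<in>S. 1 - cos (2 * pi * (real b - real b') * u))"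
    by (rule member_le_sum) (use assms in auto)
  also have "\<dots> \<le> (\<Sum>b\<in>S. \<Sum>b'\<in>S. 1 - cos (2 * pi * (real b - real b') * u))"
    by (rule member_le_sum) (use assms in \<open>auto intro!: sum_nonneg\<close>)
  also have "\<dots> = (real (card S))\<^sup>2 * (1 - sqmod S u)"
    using n by (simp add: sqmod_def trig_sum_def sum_subtractf sum_divide_distrib[symmetric] power2_eq_square field_simps)
  finally show ?thesis .
qed

lemma finite_cis_roots: "finite {x. \<bar>x\<bar> \<le> R \<and> cis (2 * pi * x) = z}"
proof (cases "\<exists>x0. \<bar>x0\<bar> \<le> R \<and> cis (2 * pi * x0) = z")
  case True
  then obtain x0 where x0: "\<bar>x0\<bar> \<le> R" "cis (2 * pi * x0) = z" by blast
  have "{x. \<bar>x\<bar> \<le> R \<and> cis (2 * pi * x) = z} \<subseteq> (\<lambda>n. x0 + of_int n) ` {- \<lceil>2 * R\<rceil>..\<lceil>2 * R\<rceil>}"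
  proof
    fix x assume x: "x \<in> {x. \<bar>x\<bar> \<le> R \<and> cis (2 * pi * x) = z}"
    have "cis (2 * pi * x - 2 * pi * x0) = cis (2 * pi * x) / cis (2 * pi * x0)" by (simp add: cis_divide)
    also have "\<dots> = 1" using x x0 cis_neq_zero[of "2 * pi * x0"] by simp
    finally have "cos (2 * pi * x - 2 * pi * x0) = 1" by (metis cis.sel(1) one_complex.sel(1))
    then obtain n :: int where "2 * pi * x - 2 * pi * x0 = real_of_int n * 2 * pi" by (auto simp only: cos_one_2pi_int)
    then have "2 * pi * (x - x0 - of_int n) = 0" by (simp add: algebra_simps)
    then have n: "x = x0 + of_int n" by simp
    then have "\<bar>real_of_int n\<bar> \<le> 2 * R" using x x0 by auto
    then have "n \<in> {- \<lceil>2 * R\<rceil>..\<lceil>2 * R\<rceil>}" by (auto simp: abs_le_iff) linarith+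
    then show "x \<in> (\<lambda>n. x0 + of_int n) ` {- \<lceil>2 * R\<rceil>..\<lceil>2 * R\<rceil>}" using n by blast
  qed
  then show ?thesis by (rule finite_subset) simp
qed (auto intro: finite_subset[of _ "{}"])

lemma finite_sqmod_zeros:
  assumes "finite S" "card S > 0"
  shows "finite {x. \<bar>x\<bar> \<le> R \<and> sqmod S x = 0}"
proof -
  define p where "p = (\<Sum>b\<in>S. monom (1::complex) b)"
  have pe: "poly p (cis (2 * pi * u)) = expsum S u" for u
    by (simp add: p_def poly_sum poly_monom expsum_def Complex.DeMoivre mult.commute mult.left_commute)
  obtain b where b: "b \<in> S" using assms by fastforce
  then have "coeff p b = 1" using assms by (simp add: p_def coeff_sum coeff_monom sum.delta')
  then have "p \<noteq> 0" by auto
  then have fin: "finite {z. poly p z = 0}" by (rule poly_roots_finite)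
  have "{x. \<bar>x\<bar> \<le> R \<and> sqmod S x = 0} \<subseteq> (\<Union>z\<in>{z. poly p z = 0}. {x. \<bar>x\<bar> \<le> R \<and> cis (2 * pi * x) = z})"
    using assms by (auto simp: sqmod_expsum pe)
  then show ?thesis by (rule finite_subset) (intro finite_UN_I fin finite_cis_roots)
qed

context digit_pair begin

lemma wave_Suc: "wave t (Suc J) z = wave t J z * (sqmod A (real K ^ J * z) * sqmod B (t * (real K ^ J * z)))"
proof -
  have "card A > 0" "card B > 0" using card_A card_B by auto
  then show ?thesis
    by (simp only: wave_def sqmod_digit_nums[OF A_sub] sqmod_digit_nums[OF B_sub] prod.lessThan_Suc ac_simps)
qed

text \<open>The waves decrease in \<open>J\<close> to a positive limit, so both factors at the
  frequency \<open>K ^ J * \<mu>\<close> tend to 1. Hence nonzero integer multiples of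
  \<open>\<mu>\<close> and of \<open>t * \<mu>\<close> become integers after multiplication by a
  power of \<open>K\<close>, and \<open>t\<close> is a quotient of rationals.\<close>

lemma rational_of_wave_bounded_below:
  assumes mu: "\<mu> \<noteq> 0" and e: "\<epsilon> > 0" and lb: "\<And>J. \<epsilon> \<le> wave t J \<mu>"
  shows "t \<in> \<rat>"
proof -
  let ?a = "\<lambda>J. sqmod A (real K ^ J * \<mu>)" and ?b = "\<lambda>J. sqmod B (t * (real K ^ J * \<mu>))"
  let ?w = "\<lambda>J. wave t J \<mu>"
  have ab: "?a J * ?b J \<le> ?a J" "?a J * ?b J \<le> ?b J" "?a J \<le> 1" "?b J \<le> 1" for J
    using sqmod_le_1[of A "real K ^ J * \<mu>"] sqmod_le_1[of B "t * (real K ^ J * \<mu>)"]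
      sqmod_nonneg[of A "real K ^ J * \<mu>"] sqmod_nonneg[of B "t * (real K ^ J * \<mu>)"]
    by (auto simp: mult_left_le mult_left_le_one_le)
  have dec: "decseq ?w"
    unfolding decseq_Suc_iff wave_Suc using ab
    by (auto intro!: mult_left_le wave_nonneg intro: order_trans)
  then obtain l where l: "?w \<longlonglongrightarrow> l" using decseq_convergent[of ?w \<epsilon>] lb by blast
  have le: "\<epsilon> \<le> l" using lb by (intro LIMSEQ_le_const[OF l]) auto
  have "(\<lambda>J. ?w (Suc J) / ?w J) \<longlonglongrightarrow> l / l" using l le e by (intro tendsto_divide LIMSEQ_Suc) auto
  moreover have "?w (Suc J) / ?w J = ?a J * ?b J" for J
    using lb[of J] e unfolding wave_Suc by simp
  ultimately have lim: "(\<lambda>J. ?a J * ?b J) \<longlonglongrightarrow> 1" using le e by simp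
  have a1: "?a \<longlonglongrightarrow> 1" by (rule tendsto_sandwich[OF _ _ lim tendsto_const]) (use ab in auto)
  have b1: "?b \<longlonglongrightarrow> 1" by (rule tendsto_sandwich[OF _ _ lim tendsto_const]) (use ab in auto)
  have key: "\<exists>d i. d \<noteq> (0::int) \<and> real K ^ i * (of_int d * c) \<in> \<int>"
    if S: "finite S" "card S > 1" and lim: "(\<lambda>J. sqmod S (real K ^ J * c)) \<longlonglongrightarrow> 1" for S c
  proof -
    obtain b b' where bb: "b \<in> S" "b' \<in> S" "b \<noteq> b'"
    proof -
      obtain b where "b \<in> S" using S by fastforce
      moreover have "\<not> S \<subseteq> {b}" using S card_mono[of "{b}" S] by auto
      ultimately show ?thesis using that by blast
    qed
    define d where "d = int b - int b'"
    have "(\<lambda>J. 1 - (real (card S))\<^sup>2 * (1 - sqmod S (real K ^ J * c))) \<longlonglongrightarrow> 1 - (real (card S))\<^sup>2 * (1 - 1)"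
      by (intro tendsto_intros lim)
    then have lo: "(\<lambda>J. 1 - (real (card S))\<^sup>2 * (1 - sqmod S (real K ^ J * c))) \<longlonglongrightarrow> 1" by simp
    have "(\<lambda>J. cos (2 * pi * (real K ^ J * (of_int d * c)))) \<longlonglongrightarrow> 1"
    proof (rule tendsto_sandwich[OF _ _ lo tendsto_const])
      show "\<forall>\<^sub>F J in sequentially. 1 - (real (card S))\<^sup>2 * (1 - sqmod S (real K ^ J * c)) \<le> cos (2 * pi * (real K ^ J * (of_int d * c)))"
      proof (rule always_eventually, rule allI)
        fix J
        have e: "2 * pi * (real b - real b') * (real K ^ J * c) = 2 * pi * (real K ^ J * (of_int d * c))" by (simp add: d_def)
        show "1 - (real (card S))\<^sup>2 * (1 - sqmod S (real K ^ J * c)) \<le> cos (2 * pi * (real K ^ J * (of_int d * c)))"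
          using one_minus_cos_le_sqmod[OF S(1) bb(1,2), of "real K ^ J * c"] unfolding e by linarith
      qed
    qed simp
    then have "\<exists>i. real K ^ i * (of_int d * c) \<in> \<int>" using K4 by (intro int_multiple_of_cos_tendsto) auto
    then show ?thesis using bb by (intro exI[of _ d]) (auto simp: d_def)
  qed
  obtain d1 i1 where 1: "d1 \<noteq> (0::int)" "real K ^ i1 * (of_int d1 * \<mu>) \<in> \<int>"
    using key[OF finA card_A a1] by blast
  have b1': "(\<lambda>J. sqmod B (real K ^ J * (t * \<mu>))) \<longlonglongrightarrow> 1" using b1 by (simp add: mult.left_commute)
  obtain d2 i2 where 2: "d2 \<noteq> (0::int)" "real K ^ i2 * (of_int d2 * (t * \<mu>)) \<in> \<int>"
    using key[OF finB card_B b1'] by blast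
  let ?n = "real K ^ i2 * (of_int d2 * (t * \<mu>))" and ?q = "real K ^ i1 * (of_int d1 * \<mu>)"
  have K0: "real K \<noteq> 0" using K4 by simp
  have "t = (?n * (real K ^ i1 * of_int d1)) / (?q * (real K ^ i2 * of_int d2))"
    using 1(1) 2(1) mu K0 by simp
  moreover have "?n \<in> \<rat>" "?q \<in> \<rat>" using 1 2 Ints_subset_Rats by blast+
  moreover have "real K ^ i1 * of_int d1 \<in> \<rat>" "real K ^ i2 * of_int d2 \<in> \<rat>" by auto
  ultimately show ?thesis by (metis Rats_divide Rats_mult)
qed

text \<open>Projecting onto the axis forgets the \<open>B\<close>-digits and leaves
  \<open>card A ^ n\<close> intervals of length \<open>1 / K ^ n\<close>. This excludes slope
  0.\<close>

lemma proj_0_small: "measure lebesgue (proj 0 n) \<le> (1 / card B) ^ n"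
proof -
  have K0: "real K ^ n > 0" using K4 by simp
  have fin: "finite (digit_nums K A n)" by (rule finite_digit_nums[OF finA])
  have sub: "proj 0 n \<subseteq> (\<Union>x\<in>digit_nums K A n. {real x / K ^ n .. (real x + 1) / K ^ n})"
    by (auto simp: proj_def sq_def pos_def)
  have "measure lebesgue (proj 0 n) \<le> measure lebesgue (\<Union>x\<in>digit_nums K A n. {real x / K ^ n .. (real x + 1) / K ^ n})"
    by (intro measure_mono_fmeasurable sub fmeasurableD lm_proj fmeasurable.finite_UN fin) auto
  also have "\<dots> \<le> (\<Sum>x\<in>digit_nums K A n. measure lebesgue {real x / K ^ n .. (real x + 1) / K ^ n})"
    by (rule measure_UNION_le[OF fin]) auto
  also have "\<dots> = (\<Sum>x\<in>digit_nums K A n. 1 / real K ^ n)"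
    using K0 by (intro sum.cong) (auto simp: divide_right_mono diff_divide_distrib[symmetric])
  also have "\<dots> = real (card A) ^ n / real K ^ n" by (simp add: card_digit_nums[OF A_sub])
  also have "\<dots> = (1 / card B) ^ n"
  proof -
    have "real (card A) / real K = 1 / card B" using ratio(1) card_A card_B K4 by (simp add: field_simps)
    then show ?thesis by (simp only: power_divide[symmetric])
  qed
  finally show ?thesis .
qed

definition mass :: "real \<Rightarrow> nat \<Rightarrow> real set \<Rightarrow> ennreal" where
  "mass t s S = (\<integral>\<^sup>+\<zeta>. ennreal (real K ^ s * wave t s \<zeta>) * indicator S \<zeta> \<partial>lborel)"

lemma mass_unit_le:
  fixes M :: real
  assumes t: "t \<ge> 0" and en: "real (energy t s) \<le> 4 * M * real K ^ s"
  shows "mass t s {x..x + 1} \<le> ennreal (112 * M)"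
proof -
  have K0: "real K ^ s > 0" using K4 by simp
  have "mass t s {x..x + 1} = (\<integral>\<^sup>+y. ennreal (real K ^ s * wave t s (x + 1 * y)) * indicator {x..x + 1} (x + 1 * y) \<partial>lborel)"
    unfolding mass_def by (subst nn_integral_real_affine[where c = 1 and t = x]) auto
  also have "\<dots> = (\<integral>\<^sup>+y. ennreal (real K ^ s * wave t s (x + y)) * indicator {0..1} y \<partial>lborel)"
    by (intro nn_integral_cong) (auto split: split_indicator)
  also have "\<dots> = ennreal (integral {0..1} (\<lambda>y. real K ^ s * wave t s (x + y)))"
    by (rule nn_integral_Icc_continuous) (auto intro!: continuous_intros simp: wave_nonneg)
  also have "integral {0..1} (\<lambda>y. real K ^ s * wave t s (x + y)) = real K ^ s * integral {0..1} (\<lambda>y. wave t s (x + y))" by simp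
  also have "\<dots> \<le> real K ^ s * (28 * energy t s / (real K ^ s)\<^sup>2)"
    by (intro mult_left_mono integral_wave_le t) auto
  also have "\<dots> = 28 * (energy t s / real K ^ s)" using K0 by (simp add: power2_eq_square)
  also have "\<dots> \<le> 112 * M" using en K0 by (simp add: divide_le_eq)
  finally show ?thesis by (simp add: ennreal_leI)
qed

text \<open>By \<open>wave_add\<close> the wave is \<open>wave t J\<close>, at most
  \<open>\<epsilon>\<close> on the interval, times a wave of \<open>s - J\<close> generations in the
  variable \<open>K ^ J * \<zeta>\<close>, in which the interval has length at most 1.\<close>

lemma mass_local_le:
  fixes M :: real
  assumes t: "t \<ge> 0" and en: "\<And>n. real (energy t n) \<le> 4 * M * real K ^ n" and M: "M \<ge> 0"
    and J: "J \<le> s" and \<delta>: "real K ^ J * (b - a) \<le> 1" and e: "\<And>\<zeta>. a < \<zeta> \<Longrightarrow> \<zeta> \<le> b \<Longrightarrow> wave t J \<zeta> \<le> \<epsilon>" and \<epsilon>: "\<epsilon> \<ge> 0"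
  shows "mass t s {a<..b} \<le> ennreal (\<epsilon> * (112 * M))"
proof -
  have KJ: "real K ^ J > 0" using K4 by simp
  have s: "s - J + J = s" using J by simp
  have pw: "real K ^ s * wave t s \<zeta> \<le> \<epsilon> * real K ^ J * (real K ^ (s - J) * wave t (s - J) (real K ^ J * \<zeta>))" if "a < \<zeta>" "\<zeta> \<le> b" for \<zeta>
  proof -
    have "wave t s \<zeta> = wave t (s - J) (real K ^ J * \<zeta>) * wave t J \<zeta>" using wave_add[of t "s - J" J \<zeta>] s by simp
    also have "\<dots> \<le> wave t (s - J) (real K ^ J * \<zeta>) * \<epsilon>" by (intro mult_left_mono e that wave_nonneg)
    finally have "real K ^ s * wave t s \<zeta> \<le> real K ^ s * (wave t (s - J) (real K ^ J * \<zeta>) * \<epsilon>)" by (intro mult_left_mono) auto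
    also have "real K ^ s * (w * \<epsilon>) = \<epsilon> * real K ^ J * (real K ^ (s - J) * w)" for w
    proof -
      have "real K ^ s = real K ^ J * real K ^ (s - J)" using J by (simp flip: power_add)
      then show ?thesis by simp
    qed
    finally show ?thesis .
  qed
  have "mass t s {a<..b} \<le> (\<integral>\<^sup>+\<zeta>. ennreal \<epsilon> * (ennreal (real K ^ J) * (ennreal (real K ^ (s - J) * wave t (s - J) (real K ^ J * \<zeta>)) * indicator {a<..b} \<zeta>)) \<partial>lborel)"
    unfolding mass_def
  proof (rule nn_integral_mono)
    fix \<zeta>
    have "ennreal (real K ^ s * wave t s \<zeta>) \<le> ennreal \<epsilon> * (ennreal (real K ^ J) * ennreal (real K ^ (s - J) * wave t (s - J) (real K ^ J * \<zeta>)))"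
      if "a < \<zeta>" "\<zeta> \<le> b"
      unfolding ennreal_mult'[OF zero_le_power[OF of_nat_0_le_iff], symmetric] ennreal_mult'[OF \<epsilon>, symmetric]
      using pw[OF that] by (intro ennreal_leI) (simp add: mult.assoc)
    then show "ennreal (real K ^ s * wave t s \<zeta>) * indicator {a<..b} \<zeta>
       \<le> ennreal \<epsilon> * (ennreal (real K ^ J) * (ennreal (real K ^ (s - J) * wave t (s - J) (real K ^ J * \<zeta>)) * indicator {a<..b} \<zeta>))"
      by (auto split: split_indicator)
  qed
  also have "\<dots> = ennreal \<epsilon> * (ennreal (real K ^ J) * (\<integral>\<^sup>+\<zeta>. ennreal (real K ^ (s - J) * wave t (s - J) (real K ^ J * \<zeta>)) * indicator {a<..b} \<zeta> \<partial>lborel))"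
    by (subst nn_integral_cmult, measurable, subst nn_integral_cmult, measurable)
  also have "ennreal (real K ^ J) * (\<integral>\<^sup>+\<zeta>. ennreal (real K ^ (s - J) * wave t (s - J) (real K ^ J * \<zeta>)) * indicator {a<..b} \<zeta> \<partial>lborel)
     = (\<integral>\<^sup>+u. ennreal (real K ^ (s - J) * wave t (s - J) u) * indicator {real K ^ J * a<..real K ^ J * b} u \<partial>lborel)"
    by (rule nn_integral_scale[symmetric]) (use KJ in auto)
  also have "\<dots> \<le> mass t (s - J) {real K ^ J * a..real K ^ J * a + 1}"
    unfolding mass_def
  proof (intro nn_integral_mono mult_left_mono)
    fix u
    have "real K ^ J * b \<le> real K ^ J * a + 1" using \<delta> by (simp add: algebra_simps)
    then show "(indicator {real K ^ J * a<..real K ^ J * b} u :: ennreal) \<le> indicator {real K ^ J * a..real K ^ J * a + 1} u"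
      by (auto split: split_indicator)
  qed simp
  also have "\<dots> \<le> ennreal (112 * M)" by (rule mass_unit_le[OF t en])
  finally show ?thesis using \<epsilon> by (simp add: ennreal_mult' mult_left_mono)
qed

text \<open>The lower bound grows like \<open>L / 2\<close>, whereas the unit interval at the origin
  carries at most \<open>112 * M\<close>. With \<open>M\<close> fixed, a long interval does the work
  of smearing.\<close>

lemma mass_total_ge:
  fixes M :: real
  assumes t: "t \<ge> 0" and en: "real (energy t s) \<le> 4 * M * real K ^ s" and L: "L \<ge> 2 * (112 * M + 1)" "L \<ge> 1"
  shows "1 \<le> mass t s {1<..L}"
proof -
  have K0: "real K ^ s > 0" using K4 by simp
  have ii: "wave t s integrable_on {a..b}" for a b by (intro integrable_continuous_real continuous_intros)
  have "L / 2 * (1 / real K ^ s) \<le> integral {0..L} (\<lambda>z. (1 - z / L) * wave t s z)"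
    using fejer_wave[of L t s] L by simp
  also have "\<dots> \<le> integral {0..L} (wave t s)"
  proof (rule integral_le)
    show "(\<lambda>z. (1 - z / L) * wave t s z) integrable_on {0..L}"
      using L by (intro integrable_continuous_real continuous_intros) auto
    fix z assume "z \<in> {0..L}"
    then have "1 - z / L \<le> 1" using L by simp
    then show "(1 - z / L) * wave t s z \<le> wave t s z" using mult_right_mono[OF _ wave_nonneg, of "1 - z / L" 1] by simp
  qed (rule ii)
  also have "\<dots> = integral {0..1} (wave t s) + integral {1..L} (wave t s)"
    using L Henstock_Kurzweil_Integration.integral_combine[where a = 0 and c = 1 and b = L and f = "wave t s"] ii by simp
  finally have "real K ^ s * (L / 2 * (1 / real K ^ s)) \<le> real K ^ s * (integral {0..1} (wave t s) + integral {1..L} (wave t s))"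
    by (intro mult_left_mono) auto
  then have "L / 2 \<le> real K ^ s * integral {0..1} (wave t s) + real K ^ s * integral {1..L} (wave t s)"
    using K0 K4 by (simp add: distrib_left)
  moreover have "real K ^ s * integral {0..1} (wave t s) \<le> 112 * M"
  proof -
    have "real K ^ s * integral {0..1} (wave t s) \<le> real K ^ s * (28 * energy t s / (real K ^ s)\<^sup>2)"
      using integral_wave_le[OF t, of s 0] by (intro mult_left_mono) auto
    also have "\<dots> = 28 * (energy t s / real K ^ s)" using K0 by (simp add: power2_eq_square)
    also have "\<dots> \<le> 112 * M" using en K0 by (simp add: divide_le_eq)
    finally show ?thesis .
  qed
  moreover have "224 * M + 2 \<le> L" using L by simp
  ultimately have "1 \<le> real K ^ s * integral {1..L} (wave t s)" by linarith
  then have "ennreal 1 \<le> ennreal (integral {1..L} (\<lambda>\<zeta>. real K ^ s * wave t s \<zeta>))" by (intro ennreal_leI) simp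
  also have "\<dots> = mass t s {1<..L}"
    unfolding mass_def nn_integral_Ioc_eq_Icc
    by (rule nn_integral_Icc_continuous[symmetric]) (auto intro!: continuous_intros simp: wave_nonneg)
  finally show ?thesis by simp
qed

text \<open>Away from the zeros of the finite product the mass in \<open>[1, L]\<close> is controlled by the band, which
  becomes small; near a zero it is controlled by the energy on a finer scale times a factor that
  becomes small when \<open>t\<close> is irrational.\<close>

theorem rational_slope:
  assumes t: "0 \<le> t" "t \<le> 1" and c: "c > 0" "\<And>n. c \<le> measure lebesgue (proj t n)"
  shows "t \<in> \<rat> \<and> t \<noteq> 0"
proof -
  have t0: "t \<noteq> 0"
  proof
    assume "t = 0"
    then have "c \<le> (1 / card B) ^ n" for n using c(2)[of n] proj_0_small[of n] by simp
    moreover have "(\<lambda>n. (1 / real (card B)) ^ n) \<longlonglongrightarrow> 0" using card_B by (intro LIMSEQ_realpow_zero) auto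
    ultimately have "c \<le> 0" by (intro LIMSEQ_le_const) auto
    then show False using c by simp
  qed
  then have tp: "t > 0" using t by simp
  \<comment> \<open>Large enough that \<open>11 * (1 + t) / M < c\<close>, which rules out the
    second alternative of \<open>stack_dichotomy\<close> in every generation.\<close>
  define M where "M = 1 + 23 / c"
  have M: "M > 1" using c by (simp add: M_def)
  have Mc: "11 * (1 + t) / M < c"
  proof -
    have "11 * (1 + t) \<le> 22" using t by simp
    also have "22 < c * M" using c by (simp add: M_def distrib_left)
    finally show ?thesis using M by (simp add: divide_less_eq)
  qed
  have en: "real (energy t n) \<le> 4 * M * real K ^ n" for n
  proof -
    have L: "16 * real K * M * ln M \<le> real (nat \<lceil>16 * real K * M * ln M\<rceil>)" by (rule real_nat_ceiling_ge)
    have "\<not> measure lebesgue (proj t (nat \<lceil>16 * real K * M * ln M\<rceil> * n)) \<le> 11 * (1 + t) / M"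
      using c(2)[of "nat \<lceil>16 * real K * M * ln M\<rceil> * n"] Mc by linarith
    then show ?thesis using stack_dichotomy[OF t(1) M, of "nat \<lceil>16 * real K * M * ln M\<rceil>" n] L by auto
  qed
  obtain m0 :: nat where m0: "2 * (112 * M + 1) < 4 ^ m0" using real_arch_pow[of 4 "2 * (112 * M + 1)"] by auto
  have m0_pos: "m0 > 0" using m0 M by (cases m0) auto
  define L where "L = real K ^ m0"
  have L: "L \<ge> 2 * (112 * M + 1)" "L \<ge> 1"
  proof -
    have "(4::real) ^ m0 \<le> real K ^ m0" using K4 by (intro power_mono) auto
    then show "L \<ge> 2 * (112 * M + 1)" unfolding L_def using m0 by linarith
    then have "224 * M + 2 \<le> L" by simp
    then show "L \<ge> 1" using M by linarith
  qed
  have K0: "real K > 0" using K4 by simp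
  \<comment> \<open>This supplies \<open>prodA\<close>, \<open>prodB\<close> and
    \<open>band\<close>. Blocks of length 1 give \<open>m = m0\<close>, and the block hypotheses
    hold with the crude constants 2 and 1, because \<open>tame\<close> is at most twice and
    \<open>wild\<close> at most once the smeared value.\<close>
  interpret S: smeared K A B "1 / (4 * real K)" 2 1 2 1 0 m0
  proof unfold_locales
    fix x
    let ?u = "\<lambda>k. (x + real k) / real K ^ Suc 0"
    let ?X = "1 / (4 * real K)"
    have "(\<Sum>k<K ^ Suc 0. wgt 0 x k * tame ?X 2 1 (?u k)) \<le> (\<Sum>k<K ^ Suc 0. wgt 0 x k * (smear B ?X (?u k) * 2 powr 1))"
      by (intro sum_mono mult_left_mono tame_le wgt_nonneg) auto
    also have "\<dots> = 2 * (\<Sum>k<K ^ Suc 0. wgt 0 x k * smear B ?X (?u k))" by (simp add: sum_distrib_left mult_ac)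
    finally show "(\<Sum>k<K ^ Suc 0. wgt 0 x k * tame ?X 2 1 (?u k)) \<le> 1 + 2" unfolding sum_wgt_smear by simp
    have "(\<Sum>k<K ^ Suc 0. wgt 0 x k * wild ?X 2 (?u k)) \<le> (\<Sum>k<K ^ Suc 0. wgt 0 x k * smear B ?X (?u k))"
      by (intro sum_mono mult_left_mono wgt_nonneg) (simp add: wild_def smear_nonneg)
    then show "(\<Sum>k<K ^ Suc 0. wgt 0 x k * wild ?X 2 (?u k)) \<le> 1" unfolding sum_wgt_smear .
  qed (use K0 in auto)
  have Sm: "S.m = m0" by (simp add: S.m_def S.G_def)
  define P where "P \<zeta> = S.prodA \<zeta> * S.prodB (\<lambda>_. sqmod B) (t * \<zeta>)" for \<zeta>
  have P0: "0 \<le> P \<zeta>" for \<zeta> unfolding P_def by (intro mult_nonneg_nonneg S.prodA_nonneg S.prodB_sqmod_nonneg)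
  have contP: "continuous_on D P" for D
    unfolding P_def S.prodA_def S.prodB_def by (intro continuous_intros) (use K0 in auto)
  define Zs where "Zs = {\<zeta>\<in>{1..L}. P \<zeta> = 0}"
  have finZ: "finite Zs"
  proof -
    let ?ZA = "{x. \<bar>x\<bar> \<le> L \<and> sqmod A x = 0}" and ?ZB = "{x. \<bar>x\<bar> \<le> L \<and> sqmod B x = 0}"
    have fin: "finite ?ZA" "finite ?ZB"
      using finite_sqmod_zeros[OF finA] finite_sqmod_zeros[OF finB] card_A card_B by auto
    have "Zs \<subseteq> (\<Union>l\<in>{1..m0 + 2}. (\<lambda>x. real K ^ l * x) ` ?ZA \<union> (\<lambda>x. real K ^ l * x / t) ` ?ZB)"
    proof
      fix \<zeta> assume "\<zeta> \<in> Zs"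
      then have z: "1 \<le> \<zeta>" "\<zeta> \<le> L" "P \<zeta> = 0" by (auto simp: Zs_def)
      have bound: "\<bar>\<zeta> / real K ^ l\<bar> \<le> L \<and> \<bar>t * \<zeta> / real K ^ l\<bar> \<le> L" for l
      proof -
        have K1: "1 \<le> real K ^ l" using K4 by (intro one_le_power) auto
        have "\<zeta> / real K ^ l \<le> \<zeta> / 1" using z K1 K0 by (intro divide_left_mono) auto
        moreover have "t * \<zeta> / real K ^ l \<le> 1 * \<zeta> / 1" using z K1 K0 t by (intro frac_le mult_right_mono) auto
        moreover have "0 \<le> \<zeta> / real K ^ l" "0 \<le> t * \<zeta> / real K ^ l" using z t by auto
        ultimately show ?thesis using z(2) by linarith
      qed
      from z(3) consider l where "l \<in> {1..m0 + 2}" "sqmod A (\<zeta> / real K ^ l) = 0" | l where "l \<in> {1..m0 + 2}" "sqmod B (t * \<zeta> / real K ^ l) = 0"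
        unfolding P_def S.prodA_def S.prodB_def Sm by (auto simp: prod_zero_iff simp del: prod.cl_ivl_Suc)
      then show "\<zeta> \<in> (\<Union>l\<in>{1..m0 + 2}. (\<lambda>x. real K ^ l * x) ` ?ZA \<union> (\<lambda>x. real K ^ l * x / t) ` ?ZB)"
      proof cases
        case 1
        have "\<zeta> = real K ^ l * (\<zeta> / real K ^ l)" using K0 by simp
        then have "\<zeta> \<in> (\<lambda>x. real K ^ l * x) ` ?ZA" using 1 bound by blast
        then show ?thesis using 1 by blast
      next
        case 2
        have "\<zeta> = real K ^ l * (t * \<zeta> / real K ^ l) / t" using K0 tp by simp
        then have "\<zeta> \<in> (\<lambda>x. real K ^ l * x / t) ` ?ZB" using 2 bound by blast
        then show ?thesis using 2 by blast
      qed
    qed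
    then show ?thesis by (rule finite_subset) (use fin in auto)
  qed
  have "t \<in> \<rat>"
  proof (rule ccontr)
    assume irr: "t \<notin> \<rat>"
    \<comment> \<open>The neighbourhoods of the zeros then carry mass at most 1 / 4 together. The
      band adds another 1 / 4, while the total is at least 1.\<close>
    define \<epsilon> where "\<epsilon> = 1 / (4 * (112 * M) * (real (card Zs) + 1))"
    have \<epsilon>: "\<epsilon> > 0" unfolding \<epsilon>_def using M by simp
    have "\<exists>x. snd x > 0 \<and> real K ^ fst x * (2 * snd x) \<le> 1 \<and> (\<forall>\<zeta>. \<bar>\<zeta> - z\<bar> \<le> snd x \<longrightarrow> wave t (fst x) \<zeta> \<le> \<epsilon>)" if z: "z \<in> Zs" for z
    proof -
      have z1: "z \<noteq> 0" using z by (auto simp: Zs_def)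
      have "\<exists>J. wave t J z < \<epsilon>" using rational_of_wave_bounded_below[OF z1 \<epsilon>, of t] irr by (meson not_less)
      then obtain J where J: "wave t J z < \<epsilon>" by blast
      have "isCont (wave t J) z"
      proof -
        have "continuous_on UNIV (wave t J)" by (intro continuous_intros)
        then show ?thesis by (simp add: continuous_on_eq_continuous_at)
      qed
      then obtain d where d: "d > 0" "\<And>\<zeta>. dist \<zeta> z < d \<Longrightarrow> dist (wave t J \<zeta>) (wave t J z) < \<epsilon> - wave t J z"
        using J unfolding continuous_at_eps_delta by (meson diff_gt_0_iff_gt)
      define \<delta> where "\<delta> = min (d / 2) (1 / (2 * real K ^ J))"
      have dp: "\<delta> > 0" using d K0 by (simp add: \<delta>_def)
      have "real K ^ J * (2 * \<delta>) \<le> real K ^ J * (2 * (1 / (2 * real K ^ J)))" by (intro mult_left_mono) (auto simp: \<delta>_def)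
      also have "\<dots> = 1" using K0 by simp
      finally have dk: "real K ^ J * (2 * \<delta>) \<le> 1" .
      have "wave t J \<zeta> \<le> \<epsilon>" if "\<bar>\<zeta> - z\<bar> \<le> \<delta>" for \<zeta>
      proof -
        have "\<delta> < d" using d by (simp add: \<delta>_def min_less_iff_disj)
        then have "dist \<zeta> z < d" using that by (simp add: dist_real_def)
        from d(2)[OF this] show ?thesis by (simp add: dist_real_def abs_less_iff)
      qed
      then show ?thesis using dp dk by (intro exI[of _ "(J, \<delta>)"]) auto
    qed
    then obtain x where x: "\<And>z. z \<in> Zs \<Longrightarrow> snd (x z) > 0 \<and> real K ^ fst (x z) * (2 * snd (x z)) \<le> 1 \<and>
        (\<forall>\<zeta>. \<bar>\<zeta> - z\<bar> \<le> snd (x z) \<longrightarrow> wave t (fst (x z)) \<zeta> \<le> \<epsilon>)" by metis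
    define U where "U = (\<Union>z\<in>Zs. {z - snd (x z)<..<z + snd (x z)})"
    have "compact ({1..L} - U)" unfolding U_def by (intro compact_diff open_UN) auto
    have "\<exists>\<eta>>0. \<forall>\<zeta>\<in>{1..L} - U. \<eta> \<le> P \<zeta>"
    proof (cases "{1..L} - U = {}")
      case False
      from continuous_attains_inf[OF \<open>compact ({1..L} - U)\<close> False contP]
      obtain y where y: "y \<in> {1..L} - U" "\<And>\<zeta>. \<zeta> \<in> {1..L} - U \<Longrightarrow> P y \<le> P \<zeta>" by blast
      have "y \<notin> Zs" using y(1) x by (force simp: U_def)
      then have "P y > 0" using y(1) P0[of y] by (auto simp: Zs_def)
      then show ?thesis using y(2) by blast
    qed (auto intro: exI[of _ 1])
    then obtain \<eta> where \<eta>: "\<eta> > 0" "\<And>\<zeta>. \<zeta> \<in> {1..L} - U \<Longrightarrow> \<eta> \<le> P \<zeta>" by blast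
    \<comment> \<open>A common bound for all \<open>fst (x z)\<close>, so that
      \<open>mass_local_le\<close> applies at every zero.\<close>
    define i0 where "i0 = (\<Sum>z\<in>Zs. fst (x z))"
    \<comment> \<open>The bands have bounded sum over all starting scales, so they cannot all exceed
      \<open>\<eta> / 4\<close> from \<open>i0\<close> on.\<close>
    have "\<exists>i\<ge>i0. S.band (i * m0) t \<le> ennreal (\<eta> / 4)"
    proof (rule ccontr)
      assume "\<not> (\<exists>i\<ge>i0. S.band (i * m0) t \<le> ennreal (\<eta> / 4))"
      then have big: "ennreal (\<eta> / 4) \<le> S.band (i * m0) t" if "i \<ge> i0" for i using that by (meson linear)
      obtain r :: nat where r: "real r > 224 * M / (\<eta> / 4)" using reals_Archimedean2 by blast
      have "ennreal (real r * (\<eta> / 4)) = (\<Sum>i\<in>{i0..<i0 + r}. ennreal (\<eta> / 4))"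
        using \<eta> by (simp add: ennreal_of_nat_eq_real_of_nat ennreal_mult'[symmetric])
      also have "\<dots> \<le> (\<Sum>i\<in>{i0..<i0 + r}. S.band (i * m0) t)" by (intro sum_mono big) auto
      also have "\<dots> \<le> (\<Sum>i<i0 + r. S.band (i * m0) t)" by (intro sum_mono2) auto
      also have "\<dots> \<le> ennreal (224 * M)"
        using S.sum_band_le[OF t refl en, of "i0 + r"] unfolding Sm .
      finally have "real r * (\<eta> / 4) \<le> 224 * M" using M by simp
      then show False using r \<eta> by (simp add: field_simps)
    qed
    then obtain i where i: "i \<ge> i0" "S.band (i * m0) t \<le> ennreal (\<eta> / 4)" by blast
    define s where "s = i * m0"
    have sJ: "fst (x z) \<le> s" if "z \<in> Zs" for z
    proof -
      have "fst (x z) \<le> i0" unfolding i0_def using finZ that by (intro member_le_sum) auto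
      also have "\<dots> \<le> i" by (rule i(1))
      also have "\<dots> \<le> s" using m0_pos by (simp add: s_def)
      finally show ?thesis .
    qed
    let ?w = "\<lambda>\<zeta>. ennreal (real K ^ s * wave t s \<zeta>)"
    let ?I = "\<lambda>z. {z - snd (x z)<..z + snd (x z)}"
    let ?b = "\<lambda>\<zeta>. ennreal (real K ^ s * (wave t s \<zeta> * (S.prodA \<zeta> * S.prodB (\<lambda>_. sqmod B) (t * \<zeta>)))) * indicator {1<..L} \<zeta>"
    have pw: "?w \<zeta> * indicator {1<..L} \<zeta> \<le> (\<Sum>z\<in>Zs. ?w \<zeta> * indicator (?I z) \<zeta>) + ennreal (1 / \<eta>) * ?b \<zeta>" for \<zeta>
    proof (cases "\<zeta> \<in> {1<..L}")
      case in1: True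
      show ?thesis
      proof (cases "\<zeta> \<in> U")
        case True
        then obtain z where z: "z \<in> Zs" "\<zeta> \<in> ?I z" by (auto simp: U_def)
        have "?w \<zeta> * indicator {1<..L} \<zeta> = ?w \<zeta> * indicator (?I z) \<zeta>" using in1 z by simp
        also have "\<dots> \<le> (\<Sum>z\<in>Zs. ?w \<zeta> * indicator (?I z) \<zeta>)" using finZ z by (intro member_le_sum) auto
        finally show ?thesis by (simp add: add_increasing2)
      next
        case False
        have "\<eta> \<le> P \<zeta>" using False in1 by (intro \<eta>) auto
        then have "1 \<le> 1 / \<eta> * P \<zeta>" using \<eta> by (simp add: field_simps)
        then have "real K ^ s * wave t s \<zeta> * 1 \<le> real K ^ s * wave t s \<zeta> * (1 / \<eta> * P \<zeta>)"
          by (intro mult_left_mono mult_nonneg_nonneg wave_nonneg) auto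
        then have "?w \<zeta> \<le> ennreal (1 / \<eta> * (real K ^ s * (wave t s \<zeta> * P \<zeta>)))" by (intro ennreal_leI) (simp add: ac_simps)
        also have "\<dots> = ennreal (1 / \<eta>) * ennreal (real K ^ s * (wave t s \<zeta> * P \<zeta>))" using \<eta> by (intro ennreal_mult') auto
        finally have "?w \<zeta> \<le> ennreal (1 / \<eta>) * ?b \<zeta>" using in1 unfolding P_def by simp
        then show ?thesis using in1 by (simp add: add_increasing)
      qed
    qed simp
    have m1: "(\<lambda>\<zeta>. \<Sum>z\<in>Zs. ?w \<zeta> * indicator (?I z) \<zeta>) \<in> borel_measurable lborel" by measurable
    have m2: "?b \<in> borel_measurable lborel" by measurable
    have m3: "(\<lambda>\<zeta>. ennreal (1 / \<eta>) * ?b \<zeta>) \<in> borel_measurable lborel" by measurable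
    have "1 \<le> mass t s {1<..L}" by (rule mass_total_ge[OF t(1) en L])
    also have "\<dots> \<le> (\<integral>\<^sup>+\<zeta>. ((\<Sum>z\<in>Zs. ?w \<zeta> * indicator (?I z) \<zeta>) + ennreal (1 / \<eta>) * ?b \<zeta>) \<partial>lborel)"
      unfolding mass_def by (rule nn_integral_mono) (rule pw)
    also have "\<dots> = (\<Sum>z\<in>Zs. mass t s (?I z)) + ennreal (1 / \<eta>) * S.band s t"
    proof -
      have "(\<integral>\<^sup>+\<zeta>. (\<Sum>z\<in>Zs. ?w \<zeta> * indicator (?I z) \<zeta>) \<partial>lborel) = (\<Sum>z\<in>Zs. mass t s (?I z))"
        unfolding mass_def by (rule nn_integral_sum) measurable
      moreover have "S.band s t = (\<integral>\<^sup>+\<zeta>. ?b \<zeta> \<partial>lborel)" unfolding S.band_def Sm L_def ..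
      ultimately show ?thesis by (simp only: nn_integral_add[OF m1 m3] nn_integral_cmult[OF m2])
    qed
    also have "\<dots> \<le> (\<Sum>z\<in>Zs. ennreal (\<epsilon> * (112 * M))) + ennreal (1 / \<eta>) * ennreal (\<eta> / 4)"
    proof (intro add_mono sum_mono mult_left_mono)
      fix z assume z: "z \<in> Zs"
      show "mass t s (?I z) \<le> ennreal (\<epsilon> * (112 * M))"
      proof (rule mass_local_le[OF t(1) en _ sJ[OF z]])
        show "real K ^ fst (x z) * (z + snd (x z) - (z - snd (x z))) \<le> 1" using x[OF z] by simp
        show "wave t (fst (x z)) \<zeta> \<le> \<epsilon>" if "z - snd (x z) < \<zeta>" "\<zeta> \<le> z + snd (x z)" for \<zeta>
          using x[OF z] that by (auto simp: abs_le_iff)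
      qed (use M \<epsilon> in auto)
    next
      show "S.band s t \<le> ennreal (\<eta> / 4)" using i(2) by (simp add: s_def)
    qed simp
    also have "\<dots> = ennreal (real (card Zs) * (\<epsilon> * (112 * M)) + 1 / 4)"
      using \<epsilon> M \<eta> by (simp add: ennreal_of_nat_eq_real_of_nat ennreal_mult'[symmetric] ennreal_plus[symmetric] del: ennreal_plus)
    also have "real (card Zs) * (\<epsilon> * (112 * M)) \<le> 1 / 4"
    proof -
      have "1 / (4 * c * n) * c = 1 / (4 * n)" if "c > 0" "n > 0" for c n :: real using that by (simp add: field_simps)
      from this[of "112 * M" "real (card Zs) + 1"] have "\<epsilon> * (112 * M) = 1 / (4 * (real (card Zs) + 1))"
        using M unfolding \<epsilon>_def by simp
      then show ?thesis by (simp add: divide_le_eq)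
    qed
    finally have "ennreal 1 \<le> ennreal (1 / 4 + 1 / 4)" by (simp add: ennreal_leI)
    then show False by (subst (asm) ennreal_le_iff) auto
  qed
  then show ?thesis using t0 by simp
qed

end

section \<open>From slopes to directions\<close>

lemma digit_sums_Suc:
  "digit_sums K A (Suc n) = (\<lambda>(y, a). y + real a / real K ^ Suc n) ` (digit_sums K A n \<times> A)"
proof (intro equalityI subsetI)
  fix x assume "x \<in> digit_sums K A (Suc n)"
  then obtain a :: "nat \<Rightarrow> nat" where a: "\<forall>j\<in>{1..Suc n}. a j \<in> A" "x = (\<Sum>j=1..Suc n. real (a j) / real K ^ j)"
    by (auto simp: digit_sums_def)
  then have "(\<Sum>j=1..n. real (a j) / real K ^ j) \<in> digit_sums K A n" by (auto simp: digit_sums_def)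
  then have "((\<Sum>j=1..n. real (a j) / real K ^ j), a (Suc n)) \<in> digit_sums K A n \<times> A" using a by auto
  moreover have "x = (\<lambda>(y, a). y + real a / real K ^ Suc n) ((\<Sum>j=1..n. real (a j) / real K ^ j), a (Suc n))"
    using a by simp
  ultimately show "x \<in> (\<lambda>(y, a). y + real a / real K ^ Suc n) ` (digit_sums K A n \<times> A)" by blast
next
  fix x assume "x \<in> (\<lambda>(y, a). y + real a / real K ^ Suc n) ` (digit_sums K A n \<times> A)"
  then obtain b c where b: "\<forall>j\<in>{1..n}. b j \<in> A" "c \<in> A" "x = (\<Sum>j=1..n. real (b j) / real K ^ j) + real c / real K ^ Suc n"
    by (auto simp: digit_sums_def)
  define a where "a = b(Suc n := c)"
  have "(\<Sum>j=1..n. real (a j) / real K ^ j) = (\<Sum>j=1..n. real (b j) / real K ^ j)"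
    by (intro sum.cong) (auto simp: a_def)
  then have "x = (\<Sum>j=1..Suc n. real (a j) / real K ^ j)" using b by (simp add: a_def)
  moreover have "\<forall>j\<in>{1..Suc n}. a j \<in> A" using b by (auto simp: a_def)
  ultimately show "x \<in> digit_sums K A (Suc n)" unfolding digit_sums_def by blast
qed

lemma digit_sums_eq:
  assumes "K > 0"
  shows "digit_sums K A n = (\<lambda>x. real x / real K ^ n) ` digit_nums K A n"
proof (induction n)
  case 0
  then show ?case by (auto simp: digit_sums_def)
next
  case (Suc n)
  have "real x / real K ^ n + real a / real K ^ Suc n = real (K * x + a) / real K ^ Suc n" for x a
    using assms by (simp add: field_simps)
  then show ?case unfolding digit_sums_Suc Suc digit_nums.simps
    by (auto simp: image_iff simp del: power_Suc) (metis (no_types, lifting) of_nat_add of_nat_mult)+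
qed

lemma cantor_iter_iff:
  "z \<in> cantor_iter K A B n \<longleftrightarrow> (\<exists>x\<in>digit_sums K A n. \<exists>y\<in>digit_sums K B n.
     x \<le> fst z \<and> fst z \<le> x + 1 / real K ^ n \<and> y \<le> snd z \<and> snd z \<le> y + 1 / real K ^ n)"
proof
  assume "z \<in> cantor_iter K A B n"
  then obtain p q where "p \<in> digit_sums K A n \<times> digit_sums K B n"
    "q \<in> {0..1 / real K ^ n} \<times> {0..1 / real K ^ n}" "z = p + q"
    unfolding cantor_iter_def by (blast elim: set_plus_elim)
  then show "\<exists>x\<in>digit_sums K A n. \<exists>y\<in>digit_sums K B n.
     x \<le> fst z \<and> fst z \<le> x + 1 / real K ^ n \<and> y \<le> snd z \<and> snd z \<le> y + 1 / real K ^ n"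
    by (intro bexI[of _ "fst p"] bexI[of _ "snd p"]) auto
next
  assume "\<exists>x\<in>digit_sums K A n. \<exists>y\<in>digit_sums K B n.
     x \<le> fst z \<and> fst z \<le> x + 1 / real K ^ n \<and> y \<le> snd z \<and> snd z \<le> y + 1 / real K ^ n"
  then obtain x y where xy: "x \<in> digit_sums K A n" "y \<in> digit_sums K B n"
    "x \<le> fst z" "fst z \<le> x + 1 / real K ^ n" "y \<le> snd z" "snd z \<le> y + 1 / real K ^ n" by blast
  have "z = (x, y) + (fst z - x, snd z - y)" by (simp add: prod_eq_iff)
  moreover have "(x, y) \<in> digit_sums K A n \<times> digit_sums K B n" using xy by simp
  moreover have "(fst z - x, snd z - y) \<in> {0..1 / real K ^ n} \<times> {0..1 / real K ^ n}" using xy by auto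
  ultimately show "z \<in> cantor_iter K A B n" unfolding cantor_iter_def by (metis set_plus_intro)
qed

lemma cantor_iter_swap: "z \<in> cantor_iter K A B n \<Longrightarrow> (snd z, fst z) \<in> cantor_iter K B A n"
  unfolding cantor_iter_iff by auto

text \<open>The digit map induced by the reflection of the unit interval that sends \<open>x\<close>
  to \<open>1 - x\<close>.\<close>

definition reflect :: "nat \<Rightarrow> nat set \<Rightarrow> nat set" where
  "reflect K A = (\<lambda>a. K - 1 - a) ` A"

text \<open>Reflection exchanges left and right ends of the intervals, hence the shift by
  \<open>1 / K ^ n\<close>.\<close>

lemma digit_sums_reflect:
  assumes A: "A \<subseteq> {0..<K}" and x: "x \<in> digit_sums K A n"
  shows "1 - 1 / real K ^ n - x \<in> digit_sums K (reflect K A) n"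
  using x
proof (induction n arbitrary: x)
  case 0
  then show ?case by (simp add: digit_sums_def)
next
  case (Suc n)
  then obtain y a where y: "y \<in> digit_sums K A n" "a \<in> A" "x = y + real a / real K ^ Suc n"
    unfolding digit_sums_Suc by auto
  have aK: "a < K" using y A by auto
  then have "real (K - 1 - a) = real K - 1 - real a" by (simp add: of_nat_diff)
  then have e: "1 - 1 / real K ^ Suc n - x = (1 - 1 / real K ^ n - y) + real (K - 1 - a) / real K ^ Suc n"
    using aK y by (simp add: diff_divide_distrib add_divide_distrib)
  have m: "(1 - 1 / real K ^ n - y, K - 1 - a) \<in> digit_sums K (reflect K A) n \<times> reflect K A"
    using Suc.IH[OF y(1)] y(2) by (auto simp: reflect_def)
  show ?case unfolding digit_sums_Suc by (rule image_eqI[OF _ m]) (simp only: prod.case e)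
qed

lemma cantor_iter_reflect:
  assumes A: "A \<subseteq> {0..<K}" and z: "z \<in> cantor_iter K A B n"
  shows "(1 - fst z, snd z) \<in> cantor_iter K (reflect K A) B n"
proof -
  obtain x y where xy: "x \<in> digit_sums K A n" "y \<in> digit_sums K B n"
    "x \<le> fst z" "fst z \<le> x + 1 / real K ^ n" "y \<le> snd z" "snd z \<le> y + 1 / real K ^ n"
    using z unfolding cantor_iter_iff by blast
  show ?thesis unfolding cantor_iter_iff
    by (rule bexI[OF _ digit_sums_reflect[OF A xy(1)]], rule bexI[OF _ xy(2)]) (use xy in auto)
qed

lemma digit_pair_swap: "digit_pair K A B \<Longrightarrow> digit_pair K B A"
  by (auto simp: digit_pair_def mult.commute)

lemma digit_pair_reflect:
  assumes "digit_pair K A B" shows "digit_pair K (reflect K A) B" "card (reflect K A) = card A"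
proof -
  have A: "A \<subseteq> {0..<K}" using assms by (simp add: digit_pair_def)
  have "inj_on (\<lambda>a. K - 1 - a) A"
  proof (rule inj_onI)
    fix a b assume ab: "a \<in> A" "b \<in> A" "K - 1 - a = K - 1 - b"
    then have "a < K" "b < K" using A by auto
    then show "a = b" using ab(3) by linarith
  qed
  then show c: "card (reflect K A) = card A" by (simp add: reflect_def card_image)
  have "K > 0" using digit_pair.K4[OF assms] by simp
  then have "reflect K A \<subseteq> {0..<K}" by (auto simp: reflect_def)
  then show "digit_pair K (reflect K A) B" using assms c by (simp add: digit_pair_def)
qed

context digit_pair begin

lemma cantor_iter_proj:
  assumes z: "z \<in> cantor_iter K A B n" and t: "t \<ge> 0"
  shows "fst z + t * snd z \<in> proj t n"
proof -
  have K0: "K > 0" "real K ^ n > 0" using K4 by auto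
  obtain a b where ab: "a \<in> digit_nums K A n" "b \<in> digit_nums K B n"
    "real a / real K ^ n \<le> fst z" "fst z \<le> real a / real K ^ n + 1 / real K ^ n"
    "real b / real K ^ n \<le> snd z" "snd z \<le> real b / real K ^ n + 1 / real K ^ n"
    using z unfolding cantor_iter_iff digit_sums_eq[OF K0(1)] by auto
  have m: "t * (real b / real K ^ n) \<le> t * snd z" "t * snd z \<le> t * (real b / real K ^ n + 1 / real K ^ n)"
    by (rule mult_left_mono[OF ab(5) t], rule mult_left_mono[OF ab(6) t])
  have e1: "pos t (a, b) / K ^ n = real a / real K ^ n + t * (real b / real K ^ n)"
    by (simp add: pos_def add_divide_distrib)
  have e2: "(pos t (a, b) + (1 + t)) / K ^ n = (real a / real K ^ n + 1 / real K ^ n) + t * (real b / real K ^ n + 1 / real K ^ n)"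
    by (simp add: pos_def add_divide_distrib algebra_simps)
  have "fst z + t * snd z \<in> {pos t (a, b) / K ^ n .. (pos t (a, b) + (1 + t)) / K ^ n}"
    unfolding e1 e2 atLeastAtMost_iff by (intro conjI add_mono ab m)
  then show ?thesis using ab unfolding proj_def sq_def by blast
qed

lemma emeasure_image_le:
  assumes h: "\<And>z. z \<in> E \<Longrightarrow> h z \<in> cantor_iter K A B n" and t: "t \<ge> 0" and r: "\<bar>r\<bar> \<le> 1"
    and f: "\<And>z. z \<in> E \<Longrightarrow> f z = r * (fst (h z) + t * snd (h z)) + d"
  shows "emeasure lebesgue (f ` E) \<le> ennreal (measure lebesgue (proj t n))"
proof -
  have sub: "f ` E \<subseteq> (\<lambda>x. r *\<^sub>R x + d) ` proj t n"
  proof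
    fix x assume "x \<in> f ` E"
    then obtain z where z: "z \<in> E" "x = f z" by blast
    then show "x \<in> (\<lambda>x. r *\<^sub>R x + d) ` proj t n" using cantor_iter_proj[OF h[OF z(1)] t] f[OF z(1)] by auto
  qed
  have "compact ((\<lambda>x. r *\<^sub>R x + d) ` proj t n)"
    by (intro compact_continuous_image continuous_intros compact_proj)
  then have "(\<lambda>x. r *\<^sub>R x + d) ` proj t n \<in> sets lebesgue"
    using lmeasurable_compact fmeasurableD by blast
  then have "emeasure lebesgue (f ` E) \<le> emeasure lebesgue ((\<lambda>x. r *\<^sub>R x + d) ` proj t n)"
    by (intro emeasure_mono sub)
  also have "\<dots> = ennreal \<bar>r\<bar> * emeasure lebesgue (proj t n)"
    using emeasure_lebesgue_affine[of r d "proj t n"] by simp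
  also have "\<dots> \<le> 1 * emeasure lebesgue (proj t n)" using r by (intro mult_right_mono) (auto simp: ennreal_le_1)
  also have "\<dots> = ennreal (measure lebesgue (proj t n))" using lm_proj by (simp add: emeasure_eq_measure2)
  finally show ?thesis .
qed

end

text \<open>Swapping the coordinates and reflecting a digit set make the slope nonnegative, at the
  cost of an affine map with factor of modulus at most 1. For every direction one of the four cases
  has slope at most 1.\<close>

lemma direction_cases:
  fixes c s :: real
  assumes AB: "digit_pair K A B" and cs: "\<bar>c\<bar> \<le> 1" "\<bar>s\<bar> \<le> 1" and E: "E \<subseteq> cantor_iter K A B n"
  defines "f \<equiv> \<lambda>z. fst z * c + snd z * s"
  shows "c \<noteq> 0 \<Longrightarrow> 0 \<le> s / c \<Longrightarrow> emeasure lebesgue (f ` E) \<le> ennreal (measure lebesgue (digit_pair.proj K A B (s / c) n))"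
    and "s \<noteq> 0 \<Longrightarrow> 0 \<le> c / s \<Longrightarrow> emeasure lebesgue (f ` E) \<le> ennreal (measure lebesgue (digit_pair.proj K B A (c / s) n))"
    and "s \<noteq> 0 \<Longrightarrow> 0 \<le> - c / s \<Longrightarrow> emeasure lebesgue (f ` E) \<le> ennreal (measure lebesgue (digit_pair.proj K (reflect K B) A (- c / s) n))"
    and "c \<noteq> 0 \<Longrightarrow> 0 \<le> - s / c \<Longrightarrow> emeasure lebesgue (f ` E) \<le> ennreal (measure lebesgue (digit_pair.proj K (reflect K A) B (- s / c) n))"
proof -
  have sub: "A \<subseteq> {0..<K}" "B \<subseteq> {0..<K}" using AB by (auto simp: digit_pair_def)
  show "c \<noteq> 0 \<Longrightarrow> 0 \<le> s / c \<Longrightarrow> emeasure lebesgue (f ` E) \<le> ennreal (measure lebesgue (digit_pair.proj K A B (s / c) n))"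
    by (rule digit_pair.emeasure_image_le[OF AB, where h = "\<lambda>z. z" and r = c and d = 0])
      (use E cs in \<open>auto simp: f_def algebra_simps\<close>)
  show "s \<noteq> 0 \<Longrightarrow> 0 \<le> c / s \<Longrightarrow> emeasure lebesgue (f ` E) \<le> ennreal (measure lebesgue (digit_pair.proj K B A (c / s) n))"
    by (rule digit_pair.emeasure_image_le[OF digit_pair_swap[OF AB], where h = "\<lambda>z. (snd z, fst z)" and r = s and d = 0])
      (use E cs cantor_iter_swap in \<open>auto simp: f_def algebra_simps\<close>)
  show "s \<noteq> 0 \<Longrightarrow> 0 \<le> - c / s \<Longrightarrow> emeasure lebesgue (f ` E) \<le> ennreal (measure lebesgue (digit_pair.proj K (reflect K B) A (- c / s) n))"
  proof (rule digit_pair.emeasure_image_le[OF digit_pair_reflect(1)[OF digit_pair_swap[OF AB]], where h = "\<lambda>z. (1 - snd z, fst z)" and r = "- s" and d = s])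
    show "(1 - snd z, fst z) \<in> cantor_iter K (reflect K B) A n" if "z \<in> E" for z
      using cantor_iter_reflect[OF sub(2) cantor_iter_swap, of z A n] that E by auto
  qed (use cs in \<open>auto simp: f_def algebra_simps\<close>)
  show "c \<noteq> 0 \<Longrightarrow> 0 \<le> - s / c \<Longrightarrow> emeasure lebesgue (f ` E) \<le> ennreal (measure lebesgue (digit_pair.proj K (reflect K A) B (- s / c) n))"
  proof (rule digit_pair.emeasure_image_le[OF digit_pair_reflect(1)[OF AB], where h = "\<lambda>z. (1 - fst z, snd z)" and r = "- c" and d = c])
    show "(1 - fst z, snd z) \<in> cantor_iter K (reflect K A) B n" if "z \<in> E" for z
      using cantor_iter_reflect[OF sub(1)] that E by auto
  qed (use cs in \<open>auto simp: f_def algebra_simps\<close>)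
qed

text \<open>\<open>rational_slope\<close> applies to whichever of the four slopes
  \<open>s / c\<close>, \<open>- s / c\<close>, \<open>c / s\<close>, \<open>- c / s\<close> lies in
  \<open>[0, 1]\<close>; negation and inversion carry rationality back to
  \<open>s / c\<close>.\<close>

lemma rational_direction:
  fixes c s :: real
  assumes AB: "digit_pair K A B" and cs: "c\<^sup>2 + s\<^sup>2 = 1"
    and pos: "emeasure lebesgue ((\<lambda>z. fst z * c + snd z * s) ` cantor_set K A B) > 0"
  shows "c \<noteq> 0 \<and> s / c \<in> \<rat> \<and> s / c \<noteq> 0"
proof -
  let ?f = "\<lambda>z. fst z * c + snd z * s"
  let ?E = "cantor_set K A B"
  have cs1: "\<bar>c\<bar> \<le> 1" "\<bar>s\<bar> \<le> 1"
    using cs by (auto simp: abs_square_le_1[symmetric]) (metis add.commute le_add_same_cancel1 zero_le_power2)+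
  have E: "?E \<subseteq> cantor_iter K A B n" if "n \<ge> 1" for n using that by (auto simp: cantor_set_def)
  have BA: "digit_pair K B A" by (rule digit_pair_swap[OF AB])
  have main: "t \<in> \<rat> \<and> t \<noteq> 0" if t: "0 \<le> t" "t \<le> 1" and D: "digit_pair K A' B'"
    and le: "\<And>n. n \<ge> 1 \<Longrightarrow> emeasure lebesgue (?f ` ?E) \<le> ennreal (measure lebesgue (digit_pair.proj K A' B' t n))" for t A' B'
  proof -
    interpret D: digit_pair K A' B' by (rule D)
    have fin: "emeasure lebesgue (?f ` ?E) < \<infinity>" using le[of 1] by (simp add: le_less_trans)
    define e where "e = enn2real (emeasure lebesgue (?f ` ?E))"
    have e: "emeasure lebesgue (?f ` ?E) = ennreal e" using fin by (simp add: e_def)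
    have e0: "e > 0" using pos unfolding e by simp
    have e1: "e \<le> measure lebesgue (D.proj t n)" if "n \<ge> 1" for n
      using le[OF that] e0 unfolding e by simp
    have "e \<le> measure lebesgue (D.proj t n)" for n
      using e1[of "max n 1"] D.measure_proj_antimono[OF t(1), of n "max n 1"] by simp
    then show ?thesis by (rule D.rational_slope[OF t e0])
  qed
  have ratio_le: "\<bar>x / y\<bar> \<le> 1" if "\<bar>x\<bar> \<le> \<bar>y\<bar>" for x y :: real using that by (simp add: abs_divide divide_le_eq_1)
  show ?thesis
  proof (cases "\<bar>s\<bar> \<le> \<bar>c\<bar>")
    case True
    then have c0: "c \<noteq> 0" using cs by auto
    have r1: "s / c \<le> 1" "- s / c \<le> 1" using ratio_le[OF True] abs_le_iff[of "s / c" 1] by auto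
    show ?thesis
    proof (cases "0 \<le> s / c")
      case p: True
      have "s / c \<in> \<rat> \<and> s / c \<noteq> 0"
        by (rule main[OF p _ AB]) (use r1 direction_cases(1)[OF AB cs1 E c0 p] in auto)
      then show ?thesis using c0 by simp
    next
      case False
      then have p: "0 \<le> - s / c" by simp
      have "- s / c \<in> \<rat> \<and> - s / c \<noteq> 0"
        by (rule main[OF p _ digit_pair_reflect(1)[OF AB]]) (use r1 direction_cases(4)[OF AB cs1 E c0 p] in auto)
      then have "- (- s / c) \<in> \<rat>" "s / c \<noteq> 0" using Rats_minus_iff by auto
      then show ?thesis using c0 by simp
    qed
  next
    case False
    then have s0: "s \<noteq> 0" by auto
    have "\<bar>c / s\<bar> \<le> 1" using False by (intro ratio_le) simp
    then have r1: "c / s \<le> 1" "- c / s \<le> 1" using abs_le_iff[of "c / s" 1] by auto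
    show ?thesis
    proof (cases "0 \<le> c / s")
      case p: True
      have m: "c / s \<in> \<rat> \<and> c / s \<noteq> 0"
        by (rule main[OF p _ BA]) (use r1 direction_cases(2)[OF AB cs1 E s0 p] in auto)
      have "inverse (c / s) \<in> \<rat>" using m by (intro Rats_inverse) blast
      then show ?thesis using s0 m unfolding inverse_divide by auto
    next
      case False
      then have p: "0 \<le> - c / s" by simp
      have m: "- c / s \<in> \<rat> \<and> - c / s \<noteq> 0"
        by (rule main[OF p _ digit_pair_reflect(1)[OF BA]]) (use r1 direction_cases(3)[OF AB cs1 E s0 p] in auto)
      have "- inverse (- c / s) \<in> \<rat>" using m by (intro Rats_minus_iff[THEN iffD2] Rats_inverse) blast
      moreover have "- inverse (- c / s) = s / c" unfolding inverse_divide by simp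
      ultimately show ?thesis using s0 m by auto
    qed
  qed
qed

lemma borel_measurable_tan [measurable]: "(tan :: real \<Rightarrow> real) \<in> borel_measurable borel"
  unfolding tan_def[abs_def] by measurable

lemma cos_tan_octant:
  assumes "x \<in> {0..pi / 4}"
  shows "0 < cos x" "0 \<le> tan x" "tan x \<le> 1"
proof -
  have x: "0 \<le> x" "x \<le> pi / 4" using assms by auto
  then show "0 < cos x" using pi_gt_zero by (intro cos_gt_zero_pi) linarith+
  have "tan 0 \<le> tan x" using x pi_gt_zero by (intro tan_mono_le) linarith+
  then show "0 \<le> tan x" by simp
  have "tan x \<le> tan (pi / 4)" using x pi_gt_zero by (intro tan_mono_le) linarith+
  then show "tan x \<le> 1" by (simp add: tan_45)
qed

text \<open>The derivative of \<open>tan\<close> is at least 1, so taking preimages does not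
  increase measure.\<close>

lemma nn_integral_tan_le:
  assumes Bad: "Bad \<in> sets borel"
  shows "(\<integral>\<^sup>+\<phi>. indicator Bad (tan \<phi>) * indicator {0..pi / 4} \<phi> \<partial>lborel) \<le> emeasure lborel Bad"
proof -
  have cos0: "cos x \<noteq> 0" if "x \<in> {0..pi / 4}" for x using cos_tan_octant(1)[OF that] by simp
  have "(\<integral>\<^sup>+\<phi>. indicator Bad (tan \<phi>) * indicator {0..pi / 4} \<phi> \<partial>lborel)
    \<le> (\<integral>\<^sup>+\<phi>. (indicator Bad (tan \<phi>) :: ennreal) * ennreal (1 + (tan \<phi>)\<^sup>2) * indicator {0..pi / 4} \<phi> \<partial>lborel)"
  proof (rule nn_integral_mono)
    fix \<phi> :: real
    have "ennreal 1 \<le> ennreal (1 + (tan \<phi>)\<^sup>2)" by (intro ennreal_leI) simp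
    then show "indicator Bad (tan \<phi>) * indicator {0..pi / 4} \<phi> \<le> (indicator Bad (tan \<phi>) :: ennreal) * ennreal (1 + (tan \<phi>)\<^sup>2) * indicator {0..pi / 4} \<phi>"
      by (auto split: split_indicator)
  qed
  also have "\<dots> = (\<integral>\<^sup>+x. (indicator Bad x :: ennreal) * indicator {tan 0..tan (pi / 4)} x \<partial>lborel)"
  proof (rule nn_integral_substitution_aux[symmetric])
    show "(\<lambda>x. indicator Bad x :: ennreal) \<in> borel_measurable borel" using Bad by measurable
    show "(tan has_real_derivative 1 + (tan x)\<^sup>2) (at x)" if "x \<in> {0..pi / 4}" for x
    proof -
      have c: "cos x \<noteq> 0" by (rule cos0[OF that])
      have "inverse ((cos x)\<^sup>2) = 1 + (tan x)\<^sup>2"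
        using c by (simp add: tan_def power_divide field_simps)
      then show ?thesis using DERIV_tan[OF c] by simp
    qed
    show "continuous_on {0..pi / 4} (\<lambda>x. 1 + (tan x)\<^sup>2)"
      by (intro continuous_intros) (use cos0 in auto)
  qed auto
  also have "\<dots> \<le> (\<integral>\<^sup>+x. indicator Bad x \<partial>lborel)" by (intro nn_integral_mono) (auto split: split_indicator)
  also have "\<dots> = emeasure lborel Bad" using Bad by simp
  finally show ?thesis .
qed

lemma nn_integral_tan_affine_le:
  fixes u v :: real
  assumes Bad: "Bad \<in> sets borel" and u: "\<bar>u\<bar> = 1"
  shows "(\<integral>\<^sup>+\<theta>. indicator Bad (tan (v + u * \<theta>)) * indicator {0..pi / 4} (v + u * \<theta>) \<partial>lborel) \<le> emeasure lborel Bad"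
proof -
  have "(\<lambda>\<phi>::real. (indicator Bad (tan \<phi>) :: ennreal) * indicator {0..pi / 4} \<phi>) \<in> borel_measurable borel"
    using Bad by measurable
  from nn_integral_real_affine[OF this, of u v] u
  have "(\<integral>\<^sup>+\<phi>. indicator Bad (tan \<phi>) * indicator {0..pi / 4} \<phi> \<partial>lborel)
    = (\<integral>\<^sup>+\<theta>. indicator Bad (tan (v + u * \<theta>)) * indicator {0..pi / 4} (v + u * \<theta>) \<partial>lborel)" by auto
  then show ?thesis using nn_integral_tan_le[OF Bad] by simp
qed

lemma codim_ge_dim_exponent:
  assumes AB: "digit_pair K A B"
  shows "0 < dim_exponent K A B" "3 / 4 * dim_exponent K A B \<le> digit_pair.codim K A" "3 / 4 * dim_exponent K A B \<le> digit_pair.codim K B"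
proof -
  interpret D: digit_pair K A B by (rule AB)
  interpret D': digit_pair K B A by (rule digit_pair_swap[OF AB])
  have "ln (real (card A)) / ln (real K) > 0" "ln (real (card B)) / ln (real K) > 0"
    using D.card_A D.card_B D.K4 by auto
  then show "0 < dim_exponent K A B" by (simp add: dim_exponent_def)
  show "3 / 4 * dim_exponent K A B \<le> D.codim" "3 / 4 * dim_exponent K A B \<le> D'.codim"
    unfolding dim_exponent_def D.codim_def D'.codim_def by (intro mult_left_mono; simp)+
qed

text \<open>A measurable majorant \<open>F\<close> is produced because the measure of the projection
  is not shown to be measurable in the direction. On \<open>Bad\<close> the trivial bound 2 is used,
  which turns \<open>C\<close> into \<open>3 * C\<close>.\<close>

lemma slope_bound_quadrant:
  fixes u v :: real
  assumes D: "digit_pair K A B" and u: "\<bar>u\<bar> = 1" and p: "p \<ge> 6 + 9 / digit_pair.codim K A"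
  shows "\<exists>C\<ge>0. \<forall>n\<ge>1. \<exists>F\<in>borel_measurable lborel. (\<integral>\<^sup>+\<theta>. F \<theta> \<partial>lborel) \<le> ennreal (C * real n powr (- 1 / p)) \<and>
     (\<forall>\<theta>. v + u * \<theta> \<in> {0..pi / 4} \<longrightarrow> ennreal (measure lebesgue (digit_pair.proj K A B (tan (v + u * \<theta>)) n)) \<le> F \<theta>)"
proof -
  interpret D: digit_pair K A B by (rule D)
  obtain C where C: "C \<ge> 0" and sb: "\<And>n. n \<ge> 1 \<Longrightarrow> \<exists>Bad\<in>sets borel. emeasure lborel Bad \<le> ennreal (C * real n powr (- 1 / p)) \<and>
    (\<forall>t. 0 \<le> t \<longrightarrow> t \<le> 1 \<longrightarrow> t \<notin> Bad \<longrightarrow> measure lebesgue (D.proj t n) \<le> C * real n powr (- 1 / p))"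
    using D.slope_bound[OF p] by blast
  have "\<exists>F\<in>borel_measurable lborel. (\<integral>\<^sup>+\<theta>. F \<theta> \<partial>lborel) \<le> ennreal (3 * C * real n powr (- 1 / p)) \<and>
     (\<forall>\<theta>. v + u * \<theta> \<in> {0..pi / 4} \<longrightarrow> ennreal (measure lebesgue (D.proj (tan (v + u * \<theta>)) n)) \<le> F \<theta>)"
    if n: "n \<ge> 1" for n
  proof -
    let ?e = "C * real n powr (- 1 / p)"
    have e0: "?e \<ge> 0" using C by simp
    obtain Bad where Bad: "Bad \<in> sets borel" "emeasure lborel Bad \<le> ennreal ?e"
      and good: "\<And>t. 0 \<le> t \<Longrightarrow> t \<le> 1 \<Longrightarrow> t \<notin> Bad \<Longrightarrow> measure lebesgue (D.proj t n) \<le> ?e"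
      using sb[OF n] by blast
    let ?I = "\<lambda>\<theta>. indicator {0..pi / 4} (v + u * \<theta>) :: ennreal"
    let ?J = "\<lambda>\<theta>. indicator Bad (tan (v + u * \<theta>)) * ?I \<theta> :: ennreal"
    have pw: "ennreal (measure lebesgue (D.proj (tan (v + u * \<theta>)) n)) \<le> ennreal ?e * ?I \<theta> + ennreal 2 * ?J \<theta>"
      if True: "v + u * \<theta> \<in> {0..pi / 4}" for \<theta>
    proof -
      define t where "t = tan (v + u * \<theta>)"
      have t: "0 \<le> t" "t \<le> 1"
        unfolding t_def by (rule cos_tan_octant[OF True])+
      have "measure lebesgue (D.proj t n) \<le> ?e + 2 * indicator Bad t"
        using good[OF t] D.measure_proj_le[OF t(1), of n] t e0 by (cases "t \<in> Bad") auto
      then have "ennreal (measure lebesgue (D.proj t n)) \<le> ennreal (?e + 2 * indicator Bad t)" by (rule ennreal_leI)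
      also have "\<dots> = ennreal ?e + ennreal 2 * indicator Bad t"
        using e0 by (subst ennreal_plus) (auto split: split_indicator)
      finally show ?thesis using True by (simp add: t_def)
    qed
    have m1: "?I \<in> borel_measurable lborel" by measurable
    have m2: "?J \<in> borel_measurable lborel" using Bad(1) by measurable
    have m3: "(\<lambda>\<theta>. ennreal ?e * ?I \<theta>) \<in> borel_measurable lborel" by measurable
    have m4: "(\<lambda>\<theta>. ennreal 2 * ?J \<theta>) \<in> borel_measurable lborel" using Bad(1) by measurable
    have I1: "(\<integral>\<^sup>+\<theta>. ?I \<theta> \<partial>lborel) \<le> 1"
    proof -
      have "(\<lambda>\<phi>::real. indicator {0..pi / 4} \<phi> :: ennreal) \<in> borel_measurable borel" by measurable
      from nn_integral_real_affine[OF this, of u v] u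
      have "(\<integral>\<^sup>+\<theta>. ?I \<theta> \<partial>lborel) = emeasure lborel {0..pi / 4}" by auto
      also have "\<dots> = ennreal (pi / 4)" by simp
      also have "\<dots> \<le> ennreal 1" using pi_less_4 by (intro ennreal_leI) simp
      finally show ?thesis by simp
    qed
    have "(\<integral>\<^sup>+\<theta>. ennreal ?e * ?I \<theta> + ennreal 2 * ?J \<theta> \<partial>lborel) = ennreal ?e * (\<integral>\<^sup>+\<theta>. ?I \<theta> \<partial>lborel) + ennreal 2 * (\<integral>\<^sup>+\<theta>. ?J \<theta> \<partial>lborel)"
      by (simp only: nn_integral_add[OF m3 m4] nn_integral_cmult[OF m1] nn_integral_cmult[OF m2])
    also have "\<dots> \<le> ennreal ?e * 1 + ennreal 2 * ennreal ?e"
      by (intro add_mono mult_left_mono I1 order_trans[OF nn_integral_tan_affine_le[OF Bad(1) u] Bad(2)]) auto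
    also have "\<dots> = ennreal (3 * C * real n powr (- 1 / p))"
    proof -
      have "ennreal 2 * ennreal ?e = ennreal (2 * ?e)" by (rule ennreal_mult'[symmetric]) simp
      moreover have "ennreal ?e + ennreal (2 * ?e) = ennreal (?e + 2 * ?e)" using e0 by (intro ennreal_plus[symmetric]) auto
      moreover have "?e + 2 * ?e = 3 * C * real n powr (- 1 / p)" by simp
      ultimately show ?thesis by (simp only: mult_1_right)
    qed
    finally have "(\<integral>\<^sup>+\<theta>. ennreal ?e * ?I \<theta> + ennreal 2 * ?J \<theta> \<partial>lborel) \<le> ennreal (3 * C * real n powr (- 1 / p))" .
    then show ?thesis using pw
      by (intro bexI[of _ "\<lambda>\<theta>. ennreal ?e * ?I \<theta> + ennreal 2 * ?J \<theta>"] conjI allI impI borel_measurable_add m3 m4)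
  qed
  then show ?thesis using C by (intro exI[of _ "3 * C"]) auto
qed

text \<open>The slope bound is applied with either digit set in the role of \<open>A\<close>, so the
  smaller dimension decides: \<open>codim\<close> is at least
  \<open>3 / 4 * dim_exponent K A B\<close>, and 9 divided by 3 / 4 is 12.\<close>

lemma favard_bound:
  assumes AB: "digit_pair K A B" and p: "p \<ge> 6 + 12 / dim_exponent K A B"
  shows "\<exists>C. \<forall>n\<ge>1. favard (cantor_iter K A B n) \<le> ennreal (C * real n powr (- 1 / p))"
proof -
  have BA: "digit_pair K B A" by (rule digit_pair_swap[OF AB])
  have RA: "digit_pair K (reflect K A) B" and RB: "digit_pair K (reflect K B) A"
    by (rule digit_pair_reflect(1)[OF AB], rule digit_pair_reflect(1)[OF BA])
  have cR: "digit_pair.codim K (reflect K A) = digit_pair.codim K A" "digit_pair.codim K (reflect K B) = digit_pair.codim K B"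
    using digit_pair.codim_def[OF RA] digit_pair.codim_def[OF RB] digit_pair.codim_def[OF AB] digit_pair.codim_def[OF BA]
      digit_pair_reflect(2)[OF AB] digit_pair_reflect(2)[OF BA] by auto
  have de: "0 < dim_exponent K A B" by (rule codim_ge_dim_exponent[OF AB])
  have pc: "6 + 9 / c \<le> p" if "3 / 4 * dim_exponent K A B \<le> c" for c
  proof -
    have "9 / c \<le> 9 / (3 / 4 * dim_exponent K A B)" using that de by (intro divide_left_mono) auto
    also have "\<dots> = 12 / dim_exponent K A B" by simp
    finally show ?thesis using p by simp
  qed
  have pA: "6 + 9 / digit_pair.codim K A \<le> p" and pB: "6 + 9 / digit_pair.codim K B \<le> p"
    by (intro pc codim_ge_dim_exponent[OF AB])+
  let ?Q = "\<lambda>A B v u C n F. F \<in> borel_measurable lborel \<and> (\<integral>\<^sup>+\<theta>. F \<theta> \<partial>lborel) \<le> ennreal (C * real n powr (- 1 / p)) \<and>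
     (\<forall>\<theta>. v + u * \<theta> \<in> {0..pi / 4} \<longrightarrow> ennreal (measure lebesgue (digit_pair.proj K A B (tan (v + u * \<theta>)) n)) \<le> F \<theta>)"
  obtain C1 where C1: "C1 \<ge> 0" "\<And>n. n \<ge> 1 \<Longrightarrow> \<exists>F. ?Q A B 0 1 C1 n F"
    using slope_bound_quadrant[OF AB _ pA, of 1 0] by (auto simp: Bex_def)
  obtain C2 where C2: "C2 \<ge> 0" "\<And>n. n \<ge> 1 \<Longrightarrow> \<exists>F. ?Q B A (pi / 2) (- 1) C2 n F"
    using slope_bound_quadrant[OF BA _ pB, of "- 1" "pi / 2"] by (auto simp: Bex_def)
  obtain C3 where C3: "C3 \<ge> 0" "\<And>n. n \<ge> 1 \<Longrightarrow> \<exists>F. ?Q (reflect K B) A (- (pi / 2)) 1 C3 n F"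
    using slope_bound_quadrant[OF RB _ pB[folded cR(2)], of 1 "- (pi / 2)"] by (auto simp: Bex_def)
  obtain C4 where C4: "C4 \<ge> 0" "\<And>n. n \<ge> 1 \<Longrightarrow> \<exists>F. ?Q (reflect K A) B pi (- 1) C4 n F"
    using slope_bound_quadrant[OF RA _ pA[folded cR(1)], of "- 1" pi] by (auto simp: Bex_def)
  have "favard (cantor_iter K A B n) \<le> ennreal ((C1 + C2 + C3 + C4) * real n powr (- 1 / p))" if n: "n \<ge> 1" for n
  proof -
    let ?e = "real n powr (- 1 / p)"
    obtain F1 where F1: "?Q A B 0 1 C1 n F1" using C1(2)[OF n] by blast
    obtain F2 where F2: "?Q B A (pi / 2) (- 1) C2 n F2" using C2(2)[OF n] by blast
    obtain F3 where F3: "?Q (reflect K B) A (- (pi / 2)) 1 C3 n F3" using C3(2)[OF n] by blast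
    obtain F4 where F4: "?Q (reflect K A) B pi (- 1) C4 n F4" using C4(2)[OF n] by blast
    have m: "F1 \<in> borel_measurable lborel" "F2 \<in> borel_measurable lborel" "F3 \<in> borel_measurable lborel" "F4 \<in> borel_measurable lborel"
      using F1 F2 F3 F4 by blast+
    let ?E = "cantor_iter K A B n"
    have pw: "emeasure lebesgue (dir_proj \<theta> ` ?E) \<le> F1 \<theta> + F2 \<theta> + F3 \<theta> + F4 \<theta>" if \<theta>: "0 \<le> \<theta>" "\<theta> \<le> pi" for \<theta>
    proof -
      have d: "dir_proj \<theta> = (\<lambda>z. fst z * cos \<theta> + snd z * sin \<theta>)" by (auto simp: dir_proj_def)
      note dc = direction_cases[OF AB abs_cos_le_one abs_sin_le_one order_refl, of \<theta> \<theta> n, folded d]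
      consider "0 + 1 * \<theta> \<in> {0..pi / 4}" | "pi / 2 + - 1 * \<theta> \<in> {0..pi / 4}" | "- (pi / 2) + 1 * \<theta> \<in> {0..pi / 4}" | "pi + - 1 * \<theta> \<in> {0..pi / 4}"
        using \<theta> unfolding atLeastAtMost_iff by linarith
      then show ?thesis
      proof cases
        case 1
        have t: "sin \<theta> / cos \<theta> = tan (0 + 1 * \<theta>)" by (simp add: tan_def)
        have "emeasure lebesgue (dir_proj \<theta> ` ?E) \<le> F1 \<theta>"
          by (rule order_trans[OF dc(1)[unfolded t]]) (use cos_tan_octant[OF 1] F1 1 in auto)
        then show ?thesis by (simp add: add_increasing2)
      next
        case 2
        have e: "sin (pi / 2 + - 1 * \<theta>) = cos \<theta>" "cos (pi / 2 + - 1 * \<theta>) = sin \<theta>" by (simp_all add: sin_diff cos_diff)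
        have t: "cos \<theta> / sin \<theta> = tan (pi / 2 + - 1 * \<theta>)" unfolding tan_def e ..
        have "emeasure lebesgue (dir_proj \<theta> ` ?E) \<le> F2 \<theta>"
          by (rule order_trans[OF dc(2)[unfolded t]]) (use cos_tan_octant[OF 2, unfolded e] F2 2 in auto)
        then show ?thesis by (simp add: add_increasing add_increasing2)
      next
        case 3
        have e: "sin (- (pi / 2) + 1 * \<theta>) = - cos \<theta>" "cos (- (pi / 2) + 1 * \<theta>) = sin \<theta>" by (simp_all add: sin_diff cos_diff)
        have t: "- cos \<theta> / sin \<theta> = tan (- (pi / 2) + 1 * \<theta>)" unfolding tan_def e ..
        have "emeasure lebesgue (dir_proj \<theta> ` ?E) \<le> F3 \<theta>"
          by (rule order_trans[OF dc(3)[unfolded t]]) (use cos_tan_octant[OF 3, unfolded e] F3 3 in auto)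
        then show ?thesis by (simp add: add_increasing add_increasing2)
      next
        case 4
        have e: "sin (pi + - 1 * \<theta>) = sin \<theta>" "cos (pi + - 1 * \<theta>) = - cos \<theta>" by (simp_all add: sin_diff cos_diff)
        have t: "- sin \<theta> / cos \<theta> = tan (pi + - 1 * \<theta>)" unfolding tan_def e by simp
        have "emeasure lebesgue (dir_proj \<theta> ` ?E) \<le> F4 \<theta>"
          by (rule order_trans[OF dc(4)[unfolded t]]) (use cos_tan_octant[OF 4, unfolded e] F4 4 in auto)
        then show ?thesis by (simp add: add_increasing)
      qed
    qed
    have "favard ?E = (\<integral>\<^sup>+\<theta>. emeasure lebesgue (dir_proj \<theta> ` ?E) * indicator {0..pi} \<theta> \<partial>lborel)"
      unfolding favard_def by (simp add: nn_integral_completion)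
    also have "\<dots> \<le> (\<integral>\<^sup>+\<theta>. F1 \<theta> + F2 \<theta> + F3 \<theta> + F4 \<theta> \<partial>lborel)"
      by (rule nn_integral_mono) (auto split: split_indicator intro: pw)
    also have "\<dots> = (\<integral>\<^sup>+\<theta>. F1 \<theta> \<partial>lborel) + (\<integral>\<^sup>+\<theta>. F2 \<theta> \<partial>lborel) + (\<integral>\<^sup>+\<theta>. F3 \<theta> \<partial>lborel) + (\<integral>\<^sup>+\<theta>. F4 \<theta> \<partial>lborel)"
      using m by (simp add: nn_integral_add)
    also have "\<dots> \<le> ennreal (C1 * ?e) + ennreal (C2 * ?e) + ennreal (C3 * ?e) + ennreal (C4 * ?e)"
      using F1 F2 F3 F4 by (intro add_mono) blast+
    also have "\<dots> = ennreal ((C1 + C2 + C3 + C4) * ?e)"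
      using C1(1) C2(1) C3(1) C4(1) by (simp add: ennreal_plus[symmetric] distrib_right del: ennreal_plus)
    finally show ?thesis .
  qed
  then show ?thesis by blast
qed

theorem mainTheorem2:
  fixes K :: nat and A B :: "nat set" and \<theta>\<^sub>0 :: real
  assumes "A \<subseteq> {0..<K}" and "B \<subseteq> {0..<K}"
    and "card A * card B = K"
    and "card A > 1" and "card B > 1"
    and "emeasure lebesgue (dir_proj \<theta>\<^sub>0 ` cantor_set K A B) > 0"
  shows "cos \<theta>\<^sub>0 \<noteq> 0 \<and> tan \<theta>\<^sub>0 \<in> \<rat>
    \<and> dim_exponent K A B > 0
    \<and> (\<forall>q r :: nat. r > 0 \<and> coprime q r \<and> \<bar>tan \<theta>\<^sub>0\<bar> = real q / real r \<longrightarrow>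
         (\<forall>p :: real. p > 6 + 4 * (1 + real q + real r) * inverse (dim_exponent K A B) \<longrightarrow>
           (\<exists>C :: real. \<forall>n :: nat. n \<ge> 1 \<longrightarrow>
              favard (cantor_iter K A B n) \<le> ennreal (C * real n powr (- 1 / p)))))
    \<and> (\<exists>p :: real. p > 6 \<and>
         (\<exists>C :: real. \<forall>n :: nat. n \<ge> 1 \<longrightarrow>
            favard (cantor_iter K A B n) \<le> ennreal (C * real n powr (- 1 / p))))"
proof -
  have AB: "digit_pair K A B" using assms by (simp add: digit_pair_def)
  have d: "dir_proj \<theta>\<^sub>0 = (\<lambda>z. fst z * cos \<theta>\<^sub>0 + snd z * sin \<theta>\<^sub>0)" by (auto simp: dir_proj_def)
  have rat: "cos \<theta>\<^sub>0 \<noteq> 0 \<and> sin \<theta>\<^sub>0 / cos \<theta>\<^sub>0 \<in> \<rat> \<and> sin \<theta>\<^sub>0 / cos \<theta>\<^sub>0 \<noteq> 0"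
    by (rule rational_direction[OF AB]) (use assms(6) in \<open>simp_all add: d\<close>)
  have tan: "tan \<theta>\<^sub>0 \<in> \<rat>" "tan \<theta>\<^sub>0 \<noteq> 0" using rat by (simp_all add: tan_def)
  have de: "dim_exponent K A B > 0" by (rule codim_ge_dim_exponent[OF AB])
  have main: "\<exists>C. \<forall>n\<ge>1. favard (cantor_iter K A B n) \<le> ennreal (C * real n powr (- 1 / p))"
    if qr: "r > 0" "\<bar>tan \<theta>\<^sub>0\<bar> = real q / real r" and p: "p > 6 + 4 * (1 + real q + real r) * inverse (dim_exponent K A B)"
    for q r :: nat and p
  proof (rule favard_bound[OF AB])
    \<comment> \<open>The axis projections of the limit set are null, so
      \<open>tan \<theta>\<^sub>0\<close> is nonzero and \<open>q >= 1\<close>. Hence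
      \<open>1 + q + r >= 3\<close>, which is where 12 is compared with
      \<open>4 * (1 + q + r)\<close>.\<close>
    have "q \<noteq> 0" using qr tan(2) by (intro notI) simp
    then have "3 \<le> 1 + real q + real r" using qr(1) by linarith
    then have "12 \<le> 4 * (1 + real q + real r)" by simp
    then have "12 * inverse (dim_exponent K A B) \<le> 4 * (1 + real q + real r) * inverse (dim_exponent K A B)"
      using de by (intro mult_right_mono) auto
    then show "6 + 12 / dim_exponent K A B \<le> p" using p by (simp add: divide_inverse)
  qed
  have "\<exists>p>6. \<exists>C. \<forall>n\<ge>1. favard (cantor_iter K A B n) \<le> ennreal (C * real n powr (- 1 / p))"
    using favard_bound[OF AB order_refl] de by (intro exI[of _ "6 + 12 / dim_exponent K A B"]) simp
  then show ?thesis using rat tan(1) de main by blast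
qed

end
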